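(* Let $N\ge 1$, $\gamma>0$, $\alpha\in(1,2]$. Let the kernel $m$ satisfy condition $(\mathcal H)$ and be nonincreasing and continuous on $(0,\infty)$. Let $s\ge 0$, $T>0$, $\theta_1>0$, and assume that $g:(0,T]\to H^{s+\theta_1}(\mathbb R^N)$ is bounded and continuous. Then for every $v_{0,\alpha}\in H^{s+\theta_2}(\mathbb R^N)$ with $\theta_2>0$, the problem $$\partial_t v_\alpha+(-\Delta)^{\frac{\alpha}{2}}v_\alpha+\gamma\,\partial_t\big(m*(-\Delta)^{\frac{\alpha}{2}}v_\alpha\big)=g(t,x),\qquad v_\alpha|_{t=0}=v_{0,\alpha}(x),$$ on $(0,T]\times\mathbb R^N$ admits a unique classical solution in $H^s$.
   Context: Notation: $*$ is convolution in time, $(a*b)(t)=\int_0^t a(t-\tau)b(\tau)\,d\tau$; $\star$ is convolution in $x\in\mathbb R^N$; $\mathbb R_+=[0,\infty)$. $(-\Delta)^{\alpha/2}$ is the Fourier multiplier with symbol $|\xi|^\alpha$. $H^s=H^s(\mathbb R^N)$ has norm $\|u\|_{H^s}^2=\int(1+|\xi|^2)^s|\tilde u(\xi)|^2d\xi$, where $\tilde u$ is the Fourier transform. Put $m_\gamma(t)=1+\gamma m(t)$. Condition $(\mathcal H)$: $m\in L^1_{loc}(\mathbb R_+)$, and there exist a nonnegative and nonincreasing function $k_\gamma\in L^1_{loc}(\mathbb R_+)$ and $\beta_\gamma\ge0$ such that $\beta_\gamma m_\gamma(t)+(k_\gamma*m_\gamma)(t)=1$ for $t>0$. For $\nu\ge0$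 let $s_\gamma(\cdot,\nu)$ be the unique solution of $s_\gamma(t,\nu)+\nu\,(m_\gamma*s_\gamma(\cdot,\nu))(t)=1$, $t\ge0$. $Q_{\gamma,\alpha}(t,\cdot)$ is the fundamental solution of the homogeneous problem, given by its Fourier transform in $x$: $\tilde Q_{\gamma,\alpha}(t,\xi)=s_\gamma(t,|\xi|^\alpha)$; thus $Q_{\gamma,\alpha}(t,\cdot)\star$ is the Fourier multiplier with symbol $s_\gamma(t,|\xi|^\alpha)$. Classical solution in $H^s$: a function $v_\alpha\in C([0,T];H^s)$ with $(-\Delta)^{\alpha/2}v_\alpha(t)\in H^s$ for $t\in(0,T]$, with $\partial_t v_\alpha$ and $\partial_t(m*(-\Delta)^{\alpha/2}v_\alpha)\in C((0,T];H^s)$, and satisfying $v_\alpha(t)=Q_{\gamma,\alpha}(t,\cdot)\star v_{0,\alpha}+\int_0^tQ_{\gamma,\alpha}(t-\tau,\cdot)\star g(\tau)\,d\tau$ for $t\in(0,T]$. *)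

theory Defs
  imports "HOL-Analysis.Analysis"
begin

section \<open>Kernels on the half-line\<close>

text \<open>The value of a kernel at \<open>t \<le> 0\<close> is irrelevant; kernels may be singular at \<open>0\<close>.\<close>

definition L1_loc_halfline :: "(real \<Rightarrow> real) \<Rightarrow> bool" where
  "L1_loc_halfline a \<longleftrightarrow> (\<forall>b>0. a absolutely_integrable_on {0..b})"

definition time_conv :: "(real \<Rightarrow> real) \<Rightarrow> (real \<Rightarrow> real) \<Rightarrow> real \<Rightarrow> real" where
  "time_conv a b t = (LINT \<tau>:{0..t}|lebesgue. a (t - \<tau>) * b \<tau>)"

definition m_gamma :: "real \<Rightarrow> (real \<Rightarrow> real) \<Rightarrow> real \<Rightarrow> real" where
  "m_gamma \<gamma> m t = 1 + \<gamma> * m t"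

definition condition_H :: "real \<Rightarrow> (real \<Rightarrow> real) \<Rightarrow> bool" where
  "condition_H \<gamma> m \<longleftrightarrow>
     L1_loc_halfline m \<and>
     (\<exists>k \<beta>. L1_loc_halfline k \<and> (\<forall>t>0. k t \<ge> 0) \<and> antimono_on {0<..} k \<and> \<beta> \<ge> 0 \<and>
        (\<forall>t>0. \<beta> * m_gamma \<gamma> m t + time_conv k (m_gamma \<gamma> m) t = 1))"

text \<open>The solution of the scalar Volterra equation is unique among continuous functions
  on \<open>[0,\<infinity>)\<close>; it is extended by zero to negative times so that the
  description picks out a single total function.\<close>

definition s_gamma :: "real \<Rightarrow> (real \<Rightarrow> real) \<Rightarrow> real \<Rightarrow> real \<Rightarrow> real" where
  "s_gamma \<gamma> m \<nu> = (THE f. continuous_on {0..} f \<and> (\<forall>t<0. f t = 0) \<and>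
     (\<forall>t\<ge>0. f t + \<nu> * time_conv (m_gamma \<gamma> m) f t = 1))"

section \<open>The Fourier transform on square-integrable functions\<close>

text \<open>Elements of \<open>L\<^sup>2\<close> are represented by Borel functions, with equality almost
  everywhere in place of equality. The transform uses the normalisation
  \<open>\<integral> e\<^sup>-\<^sup>i\<^sup>x\<^sup>\<xi> u(x) dx\<close>, for which convolution with a kernel corresponds to multiplication by
  the transform of that kernel.\<close>

definition square_integrable :: "(real^'n \<Rightarrow> complex) \<Rightarrow> bool" where
  "square_integrable u \<longleftrightarrow>
     u \<in> borel_measurable lborel \<and> integrable lborel (\<lambda>x. (norm (u x))\<^sup>2)"

definition truncated_fourier :: "real \<Rightarrow> (real^'n \<Rightarrow> complex) \<Rightarrow> real^'n \<Rightarrow> complex" where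
  "truncated_fourier R u \<xi> = (LINT x:cball 0 R|lborel. cis (- (\<xi> \<bullet> x)) * u x)"

definition has_fourier :: "(real^'n \<Rightarrow> complex) \<Rightarrow> (real^'n \<Rightarrow> complex) \<Rightarrow> bool" where
  "has_fourier u U \<longleftrightarrow> square_integrable U \<and>
     ((\<lambda>R. \<integral>\<^sup>+\<xi>. ennreal ((norm (U \<xi> - truncated_fourier R u \<xi>))\<^sup>2) \<partial>lborel) \<longlongrightarrow> 0) at_top"

text \<open>By Plancherel's theorem this is defined for every square-integrable function,
  uniquely up to null sets; an arbitrary representative is chosen.\<close>

definition fourier :: "(real^'n \<Rightarrow> complex) \<Rightarrow> real^'n \<Rightarrow> complex" where
  "fourier u = (SOME U. has_fourier u U)"

section \<open>The Sobolev spaces of nonnegative order\<close>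

definition Hs :: "real \<Rightarrow> (real^'n \<Rightarrow> complex) set" where
  "Hs s = {u. square_integrable u \<and>
     integrable lborel (\<lambda>\<xi>. (1 + (norm \<xi>)\<^sup>2) powr s * (norm (fourier u \<xi>))\<^sup>2)}"

definition Hs_norm :: "real \<Rightarrow> (real^'n \<Rightarrow> complex) \<Rightarrow> real" where
  "Hs_norm s u = sqrt (LINT \<xi>|lborel. (1 + (norm \<xi>)\<^sup>2) powr s * (norm (fourier u \<xi>))\<^sup>2)"

definition Hs_dist :: "real \<Rightarrow> (real^'n \<Rightarrow> complex) \<Rightarrow> (real^'n \<Rightarrow> complex) \<Rightarrow> real" where
  "Hs_dist s u w = Hs_norm s (\<lambda>x. u x - w x)"

definition Hs_continuous_on :: "real \<Rightarrow> real set \<Rightarrow> (real \<Rightarrow> real^'n \<Rightarrow> complex) \<Rightarrow> bool" where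
  "Hs_continuous_on s I f \<longleftrightarrow> (\<forall>t\<in>I. f t \<in> Hs s) \<and>
     (\<forall>t\<in>I. ((\<lambda>\<tau>. Hs_dist s (f \<tau>) (f t)) \<longlongrightarrow> 0) (at t within I))"

definition has_Hs_derivative ::
  "real \<Rightarrow> real set \<Rightarrow> (real \<Rightarrow> real^'n \<Rightarrow> complex) \<Rightarrow> (real^'n \<Rightarrow> complex) \<Rightarrow> real \<Rightarrow> bool" where
  "has_Hs_derivative s I f d t \<longleftrightarrow> (\<forall>\<tau>\<in>I. f \<tau> \<in> Hs s) \<and> d \<in> Hs s \<and>
     ((\<lambda>\<tau>. Hs_dist s (\<lambda>x. (f \<tau> x - f t x) / complex_of_real (\<tau> - t)) d) \<longlongrightarrow> 0) (at t within I)"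

text \<open>The Bochner integral over \<open>[0,t]\<close> in \<open>H\<^sup>s\<close>. The library's Bochner integral is not
  applicable because \<open>H\<^sup>s\<close>, with its real parameter \<open>s\<close>, is not a type.\<close>

definition Hs_simple :: "real \<Rightarrow> real \<Rightarrow> (real \<Rightarrow> real^'n \<Rightarrow> complex) \<Rightarrow> bool" where
  "Hs_simple s t \<phi> \<longleftrightarrow> simple_function (lebesgue_on {0..t}) \<phi> \<and> \<phi> ` {0..t} \<subseteq> Hs s"

definition simple_integral_fun :: "real \<Rightarrow> (real \<Rightarrow> real^'n \<Rightarrow> complex) \<Rightarrow> real^'n \<Rightarrow> complex" where
  "simple_integral_fun t \<phi> x =
     (\<Sum>u\<in>\<phi> ` {0..t}. complex_of_real (measure lebesgue {\<tau>\<in>{0..t}. \<phi> \<tau> = u}) * u x)"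

definition has_Hs_integral ::
  "real \<Rightarrow> real \<Rightarrow> (real \<Rightarrow> real^'n \<Rightarrow> complex) \<Rightarrow> (real^'n \<Rightarrow> complex) \<Rightarrow> bool" where
  "has_Hs_integral s t f w \<longleftrightarrow> w \<in> Hs s \<and> (AE \<tau> in lebesgue_on {0..t}. f \<tau> \<in> Hs s) \<and>
     (\<exists>\<phi> :: nat \<Rightarrow> real \<Rightarrow> real^'n \<Rightarrow> complex.
        (\<forall>i. Hs_simple s t (\<phi> i)) \<and>
        (AE \<tau> in lebesgue_on {0..t}. (\<lambda>i. Hs_dist s (f \<tau>) (\<phi> i \<tau>)) \<longlonglongrightarrow> 0) \<and>
        (\<lambda>i. \<integral>\<^sup>+\<tau>. ennreal (Hs_dist s (f \<tau>) (\<phi> i \<tau>)) \<partial>lebesgue_on {0..t}) \<longlonglongrightarrow> 0 \<and>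
        (\<lambda>i. Hs_dist s (simple_integral_fun t (\<phi> i)) w) \<longlonglongrightarrow> 0)"

definition Hs_integrable :: "real \<Rightarrow> real \<Rightarrow> (real \<Rightarrow> real^'n \<Rightarrow> complex) \<Rightarrow> bool" where
  "Hs_integrable s t f \<longleftrightarrow> (\<exists>w. has_Hs_integral s t f w)"

definition Hs_integral :: "real \<Rightarrow> real \<Rightarrow> (real \<Rightarrow> real^'n \<Rightarrow> complex) \<Rightarrow> real^'n \<Rightarrow> complex" where
  "Hs_integral s t f = (SOME w. has_Hs_integral s t f w)"

section \<open>Fourier multipliers\<close>

text \<open>A multiplier is in general unbounded; \<open>multiplier a u\<close> is meaningful only for \<open>u\<close> in
  the domain.\<close>

definition multiplier_domain :: "(real^'n \<Rightarrow> real) \<Rightarrow> (real^'n \<Rightarrow> complex) set" where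
  "multiplier_domain a = {u. square_integrable u \<and>
     square_integrable (\<lambda>\<xi>. complex_of_real (a \<xi>) * fourier u \<xi>)}"

definition multiplier ::
  "(real^'n \<Rightarrow> real) \<Rightarrow> (real^'n \<Rightarrow> complex) \<Rightarrow> real^'n \<Rightarrow> complex" where
  "multiplier a u = (SOME w. square_integrable w \<and>
     (AE \<xi> in lborel. fourier w \<xi> = complex_of_real (a \<xi>) * fourier u \<xi>))"

definition frac_symbol :: "real \<Rightarrow> real^'n \<Rightarrow> real" where
  "frac_symbol \<alpha> \<xi> = norm \<xi> powr \<alpha>"

abbreviation frac_laplacian :: "real \<Rightarrow> (real^'n \<Rightarrow> complex) \<Rightarrow> real^'n \<Rightarrow> complex" where
  "frac_laplacian \<alpha> \<equiv> multiplier (frac_symbol \<alpha>)"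

definition Q_conv ::
  "real \<Rightarrow> real \<Rightarrow> (real \<Rightarrow> real) \<Rightarrow> real \<Rightarrow> (real^'n \<Rightarrow> complex) \<Rightarrow> real^'n \<Rightarrow> complex" where
  "Q_conv \<gamma> \<alpha> m t = multiplier (\<lambda>\<xi>. s_gamma \<gamma> m (frac_symbol \<alpha> \<xi>) t)"

section \<open>The problem and its classical solutions\<close>

definition memory_integrand ::
  "real \<Rightarrow> (real \<Rightarrow> real) \<Rightarrow> (real \<Rightarrow> real^'n \<Rightarrow> complex) \<Rightarrow> real \<Rightarrow> real \<Rightarrow> real^'n \<Rightarrow> complex" where
  "memory_integrand \<alpha> m v t \<tau> x = complex_of_real (m (t - \<tau>)) * frac_laplacian \<alpha> (v \<tau>) x"

definition memory_term ::
  "real \<Rightarrow> real \<Rightarrow> (real \<Rightarrow> real) \<Rightarrow> (real \<Rightarrow> real^'n \<Rightarrow> complex) \<Rightarrow> real \<Rightarrow> real^'n \<Rightarrow> complex" where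
  "memory_term s \<alpha> m v t = Hs_integral s t (memory_integrand \<alpha> m v t)"

definition duhamel_integrand ::
  "real \<Rightarrow> real \<Rightarrow> (real \<Rightarrow> real) \<Rightarrow> (real \<Rightarrow> real^'n \<Rightarrow> complex) \<Rightarrow> real \<Rightarrow> real \<Rightarrow> real^'n \<Rightarrow> complex" where
  "duhamel_integrand \<gamma> \<alpha> m g t \<tau> = Q_conv \<gamma> \<alpha> m (t - \<tau>) (g \<tau>)"

definition classical_solution ::
  "real \<Rightarrow> real \<Rightarrow> (real \<Rightarrow> real) \<Rightarrow> real \<Rightarrow> real \<Rightarrow> (real^'n \<Rightarrow> complex) \<Rightarrow>
   (real \<Rightarrow> real^'n \<Rightarrow> complex) \<Rightarrow> (real \<Rightarrow> real^'n \<Rightarrow> complex) \<Rightarrow> bool" where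
  "classical_solution \<gamma> \<alpha> m s T v\<^sub>0 g v \<longleftrightarrow>
     Hs_continuous_on s {0..T} v \<and>
     (\<forall>t\<in>{0<..T}. v t \<in> multiplier_domain (frac_symbol \<alpha>) \<and> frac_laplacian \<alpha> (v t) \<in> Hs s) \<and>
     (\<exists>dv. Hs_continuous_on s {0<..T} dv \<and>
        (\<forall>t\<in>{0<..T}. has_Hs_derivative s {0<..T} v (dv t) t)) \<and>
     (\<forall>t\<in>{0<..T}. Hs_integrable s t (memory_integrand \<alpha> m v t)) \<and>
     (\<exists>dM. Hs_continuous_on s {0<..T} dM \<and>
        (\<forall>t\<in>{0<..T}. has_Hs_derivative s {0<..T} (memory_term s \<alpha> m v) (dM t) t)) \<and>
     (\<forall>t\<in>{0<..T}. Hs_integrable s t (duhamel_integrand \<gamma> \<alpha> m g t) \<and>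
        (AE x in lborel. v t x =
           Q_conv \<gamma> \<alpha> m t v\<^sub>0 x + Hs_integral s t (duhamel_integrand \<gamma> \<alpha> m g t) x))"

definition solves_problem ::
  "real \<Rightarrow> real \<Rightarrow> (real \<Rightarrow> real) \<Rightarrow> real \<Rightarrow> real \<Rightarrow> (real^'n \<Rightarrow> complex) \<Rightarrow>
   (real \<Rightarrow> real^'n \<Rightarrow> complex) \<Rightarrow> (real \<Rightarrow> real^'n \<Rightarrow> complex) \<Rightarrow> bool" where
  "solves_problem \<gamma> \<alpha> m s T v\<^sub>0 g v \<longleftrightarrow>
     (\<forall>t\<in>{0<..T}. \<exists>d e.
        has_Hs_derivative s {0<..T} v d t \<and>
        has_Hs_derivative s {0<..T} (memory_term s \<alpha> m v) e t \<and>
        (AE x in lborel. d x + frac_laplacian \<alpha> (v t) x + complex_of_real \<gamma> * e x = g t x)) \<and>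
     (AE x in lborel. v 0 x = v\<^sub>0 x)"

end

theory Submission
  imports Defs "HOL-Probability.Probability"
begin

text \<open>By Plancherel's theorem \<open>H\<^sup>s\<close> is an isometric copy of \<open>L\<^sup>2\<close> on which every operator of the problem
  is a multiplication operator. For the scalar equation \<open>s + \<nu> m\<^sub>\<gamma> * s = 1\<close>, condition (H) makes \<open>s\<close>
  nonnegative and nonincreasing with \<open>s \<le> 1 / (1 + \<nu> M)\<close>, where \<open>M\<close> is the primitive of \<open>m\<^sub>\<gamma>\<close>, and
  \<open>r = - \<partial>\<^sub>t s\<close> exists, is continuous and satisfies \<open>r \<le> \<nu> m\<^sub>\<gamma> s\<close>. With \<open>\<nu> = |\<xi>|\<^sup>\<alpha>\<close>, an excess regularity of
  order \<open>\<epsilon> \<alpha>\<close> of the data therefore bounds \<open>\<nu> s\<close> by \<open>M\<^sup>\<epsilon>\<^sup>-\<^sup>1\<close> and \<open>r\<close> by \<open>m\<^sub>\<gamma> M\<^sup>\<epsilon>\<^sup>-\<^sup>1 = \<partial>\<^sub>t M\<^sup>\<epsilon> / \<epsilon>\<close>; both are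
  integrable at \<open>0\<close>, so Duhamel's formula may be differentiated and convolved with \<open>m\<^sub>\<gamma>\<close>.\<close>

section \<open>The Hilbert space of square-integrable functions\<close>

text \<open>Without excess regularity the bound uniform in \<nu> is \<nu> s \<le> 1 / M, and 1 / M
  fails to be integrable at 0 already for m = 0, where M(t) = t. A smoothing symbol c with
  \<nu>^\<epsilon> c \<le> 1 interpolates this bound with s \<le> 1; the choice c = (1 +
  |\<xi>|^2)^(-\<theta>/2) with \<epsilon> = \<theta> / \<alpha> takes data of order s + \<theta> to
  order s. The scalar facts have to be won without complete monotonicity or Laplace inversion. Since
  \<beta> may be 0, the equation built from k can be of the first kind; it is perturbed to \<beta> +
  1/n, where positivity can be proved, and the limit is taken in the primitives of the solutions.
  The function r is obtained from difference quotients of s by Fatou's lemma, and even the sign of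
  m_\<gamma> has to be extracted from condition (H). Bochner integrals need a complete separable
  space given as a type, hence the construction of L2 from chosen representatives. Uniqueness rests
  on the representation formula for t > 0 and on continuity at t = 0.\<close>

lemma norm_add_power2_le: "(norm (a + b :: 'a::real_normed_vector))\<^sup>2 \<le> 2 * (norm a)\<^sup>2 + 2 * (norm b)\<^sup>2"
proof -
  have "(norm (a + b))\<^sup>2 \<le> (norm a + norm b)\<^sup>2"
    by (simp add: norm_triangle_ineq power_mono)
  also have "\<dots> \<le> 2 * (norm a)\<^sup>2 + 2 * (norm b)\<^sup>2"
    using sum_squares_bound[of "norm a" "norm b"] by (simp add: power2_sum)
  finally show ?thesis .
qed

lemma square_integrable_bound:
  assumes u: "u \<in> borel_measurable lborel" and w: "integrable lborel w"
    and le: "AE x in lborel. (norm (u x))\<^sup>2 \<le> w x"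
  shows "square_integrable u"
  unfolding square_integrable_def
proof
  show "integrable lborel (\<lambda>x. (norm (u x))\<^sup>2)"
    by (rule Bochner_Integration.integrable_bound[OF w]) (use u le in auto)
qed (rule u)

lemma square_integrable_measurable [measurable_dest]:
  "square_integrable u \<Longrightarrow> u \<in> borel_measurable borel"
  by (simp add: square_integrable_def)

lemma square_integrable_power2: "square_integrable u \<Longrightarrow> integrable lborel (\<lambda>x. (norm (u x))\<^sup>2)"
  by (simp add: square_integrable_def)

lemma square_integrable_add:
  assumes "square_integrable u" "square_integrable v"
  shows "square_integrable (\<lambda>x. u x + v x)"
  using assms
  by (intro square_integrable_bound[where w = "\<lambda>x. 2 * (norm (u x))\<^sup>2 + 2 * (norm (v x))\<^sup>2"])
    (auto intro!: Bochner_Integration.integrable_add integrable_mult_right square_integrable_power2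
      norm_add_power2_le dest: square_integrable_measurable)

lemma square_integrable_mult_bounded:
  fixes a :: "real^'n \<Rightarrow> complex"
  assumes u: "square_integrable u" and a: "a \<in> borel_measurable borel" and K: "\<And>x. norm (a x) \<le> K"
  shows "square_integrable (\<lambda>x. a x * u x)"
proof (rule square_integrable_bound[where w = "\<lambda>x. K\<^sup>2 * (norm (u x))\<^sup>2"])
  have "(norm (a x))\<^sup>2 \<le> K\<^sup>2" for x
    using K[of x] by (simp add: power_mono)
  then show "AE x in lborel. (norm (a x * u x))\<^sup>2 \<le> K\<^sup>2 * (norm (u x))\<^sup>2"
    by (auto simp: norm_mult power_mult_distrib mult_right_mono)
qed (use u a square_integrable_measurable[OF u] in \<open>auto intro: square_integrable_power2\<close>)

lemma square_integrable_cmult: "square_integrable u \<Longrightarrow> square_integrable (\<lambda>x. c * u x)"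
  by (rule square_integrable_mult_bounded[where K = "norm c"]) auto

lemma square_integrable_scaleR: "square_integrable u \<Longrightarrow> square_integrable (\<lambda>x. r *\<^sub>R u x)"
  using square_integrable_cmult[of u "of_real r"] by (simp add: scaleR_conv_of_real)

lemma square_integrable_diff:
  "square_integrable u \<Longrightarrow> square_integrable v \<Longrightarrow> square_integrable (\<lambda>x. u x - v x)"
  using square_integrable_add[of u "\<lambda>x. (- 1) * v x"] square_integrable_cmult[of v "- 1"] by simp

lemma square_integrable_zero [simp]: "square_integrable (\<lambda>x. 0)"
  by (simp add: square_integrable_def)

lemma square_integrable_cong_AE:
  assumes "square_integrable u" "v \<in> borel_measurable borel" "AE x in lborel. v x = u x"
  shows "square_integrable v"
  using assms by (intro square_integrable_bound[where w = "\<lambda>x. (norm (u x))\<^sup>2"])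
    (auto intro: square_integrable_power2)

lemma square_integrable_inner:
  assumes "square_integrable u" "square_integrable v"
  shows "integrable lborel (\<lambda>x. u x \<bullet> v x)"
proof (rule Bochner_Integration.integrable_bound)
  show "integrable lborel (\<lambda>x. (norm (u x))\<^sup>2 + (norm (v x))\<^sup>2)"
    using assms by (auto intro: square_integrable_power2)
  have "norm (u x \<bullet> v x) \<le> (norm (u x))\<^sup>2 + (norm (v x))\<^sup>2" for x
  proof -
    have "norm (u x \<bullet> v x) \<le> norm (u x) * norm (v x)"
      by (simp add: Cauchy_Schwarz_ineq2)
    also have "\<dots> \<le> (norm (u x))\<^sup>2 + (norm (v x))\<^sup>2"
      using sum_squares_bound[of "norm (u x)" "norm (v x)"]
        mult_nonneg_nonneg[OF norm_ge_zero norm_ge_zero, of "u x" "v x"]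
      unfolding mult.assoc by linarith
    finally show ?thesis .
  qed
  then show "AE x in lborel. norm (u x \<bullet> v x) \<le> norm ((norm (u x))\<^sup>2 + (norm (v x))\<^sup>2)"
    by (intro always_eventually allI) (smt (verit) real_norm_def zero_le_power2)
qed (use assms in \<open>auto intro!: borel_measurable_inner dest: square_integrable_measurable\<close>)

section \<open>Classes of square-integrable functions as a type\<close>

text \<open>Choosing one representative per class, instead of forming a quotient, makes
  \<open>fn F\<close> an honest measurable function that can stand under integrals.\<close>

definition canonical_rep :: "(real^'n \<Rightarrow> complex) \<Rightarrow> real^'n \<Rightarrow> complex" where
  "canonical_rep u = (SOME v. square_integrable v \<and> (AE x in lborel. v x = u x))"

typedef (overloaded) ('n::finite) L2 = "canonical_rep ` {u :: real^'n \<Rightarrow> complex. square_integrable u}"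
  morphisms fn Abs_L2
  using square_integrable_zero by blast

definition cls :: "(real^'n \<Rightarrow> complex) \<Rightarrow> 'n L2" where
  "cls u = Abs_L2 (canonical_rep u)"

lemma canonical_rep:
  assumes "square_integrable u"
  shows "square_integrable (canonical_rep u) \<and> (AE x in lborel. canonical_rep u x = u x)"
  unfolding canonical_rep_def by (rule someI[where x = u]) (use assms in auto)

text \<open>The predicate handed to the choice operator depends on \<open>u\<close> only through its
  class, so the same function is chosen on both sides.\<close>

lemma canonical_rep_cong:
  fixes u v :: "real^'n \<Rightarrow> complex"
  assumes "AE x in lborel. u x = v x"
  shows "canonical_rep u = canonical_rep v"
proof -
  have "(AE x in lborel. w x = u x) \<longleftrightarrow> (AE x in lborel. w x = v x)" for w :: "real^'n \<Rightarrow> complex"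
    using assms by (auto elim: AE_mp)
  then show ?thesis
    by (simp add: canonical_rep_def)
qed

lemma square_integrable_fn [simp, intro]: "square_integrable (fn F)"
  using fn[of F] canonical_rep by (metis (mono_tags, lifting) imageE mem_Collect_eq)

lemma measurable_fn [measurable]: "fn F \<in> borel_measurable borel"
  using square_integrable_fn square_integrable_measurable by blast

lemma fn_cls: "square_integrable u \<Longrightarrow> AE x in lborel. fn (cls u) x = u x"
  by (simp add: cls_def Abs_L2_inverse canonical_rep)

lemma cls_fn [simp]: "cls (fn F) = F"
proof -
  obtain u where u: "square_integrable u" "fn F = canonical_rep u"
    using fn[of F] by auto
  have "canonical_rep (fn F) = fn F"
    using canonical_rep_cong[of "canonical_rep u" u] canonical_rep[OF u(1)] u(2) by simp
  then show ?thesis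
    by (simp add: cls_def fn_inverse)
qed

lemma cls_eqI: "AE x in lborel. u x = v x \<Longrightarrow> cls u = cls v"
  by (simp add: cls_def canonical_rep_cong)

lemma cls_eq_iff:
  assumes "square_integrable u" "square_integrable v"
  shows "cls u = cls v \<longleftrightarrow> (AE x in lborel. u x = v x)"
proof
  assume "cls u = cls v"
  with fn_cls[OF assms(1)] fn_cls[OF assms(2)] show "AE x in lborel. u x = v x"
    by (auto elim: AE_mp)
qed (rule cls_eqI)

lemma L2_eqI: "AE x in lborel. fn F x = fn G x \<Longrightarrow> F = G"
  using cls_eqI[of "fn F" "fn G"] by simp

instantiation L2 :: (finite) real_inner
begin

definition "(0 :: 'a L2) = cls (\<lambda>x. 0)"
definition "F + G = cls (\<lambda>x. fn F x + fn G x)"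
definition "F - G = cls (\<lambda>x. fn F x - fn G x)"
definition "- F = cls (\<lambda>x. - fn F x)"
definition "r *\<^sub>R F = cls (\<lambda>x. r *\<^sub>R fn F x)"
text \<open>Complex values are paired as vectors of the plane, so this is the real part of the
  Hermitian product.\<close>

definition "F \<bullet> G = (LINT x|lborel. fn F x \<bullet> fn G x)"
definition "norm (F :: 'a L2) = sqrt (F \<bullet> F)"
definition "dist (F :: 'a L2) G = norm (F - G)"
definition "sgn (F :: 'a L2) = inverse (norm F) *\<^sub>R F"
definition "uniformity = (INF e\<in>{0<..}. principal {(F :: 'a L2, G). dist F G < e})"
definition "open U \<longleftrightarrow> (\<forall>F\<in>U. \<forall>\<^sub>F (F', G) in uniformity. F' = F \<longrightarrow> G \<in> (U :: 'a L2 set))"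

lemma fn_zero: "AE x in lborel. fn (0 :: 'a L2) x = 0"
  unfolding zero_L2_def by (rule fn_cls) simp

lemma fn_add: "AE x in lborel. fn (F + G :: 'a L2) x = fn F x + fn G x"
  unfolding plus_L2_def by (rule fn_cls) (simp add: square_integrable_add)

lemma fn_diff: "AE x in lborel. fn (F - G :: 'a L2) x = fn F x - fn G x"
  unfolding minus_L2_def by (rule fn_cls) (simp add: square_integrable_diff)

lemma fn_uminus: "AE x in lborel. fn (- F :: 'a L2) x = - fn F x"
  unfolding uminus_L2_def using square_integrable_cmult[OF square_integrable_fn[of F], of "- 1"]
  by (intro fn_cls) simp

lemma fn_scaleR: "AE x in lborel. fn (r *\<^sub>R F :: 'a L2) x = r *\<^sub>R fn F x"
  unfolding scaleR_L2_def by (rule fn_cls) (simp add: square_integrable_scaleR)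

instance
proof
  fix F G H :: "'a L2" and a b :: real
  show "F + G + H = F + (G + H)"
    using fn_add[of "F + G" H] fn_add[of F "G + H"] fn_add[of F G] fn_add[of G H]
    by (intro L2_eqI) (auto elim!: AE_mp)
  show "F + G = G + F"
    by (simp add: plus_L2_def add.commute)
  show "0 + F = F"
    using fn_add[of 0 F] fn_zero by (intro L2_eqI) (auto elim!: AE_mp)
  show "- F + F = 0"
    using fn_add[of "- F" F] fn_zero fn_uminus[of F] by (intro L2_eqI) (auto elim!: AE_mp)
  show "F - G = F + - G"
    using fn_add[of F "- G"] fn_diff[of F G] fn_uminus[of G] by (intro L2_eqI) (auto elim!: AE_mp)
  show "a *\<^sub>R (F + G) = a *\<^sub>R F + a *\<^sub>R G"
    using fn_add[of F G] fn_scaleR[of a "F + G"] fn_add[of "a *\<^sub>R F" "a *\<^sub>R G"] fn_scaleR[of a F] fn_scaleR[of a G]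
    by (intro L2_eqI) (auto elim!: AE_mp simp: scaleR_add_right)
  show "(a + b) *\<^sub>R F = a *\<^sub>R F + b *\<^sub>R F"
    using fn_scaleR[of "a + b" F] fn_add[of "a *\<^sub>R F" "b *\<^sub>R F"] fn_scaleR[of a F] fn_scaleR[of b F]
    by (intro L2_eqI) (auto elim!: AE_mp simp: scaleR_add_left)
  show "a *\<^sub>R b *\<^sub>R F = (a * b) *\<^sub>R F"
    using fn_scaleR[of "a * b" F] fn_scaleR[of a "b *\<^sub>R F"] fn_scaleR[of b F]
    by (intro L2_eqI) (auto elim!: AE_mp)
  show "1 *\<^sub>R F = F"
    using fn_scaleR[of 1 F] by (intro L2_eqI) (auto elim!: AE_mp)
  show "dist F G = norm (F - G)" "sgn F = inverse (norm F) *\<^sub>R F" "norm F = sqrt (F \<bullet> F)"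
    by (simp_all add: dist_L2_def sgn_L2_def norm_L2_def)
  show "uniformity = (INF e\<in>{0<..}. principal {(F :: 'a L2, G). dist F G < e})"
    by (simp add: uniformity_L2_def)
  show "open U \<longleftrightarrow> (\<forall>F\<in>U. \<forall>\<^sub>F (F', G) in uniformity. F' = F \<longrightarrow> G \<in> U)" for U :: "'a L2 set"
    by (simp add: open_L2_def)
  show "F \<bullet> G = G \<bullet> F"
    by (simp add: inner_L2_def inner_commute)
  have "(F + G) \<bullet> H = (LINT x|lborel. fn F x \<bullet> fn H x + fn G x \<bullet> fn H x)"
    unfolding inner_L2_def using fn_add[of F G]
    by (intro integral_cong_AE) (auto elim!: AE_mp simp: inner_add_left)
  also have "\<dots> = F \<bullet> H + G \<bullet> H"
    unfolding inner_L2_def by (intro Bochner_Integration.integral_add square_integrable_inner) auto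
  finally show "(F + G) \<bullet> H = F \<bullet> H + G \<bullet> H" .
  have "(a *\<^sub>R F) \<bullet> G = (LINT x|lborel. a * (fn F x \<bullet> fn G x))"
    unfolding inner_L2_def using fn_scaleR[of a F]
    by (intro integral_cong_AE) (auto elim!: AE_mp)
  then show "(a *\<^sub>R F) \<bullet> G = a * (F \<bullet> G)"
    by (simp add: inner_L2_def)
  show "0 \<le> F \<bullet> F"
    by (simp add: inner_L2_def)
  show "F \<bullet> F = 0 \<longleftrightarrow> F = 0"
  proof
    assume "F \<bullet> F = 0"
    then have "AE x in lborel. fn F x \<bullet> fn F x = 0"
      unfolding inner_L2_def
      by (subst (asm) integral_nonneg_eq_0_iff_AE) (auto intro: square_integrable_inner)
    then show "F = 0"
      using fn_zero by (intro L2_eqI) (auto elim!: AE_mp)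
  next
    assume "F = 0"
    have "F \<bullet> F = (LINT x|(lborel :: (real^'a) measure). 0)"
      unfolding inner_L2_def using fn_zero \<open>F = 0\<close> by (intro integral_cong_AE) (auto elim!: AE_mp)
    then show "F \<bullet> F = 0"
      by simp
  qed
qed

end

lemma cls_add:
  assumes "square_integrable u" "square_integrable v"
  shows "cls (\<lambda>x. u x + v x) = cls u + cls v"
  unfolding plus_L2_def using fn_cls[OF assms(1)] fn_cls[OF assms(2)]
  by (intro cls_eqI) (auto elim!: AE_mp)

lemma cls_diff:
  assumes "square_integrable u" "square_integrable v"
  shows "cls (\<lambda>x. u x - v x) = cls u - cls v"
  unfolding minus_L2_def using fn_cls[OF assms(1)] fn_cls[OF assms(2)]
  by (intro cls_eqI) (auto elim!: AE_mp)

lemma cls_scaleR: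
  assumes "square_integrable u"
  shows "cls (\<lambda>x. r *\<^sub>R u x) = r *\<^sub>R cls u"
  unfolding scaleR_L2_def using fn_cls[OF assms]
  by (intro cls_eqI) (auto elim!: AE_mp)

lemma inner_cls:
  assumes "square_integrable u" "square_integrable v"
  shows "cls u \<bullet> cls v = (LINT x|lborel. u x \<bullet> v x)"
  unfolding inner_L2_def using fn_cls[OF assms(1)] fn_cls[OF assms(2)] assms
  by (intro integral_cong_AE)
    (auto elim!: AE_mp intro!: borel_measurable_inner dest: square_integrable_measurable)

lemma norm_cls:
  assumes "square_integrable u"
  shows "norm (cls u) = sqrt (LINT x|lborel. (norm (u x))\<^sup>2)"
  using inner_cls[OF assms assms] by (simp add: norm_L2_def power2_norm_eq_inner)

lemma nn_norm_cls:
  assumes "square_integrable u"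
  shows "(\<integral>\<^sup>+x. ennreal ((norm (u x))\<^sup>2) \<partial>lborel) = ennreal ((norm (cls u))\<^sup>2)"
  using assms by (simp add: nn_integral_eq_integral square_integrable_power2 norm_cls)

text \<open>The majorant bounds the squared distance to the limit rather than the functions
  themselves, which is the form in which truncations and symbols deliver it.\<close>

lemma cls_dominated_convergence:
  fixes u :: "nat \<Rightarrow> real^'n \<Rightarrow> complex"
  assumes u: "\<And>n. square_integrable (u n)" and u': "square_integrable u'"
    and w: "integrable lborel w"
    and lim: "AE x in lborel. (\<lambda>n. u n x) \<longlonglongrightarrow> u' x"
    and bnd: "\<And>n. AE x in lborel. (norm (u n x - u' x))\<^sup>2 \<le> w x"
  shows "(\<lambda>n. cls (u n)) \<longlonglongrightarrow> cls u'"
proof -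
  have "(\<lambda>n. LINT x|lborel. (norm (u n x - u' x))\<^sup>2) \<longlonglongrightarrow> (LINT x|(lborel :: (real^'n) measure). 0)"
  proof (rule integral_dominated_convergence[where w = w])
    show "AE x in lborel. (\<lambda>n. (norm (u n x - u' x))\<^sup>2) \<longlonglongrightarrow> 0"
      using lim
    proof eventually_elim
      case (elim x)
      then have "(\<lambda>n. (norm (u n x - u' x))\<^sup>2) \<longlonglongrightarrow> (norm (u' x - u' x))\<^sup>2"
        by (intro tendsto_intros)
      then show ?case by simp
    qed
  qed (use w bnd u u' in \<open>auto dest!: square_integrable_measurable\<close>)
  then have "(\<lambda>n. sqrt (LINT x|lborel. (norm (u n x - u' x))\<^sup>2)) \<longlonglongrightarrow> sqrt 0"
    by (intro tendsto_real_sqrt) simp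
  then have "(\<lambda>n. norm (cls (u n) - cls u')) \<longlonglongrightarrow> 0"
    using u u' by (simp add: norm_cls square_integrable_diff flip: cls_diff)
  then show ?thesis
    by (simp add: tendsto_norm_zero_iff LIM_zero_iff)
qed

section \<open>Completeness\<close>

text \<open>Riesz-Fischer: a subsequence with geometrically small increments converges almost
  everywhere, and Fatou's lemma turns the Cauchy estimate into convergence in norm of the full
  sequence.\<close>

instance L2 :: (finite) banach
proof
  fix X :: "nat \<Rightarrow> 'a L2"
  assume X: "Cauchy X"
  have "\<exists>N. \<forall>m\<ge>N. \<forall>n\<ge>N. norm (X m - X n) < (1/4)^k" for k :: nat
    using CauchyD[OF X, of "(1/4)^k"] by auto
  then obtain N where N: "\<And>k m n. m \<ge> N k \<Longrightarrow> n \<ge> N k \<Longrightarrow> norm (X m - X n) < (1/4)^k"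
    by metis
  \<comment> \<open>\<open>r k\<close> exceeds every threshold up to \<open>k\<close>, so one
    sequence of indices serves all estimates with j \<le> k.\<close>
  define r where "r k = Max (N ` {..k})" for k
  have N_r: "N j \<le> r k" if "j \<le> k" for j k
    using that by (auto simp: r_def)
  define d where "d k x = fn (X (r (Suc k))) x - fn (X (r k)) x" for k x
  have sq_d: "square_integrable (d k)" for k
    unfolding d_def by (intro square_integrable_diff) auto
  then have [measurable]: "d k \<in> borel_measurable borel" for k
    by (rule square_integrable_measurable)
  \<comment> \<open>The rate 4^(-k) is fast enough that the squares stay summable in the mean after
    multiplication by 4^k; finiteness of the weighted sum then makes the increments O(2^(-k)) almost
    everywhere.\<close>
  have norm_d: "norm (cls (d k)) < (1/4)^k" for k
  proof -
    have "cls (d k) = X (r (Suc k)) - X (r k)"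
      unfolding d_def by (subst cls_diff) auto
    then show ?thesis
      using N[of k "r (Suc k)" "r k"] N_r by auto
  qed
  have "(\<integral>\<^sup>+x. (\<Sum>k. ennreal (4^k * (norm (d k x))\<^sup>2)) \<partial>lborel)
      = (\<Sum>k. \<integral>\<^sup>+x. ennreal (4^k * (norm (d k x))\<^sup>2) \<partial>lborel)"
    by (rule nn_integral_suminf) measurable
  also have "\<dots> \<le> (\<Sum>k. ennreal ((1/4)^k))"
  proof (intro suminf_le allI)
    fix k
    have "(\<integral>\<^sup>+x. ennreal (4^k * (norm (d k x))\<^sup>2) \<partial>lborel) = ennreal (4^k * (norm (cls (d k)))\<^sup>2)"
      by (simp add: ennreal_mult nn_integral_cmult nn_norm_cls sq_d)
    also have "4^k * (norm (cls (d k)))\<^sup>2 \<le> 4^k * ((1/4)^k)\<^sup>2"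
      using norm_d[of k] by (intro mult_left_mono power_mono) auto
    also have "\<dots> = (1/4::real)^k"
      by (simp add: power2_eq_square field_simps)
    finally show "(\<integral>\<^sup>+x. ennreal (4^k * (norm (d k x))\<^sup>2) \<partial>lborel) \<le> ennreal ((1/4)^k)"
      by (simp add: ennreal_leI)
  qed auto
  also have "\<dots> = ennreal (\<Sum>k. (1/4)^k)"
    by (intro suminf_ennreal2 summable_geometric) auto
  finally have "(\<integral>\<^sup>+x. (\<Sum>k. ennreal (4^k * (norm (d k x))\<^sup>2)) \<partial>lborel) < top"
    by (rule le_less_trans) (rule ennreal_less_top)
  then have "(\<integral>\<^sup>+x. (\<Sum>k. ennreal (4^k * (norm (d k x))\<^sup>2)) \<partial>lborel) \<noteq> \<infinity>"
    by auto
  then have "AE x in lborel. (\<Sum>k. ennreal (4^k * (norm (d k x))\<^sup>2)) \<noteq> \<infinity>"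
    by (rule nn_integral_noteq_infinite[rotated]) measurable
  then have conv: "AE x in lborel. convergent (\<lambda>k. fn (X (r k)) x)"
  proof eventually_elim
    case (elim x)
    then have "(\<Sum>k. ennreal (4^k * (norm (d k x))\<^sup>2)) < top"
      unfolding infinity_ennreal_def top.not_eq_extremum .
    then obtain C where C: "C \<ge> 0" "(\<Sum>k. ennreal (4^k * (norm (d k x))\<^sup>2)) = ennreal C"
      using less_top_ennreal by blast
    have bound: "norm (d k x) \<le> sqrt C * (1/2)^k" for k
    proof -
      have "ennreal (4^k * (norm (d k x))\<^sup>2) \<le> ennreal C"
        using C(2) sum_le_suminf[of "\<lambda>k. ennreal (4^k * (norm (d k x))\<^sup>2)" "{k}"] by simp
      moreover have "((2::real)^k)\<^sup>2 = 4^k"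
        by (simp add: power2_eq_square flip: power_mult_distrib)
      ultimately have "(2^k * norm (d k x))\<^sup>2 \<le> C"
        using C(1) by (simp add: power_mult_distrib)
      then have "2^k * norm (d k x) \<le> sqrt C"
        by (rule real_le_rsqrt)
      then show ?thesis
        by (simp add: field_simps power_one_over)
    qed
    have "summable (\<lambda>k. d k x)"
      by (rule summable_comparison_test'[OF _ bound]) (intro summable_mult summable_geometric, simp)
    then have "convergent (\<lambda>k. \<Sum>i<k. d i x)"
      by (simp add: summable_iff_convergent)
    moreover have "(\<Sum>i<k. d i x) = fn (X (r k)) x - fn (X (r 0)) x" for k
      unfolding d_def by (rule sum_lessThan_telescope)
    ultimately show ?case
      by (simp add: convergent_diff_const_right_iff)
  qed
  define u where "u x = lim (\<lambda>k. fn (X (r k)) x)" for x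
  have u_meas [measurable]: "u \<in> borel_measurable borel"
    unfolding u_def by measurable
  have lim_u: "AE x in lborel. (\<lambda>k. fn (X (r k)) x) \<longlonglongrightarrow> u x"
    using conv by eventually_elim (simp add: u_def convergent_LIMSEQ_iff)
  have close: "(\<integral>\<^sup>+x. ennreal ((norm (u x - fn (X n) x))\<^sup>2) \<partial>lborel) \<le> ennreal (((1/4)^k)\<^sup>2)"
    if n: "n \<ge> N k" for n k
  proof -
    have "(\<integral>\<^sup>+x. ennreal ((norm (u x - fn (X n) x))\<^sup>2) \<partial>lborel)
        = (\<integral>\<^sup>+x. liminf (\<lambda>j. ennreal ((norm (fn (X (r j)) x - fn (X n) x))\<^sup>2)) \<partial>lborel)"
    proof (rule nn_integral_cong_AE)
      show "AE x in lborel. ennreal ((norm (u x - fn (X n) x))\<^sup>2)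
          = liminf (\<lambda>j. ennreal ((norm (fn (X (r j)) x - fn (X n) x))\<^sup>2))"
        using lim_u
      proof eventually_elim
        case (elim x)
        then have "(\<lambda>j. ennreal ((norm (fn (X (r j)) x - fn (X n) x))\<^sup>2)) \<longlonglongrightarrow> ennreal ((norm (u x - fn (X n) x))\<^sup>2)"
          by (intro tendsto_intros)
        then show ?case
          by (intro lim_imp_Liminf[symmetric]) simp_all
      qed
    qed
    also have "\<dots> \<le> liminf (\<lambda>j. \<integral>\<^sup>+x. ennreal ((norm (fn (X (r j)) x - fn (X n) x))\<^sup>2) \<partial>lborel)"
      using nn_integral_liminf[of "\<lambda>j x. ennreal ((norm (fn (X (r j)) x - fn (X n) x))\<^sup>2)" lborel]
      by simp
    also have "\<dots> \<le> liminf (\<lambda>j. ennreal (((1/4)^k)\<^sup>2))"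
    proof (rule Liminf_mono)
      show "\<forall>\<^sub>F j in sequentially. (\<integral>\<^sup>+x. ennreal ((norm (fn (X (r j)) x - fn (X n) x))\<^sup>2) \<partial>lborel)
          \<le> ennreal (((1/4)^k)\<^sup>2)"
        using eventually_ge_at_top[of k]
      proof eventually_elim
        case (elim j)
        have "(\<integral>\<^sup>+x. ennreal ((norm (fn (X (r j)) x - fn (X n) x))\<^sup>2) \<partial>lborel) = ennreal ((norm (X (r j) - X n))\<^sup>2)"
          by (subst nn_norm_cls) (auto simp: square_integrable_diff cls_diff)
        also have "\<dots> \<le> ennreal (((1/4)^k)\<^sup>2)"
          using N[of k "r j" n] N_r[OF elim] n by (intro ennreal_leI power_mono) auto
        finally show ?case .
      qed
    qed
    finally show ?thesis
      by (simp add: Liminf_const)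
  qed
  have sq: "square_integrable (\<lambda>x. u x - fn (X n) x)" if "n \<ge> N 0" for n
    unfolding square_integrable_def using le_less_trans[OF close[OF that] ennreal_less_top]
    by (intro conjI integrableI_bounded) simp_all
  have sq_u: "square_integrable u"
    using square_integrable_add[OF sq[OF order_refl] square_integrable_fn[of "X (N 0)"]] by simp
  have "X \<longlonglongrightarrow> cls u"
  proof (rule metric_LIMSEQ_I)
    fix e :: real
    assume "e > 0"
    then obtain k where k: "(1/4)^k < e"
      using real_arch_pow_inv[of e "1/4"] by auto
    have "dist (X n) (cls u) < e" if "n \<ge> N k" for n
    proof -
      have "norm (cls u - X n) \<le> (1/4)^k"
        using close[OF that] sq_u
        by (subst (asm) nn_norm_cls) (auto simp: square_integrable_diff cls_diff power2_le_iff_abs_le)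
      then show ?thesis
        using k by (simp add: dist_norm norm_minus_commute)
    qed
    then show "\<exists>n0. \<forall>n\<ge>n0. dist (X n) (cls u) < e"
      by blast
  qed
  then show "convergent X"
    by (rule convergentI)
qed

section \<open>Density of continuous functions and separability\<close>

lemma integrable_cmult_cball:
  "integrable lborel (\<lambda>x::'a::euclidean_space. c * indicator (cball 0 r) x :: real)"
  using emeasure_lborel_cball_finite[of "0::'a" r]
  by (intro integrable_mult_right integrable_real_indicator) auto

text \<open>Lebesgue measurability yields continuous functions converging almost everywhere; a
  cutoff in space and a clamp on the modulus make them dominated, so that they converge in norm as
  well.\<close>

lemma cutoff_in_closure:
  fixes u :: "real^'n \<Rightarrow> complex"
  assumes u: "u \<in> borel_measurable borel" and B: "\<And>x. norm (u x) \<le> B" and R: "\<And>x. norm x > R \<Longrightarrow> u x = 0"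
  shows "cls u \<in> closure (cls ` {\<phi>. continuous_on UNIV \<phi> \<and> (\<forall>x. norm x > R + 1 \<longrightarrow> \<phi> x = 0)})"
proof -
  \<comment> \<open>Adding 1 keeps the divisor of the clamp positive even when \<open>B\<close> is
    0.\<close>
  define b where "b = B + 1"
  have b: "b > 0" and ub: "norm (u x) \<le> b" for x
    using B[of x] order_trans[OF norm_ge_zero B[of 0]] by (auto simp: b_def)
  have "u measurable_on UNIV"
    using u by (intro lebesgue_measurable_imp_measurable_on) (auto intro: measurable_completion)
  then obtain N g where N: "negligible N" and g: "\<And>n. continuous_on UNIV (g n)"
    and lim: "\<And>x. x \<notin> N \<Longrightarrow> (\<lambda>n. g n x) \<longlonglongrightarrow> u x"
    unfolding measurable_on_def by auto
  \<comment> \<open>The first factor is 1 on the ball of radius \<open>R\<close> and 0 beyond radius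
    \<open>R + 1\<close>; the last one scales values of modulus above \<open>b\<close> back to the
    circle of radius \<open>b\<close>.\<close>
  define \<phi> where "\<phi> n x = of_real (max 0 (min 1 (R + 1 - norm x))) * (g n x * of_real (b / max b (norm (g n x))))" for n x
  have cont: "continuous_on UNIV (\<phi> n)" for n
    unfolding \<phi>_def using b by (intro continuous_intros g) auto
  have supp: "\<phi> n x = 0" if "norm x > R + 1" for n x
    using that by (simp add: \<phi>_def)
  have bound: "norm (\<phi> n x) \<le> b" for n x
  proof -
    have "norm (g n x * of_real (b / max b (norm (g n x)))) = norm (g n x) * (b / max b (norm (g n x)))"
      using b by (simp add: norm_mult norm_divide abs_of_pos)
    also have "\<dots> \<le> b"
      using b by (simp add: field_simps max_def)
    finally have "norm (g n x * of_real (b / max b (norm (g n x)))) \<le> b" .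
    then have "\<bar>max 0 (min 1 (R + 1 - norm x))\<bar> * norm (g n x * of_real (b / max b (norm (g n x)))) \<le> 1 * b"
      using b by (intro mult_mono) auto
    then show ?thesis
      by (simp only: \<phi>_def norm_mult norm_of_real mult_1)
  qed
  have sqI: "square_integrable f"
    if "f \<in> borel_measurable borel" "\<And>x. norm (f x) \<le> c" "\<And>x. norm x > R + 1 \<Longrightarrow> f x = 0"
    for f :: "real^'n \<Rightarrow> complex" and c
  proof (rule square_integrable_bound[where w = "\<lambda>x. c\<^sup>2 * indicator (cball 0 (R + 1)) x"])
    have "(norm (f x))\<^sup>2 \<le> c\<^sup>2 * indicator (cball 0 (R + 1)) x" for x
      using that(2)[of x] that(3)[of x] by (auto simp: indicator_def power_mono not_le)
    then show "AE x in lborel. (norm (f x))\<^sup>2 \<le> c\<^sup>2 * indicator (cball 0 (R + 1)) x"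
      by simp
    show "integrable lborel (\<lambda>x::real^'n. c\<^sup>2 * indicator (cball 0 (R + 1)) x :: real)"
      by (rule integrable_cmult_cball)
  qed (use that in auto)
  have "(\<lambda>n. cls (\<phi> n)) \<longlonglongrightarrow> cls u"
  proof (rule cls_dominated_convergence[where w = "\<lambda>x. (2 * b)\<^sup>2 * indicator (cball 0 (R + 1)) x"])
    show "square_integrable (\<phi> n)" for n
      by (rule sqI[where c = b, OF borel_measurable_continuous_onI[OF cont] bound supp])
    show "square_integrable u"
      by (rule sqI[where c = b]) (use ub R u in auto)
    show "integrable lborel (\<lambda>x::real^'n. (2 * b)\<^sup>2 * indicator (cball 0 (R + 1)) x :: real)"
      by (rule integrable_cmult_cball)
    have "(norm (\<phi> n x - u x))\<^sup>2 \<le> (2 * b)\<^sup>2 * indicator (cball 0 (R + 1)) x" for n x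
    proof (cases "norm x \<le> R + 1")
      case True
      have "norm (\<phi> n x - u x) \<le> 2 * b"
        using bound[of n x] ub[of x] norm_triangle_ineq4[of "\<phi> n x" "u x"] by linarith
      then have "(norm (\<phi> n x - u x))\<^sup>2 \<le> (2 * b)\<^sup>2"
        by (rule power_mono) simp
      with True show ?thesis
        by simp
    next
      case False
      then show ?thesis
        using supp[of x n] R[of x] by simp
    qed
    then show "AE x in lborel. (norm (\<phi> n x - u x))\<^sup>2 \<le> (2 * b)\<^sup>2 * indicator (cball 0 (R + 1)) x" for n
      by simp
    have "(\<lambda>n. \<phi> n x) \<longlonglongrightarrow> u x" if x: "x \<notin> N" for x
    proof -
      have "(\<lambda>n. \<phi> n x) \<longlonglongrightarrow> of_real (max 0 (min 1 (R + 1 - norm x))) * (u x * of_real (b / max b (norm (u x))))"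
        unfolding \<phi>_def using b by (intro tendsto_intros lim[OF x]) auto
      also have "of_real (max 0 (min 1 (R + 1 - norm x))) * (u x * of_real (b / max b (norm (u x)))) = u x"
        using ub[of x] b R[of x] by (cases "norm x > R") (auto simp: max_def min_def)
      finally show ?thesis .
    qed
    moreover have "AE x in lborel. x \<notin> N"
      using AE_not_in[of N lebesgue] N unfolding negligible_iff_null_sets AE_completion_iff by blast
    ultimately show "AE x in lborel. (\<lambda>n. \<phi> n x) \<longlonglongrightarrow> u x"
      by (auto elim!: AE_mp)
  qed
  then show ?thesis
    unfolding closure_sequential using cont supp
    by (intro exI[of _ "\<lambda>n. cls (\<phi> n)"] conjI allI imageI) simp_all
qed

lemma compactly_supported_dense:
  "closure (cls ` {\<phi> :: real^'n \<Rightarrow> complex. continuous_on UNIV \<phi> \<and> (\<exists>R. \<forall>x. norm x > R \<longrightarrow> \<phi> x = 0)}) = UNIV"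
  (is "closure ?D = UNIV")
proof -
  have "F \<in> closure ?D" for F :: "'n L2"
  proof -
    define u where "u n x = (if norm x \<le> real n \<and> norm (fn F x) \<le> real n then fn F x else 0)" for n x
    have [measurable]: "u n \<in> borel_measurable borel" for n
      unfolding u_def by measurable
    have sq: "square_integrable (u n)" for n
      by (rule square_integrable_bound[where w = "\<lambda>x. (norm (fn F x))\<^sup>2"])
        (auto intro: square_integrable_power2 simp: u_def)
    have "(\<lambda>n. cls (u n)) \<longlonglongrightarrow> cls (fn F)"
    proof (rule cls_dominated_convergence[where w = "\<lambda>x. (norm (fn F x))\<^sup>2"])
      show "AE x in lborel. (\<lambda>n. u n x) \<longlonglongrightarrow> fn F x"
      proof (intro AE_I2 tendsto_eventually)
        fix x
        have "\<forall>\<^sub>F n in sequentially. real n \<ge> norm x" "\<forall>\<^sub>F n in sequentially. real n \<ge> norm (fn F x)"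
          using filterlim_real_sequentially by (auto simp: filterlim_at_top)
        then show "\<forall>\<^sub>F n in sequentially. u n x = fn F x"
          by eventually_elim (simp add: u_def)
      qed
      show "square_integrable (u n)" for n
        by (rule sq)
    qed (auto simp: u_def intro: square_integrable_power2)
    moreover have "cls (u n) \<in> closure ?D" for n
    proof -
      have "cls (u n) \<in> closure (cls ` {\<phi>. continuous_on UNIV \<phi> \<and> (\<forall>x. norm x > real n + 1 \<longrightarrow> \<phi> x = 0)})"
        by (rule cutoff_in_closure[where B = "real n"]) (auto simp: u_def)
      also have "\<dots> \<subseteq> closure ?D"
        by (intro closure_mono image_mono) blast
      finally show ?thesis .
    qed
    ultimately have "cls (fn F) \<in> closure (closure ?D)"
      unfolding closure_sequential[of _ "closure ?D"] by (intro exI[of _ "\<lambda>n. cls (u n)"]) simp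
    then show ?thesis
      by simp
  qed
  then show ?thesis
    by blast
qed

text \<open>Lists of index-coefficient pairs form a countable set as soon as the indices do. The
  closure of the rational combinations is a real subspace because rationals approximate each
  scalar.\<close>

lemma rational_span_dense:
  fixes e :: "'i \<Rightarrow> 'a::real_normed_vector"
  shows "span (range e) \<subseteq> closure (range (\<lambda>l :: ('i \<times> rat) list. \<Sum>(i, q)\<leftarrow>l. of_rat q *\<^sub>R e i))"
    (is "_ \<subseteq> closure ?D")
proof (rule span_minimal)
  have add_D: "x + y \<in> ?D" if x: "x \<in> ?D" and y: "y \<in> ?D" for x y
  proof -
    obtain l where "x = (\<Sum>(i, q)\<leftarrow>l. of_rat q *\<^sub>R e i)"
      using x by blast
    moreover obtain l' where "y = (\<Sum>(i, q)\<leftarrow>l'. of_rat q *\<^sub>R e i)"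
      using y by blast
    ultimately have "x + y = (\<Sum>(i, q)\<leftarrow>l @ l'. of_rat q *\<^sub>R e i)"
      by simp
    then show ?thesis
      by blast
  qed
  have scale_D: "of_rat p *\<^sub>R x \<in> ?D" if x: "x \<in> ?D" for p x
  proof -
    obtain l where l: "x = (\<Sum>(i, q)\<leftarrow>l. of_rat q *\<^sub>R e i)"
      using x by blast
    have "of_rat p *\<^sub>R (\<Sum>(i, q)\<leftarrow>l. of_rat q *\<^sub>R e i)
        = (\<Sum>(i, q)\<leftarrow>map (\<lambda>(i, q). (i, p * q)) l. of_rat q *\<^sub>R e i)"
      by (induction l) (auto simp: algebra_simps of_rat_mult)
    then show ?thesis
      unfolding l by (metis rangeI)
  qed
  show "subspace (closure ?D)"
    unfolding subspace_def
  proof (intro conjI ballI allI)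
    have "(\<Sum>(i, q)\<leftarrow>[]. of_rat q *\<^sub>R e i) \<in> ?D"
      by blast
    then show "0 \<in> closure ?D"
      using closure_subset[of ?D] by auto
    fix x y assume "x \<in> closure ?D" "y \<in> closure ?D"
    then obtain X Y where X: "\<And>n. X n \<in> ?D" "X \<longlonglongrightarrow> x" and Y: "\<And>n. Y n \<in> ?D" "Y \<longlonglongrightarrow> y"
      unfolding closure_sequential by blast
    then show "x + y \<in> closure ?D"
      unfolding closure_sequential
      by (intro exI[of _ "\<lambda>n. X n + Y n"] conjI allI tendsto_add[OF X(2) Y(2)] add_D X(1) Y(1))
  next
    fix c :: real and x assume "x \<in> closure ?D"
    then obtain X where X: "\<And>n. X n \<in> ?D" "X \<longlonglongrightarrow> x"
      unfolding closure_sequential by blast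
    have "\<exists>q. \<bar>of_rat q - c\<bar> < 1 / Suc n" for n
      using of_rat_dense[of "c - 1 / Suc n" "c + 1 / Suc n"] by (auto simp: abs_less_iff algebra_simps)
    then obtain q where q: "\<And>n. \<bar>of_rat (q n) - c\<bar> < 1 / Suc n"
      by metis
    have "(\<lambda>n. of_rat (q n) - c) \<longlonglongrightarrow> 0"
      by (rule tendsto_rabs_zero_cancel[OF tendsto_sandwich[OF _ _ tendsto_const LIMSEQ_inverse_real_of_nat]])
        (use q in \<open>auto intro!: always_eventually less_imp_le simp: inverse_eq_divide\<close>)
    then have "(\<lambda>n. of_rat (q n)) \<longlonglongrightarrow> c"
      by (simp add: LIM_zero_iff)
    then have "(\<lambda>n. of_rat (q n) *\<^sub>R X n) \<longlonglongrightarrow> c *\<^sub>R x"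
      using X by (intro tendsto_intros)
    then show "c *\<^sub>R x \<in> closure ?D"
      unfolding closure_sequential
      by (intro exI[of _ "\<lambda>n. of_rat (q n) *\<^sub>R X n"] conjI allI scale_D X(1))
  qed
  show "range e \<subseteq> closure ?D"
  proof
    fix x assume "x \<in> range e"
    then obtain i where "x = (\<Sum>(i, q)\<leftarrow>[(i, 1)]. of_rat q *\<^sub>R e i)"
      by auto
    then show "x \<in> closure ?D"
      using closure_subset[of ?D] by blast
  qed
qed

text \<open>Indicator of a cell of the grid of mesh 1 / (N + 1) inside the ball of radius
  \<open>K\<close>, times 1 or \<i>; both values occur because only real scalars act on the space.
  The index type is countable.\<close>

definition cell_fun :: "nat \<times> nat \<times> (int^'n) \<times> bool \<Rightarrow> real^'n \<Rightarrow> complex" where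
  "cell_fun = (\<lambda>(N, K, z, b) x. if norm x \<le> real K \<and> (\<chi> i. \<lfloor>Suc N * x $ i\<rfloor>) = z
     then (if b then 1 else \<i>) else 0)"

lemma square_integrable_cell_fun: "square_integrable (cell_fun i)"
proof (cases i)
  case (fields N K z b)
  have [measurable]: "cell_fun i \<in> borel_measurable borel"
    unfolding fields cell_fun_def prod.case vec_eq_iff vec_lambda_beta by measurable
  show ?thesis
  proof (rule square_integrable_bound[OF _ integrable_cmult_cball[of 1 K]])
    show "AE x in lborel. (norm (cell_fun i x))\<^sup>2 \<le> 1 * indicator (cball 0 (real K)) x"
      by (auto simp: fields cell_fun_def indicator_def)
  qed simp
qed

lemma square_integrable_sum:
  "(\<And>i. i \<in> I \<Longrightarrow> square_integrable (u i)) \<Longrightarrow> square_integrable (\<lambda>x. \<Sum>i\<in>I. u i x)"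
  by (induction I rule: infinite_finite_induct) (auto intro: square_integrable_add)

lemma cls_sum:
  "(\<And>i. i \<in> I \<Longrightarrow> square_integrable (u i)) \<Longrightarrow> cls (\<lambda>x. \<Sum>i\<in>I. u i x) = (\<Sum>i\<in>I. cls (u i))"
  by (induction I rule: infinite_finite_induct)
    (auto simp: cls_add square_integrable_sum zero_L2_def)

text \<open>A continuous function of compact support is the pointwise limit of step functions taking
  its values at the lower corners of the cells, and a bounded set meets only finitely many
  cells.\<close>

lemma cell_funs_total: "closure (span (range (\<lambda>i. cls (cell_fun i)))) = (UNIV :: ('n::finite) L2 set)"
proof -
  have "cls \<phi> \<in> closure (span (range (\<lambda>i. cls (cell_fun i))))"
    if cont: "continuous_on UNIV \<phi>" and R: "\<And>x. norm x > R \<Longrightarrow> \<phi> x = 0" for \<phi> :: "real^'n \<Rightarrow> complex" and R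
  proof -
    obtain K :: nat where K: "R \<le> real K"
      using real_arch_simple by blast
    define q :: "nat \<Rightarrow> real^'n \<Rightarrow> int^'n" where "q N x = (\<chi> i. \<lfloor>Suc N * x $ i\<rfloor>)" for N x
    define pt :: "nat \<Rightarrow> int^'n \<Rightarrow> real^'n" where "pt N z = (\<chi> i. z $ i / Suc N)" for N z
    define \<psi> where "\<psi> N x = (if norm x \<le> real K then \<phi> (pt N (q N x)) else 0)" for N x
    define Z where "Z N = q N ` cball 0 (real K)" for N
    have fin: "finite (Z N)" for N
    proof -
      have "\<bar>z $ i\<bar> \<le> int (Suc N * K + 1)" if "z \<in> Z N" for z i
      proof -
        obtain x where x: "norm x \<le> K" "z = q N x"
          using \<open>z \<in> Z N\<close> by (auto simp: Z_def)
        have "\<bar>real (Suc N) * x $ i\<bar> \<le> real (Suc N) * real K"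
          using order_trans[OF component_le_norm_cart[of x i] x(1)]
          unfolding abs_mult by (intro mult_mono) auto
        then have "\<lfloor>Suc N * x $ i\<rfloor> \<le> int (Suc N * K)" "- int (Suc N * K) \<le> \<lfloor>Suc N * x $ i\<rfloor>"
          unfolding floor_le_iff le_floor_iff by (simp_all only: abs_le_iff of_int_minus of_int_of_nat_eq of_nat_mult of_int_mult) linarith+
        then show ?thesis
          by (simp add: x q_def)
      qed
      then have "Z N \<subseteq> vec_lambda ` (UNIV \<rightarrow>\<^sub>E {- int (Suc N * K + 1) .. int (Suc N * K + 1)})"
        by (auto simp: abs_le_iff intro!: image_eqI[of _ vec_lambda "vec_nth _"])
          (smt (verit))
      then show ?thesis
        by (rule finite_subset) (intro finite_imageI finite_PiE, auto)
    qed
    have \<psi>_sum: "\<psi> N x = (\<Sum>z\<in>Z N. Re (\<phi> (pt N z)) *\<^sub>R cell_fun (N, K, z, True) x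
        + Im (\<phi> (pt N z)) *\<^sub>R cell_fun (N, K, z, False) x)" for N x
    proof -
      have "(\<Sum>z\<in>Z N. Re (\<phi> (pt N z)) *\<^sub>R cell_fun (N, K, z, True) x
          + Im (\<phi> (pt N z)) *\<^sub>R cell_fun (N, K, z, False) x)
        = (\<Sum>z\<in>Z N. if z = q N x then (if norm x \<le> real K then \<phi> (pt N z) else 0) else 0)"
        by (intro sum.cong) (auto simp: cell_fun_def q_def complex_eq_iff)
      also have "\<dots> = \<psi> N x"
        using fin by (auto simp: sum.delta \<psi>_def Z_def)
      finally show ?thesis ..
    qed
    have sq_term: "square_integrable (\<lambda>x. Re (\<phi> (pt N z)) *\<^sub>R cell_fun (N, K, z, True) x
        + Im (\<phi> (pt N z)) *\<^sub>R cell_fun (N, K, z, False) x)" for N z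
      by (intro square_integrable_add square_integrable_scaleR square_integrable_cell_fun)
    have in_span: "cls (\<psi> N) \<in> span (range (\<lambda>i. cls (cell_fun i)))" for N
    proof -
      have "cls (\<psi> N) = (\<Sum>z\<in>Z N. Re (\<phi> (pt N z)) *\<^sub>R cls (cell_fun (N, K, z, True))
        + Im (\<phi> (pt N z)) *\<^sub>R cls (cell_fun (N, K, z, False)))"
        unfolding \<psi>_sum by (subst cls_sum[OF sq_term])
          (simp add: cls_add cls_scaleR square_integrable_cell_fun square_integrable_scaleR)
      also have "\<dots> \<in> span (range (\<lambda>i. cls (cell_fun i)))"
        by (intro span_sum span_add span_scale span_base) auto
      finally show ?thesis .
    qed
    obtain B where B: "\<And>x. norm (\<phi> x) \<le> B"
    proof -
      have "compact (\<phi> ` cball 0 R)"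
        by (intro compact_continuous_image continuous_on_subset[OF cont]) auto
      then obtain B where "\<And>x. x \<in> cball 0 R \<Longrightarrow> norm (\<phi> x) \<le> B"
        by (metis bounded_iff compact_imp_bounded imageI)
      then have "norm (\<phi> x) \<le> max B 0" for x
        using R[of x] by (cases "norm x > R") (simp_all add: not_less le_max_iff_disj)
      then show ?thesis
        using that by blast
    qed
    have B0: "0 \<le> B"
      using order_trans[OF norm_ge_zero B] by blast
    have "(\<lambda>N. cls (\<psi> N)) \<longlonglongrightarrow> cls \<phi>"
    proof (rule cls_dominated_convergence[where w = "\<lambda>x. (2 * B)\<^sup>2 * indicator (cball 0 (real K)) x"])
      show "square_integrable (\<psi> N)" for N
        unfolding \<psi>_sum by (intro square_integrable_sum sq_term)
      show int: "integrable lborel (\<lambda>x::real^'n. c * indicator (cball 0 (real K)) x :: real)" for c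
        by (rule integrable_cmult_cball)
      show "square_integrable \<phi>"
      proof (rule square_integrable_bound[OF _ int[of "B\<^sup>2"]])
        show "AE x in lborel. (norm (\<phi> x))\<^sup>2 \<le> B\<^sup>2 * indicator (cball 0 (real K)) x"
          using B R K by (intro AE_I2) (auto simp: indicator_def power_mono not_le)
      qed (use cont borel_measurable_continuous_onI in auto)
      show "AE x in lborel. (norm (\<psi> N x - \<phi> x))\<^sup>2 \<le> (2 * B)\<^sup>2 * indicator (cball 0 (real K)) x" for N
      proof (rule AE_I2)
        fix x
        have "norm (\<psi> N x - \<phi> x) \<le> 2 * B"
          using norm_triangle_ineq4[of "\<psi> N x" "\<phi> x"] B[of x] B[of "pt N (q N x)"] B0
          by (auto simp: \<psi>_def)
        then have "(norm (\<psi> N x - \<phi> x))\<^sup>2 \<le> (2 * B)\<^sup>2"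
          by (rule power_mono) simp
        then show "(norm (\<psi> N x - \<phi> x))\<^sup>2 \<le> (2 * B)\<^sup>2 * indicator (cball 0 (real K)) x"
          using R[of x] K by (cases "norm x \<le> real K") (simp_all add: \<psi>_def)
      qed
      have "(\<lambda>N. \<psi> N x) \<longlonglongrightarrow> \<phi> x" for x
      proof (cases "norm x \<le> real K")
        case True
        have "(\<lambda>N. pt N (q N x)) \<longlonglongrightarrow> x"
        proof (rule vec_tendstoI)
          fix i
          have "\<bar>pt N (q N x) $ i - x $ i\<bar> \<le> inverse (real (Suc N))" for N
          proof -
            have eq: "pt N (q N x) $ i - x $ i = (of_int \<lfloor>Suc N * x $ i\<rfloor> - Suc N * x $ i) / Suc N"
              by (simp add: pt_def q_def diff_divide_distrib)
            show ?thesis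
              unfolding eq abs_divide inverse_eq_divide abs_of_nat
              by (rule divide_right_mono) (linarith, simp)
          qed
          then have "(\<lambda>N. pt N (q N x) $ i - x $ i) \<longlonglongrightarrow> 0"
            by (intro tendsto_rabs_zero_cancel[OF tendsto_sandwich[OF _ _ tendsto_const LIMSEQ_inverse_real_of_nat]])
              auto
          then show "(\<lambda>N. pt N (q N x) $ i) \<longlonglongrightarrow> x $ i"
            by (simp add: LIM_zero_iff)
        qed
        then have "(\<lambda>N. \<phi> (pt N (q N x))) \<longlonglongrightarrow> \<phi> x"
          by (rule continuous_on_tendsto_compose[OF cont]) auto
        then show ?thesis
          using True by (simp add: \<psi>_def)
      next
        case False
        then show ?thesis
          using R[of x] K by (simp add: \<psi>_def)
      qed
      then show "AE x in lborel. (\<lambda>N. \<psi> N x) \<longlonglongrightarrow> \<phi> x"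
        by simp
    qed
    then show ?thesis
      unfolding closure_sequential using in_span by (intro exI[of _ "\<lambda>N. cls (\<psi> N)"]) simp
  qed
  then have "closure (cls ` {\<phi> :: real^'n \<Rightarrow> complex. continuous_on UNIV \<phi> \<and> (\<exists>R. \<forall>x. norm x > R \<longrightarrow> \<phi> x = 0)})
      \<subseteq> closure (span (range (\<lambda>i. cls (cell_fun i))))"
    by (intro closure_minimal) auto
  then show ?thesis
    unfolding compactly_supported_dense by blast
qed

text \<open>Needed for the Bochner integral of functions with values in this space. A basis is given
  by balls of radius 1 / (k + 1) around the rational combinations of cell functions.\<close>

instance L2 :: (finite) second_countable_topology
proof
  define D :: "'a L2 set" where
    "D = range (\<lambda>l :: ((nat \<times> nat \<times> (int^'a) \<times> bool) \<times> rat) list. \<Sum>(i, q)\<leftarrow>l. of_rat q *\<^sub>R cls (cell_fun i))"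
  have "closure (span (range (\<lambda>i. cls (cell_fun i)))) \<subseteq> closure D"
    unfolding D_def by (intro closure_minimal rational_span_dense) auto
  then have dense: "closure D = UNIV"
    unfolding cell_funs_total by blast
  define \<B> where "\<B> = (\<lambda>(F, k). ball F (inverse (real (Suc k)))) ` (D \<times> UNIV)"
  have "countable \<B>"
    unfolding \<B>_def D_def by (intro countable_image countable_SIGMA) auto
  moreover have "topological_basis \<B>"
  proof (rule topological_basisI)
    show "open U" if "U \<in> \<B>" for U
      using that by (auto simp: \<B>_def)
    fix U :: "'a L2 set" and F
    assume "open U" "F \<in> U"
    then obtain e where e: "e > 0" "ball F e \<subseteq> U"
      by (auto simp: open_contains_ball)
    obtain k where k: "inverse (real (Suc k)) < e / 2"
      using reals_Archimedean[of "e / 2"] e by auto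
    obtain G where G: "G \<in> D" "dist G F < inverse (real (Suc k))"
      using dense closure_approachable[of F D]
      by (metis UNIV_I inverse_positive_iff_positive of_nat_0_less_iff zero_less_Suc)
    have "ball G (inverse (real (Suc k))) \<subseteq> ball F e"
    proof
      fix H assume "H \<in> ball G (inverse (real (Suc k)))"
      then have "dist F H < inverse (real (Suc k)) + inverse (real (Suc k))"
        using G(2) dist_triangle[of F H G] by (simp add: dist_commute)
      then show "H \<in> ball F e"
        using k by simp
    qed
    then show "\<exists>B\<in>\<B>. F \<in> B \<and> B \<subseteq> U"
      using G e by (intro bexI[of _ "ball G (inverse (real (Suc k)))"]) (auto simp: \<B>_def)
  qed
  ultimately show "\<exists>B :: 'a L2 set set. countable B \<and> open = generate_topology B"
    using topological_basis_imp_subbasis by blast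
qed

section \<open>Multiplication operators\<close>

text \<open>Nothing forces the product to be square integrable; a \<open>bounded_symbol\<close>
  hypothesis supplies this wherever the values matter.\<close>

definition mul :: "(real^'n \<Rightarrow> real) \<Rightarrow> 'n L2 \<Rightarrow> 'n L2" where
  "mul a F = cls (\<lambda>x. a x *\<^sub>R fn F x)"

definition bounded_symbol :: "(real^'n \<Rightarrow> real) \<Rightarrow> real \<Rightarrow> bool" where
  "bounded_symbol a K \<longleftrightarrow> a \<in> borel_measurable borel \<and> (\<forall>x. \<bar>a x\<bar> \<le> K)"

lemma square_integrable_symbol:
  assumes "bounded_symbol a K" "square_integrable u"
  shows "square_integrable (\<lambda>x. a x *\<^sub>R u x)"
  using square_integrable_mult_bounded[OF assms(2), of "\<lambda>x. of_real (a x)" K] assms(1)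
  by (auto simp: bounded_symbol_def scaleR_conv_of_real)

lemma mul_cls:
  assumes "square_integrable u"
  shows "mul a (cls u) = cls (\<lambda>x. a x *\<^sub>R u x)"
  unfolding mul_def using fn_cls[OF assms] by (intro cls_eqI) (auto elim!: AE_mp)

lemma mul_mul:
  assumes "bounded_symbol b K"
  shows "mul a (mul b F) = mul (\<lambda>x. a x * b x) F"
proof -
  have "mul a (mul b F) = mul a (cls (\<lambda>x. b x *\<^sub>R fn F x))"
    by (simp add: mul_def)
  also have "\<dots> = cls (\<lambda>x. a x *\<^sub>R b x *\<^sub>R fn F x)"
    by (rule mul_cls) (rule square_integrable_symbol[OF assms square_integrable_fn])
  finally show ?thesis
    by (simp add: mul_def)
qed

lemma mul_add: "bounded_symbol a K \<Longrightarrow> mul a (F + G) = mul a F + mul a G"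
  using mul_cls[OF square_integrable_add[of "fn F" "fn G"], of a]
  by (simp add: cls_add mul_def square_integrable_symbol scaleR_add_right)

lemma mul_diff: "bounded_symbol a K \<Longrightarrow> mul a (F - G) = mul a F - mul a G"
  using mul_cls[OF square_integrable_diff[of "fn F" "fn G"], of a]
  by (simp add: cls_diff mul_def square_integrable_symbol scaleR_diff_right)

lemma mul_scaleR: "bounded_symbol a K \<Longrightarrow> mul a (r *\<^sub>R F) = r *\<^sub>R mul a F"
  using mul_cls[OF square_integrable_scaleR[of "fn F" r], of a]
    cls_scaleR[OF square_integrable_symbol[of a K "fn F"], of r]
  by (simp add: cls_scaleR mul_def mult.commute)

lemma norm_mul_le:
  assumes "bounded_symbol a K"
  shows "norm (mul a F) \<le> K * norm F"
proof -
  have a: "\<bar>a x\<bar> \<le> K" for x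
    using assms by (simp add: bounded_symbol_def)
  have "(norm (a x *\<^sub>R fn F x))\<^sup>2 \<le> (K * norm (fn F x))\<^sup>2" for x
    using a[of x] by (intro power_mono) (auto intro!: mult_right_mono)
  then have K: "K \<ge> 0" "\<And>x. (norm (a x *\<^sub>R fn F x))\<^sup>2 \<le> K\<^sup>2 * (norm (fn F x))\<^sup>2"
    using order_trans[OF abs_ge_zero a] by (auto simp: power_mult_distrib)
  have "(LINT x|lborel. (norm (a x *\<^sub>R fn F x))\<^sup>2) \<le> (LINT x|lborel. K\<^sup>2 * (norm (fn F x))\<^sup>2)"
    using assms by (intro integral_mono K square_integrable_power2 square_integrable_symbol integrable_mult_right) auto
  also have "\<dots> = (K * norm F)\<^sup>2"
    using norm_cls[OF square_integrable_fn[of F]] by (simp add: power_mult_distrib)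
  finally have "(norm (mul a F))\<^sup>2 \<le> (K * norm F)\<^sup>2"
    using norm_cls[OF square_integrable_symbol[OF assms square_integrable_fn[of F]]] by (simp add: mul_def)
  then show ?thesis
    by (rule power2_le_imp_le) (simp add: K)
qed

text \<open>Pointwise convergence of uniformly bounded symbols gives strong convergence only, by
  dominated convergence for each fixed element. Continuity in time of the solution operators is
  meant in this sense.\<close>

lemma mul_tendsto:
  assumes a: "\<And>n. bounded_symbol (a n) K" and b: "bounded_symbol b L"
    and lim: "\<And>x. (\<lambda>n. a n x) \<longlonglongrightarrow> b x"
  shows "(\<lambda>n. mul (a n) F) \<longlonglongrightarrow> mul b F"
  unfolding mul_def
proof (rule cls_dominated_convergence[where w = "\<lambda>x. (K + L)\<^sup>2 * (norm (fn F x))\<^sup>2"])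
  have "(norm (a n x *\<^sub>R fn F x - b x *\<^sub>R fn F x))\<^sup>2 \<le> (K + L)\<^sup>2 * (norm (fn F x))\<^sup>2" for n x
  proof -
    have "\<bar>a n x - b x\<bar> \<le> K + L"
      using a[of n] b by (auto simp: bounded_symbol_def abs_le_iff) (smt (verit, best))+
    then have "(norm ((a n x - b x) *\<^sub>R fn F x))\<^sup>2 \<le> ((K + L) * norm (fn F x))\<^sup>2"
      by (intro power_mono) (auto intro!: mult_right_mono)
    then show ?thesis
      by (simp add: scaleR_diff_left power_mult_distrib)
  qed
  then show "AE x in lborel. (norm (a n x *\<^sub>R fn F x - b x *\<^sub>R fn F x))\<^sup>2 \<le> (K + L)\<^sup>2 * (norm (fn F x))\<^sup>2" for n
    by simp
  show "AE x in lborel. (\<lambda>n. a n x *\<^sub>R fn F x) \<longlonglongrightarrow> b x *\<^sub>R fn F x"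
    by (intro AE_I2 tendsto_intros lim)
qed (use a b in \<open>auto intro!: square_integrable_symbol integrable_mult_right square_integrable_power2\<close>)

section \<open>Plancherel's theorem\<close>

lemma measurable_cis [measurable]: "cis \<in> borel_measurable borel"
  by (intro borel_measurable_continuous_onI continuous_intros)

lemma measurable_cnj [measurable]: "cnj \<in> borel_measurable borel"
  by (intro borel_measurable_continuous_onI continuous_intros)

section \<open>The Fourier integral of integrable functions\<close>

definition ft :: "(real^'n \<Rightarrow> complex) \<Rightarrow> real^'n \<Rightarrow> complex" where
  "ft u \<xi> = (LINT x|lborel. cis (- (\<xi> \<bullet> x)) * u x)"

lemma ft_measurable [measurable]:
  assumes [measurable]: "u \<in> borel_measurable borel"
  shows "ft u \<in> borel_measurable borel"
  unfolding ft_def by measurable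

lemma integrable_cis_mult:
  fixes u :: "real^'n \<Rightarrow> complex"
  assumes "integrable lborel u"
  shows "integrable lborel (\<lambda>x. cis (- (\<xi> \<bullet> x)) * u x)"
  using assms by (intro Bochner_Integration.integrable_bound[OF integrable_norm[OF assms]]) (auto simp: norm_mult)

lemma norm_ft_le: "integrable lborel u \<Longrightarrow> norm (ft u \<xi>) \<le> (LINT x|lborel. norm (u x))"
  unfolding ft_def using integral_norm_bound[of lborel "\<lambda>x. cis (- (\<xi> \<bullet> x)) * u x"]
  by (simp add: norm_mult)

lemma ft_diff: "integrable lborel u \<Longrightarrow> integrable lborel v \<Longrightarrow> ft (\<lambda>x. u x - v x) \<xi> = ft u \<xi> - ft v \<xi>"
  unfolding ft_def by (simp add: right_diff_distrib Bochner_Integration.integral_diff integrable_cis_mult)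

lemma ft_add: "integrable lborel u \<Longrightarrow> integrable lborel v \<Longrightarrow> ft (\<lambda>x. u x + v x) \<xi> = ft u \<xi> + ft v \<xi>"
  unfolding ft_def by (simp add: distrib_left Bochner_Integration.integral_add integrable_cis_mult)

lemma ft_scaleR: "ft (\<lambda>x. r *\<^sub>R u x) \<xi> = r *\<^sub>R ft u \<xi>"
  unfolding ft_def by (simp add: integral_scaleR_right)

text \<open>Fubini for the kernel e^(-i x \<xi>), which is symmetric in its two variables.\<close>

lemma ft_multiplication_formula:
  fixes u v :: "real^'n \<Rightarrow> complex"
  assumes u: "integrable lborel u" and v: "integrable lborel v"
  shows "(LINT \<xi>|lborel. ft u \<xi> * v \<xi>) = (LINT x|lborel. u x * ft v x)"
proof -
  note [measurable] = borel_measurable_integrable[OF u] borel_measurable_integrable[OF v]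
  define f where "f = (\<lambda>(\<xi>, x). cis (- (\<xi> \<bullet> x)) * u x * v \<xi>)"
  have "integrable (lborel \<Otimes>\<^sub>M lborel) f"
  proof (rule lborel_pair.Fubini_integrable)
    show "f \<in> borel_measurable (lborel \<Otimes>\<^sub>M lborel)"
      unfolding f_def by measurable
    show "integrable lborel (\<lambda>\<xi>. LINT x|lborel. norm (f (\<xi>, x)))"
      using v by (simp add: f_def norm_mult)
    show "AE \<xi> in lborel. integrable lborel (\<lambda>x. f (\<xi>, x))"
      using u by (auto simp: f_def intro!: integrable_mult_left integrable_cis_mult)
  qed
  then have "(LINT x|lborel. LINT \<xi>|lborel. f (\<xi>, x)) = (LINT \<xi>|lborel. LINT x|lborel. f (\<xi>, x))"
    by (intro lborel_pair.Fubini_integral) (simp add: f_def case_prod_unfold)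
  moreover have "(LINT \<xi>|lborel. f (\<xi>, x)) = u x * ft v x" for x
    unfolding f_def ft_def by (simp add: inner_commute mult_ac flip: integral_mult_right_zero)
  moreover have "(LINT x|lborel. f (\<xi>, x)) = ft u \<xi> * v \<xi>" for \<xi>
    by (simp add: f_def ft_def)
  ultimately show ?thesis
    by simp
qed

section \<open>Gaussians and their transforms\<close>

definition gauss :: "real^'n \<Rightarrow> real" where
  "gauss x = exp (- (norm x)\<^sup>2 / 2)"

text \<open>This is (2 \<pi>)^(N/2): the integral of the Gaussian and, in the chosen normalisation,
  the constant in Plancherel's identity.\<close>

definition gauss_mass :: "('n::finite) itself \<Rightarrow> real" where
  "gauss_mass _ = sqrt (2 * pi) ^ CARD('n)"

lemma gauss_mass_pos: "gauss_mass TYPE('n::finite) > 0"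
  by (simp add: gauss_mass_def)

lemma gauss_measurable [measurable]: "gauss \<in> borel_measurable borel"
  unfolding gauss_def by measurable

text \<open>The characteristic function of the standard normal distribution, rescaled by sqrt (2
  \<pi>).\<close>

lemma ft_gauss_real:
  "integrable lborel (\<lambda>x::real. cis (- (t * x)) * complex_of_real (exp (- x\<^sup>2 / 2)))"
  "(LINT x|lborel. cis (- (t * x)) * complex_of_real (exp (- x\<^sup>2 / 2))) = complex_of_real (sqrt (2 * pi) * exp (- t\<^sup>2 / 2))"
proof -
  have eq: "cis (- (t * x)) * complex_of_real (exp (- x\<^sup>2 / 2)) = complex_of_real (sqrt (2 * pi)) * (std_normal_density x *\<^sub>R iexp (- t * x))" for x
    by (simp add: std_normal_density_def cis_conv_exp scaleR_conv_of_real flip: exp_of_real)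
  have int: "integrable lborel (\<lambda>x. std_normal_density x *\<^sub>R iexp (- t * x))"
    by (rule Bochner_Integration.integrable_bound[OF integrable_normal_density[of 1 0]])
      auto
  then show "integrable lborel (\<lambda>x::real. cis (- (t * x)) * complex_of_real (exp (- x\<^sup>2 / 2)))"
    unfolding eq by (rule integrable_mult_right)
  have "char std_normal_distribution (- t) = (LINT x|lborel. std_normal_density x *\<^sub>R iexp (- t * x))"
    unfolding char_def by (subst integral_density) auto
  then have "(LINT x|lborel. std_normal_density x *\<^sub>R iexp (- t * x)) = complex_of_real (exp (- t\<^sup>2 / 2))"
    by (simp add: char_std_normal_distribution)
  then show "(LINT x|lborel. cis (- (t * x)) * complex_of_real (exp (- x\<^sup>2 / 2))) = complex_of_real (sqrt (2 * pi) * exp (- t\<^sup>2 / 2))"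
    unfolding eq integral_mult_right_zero by simp
qed

lemma cis_sum: "finite A \<Longrightarrow> cis (\<Sum>a\<in>A. f a) = (\<Prod>a\<in>A. cis (f a))"
  by (induction rule: finite_induct) (auto simp: cis_mult[symmetric])

text \<open>Lebesgue measure is the image of the product measure over the basis, and both the
  Gaussian and the character factor over coordinates, which reduces everything to dimension
  one.\<close>

lemma ft_gauss:
  fixes z :: "real^'n"
  shows "integrable lborel (\<lambda>x::real^'n. complex_of_real (gauss x))"
    and "ft (\<lambda>x. complex_of_real (gauss x)) z = gauss_mass TYPE('n) * gauss z"
proof -
  interpret P: product_sigma_finite "\<lambda>b::real^'n. lborel :: real measure" ..
  let ?M = "\<Pi>\<^sub>M b\<in>(Basis::(real^'n) set). (lborel :: real measure)"
  have L: "(lborel :: (real^'n) measure) = distr ?M borel (\<lambda>y. \<Sum>b\<in>Basis. y b *\<^sub>R b)"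
    by (rule lborel_eq)
  have fin: "finite (Basis :: (real^'n) set)"
    by simp
  have emb: "(\<lambda>y. \<Sum>b\<in>Basis. y b *\<^sub>R b) \<in> ?M \<rightarrow>\<^sub>M (borel :: (real^'n) measure)"
    by measurable
  have gauss_prod: "gauss (\<Sum>b\<in>Basis. y b *\<^sub>R b :: real^'n) = (\<Prod>b\<in>Basis. exp (- (y b)\<^sup>2 / 2))" for y
  proof -
    have "(norm (\<Sum>b\<in>Basis. y b *\<^sub>R b :: real^'n))\<^sup>2 = (\<Sum>b\<in>Basis. (y b)\<^sup>2)"
      by (subst norm_sum_Pythagorean) (auto simp: pairwise_def orthogonal_def inner_Basis power_mult_distrib)
    then show ?thesis
      by (simp add: gauss_def exp_sum sum_divide_distrib flip: sum_negf)
  qed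
  have split: "cis (- (w \<bullet> (\<Sum>b\<in>Basis. y b *\<^sub>R b))) * gauss (\<Sum>b\<in>Basis. y b *\<^sub>R b)
      = (\<Prod>b\<in>Basis. cis (- ((w \<bullet> b) * y b)) * exp (- (y b)\<^sup>2 / 2))" for w :: "real^'n" and y
  proof -
    have "cis (- (w \<bullet> (\<Sum>b\<in>Basis. y b *\<^sub>R b))) = (\<Prod>b\<in>Basis. cis (- ((w \<bullet> b) * y b)))"
      using cis_sum[OF fin, of "\<lambda>b. - ((w \<bullet> b) * y b)"] by (simp add: inner_sum_right sum_negf mult_ac)
    then show ?thesis
      by (simp add: gauss_prod prod.distrib)
  qed
  have int: "integrable ?M (\<lambda>y. \<Prod>b\<in>Basis. cis (- ((w \<bullet> b) * y b)) * exp (- (y b)\<^sup>2 / 2))" for w :: "real^'n"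
    by (rule P.product_integrable_prod[OF fin]) (rule ft_gauss_real)
  have "integrable lborel (\<lambda>x::real^'n. cis (- (0 \<bullet> x)) * gauss x)"
    unfolding L by (subst integrable_distr_eq[OF emb]) (measurable, simp only: split int)
  then show "integrable lborel (\<lambda>x::real^'n. complex_of_real (gauss x))"
    by simp
  have "ft (\<lambda>x. complex_of_real (gauss x)) z
      = (LINT y|?M. (\<Prod>b\<in>Basis. cis (- ((z \<bullet> b) * y b)) * exp (- (y b)\<^sup>2 / 2)))"
    unfolding ft_def L by (subst integral_distr[OF emb]) (measurable, simp only: split)
  also have "\<dots> = (\<Prod>b\<in>Basis. (LINT x|lborel. cis (- ((z \<bullet> b) * x)) * complex_of_real (exp (- x\<^sup>2 / 2))))"
    by (rule P.product_integral_prod[OF fin, of "\<lambda>b x. cis (- ((z \<bullet> b) * x)) * complex_of_real (exp (- x\<^sup>2 / 2))"])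
      (rule ft_gauss_real)
  also have "\<dots> = (\<Prod>b\<in>(Basis :: (real^'n) set). complex_of_real (sqrt (2 * pi)) * exp (- (z \<bullet> b)\<^sup>2 / 2))"
    by (simp only: ft_gauss_real(2) of_real_mult)
  also have "\<dots> = gauss_mass TYPE('n) * gauss z"
  proof -
    have "gauss z = (\<Prod>b\<in>Basis. exp (- (z \<bullet> b)\<^sup>2 / 2))"
      using gauss_prod[of "\<lambda>b. z \<bullet> b"] by (simp add: euclidean_representation)
    then show ?thesis
      by (simp add: prod.distrib gauss_mass_def)
  qed
  finally show "ft (\<lambda>x. complex_of_real (gauss x)) z = gauss_mass TYPE('n) * gauss z" .
qed

lemma lborel_integral_affine:
  fixes h :: "real^'n \<Rightarrow> complex"
  assumes [measurable]: "h \<in> borel_measurable borel" and c: "c > 0"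
  shows "(LINT y|lborel. h y) = c ^ CARD('n) *\<^sub>R (LINT w|lborel. h (x + c *\<^sub>R w))"
proof -
  have "(LINT y|lborel. h y) = (LINT y|density (distr lborel borel (\<lambda>w. x + c *\<^sub>R w)) (\<lambda>_. ennreal (c ^ CARD('n))). h y)"
    using c lborel_affine[of c x] by simp
  also have "\<dots> = (LINT w|lborel. c ^ CARD('n) *\<^sub>R h (x + c *\<^sub>R w))"
    using c by (subst integral_density) (auto simp: integral_distr)
  finally show ?thesis
    by (simp add: integral_scaleR_right)
qed

lemma lborel_integrable_affine:
  fixes h :: "real^'n \<Rightarrow> complex"
  assumes h: "integrable lborel h" and c: "c > 0"
  shows "integrable lborel (\<lambda>w. h (x + c *\<^sub>R w))"
proof -
  have [measurable]: "h \<in> borel_measurable borel"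
    using borel_measurable_integrable[OF h] by simp
  have "integrable (density (distr lborel borel (\<lambda>w. x + c *\<^sub>R w)) (\<lambda>_. ennreal (c ^ CARD('n)))) h"
    using h c lborel_affine[of c x] by simp
  then have "integrable lborel (\<lambda>w. c ^ CARD('n) *\<^sub>R h (x + c *\<^sub>R w))"
    using c by (subst (asm) integrable_density) (auto simp: integrable_distr_eq)
  from integrable_scaleR_right[OF this, of "inverse (c ^ CARD('n))"] show ?thesis
    using c by simp
qed

lemma gauss_bounds: "0 < gauss x" "gauss x \<le> 1"
  by (simp_all add: gauss_def)

lemma integral_gauss:
  "(LINT x|lborel. gauss (x::real^'n)) = gauss_mass TYPE('n)"
proof -
  have "complex_of_real (LINT x|lborel. gauss (x::real^'n)) = ft (\<lambda>x::real^'n. complex_of_real (gauss x)) 0"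
    by (simp add: ft_def)
  also have "\<dots> = complex_of_real (gauss_mass TYPE('n))"
    by (simp only: ft_gauss(2)) (simp add: gauss_def)
  finally show ?thesis
    by (simp only: of_real_eq_iff)
qed

lemma ft_scaled_gauss:
  fixes x y :: "real^'n"
  assumes e: "e > 0"
  shows "ft (\<lambda>\<xi>. cis (x \<bullet> \<xi>) * gauss (e *\<^sub>R \<xi>)) y
    = (1 / e) ^ CARD('n) *\<^sub>R (gauss_mass TYPE('n) * gauss ((1 / e) *\<^sub>R (y - x)))"
proof -
  have "ft (\<lambda>\<xi>. cis (x \<bullet> \<xi>) * gauss (e *\<^sub>R \<xi>)) y = (LINT \<xi>|lborel. cis (- ((y - x) \<bullet> \<xi>)) * gauss (e *\<^sub>R \<xi>))"
    unfolding ft_def by (simp add: mult.assoc[symmetric] cis_mult inner_diff_left)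
  also have "\<dots> = (1 / e) ^ CARD('n) *\<^sub>R (LINT \<eta>|lborel. cis (- (((1 / e) *\<^sub>R (y - x)) \<bullet> \<eta>)) * gauss \<eta>)"
    using e by (subst lborel_integral_affine[of _ "1 / e" 0]) (auto simp: inner_diff_left diff_divide_distrib)
  also have "\<dots> = (1 / e) ^ CARD('n) *\<^sub>R (gauss_mass TYPE('n) * gauss ((1 / e) *\<^sub>R (y - x)))"
    using ft_gauss(2)[of "(1 / e) *\<^sub>R (y - x)"] by (simp add: ft_def scaleR_conv_of_real)
  finally show ?thesis .
qed

text \<open>The multiplication formula for \<open>f\<close> and for the conjugate of
  \<open>ft f\<close> damped by a Gaussian. By a second use of the formula, the transform of the
  damped factor at x is the conjugate of an average of \<open>f\<close> around x at scale
  \<open>e\<close>.\<close>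

lemma ft_parseval_regularised:
  fixes f :: "real^'n \<Rightarrow> complex"
  assumes f: "integrable lborel f" and e: "e > 0"
  shows "(LINT \<xi>|lborel. ft f \<xi> * (cnj (ft f \<xi>) * gauss (e *\<^sub>R \<xi>)))
    = (LINT x|lborel. f x * cnj (LINT w|lborel. f (x + e *\<^sub>R w) * (gauss_mass TYPE('n) * gauss w)))"
proof -
  note [measurable] = borel_measurable_integrable[OF f, simplified]
  have gauss_e: "integrable lborel (\<lambda>\<xi>::real^'n. complex_of_real (gauss (e *\<^sub>R \<xi>)))"
    using lborel_integrable_affine[OF ft_gauss(1) e, of 0] by simp
  have int_gx: "integrable lborel (\<lambda>\<xi>. cis (x \<bullet> \<xi>) * gauss (e *\<^sub>R \<xi>))" for x :: "real^'n"
    using integrable_cis_mult[OF gauss_e, of "- x"] by simp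
  have int_v: "integrable lborel (\<lambda>\<xi>. cnj (ft f \<xi>) * gauss (e *\<^sub>R \<xi>))"
  proof (rule Bochner_Integration.integrable_bound)
    show "integrable lborel (\<lambda>\<xi>::real^'n. (LINT x|lborel. norm (f x)) *\<^sub>R complex_of_real (gauss (e *\<^sub>R \<xi>)))"
      by (intro integrable_scaleR_right gauss_e)
    show "AE \<xi> in lborel. norm (cnj (ft f \<xi>) * gauss (e *\<^sub>R \<xi>))
        \<le> norm ((LINT x|lborel. norm (f x)) *\<^sub>R complex_of_real (gauss (e *\<^sub>R \<xi>)))"
      using norm_ft_le[OF f] by (intro AE_I2) (auto simp: norm_mult intro!: mult_right_mono)
  qed measurable
  have "ft (\<lambda>\<xi>. cnj (ft f \<xi>) * gauss (e *\<^sub>R \<xi>)) x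
      = cnj (LINT w|lborel. f (x + e *\<^sub>R w) * (gauss_mass TYPE('n) * gauss w))" for x
  proof -
    have "ft (\<lambda>\<xi>. cnj (ft f \<xi>) * gauss (e *\<^sub>R \<xi>)) x
        = (LINT \<xi>|lborel. cnj (ft f \<xi> * (cis (x \<bullet> \<xi>) * gauss (e *\<^sub>R \<xi>))))"
      unfolding ft_def[of "\<lambda>\<xi>. cnj (ft f \<xi>) * gauss (e *\<^sub>R \<xi>)"]
      by (intro Bochner_Integration.integral_cong) (auto simp: cis_cnj mult_ac)
    also have "\<dots> = cnj (LINT \<xi>|lborel. ft f \<xi> * (cis (x \<bullet> \<xi>) * gauss (e *\<^sub>R \<xi>)))"
      by (rule Bochner_Integration.integral_cnj)
    also have "(LINT \<xi>|lborel. ft f \<xi> * (cis (x \<bullet> \<xi>) * gauss (e *\<^sub>R \<xi>)))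
        = (LINT y|lborel. f y * ((1 / e) ^ CARD('n) *\<^sub>R (gauss_mass TYPE('n) * gauss ((1 / e) *\<^sub>R (y - x)))))"
      unfolding ft_scaled_gauss[OF e, symmetric] by (rule ft_multiplication_formula[OF f int_gx])
    also have "\<dots> = e ^ CARD('n) *\<^sub>R (LINT w|lborel. f (x + e *\<^sub>R w)
        * ((1 / e) ^ CARD('n) *\<^sub>R (gauss_mass TYPE('n) * gauss w)))"
      using e by (subst lborel_integral_affine[OF _ e, of _ x]) auto
    also have "\<dots> = (LINT w|lborel. f (x + e *\<^sub>R w) * (gauss_mass TYPE('n) * gauss w))"
      using e by (simp add: power_one_over scaleR_conv_of_real field_simps)
    finally show ?thesis .
  qed
  then show ?thesis
    using ft_multiplication_formula[OF f int_v] by simp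
qed

text \<open>Pointwise limits are the natural hypothesis here: Fourier integrals are seen to converge
  at each frequency before anything is known about the limit in norm.\<close>

lemma L2_Fatou:
  fixes f :: "nat \<Rightarrow> real^'n \<Rightarrow> complex"
  assumes f: "\<And>j. square_integrable (f j)" and lim: "\<And>x. (\<lambda>j. f j x) \<longlonglongrightarrow> h x"
    and L: "(\<lambda>j. norm (cls (f j))) \<longlonglongrightarrow> L"
  shows "square_integrable h" "norm (cls h) \<le> L"
proof -
  have [measurable]: "f j \<in> borel_measurable borel" for j
    by (rule square_integrable_measurable[OF f])
  have [measurable]: "h \<in> borel_measurable borel"
    by (rule borel_measurable_LIMSEQ_metric[OF _ lim]) simp
  have "(\<integral>\<^sup>+x. ennreal ((norm (h x))\<^sup>2) \<partial>lborel) = (\<integral>\<^sup>+x. liminf (\<lambda>j. ennreal ((norm (f j x))\<^sup>2)) \<partial>lborel)"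
  proof (rule nn_integral_cong)
    fix x
    have "(\<lambda>j. ennreal ((norm (f j x))\<^sup>2)) \<longlonglongrightarrow> ennreal ((norm (h x))\<^sup>2)"
      by (intro tendsto_intros lim)
    then show "ennreal ((norm (h x))\<^sup>2) = liminf (\<lambda>j. ennreal ((norm (f j x))\<^sup>2))"
      by (intro lim_imp_Liminf[symmetric]) simp_all
  qed
  also have "\<dots> \<le> liminf (\<lambda>j. \<integral>\<^sup>+x. ennreal ((norm (f j x))\<^sup>2) \<partial>lborel)"
    using nn_integral_liminf[of "\<lambda>j x. ennreal ((norm (f j x))\<^sup>2)" lborel] by simp
  also have "\<dots> = liminf (\<lambda>j. ennreal ((norm (cls (f j)))\<^sup>2))"
    by (simp add: nn_norm_cls f)
  also have "\<dots> = ennreal (L\<^sup>2)"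
    by (intro lim_imp_Liminf tendsto_ennrealI tendsto_power L) simp
  finally have le: "(\<integral>\<^sup>+x. ennreal ((norm (h x))\<^sup>2) \<partial>lborel) \<le> ennreal (L\<^sup>2)" .
  show sq: "square_integrable h"
    unfolding square_integrable_def using le_less_trans[OF le ennreal_less_top]
    by (intro conjI integrableI_bounded) simp_all
  have "L \<ge> 0"
    by (rule LIMSEQ_le_const[OF L]) auto
  then show "norm (cls h) \<le> L"
    using le nn_norm_cls[OF sq] by (auto simp: power2_le_iff_abs_le)
qed

lemma integrable_compactly_supported:
  fixes \<phi> :: "real^'n \<Rightarrow> complex"
  assumes cont: "continuous_on UNIV \<phi>" and R: "\<And>x. norm x > R \<Longrightarrow> \<phi> x = 0"
  obtains B where "\<And>x. norm (\<phi> x) \<le> B" "integrable lborel \<phi>" "square_integrable \<phi>"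
proof -
  have "compact (\<phi> ` cball 0 R)"
    by (intro compact_continuous_image continuous_on_subset[OF cont]) auto
  then obtain B where "\<And>x. x \<in> cball 0 R \<Longrightarrow> norm (\<phi> x) \<le> B"
    by (metis bounded_iff compact_imp_bounded imageI)
  then have B: "norm (\<phi> x) \<le> max B 0" for x
    using R[of x] by (cases "norm x > R") (simp_all add: not_less le_max_iff_disj)
  have [measurable]: "\<phi> \<in> borel_measurable borel"
    by (rule borel_measurable_continuous_onI[OF cont])
  have "norm (\<phi> x) \<le> max B 0 * indicator (cball 0 R) x" for x
    using B[of x] R[of x] by (cases "norm x \<le> R") auto
  then have "integrable lborel \<phi>"
    by (intro Bochner_Integration.integrable_bound[OF integrable_cmult_cball[of "max B 0" R]])
      (auto intro: order_trans)
  moreover have "square_integrable \<phi>"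
  proof (rule square_integrable_bound[OF _ integrable_cmult_cball[of "(max B 0)\<^sup>2" R]])
    have "(norm (\<phi> x))\<^sup>2 \<le> (max B 0)\<^sup>2 * indicator (cball 0 R) x" for x
      using power_mono[OF B[of x] norm_ge_zero, of 2] R[of x] by (cases "norm x \<le> R") auto
    then show "AE x in lborel. (norm (\<phi> x))\<^sup>2 \<le> (max B 0)\<^sup>2 * indicator (cball 0 R) x"
      by simp
  qed simp
  ultimately show ?thesis
    using B that by blast
qed

text \<open>Letting the width of the Gaussian regularisation grow turns the regularised identity into
  Parseval's identity: the left-hand side converges monotonically, the right-hand side by
  dominated convergence.\<close>

lemma ft_parseval_compactly_supported:
  fixes f :: "real^'n \<Rightarrow> complex"
  assumes cont: "continuous_on UNIV f" and R: "\<And>x. norm x > R \<Longrightarrow> f x = 0"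
  shows "square_integrable (ft f)" "norm (cls (ft f)) = gauss_mass TYPE('n) * norm (cls f)"
proof -
  obtain B where B: "\<And>x. norm (f x) \<le> B" and f: "integrable lborel f" and sq: "square_integrable f"
    using integrable_compactly_supported[OF assms] by blast
  let ?\<kappa> = "gauss_mass TYPE('n)"
  have B0: "B \<ge> 0"
    using order_trans[OF norm_ge_zero B] by blast
  have [measurable]: "f \<in> borel_measurable borel"
    by (rule square_integrable_measurable[OF sq])
  define e where "e k = inverse (real (Suc k))" for k
  have e: "e k > 0" for k
    by (simp add: e_def)
  have e_lim: "e \<longlonglongrightarrow> 0"
    unfolding e_def by (rule LIMSEQ_inverse_real_of_nat)
  have gint: "integrable lborel (\<lambda>w::real^'n. B * (?\<kappa> * gauss w))"
    using ft_gauss(1) by (intro integrable_mult_right) (simp add: complex_of_real_integrable_eq)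
  have nb: "norm (f (x + e k *\<^sub>R w) * (?\<kappa> * gauss w)) \<le> B * (?\<kappa> * gauss w)" for x k and w :: "real^'n"
  proof -
    have "norm (f (x + e k *\<^sub>R w)) * (?\<kappa> * gauss w) \<le> B * (?\<kappa> * gauss w)"
      using gauss_mass_pos[where 'n='n] gauss_bounds(1)[of w] by (intro mult_right_mono B) auto
    then show ?thesis
      using gauss_mass_pos[where 'n='n] gauss_bounds(1)[of w] by (simp add: norm_mult)
  qed
  have norm_I: "norm (LINT w|lborel. f (x + e k *\<^sub>R w) * (?\<kappa> * gauss w)) \<le> (LINT w|(lborel :: (real^'n) measure). B * (?\<kappa> * gauss w))" for k x
  proof (rule Bochner_Integration.integral_norm_bound_integral[OF _ gint nb])
    show "integrable lborel (\<lambda>w. f (x + e k *\<^sub>R w) * (?\<kappa> * gauss w))"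
      by (rule Bochner_Integration.integrable_bound[OF gint])
        (measurable, intro AE_I2 order_trans[OF nb], simp)
  qed
  have I_lim: "(\<lambda>k. LINT w|lborel. f (x + e k *\<^sub>R w) * (?\<kappa> * gauss w)) \<longlonglongrightarrow> f x * ?\<kappa>\<^sup>2" for x
  proof -
    have "(\<lambda>k. LINT w|lborel. f (x + e k *\<^sub>R w) * (?\<kappa> * gauss w))
        \<longlonglongrightarrow> (LINT w|lborel. f x * complex_of_real (?\<kappa> * gauss (w::real^'n)))"
    proof (rule integral_dominated_convergence)
      have "(\<lambda>k. f (x + e k *\<^sub>R w) * (?\<kappa> * gauss w)) \<longlonglongrightarrow> f x * (?\<kappa> * gauss w)" for w
      proof (intro tendsto_mult tendsto_const)
        have "(\<lambda>k. x + e k *\<^sub>R w) \<longlonglongrightarrow> x + 0 *\<^sub>R w"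
          by (intro tendsto_intros e_lim)
        then show "(\<lambda>k. f (x + e k *\<^sub>R w)) \<longlonglongrightarrow> f x"
          by (intro continuous_on_tendsto_compose[OF cont]) auto
      qed
      then show "AE w in lborel. (\<lambda>k. f (x + e k *\<^sub>R w) * (?\<kappa> * gauss w)) \<longlonglongrightarrow> f x * (?\<kappa> * gauss w)"
        by simp
      show "AE w in lborel. norm (f (x + e k *\<^sub>R w) * (?\<kappa> * gauss w)) \<le> B * (?\<kappa> * gauss w)" for k
        using nb by (simp only: AE_I2)
    qed (measurable, measurable, rule gint)
    then show ?thesis
      by (simp add: integral_gauss power2_eq_square)
  qed
  have "(\<lambda>k. LINT x|lborel. f x * cnj (LINT w|lborel. f (x + e k *\<^sub>R w) * (?\<kappa> * gauss w)))
      \<longlonglongrightarrow> (LINT x|lborel. f x * cnj (f x * ?\<kappa>\<^sup>2))"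
  proof (rule integral_dominated_convergence[where w = "\<lambda>x. norm (f x) * (LINT w|(lborel :: (real^'n) measure). B * (?\<kappa> * gauss w))"])
    show "AE x in lborel. (\<lambda>k. f x * cnj (LINT w|lborel. f (x + e k *\<^sub>R w) * (?\<kappa> * gauss w))) \<longlonglongrightarrow> f x * cnj (f x * ?\<kappa>\<^sup>2)"
      by (intro AE_I2 tendsto_intros I_lim)
    show "AE x in lborel. norm (f x * cnj (LINT w|lborel. f (x + e k *\<^sub>R w) * (?\<kappa> * gauss w)))
        \<le> norm (f x) * (LINT w|(lborel :: (real^'n) measure). B * (?\<kappa> * gauss w))" for k
      using norm_I unfolding norm_mult complex_mod_cnj by (intro AE_I2 mult_left_mono) auto
  qed (use f in auto)
  also have "(LINT x|lborel. f x * cnj (f x * ?\<kappa>\<^sup>2)) = complex_of_real (?\<kappa>\<^sup>2 * (LINT x|lborel. (norm (f x))\<^sup>2))"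
  proof -
    have "(LINT x|lborel. f x * cnj (f x * ?\<kappa>\<^sup>2)) = (LINT x|lborel. complex_of_real (?\<kappa>\<^sup>2 * (norm (f x))\<^sup>2))"
    proof (intro Bochner_Integration.integral_cong refl)
      fix x
      have "f x * cnj (f x * ?\<kappa>\<^sup>2) = (f x * cnj (f x)) * ?\<kappa>\<^sup>2"
        by simp
      then show "f x * cnj (f x * ?\<kappa>\<^sup>2) = complex_of_real (?\<kappa>\<^sup>2 * (norm (f x))\<^sup>2)"
        by (simp only: complex_norm_square[symmetric]) simp
    qed
    then show ?thesis
      by (simp only: integral_complex_of_real integral_mult_right_zero)
  qed
  also have "(\<lambda>k. LINT x|lborel. f x * cnj (LINT w|lborel. f (x + e k *\<^sub>R w) * (?\<kappa> * gauss w)))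
      = (\<lambda>k. complex_of_real (LINT \<xi>|lborel. (norm (ft f \<xi>))\<^sup>2 * gauss (e k *\<^sub>R \<xi>)))"
  proof
    fix k
    have sq: "ft f \<xi> * (cnj (ft f \<xi>) * gauss (e k *\<^sub>R \<xi>)) = complex_of_real ((norm (ft f \<xi>))\<^sup>2 * gauss (e k *\<^sub>R \<xi>))" for \<xi>
    proof -
      have "ft f \<xi> * (cnj (ft f \<xi>) * gauss (e k *\<^sub>R \<xi>)) = (ft f \<xi> * cnj (ft f \<xi>)) * gauss (e k *\<^sub>R \<xi>)"
        by simp
      then show ?thesis
        by (simp only: complex_norm_square[symmetric]) simp
    qed
    show "(LINT x|lborel. f x * cnj (LINT w|lborel. f (x + e k *\<^sub>R w) * (?\<kappa> * gauss w)))
        = complex_of_real (LINT \<xi>|lborel. (norm (ft f \<xi>))\<^sup>2 * gauss (e k *\<^sub>R \<xi>))"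
      unfolding ft_parseval_regularised[OF f e[of k], symmetric] sq by (rule integral_complex_of_real)
  qed
  finally have lim1: "(\<lambda>k. LINT \<xi>|lborel. (norm (ft f \<xi>))\<^sup>2 * gauss (e k *\<^sub>R \<xi>)) \<longlonglongrightarrow> ?\<kappa>\<^sup>2 * (LINT x|lborel. (norm (f x))\<^sup>2)"
    by (simp only: tendsto_of_real_iff)
  have nn: "ennreal (LINT \<xi>|lborel. (norm (ft f \<xi>))\<^sup>2 * gauss (e k *\<^sub>R \<xi>))
      = (\<integral>\<^sup>+\<xi>. ennreal ((norm (ft f \<xi>))\<^sup>2 * gauss (e k *\<^sub>R \<xi>)) \<partial>lborel)" for k
  proof (rule nn_integral_eq_integral[symmetric])
    have ge: "integrable lborel (\<lambda>\<xi>::real^'n. gauss (e k *\<^sub>R \<xi>))"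
      using lborel_integrable_affine[OF ft_gauss(1) e[of k], of 0] by (simp add: complex_of_real_integrable_eq)
    show "integrable lborel (\<lambda>\<xi>. (norm (ft f \<xi>))\<^sup>2 * gauss (e k *\<^sub>R \<xi>))"
    proof (rule Bochner_Integration.integrable_bound[OF integrable_mult_right[OF ge, of "(LINT x|lborel. norm (f x))\<^sup>2"]])
      show "AE \<xi> in lborel. norm ((norm (ft f \<xi>))\<^sup>2 * gauss (e k *\<^sub>R \<xi>))
          \<le> norm ((LINT x|lborel. norm (f x))\<^sup>2 * gauss (e k *\<^sub>R \<xi>))"
        using norm_ft_le[OF f] gauss_bounds(1)
        by (intro AE_I2) (auto simp: abs_mult intro!: mult_right_mono power_mono)
    qed measurable
  qed (intro AE_I2 mult_nonneg_nonneg zero_le_power2 less_imp_le[OF gauss_bounds(1)])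
  have "(\<lambda>k. \<integral>\<^sup>+\<xi>. ennreal ((norm (ft f \<xi>))\<^sup>2 * gauss (e k *\<^sub>R \<xi>)) \<partial>lborel)
      \<longlonglongrightarrow> (\<integral>\<^sup>+\<xi>. ennreal ((norm (ft f \<xi>))\<^sup>2) \<partial>lborel)"
  proof (rule nn_integral_LIMSEQ)
    show "incseq (\<lambda>k \<xi>. ennreal ((norm (ft f \<xi>))\<^sup>2 * gauss (e k *\<^sub>R \<xi>)))"
    proof (intro incseq_SucI le_funI ennreal_leI mult_left_mono)
      fix k and \<xi> :: "real^'n"
      have "(norm (e (Suc k) *\<^sub>R \<xi>))\<^sup>2 \<le> (norm (e k *\<^sub>R \<xi>))\<^sup>2"
        unfolding norm_scaleR by (intro power_mono mult_right_mono) (auto simp: e_def divide_simps)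
      then show "gauss (e k *\<^sub>R \<xi>) \<le> gauss (e (Suc k) *\<^sub>R \<xi>)"
        by (simp add: gauss_def)
    qed auto
    show "(\<lambda>k. ennreal ((norm (ft f \<xi>))\<^sup>2 * gauss (e k *\<^sub>R \<xi>))) \<longlonglongrightarrow> ennreal ((norm (ft f \<xi>))\<^sup>2)" for \<xi>
    proof -
      have "(\<lambda>k. (norm (ft f \<xi>))\<^sup>2 * exp (- (norm (e k *\<^sub>R \<xi>))\<^sup>2 / 2)) \<longlonglongrightarrow> (norm (ft f \<xi>))\<^sup>2 * exp (- (norm (0 *\<^sub>R \<xi>))\<^sup>2 / 2)"
        by (intro tendsto_intros e_lim) auto
      then show ?thesis
        by (intro tendsto_ennrealI) (simp add: gauss_def)
    qed
  qed measurable
  moreover have "(\<lambda>k. ennreal (LINT \<xi>|lborel. (norm (ft f \<xi>))\<^sup>2 * gauss (e k *\<^sub>R \<xi>)))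
      \<longlonglongrightarrow> ennreal (?\<kappa>\<^sup>2 * (LINT x|lborel. (norm (f x))\<^sup>2))"
    by (intro tendsto_ennrealI lim1)
  \<comment> \<open>Finiteness of the left-hand side is a conclusion: it yields the square
    integrability of \<open>ft f\<close> together with its norm.\<close>
  ultimately have eq: "(\<integral>\<^sup>+\<xi>. ennreal ((norm (ft f \<xi>))\<^sup>2) \<partial>lborel) = ennreal (?\<kappa>\<^sup>2 * (LINT x|lborel. (norm (f x))\<^sup>2))"
    unfolding nn by (rule LIMSEQ_unique)
  show sq': "square_integrable (ft f)"
    unfolding square_integrable_def using eq
    by (intro conjI integrableI_bounded) simp_all
  have "(norm (cls (ft f)))\<^sup>2 = (?\<kappa> * norm (cls f))\<^sup>2"
    using eq unfolding nn_norm_cls[OF sq'] by (simp add: norm_cls[OF sq] power_mult_distrib)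
  then show "norm (cls (ft f)) = ?\<kappa> * norm (cls f)"
    using gauss_mass_pos[where 'n='n] by (simp add: power2_eq_iff_nonneg)
qed

section \<open>From continuous functions to square-integrable functions on a ball\<close>

lemma cutoff_in_closure_square_integrable:
  fixes u :: "real^'n \<Rightarrow> complex"
  assumes u: "square_integrable u" and R: "\<And>x. norm x > R \<Longrightarrow> u x = 0"
  shows "cls u \<in> closure (cls ` {\<phi>. continuous_on UNIV \<phi> \<and> (\<forall>x. norm x > R + 1 \<longrightarrow> \<phi> x = 0)})"
    (is "_ \<in> closure ?D")
proof -
  note [measurable] = square_integrable_measurable[OF u]
  define v where "v n x = (if norm (u x) \<le> real n then u x else 0)" for n x
  have [measurable]: "v n \<in> borel_measurable borel" for n
    unfolding v_def by measurable
  have sq: "square_integrable (v n)" for n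
    by (rule square_integrable_bound[where w = "\<lambda>x. (norm (u x))\<^sup>2"])
      (auto intro: square_integrable_power2[OF u] simp: v_def)
  have "(\<lambda>n. cls (v n)) \<longlonglongrightarrow> cls u"
  proof (rule cls_dominated_convergence[where w = "\<lambda>x. (norm (u x))\<^sup>2"])
    show "AE x in lborel. (\<lambda>n. v n x) \<longlonglongrightarrow> u x"
    proof (intro AE_I2 tendsto_eventually)
      fix x
      have "\<forall>\<^sub>F n in sequentially. real n \<ge> norm (u x)"
        using filterlim_real_sequentially by (auto simp: filterlim_at_top)
      then show "\<forall>\<^sub>F n in sequentially. v n x = u x"
        by eventually_elim (simp add: v_def)
    qed
  qed (use u sq in \<open>auto simp: v_def intro: square_integrable_power2\<close>)
  moreover have "cls (v n) \<in> closure ?D" for n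
    by (rule cutoff_in_closure[where B = "real n"]) (auto simp: v_def R)
  ultimately have "cls u \<in> closure (closure ?D)"
    unfolding closure_sequential[of _ "closure ?D"] by (intro exI[of _ "\<lambda>n. cls (v n)"]) simp
  then show ?thesis
    by simp
qed

text \<open>Cauchy-Schwarz against the indicator of the ball. Approximation in L2 within a fixed
  ball thereby controls Fourier integrals uniformly in the frequency.\<close>

lemma L1_le_L2_on_ball:
  fixes u :: "real^'n \<Rightarrow> complex"
  assumes u: "square_integrable u" and R: "\<And>x. norm x > R \<Longrightarrow> u x = 0"
  shows "integrable lborel u"
    "(LINT x|lborel. norm (u x)) \<le> norm (cls (indicator (cball 0 R) :: real^'n \<Rightarrow> complex)) * norm (cls u)"
proof -
  note [measurable] = square_integrable_measurable[OF u]
  let ?i = "indicator (cball 0 R) :: real^'n \<Rightarrow> complex"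
  have [measurable]: "?i \<in> borel_measurable borel"
    by (rule borel_measurable_indicator) simp
  have i: "square_integrable ?i"
    by (rule square_integrable_bound[OF _ integrable_cmult_cball[of 1 R]]) (auto simp: indicator_def)
  have nu: "square_integrable (\<lambda>x. complex_of_real (norm (u x)))"
    using u by (simp add: square_integrable_def)
  have eq: "?i x \<bullet> complex_of_real (norm (u x)) = norm (u x)" for x
    using R[of x] by (cases "norm x > R") (auto simp: inner_complex_def)
  show "integrable lborel u"
    using square_integrable_inner[OF i nu] unfolding eq by (subst (asm) integrable_norm_iff) auto
  have "(LINT x|lborel. norm (u x)) = cls ?i \<bullet> cls (\<lambda>x. complex_of_real (norm (u x)))"
    unfolding inner_cls[OF i nu] eq ..
  also have "\<dots> \<le> norm (cls ?i) * norm (cls (\<lambda>x. complex_of_real (norm (u x))))"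
    by (rule norm_cauchy_schwarz)
  also have "norm (cls (\<lambda>x. complex_of_real (norm (u x)))) = norm (cls u)"
    by (simp add: norm_cls[OF nu] norm_cls[OF u])
  finally show "(LINT x|lborel. norm (u x)) \<le> norm (cls ?i) * norm (cls u)" .
qed

text \<open>Approximants supported in the ball of radius \<open>R + 1\<close> also converge in L1,
  so their transforms converge pointwise to \<open>ft u\<close>, while Parseval makes these
  transforms Cauchy in L2; Fatou's lemma identifies the two limits.\<close>

lemma ft_parseval_ball:
  fixes u :: "real^'n \<Rightarrow> complex"
  assumes u: "square_integrable u" and R: "\<And>x. norm x > R \<Longrightarrow> u x = 0"
  shows "square_integrable (ft u)" "norm (cls (ft u)) = gauss_mass TYPE('n) * norm (cls u)"
proof -
  let ?\<kappa> = "gauss_mass TYPE('n)"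
  obtain X where X: "\<And>j. X j \<in> cls ` {\<phi>. continuous_on UNIV \<phi> \<and> (\<forall>x. norm x > R + 1 \<longrightarrow> \<phi> x = 0)}" "X \<longlonglongrightarrow> cls u"
    using cutoff_in_closure_square_integrable[OF assms] unfolding closure_sequential by blast
  then obtain \<phi> where X_eq: "\<And>j. X j = cls (\<phi> j)" and cont: "\<And>j. continuous_on UNIV (\<phi> j)"
    and supp: "\<And>j x. norm x > R + 1 \<Longrightarrow> \<phi> j x = 0"
    unfolding image_iff Bex_def mem_Collect_eq by metis
  have \<phi>_lim: "(\<lambda>j. cls (\<phi> j)) \<longlonglongrightarrow> cls u"
  proof -
    have "X = (\<lambda>j. cls (\<phi> j))"
      using X_eq by blast
    then show ?thesis
      using X(2) by simp
  qed
  have sq: "square_integrable (\<phi> j)" and int: "integrable lborel (\<phi> j)" for j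
    using integrable_compactly_supported[OF cont supp] by metis+
  have int_u: "integrable lborel u"
    by (rule L1_le_L2_on_ball[OF assms])
  have sq_ft: "square_integrable (ft (\<phi> j))" for j
    by (rule ft_parseval_compactly_supported[OF cont supp])
  have norm_diff: "norm (cls (ft (\<phi> j)) - cls (ft (\<phi> k))) = ?\<kappa> * norm (cls (\<phi> j) - cls (\<phi> k))" for j k
  proof -
    have "cls (ft (\<phi> j)) - cls (ft (\<phi> k)) = cls (ft (\<lambda>x. \<phi> j x - \<phi> k x))"
      using cls_diff[OF sq_ft[of j] sq_ft[of k]] ft_diff[OF int[of j] int[of k]] by presburger
    also have "norm \<dots> = ?\<kappa> * norm (cls (\<lambda>x. \<phi> j x - \<phi> k x))"
      by (rule ft_parseval_compactly_supported[of _ "R + 1"]) (auto intro!: continuous_on_diff cont supp simp: supp)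
    finally show ?thesis
      by (simp add: cls_diff sq)
  qed
  have ft_lim: "(\<lambda>j. ft (\<phi> j) \<xi>) \<longlonglongrightarrow> ft u \<xi>" for \<xi>
  proof -
    let ?c = "norm (cls (indicator (cball 0 (R + 1)) :: real^'n \<Rightarrow> complex))"
    have "norm (ft (\<phi> j) \<xi> - ft u \<xi>) \<le> ?c * norm (cls (\<phi> j) - cls u)" for j
    proof -
      have sqd: "square_integrable (\<lambda>x. \<phi> j x - u x)"
        by (intro square_integrable_diff sq u)
      have "norm (ft (\<phi> j) \<xi> - ft u \<xi>) \<le> (LINT x|lborel. norm (\<phi> j x - u x))"
        using norm_ft_le[of "\<lambda>x. \<phi> j x - u x" \<xi>] by (simp add: ft_diff int int_u)
      also have "\<dots> \<le> ?c * norm (cls (\<lambda>x. \<phi> j x - u x))"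
        by (rule L1_le_L2_on_ball[OF sqd]) (simp add: supp R)
      finally show ?thesis
        by (simp add: cls_diff sq u)
    qed
    moreover have "(\<lambda>j. ?c * norm (cls (\<phi> j) - cls u)) \<longlonglongrightarrow> 0"
      using tendsto_mult_right_zero[OF tendsto_norm_zero[OF LIM_zero[OF \<phi>_lim]]] .
    ultimately have "(\<lambda>j. ft (\<phi> j) \<xi> - ft u \<xi>) \<longlonglongrightarrow> 0"
      by (intro Lim_null_comparison[OF always_eventually, of "\<lambda>j. ft (\<phi> j) \<xi> - ft u \<xi>"]) auto
    then show ?thesis
      by (simp add: LIM_zero_iff)
  qed
  \<comment> \<open>The isometry on differences of approximants passes to the limit in
    \<open>j\<close> with \<open>k\<close> fixed.\<close>
  have Fatou: "square_integrable (\<lambda>\<xi>. ft u \<xi> - ft (\<phi> k) \<xi>)"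
    "norm (cls (\<lambda>\<xi>. ft u \<xi> - ft (\<phi> k) \<xi>)) \<le> ?\<kappa> * norm (cls u - cls (\<phi> k))" for k
  proof -
    have sqd: "square_integrable (\<lambda>\<xi>. ft (\<phi> j) \<xi> - ft (\<phi> k) \<xi>)" for j
      by (intro square_integrable_diff sq_ft)
    have "(\<lambda>j. ft (\<phi> j) \<xi> - ft (\<phi> k) \<xi>) \<longlonglongrightarrow> ft u \<xi> - ft (\<phi> k) \<xi>" for \<xi>
      by (intro tendsto_intros ft_lim)
    moreover have "(\<lambda>j. norm (cls (\<lambda>\<xi>. ft (\<phi> j) \<xi> - ft (\<phi> k) \<xi>))) \<longlonglongrightarrow> ?\<kappa> * norm (cls u - cls (\<phi> k))"
      unfolding cls_diff[OF sq_ft sq_ft] norm_diff by (intro tendsto_intros \<phi>_lim)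
    ultimately show "square_integrable (\<lambda>\<xi>. ft u \<xi> - ft (\<phi> k) \<xi>)"
      "norm (cls (\<lambda>\<xi>. ft u \<xi> - ft (\<phi> k) \<xi>)) \<le> ?\<kappa> * norm (cls u - cls (\<phi> k))"
      by (intro L2_Fatou[of "\<lambda>j \<xi>. ft (\<phi> j) \<xi> - ft (\<phi> k) \<xi>", OF sqd]; simp)+
  qed
  show sq_u: "square_integrable (ft u)"
    using square_integrable_add[OF Fatou(1)[of 0] sq_ft[of 0]] by simp
  have "(\<lambda>k. cls (ft u) - cls (ft (\<phi> k))) \<longlonglongrightarrow> 0"
  proof (rule Lim_null_comparison[OF always_eventually])
    show "\<forall>k. norm (cls (ft u) - cls (ft (\<phi> k))) \<le> ?\<kappa> * norm (cls (\<phi> k) - cls u)"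
      using Fatou(2) by (simp add: cls_diff sq_u sq_ft norm_minus_commute)
    show "(\<lambda>k. ?\<kappa> * norm (cls (\<phi> k) - cls u)) \<longlonglongrightarrow> 0"
      using tendsto_mult_right_zero[OF tendsto_norm_zero[OF LIM_zero[OF \<phi>_lim]]] .
  qed
  then have "(\<lambda>k. cls (ft u) - (cls (ft u) - cls (ft (\<phi> k)))) \<longlonglongrightarrow> cls (ft u) - 0"
    by (intro tendsto_diff tendsto_const)
  then have "(\<lambda>k. norm (cls (ft (\<phi> k)))) \<longlonglongrightarrow> norm (cls (ft u))"
    by (intro tendsto_norm) simp
  moreover have "(\<lambda>k. norm (cls (ft (\<phi> k)))) \<longlonglongrightarrow> ?\<kappa> * norm (cls u)"
  proof -
    have "norm (cls (ft (\<phi> k))) = ?\<kappa> * norm (cls (\<phi> k))" for k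
      by (rule ft_parseval_compactly_supported(2)[OF cont supp])
    then show ?thesis
      by (simp only:) (intro tendsto_intros \<phi>_lim)
  qed
  ultimately show "norm (cls (ft u)) = ?\<kappa> * norm (cls u)"
    by (rule LIMSEQ_unique)
qed

section \<open>The transform on all of L2 as a limit of truncated integrals\<close>

definition trunc :: "real \<Rightarrow> (real^'n \<Rightarrow> complex) \<Rightarrow> real^'n \<Rightarrow> complex" where
  "trunc R u x = indicator (cball 0 R) x *\<^sub>R u x"

lemma truncated_fourier_eq: "truncated_fourier R u = ft (trunc R u)"
  by (simp add: fun_eq_iff truncated_fourier_def ft_def trunc_def set_lebesgue_integral_def)

lemma trunc_outside: "norm x > R \<Longrightarrow> trunc R u x = 0"
  by (simp add: trunc_def)

lemma square_integrable_trunc: "square_integrable u \<Longrightarrow> square_integrable (trunc R u)"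
  unfolding trunc_def by (rule square_integrable_symbol[where K = 1]) (auto simp: bounded_symbol_def indicator_def)

lemma trunc_tendsto:
  fixes u :: "real^'n \<Rightarrow> complex"
  assumes u: "square_integrable u"
  shows "((\<lambda>R. cls (trunc R u)) \<longlongrightarrow> cls u) at_top"
proof (rule tendsto_at_topI_sequentially)
  fix X :: "nat \<Rightarrow> real"
  assume X: "filterlim X at_top sequentially"
  show "(\<lambda>n. cls (trunc (X n) u)) \<longlonglongrightarrow> cls u"
  proof (rule cls_dominated_convergence[where w = "\<lambda>x. (norm (u x))\<^sup>2"])
    show "AE x in lborel. (\<lambda>n. trunc (X n) u x) \<longlonglongrightarrow> u x"
    proof (intro AE_I2 tendsto_eventually)
      fix x :: "real^'n"
      have "\<forall>\<^sub>F n in sequentially. norm x \<le> X n"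
        using X by (simp add: filterlim_at_top)
      then show "\<forall>\<^sub>F n in sequentially. trunc (X n) u x = u x"
        by eventually_elim (simp add: trunc_def)
    qed
  qed (use u in \<open>auto simp: trunc_def indicator_def intro: square_integrable_power2 square_integrable_trunc\<close>)
qed

lemma ft_trunc:
  fixes u :: "real^'n \<Rightarrow> complex"
  assumes u: "square_integrable u"
  shows "integrable lborel (trunc R u)" "square_integrable (ft (trunc R u))"
    "norm (cls (ft (trunc R u))) = gauss_mass TYPE('n) * norm (cls (trunc R u))"
  using L1_le_L2_on_ball[OF square_integrable_trunc[OF u] trunc_outside]
    ft_parseval_ball[OF square_integrable_trunc[OF u] trunc_outside] by auto

lemma norm_ft_trunc_diff:
  fixes u :: "real^'n \<Rightarrow> complex"
  assumes u: "square_integrable u"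
  shows "norm (cls (ft (trunc R u)) - cls (ft (trunc R' u))) = gauss_mass TYPE('n) * norm (cls (trunc R u) - cls (trunc R' u))"
proof -
  have sqd: "square_integrable (\<lambda>x. trunc R u x - trunc R' u x)"
    by (intro square_integrable_diff square_integrable_trunc u)
  have "cls (ft (trunc R u)) - cls (ft (trunc R' u)) = cls (ft (\<lambda>x. trunc R u x - trunc R' u x))"
    using cls_diff[OF ft_trunc(2)[OF u, of R] ft_trunc(2)[OF u, of R']]
      ft_diff[OF ft_trunc(1)[OF u, of R] ft_trunc(1)[OF u, of R']] by presburger
  also have "norm \<dots> = gauss_mass TYPE('n) * norm (cls (\<lambda>x. trunc R u x - trunc R' u x))"
    by (rule ft_parseval_ball(2)[OF sqd, of "max R R'"]) (simp add: trunc_outside)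
  finally show ?thesis
    by (simp add: cls_diff square_integrable_trunc u)
qed

text \<open>Rewrites the distance with values in [0,\<infinity>] as convergence in the space of
  classes, which gives access to completeness and to uniqueness of limits.\<close>

lemma has_fourier_iff:
  fixes u :: "real^'n \<Rightarrow> complex"
  assumes u: "square_integrable u"
  shows "has_fourier u U \<longleftrightarrow> square_integrable U \<and> ((\<lambda>R. cls (ft (trunc R u))) \<longlongrightarrow> cls U) at_top"
proof -
  have "((\<lambda>R. \<integral>\<^sup>+\<xi>. ennreal ((norm (U \<xi> - truncated_fourier R u \<xi>))\<^sup>2) \<partial>lborel) \<longlongrightarrow> 0) at_top
      \<longleftrightarrow> ((\<lambda>R. cls (ft (trunc R u))) \<longlongrightarrow> cls U) at_top" (is "?A \<longleftrightarrow> ?B") if U: "square_integrable U"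
  proof -
    have "(\<integral>\<^sup>+\<xi>. ennreal ((norm (U \<xi> - truncated_fourier R u \<xi>))\<^sup>2) \<partial>lborel)
        = ennreal ((norm (cls U - cls (ft (trunc R u))))\<^sup>2)" for R
      unfolding truncated_fourier_eq
      by (subst nn_norm_cls) (auto simp: square_integrable_diff cls_diff U ft_trunc u)
    then have "?A \<longleftrightarrow> ((\<lambda>R. ennreal ((norm (cls U - cls (ft (trunc R u))))\<^sup>2)) \<longlongrightarrow> ennreal 0) at_top"
      by simp
    also have "\<dots> \<longleftrightarrow> ((\<lambda>R. (norm (cls U - cls (ft (trunc R u))))\<^sup>2) \<longlongrightarrow> 0) at_top"
      by (rule tendsto_ennreal_iff) auto
    also have "\<dots> \<longleftrightarrow> ((\<lambda>R. norm (cls U - cls (ft (trunc R u)))) \<longlongrightarrow> 0) at_top"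
    proof
      assume "((\<lambda>R. (norm (cls U - cls (ft (trunc R u))))\<^sup>2) \<longlongrightarrow> 0) at_top"
      then have "((\<lambda>R. sqrt ((norm (cls U - cls (ft (trunc R u))))\<^sup>2)) \<longlongrightarrow> sqrt 0) at_top"
        by (rule tendsto_real_sqrt)
      then show "((\<lambda>R. norm (cls U - cls (ft (trunc R u)))) \<longlongrightarrow> 0) at_top"
        by simp
    next
      assume "((\<lambda>R. norm (cls U - cls (ft (trunc R u)))) \<longlongrightarrow> 0) at_top"
      then have "((\<lambda>R. (norm (cls U - cls (ft (trunc R u))))\<^sup>2) \<longlongrightarrow> 0\<^sup>2) at_top"
        by (rule tendsto_power)
      then show "((\<lambda>R. (norm (cls U - cls (ft (trunc R u))))\<^sup>2) \<longlongrightarrow> 0) at_top"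
        by simp
    qed
    also have "\<dots> \<longleftrightarrow> ?B"
      unfolding norm_minus_commute[of "cls U"] tendsto_norm_zero_iff LIM_zero_iff ..
    finally show ?thesis .
  qed
  then show ?thesis
    unfolding has_fourier_def by blast
qed

text \<open>Integer radii suffice to produce the limit by completeness; the isometry then expresses
  the distance to it at every real radius by the distance of the truncation to
  \<open>u\<close>.\<close>

lemma fourier_exists:
  fixes u :: "real^'n \<Rightarrow> complex"
  assumes u: "square_integrable u"
  shows "\<exists>U. has_fourier u U"
proof -
  let ?\<kappa> = "gauss_mass TYPE('n)"
  have lim_n: "(\<lambda>n. cls (trunc (real n) u)) \<longlonglongrightarrow> cls u"
    using filterlim_compose[OF trunc_tendsto[OF u] filterlim_real_sequentially] .
  have "Cauchy (\<lambda>n. cls (ft (trunc (real n) u)))"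
  proof (rule CauchyI)
    fix e :: real assume "e > 0"
    then have "e / ?\<kappa> > 0"
      using gauss_mass_pos[where 'n='n] by simp
    from CauchyD[OF LIMSEQ_imp_Cauchy[OF lim_n] this]
    show "\<exists>M. \<forall>m\<ge>M. \<forall>n\<ge>M. norm (cls (ft (trunc (real m) u)) - cls (ft (trunc (real n) u))) < e"
      unfolding norm_ft_trunc_diff[OF u] using gauss_mass_pos[where 'n='n] by (simp add: field_simps)
  qed
  then obtain W where W: "(\<lambda>n. cls (ft (trunc (real n) u))) \<longlonglongrightarrow> W"
    using Cauchy_convergent convergent_def by blast
  have "norm (cls (ft (trunc R u)) - W) = ?\<kappa> * norm (cls (trunc R u) - cls u)" for R
  proof (rule LIMSEQ_unique)
    show "(\<lambda>n. norm (cls (ft (trunc R u)) - cls (ft (trunc (real n) u)))) \<longlonglongrightarrow> norm (cls (ft (trunc R u)) - W)"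
      by (intro tendsto_intros W)
    show "(\<lambda>n. norm (cls (ft (trunc R u)) - cls (ft (trunc (real n) u)))) \<longlonglongrightarrow> ?\<kappa> * norm (cls (trunc R u) - cls u)"
      unfolding norm_ft_trunc_diff[OF u] by (intro tendsto_intros lim_n)
  qed
  moreover have "((\<lambda>R. ?\<kappa> * norm (cls (trunc R u) - cls u)) \<longlongrightarrow> 0) at_top"
    using tendsto_mult_right_zero[OF tendsto_norm_zero[OF LIM_zero[OF trunc_tendsto[OF u]]]] .
  ultimately have "((\<lambda>R. norm (cls (ft (trunc R u)) - W)) \<longlongrightarrow> 0) at_top"
    by simp
  then have "((\<lambda>R. cls (ft (trunc R u))) \<longlongrightarrow> W) at_top"
    by (simp only: tendsto_norm_zero_iff LIM_zero_iff)
  then have "has_fourier u (fn W)"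
    by (simp add: has_fourier_iff[OF u])
  then show ?thesis
    by blast
qed

lemma fourier:
  assumes u: "square_integrable u"
  shows square_integrable_fourier: "square_integrable (fourier u)"
    and fourier_tendsto: "((\<lambda>R. cls (ft (trunc R u))) \<longlongrightarrow> cls (fourier u)) at_top"
proof -
  have "has_fourier u (fourier u)"
    unfolding fourier_def using fourier_exists[OF u] by (rule someI_ex)
  then show "square_integrable (fourier u)" "((\<lambda>R. cls (ft (trunc R u))) \<longlongrightarrow> cls (fourier u)) at_top"
    by (simp_all add: has_fourier_iff[OF u])
qed

lemma fourier_add:
  assumes u: "square_integrable u" and v: "square_integrable v"
  shows "cls (fourier (\<lambda>x. u x + v x)) = cls (fourier u) + cls (fourier v)"
proof (rule tendsto_unique[OF trivial_limit_at_top_linorder fourier_tendsto[OF square_integrable_add[OF u v]]])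
  have "cls (ft (trunc R (\<lambda>x. u x + v x))) = cls (ft (trunc R u)) + cls (ft (trunc R v))" for R
  proof -
    have "trunc R (\<lambda>x. u x + v x) = (\<lambda>x. trunc R u x + trunc R v x)"
      by (simp add: fun_eq_iff trunc_def scaleR_add_right)
    moreover have "ft (\<lambda>x. trunc R u x + trunc R v x) = (\<lambda>\<xi>. ft (trunc R u) \<xi> + ft (trunc R v) \<xi>)"
      by (simp add: fun_eq_iff ft_add ft_trunc u v)
    ultimately show ?thesis
      by (simp add: cls_add ft_trunc u v)
  qed
  then show "((\<lambda>R. cls (ft (trunc R (\<lambda>x. u x + v x)))) \<longlongrightarrow> cls (fourier u) + cls (fourier v)) at_top"
    by (simp add: tendsto_add fourier_tendsto u v)
qed

lemma fourier_scaleR: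
  assumes u: "square_integrable u"
  shows "cls (fourier (\<lambda>x. r *\<^sub>R u x)) = r *\<^sub>R cls (fourier u)"
proof (rule tendsto_unique[OF trivial_limit_at_top_linorder fourier_tendsto[OF square_integrable_scaleR[OF u]]])
  have "cls (ft (trunc R (\<lambda>x. r *\<^sub>R u x))) = r *\<^sub>R cls (ft (trunc R u))" for R
  proof -
    have "trunc R (\<lambda>x. r *\<^sub>R u x) = (\<lambda>x. r *\<^sub>R trunc R u x)"
      by (simp add: fun_eq_iff trunc_def scaleR_left_commute)
    moreover have "ft (\<lambda>x. r *\<^sub>R trunc R u x) = (\<lambda>\<xi>. r *\<^sub>R ft (trunc R u) \<xi>)"
      by (simp add: fun_eq_iff ft_scaleR)
    ultimately show ?thesis
      by (simp add: cls_scaleR ft_trunc u)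
  qed
  then show "((\<lambda>R. cls (ft (trunc R (\<lambda>x. r *\<^sub>R u x)))) \<longlongrightarrow> r *\<^sub>R cls (fourier u)) at_top"
    by (simp add: tendsto_scaleR fourier_tendsto u)
qed

lemma plancherel:
  fixes u :: "real^'n \<Rightarrow> complex"
  assumes u: "square_integrable u"
  shows "norm (cls (fourier u)) = gauss_mass TYPE('n) * norm (cls u)"
proof (rule tendsto_unique[OF trivial_limit_at_top_linorder])
  show "((\<lambda>R. norm (cls (ft (trunc R u)))) \<longlongrightarrow> norm (cls (fourier u))) at_top"
    by (intro tendsto_norm fourier_tendsto u)
  show "((\<lambda>R. norm (cls (ft (trunc R u)))) \<longlongrightarrow> gauss_mass TYPE('n) * norm (cls u)) at_top"
    unfolding ft_trunc(3)[OF u] by (intro tendsto_intros trunc_tendsto u)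
qed

lemma square_integrable_cnj: "square_integrable u \<Longrightarrow> square_integrable (\<lambda>x. cnj (u x))"
  by (auto simp: square_integrable_def)

text \<open>The multiplication formula for truncations. It is bilinear, whereas the inner product
  conjugates its second argument; this is where the two conjugations come from.\<close>

lemma fourier_adjoint:
  fixes u v :: "real^'n \<Rightarrow> complex"
  assumes u: "square_integrable u" and v: "square_integrable v"
  shows "cls (fourier u) \<bullet> cls v = cls u \<bullet> cls (\<lambda>x. cnj (fourier (\<lambda>y. cnj (v y)) x))"
proof (rule tendsto_unique[OF trivial_limit_at_top_linorder])
  let ?v = "\<lambda>y. cnj (v y)"
  show "((\<lambda>R. cls (ft (trunc R u)) \<bullet> cls (trunc R v)) \<longlongrightarrow> cls (fourier u) \<bullet> cls v) at_top"
    by (intro tendsto_intros fourier_tendsto trunc_tendsto u v)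
  have v': "square_integrable ?v"
    by (rule square_integrable_cnj[OF v])
  have inner_eq: "z \<bullet> w = Re (z * cnj w)" for z w :: complex
    by (simp add: inner_complex_def)
  have eq: "cls (ft (trunc R u)) \<bullet> cls (trunc R v) = cls (trunc R u) \<bullet> cls (\<lambda>x. cnj (ft (trunc R ?v) x))" for R
  proof -
    have cnj_trunc: "cnj (trunc R v x) = trunc R ?v x" for x
      by (simp add: trunc_def)
    have int1: "integrable lborel (\<lambda>\<xi>. ft (trunc R u) \<xi> * cnj (trunc R v \<xi>))"
    proof (rule Bochner_Integration.integrable_bound)
      show "integrable lborel (\<lambda>\<xi>. (LINT x|lborel. norm (trunc R u x)) *\<^sub>R trunc R ?v \<xi>)"
        by (intro integrable_scaleR_right ft_trunc v')
      show "AE \<xi> in lborel. norm (ft (trunc R u) \<xi> * cnj (trunc R v \<xi>))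
          \<le> norm ((LINT x|lborel. norm (trunc R u x)) *\<^sub>R trunc R ?v \<xi>)"
        using norm_ft_le[OF ft_trunc(1)[OF u]]
        by (intro AE_I2) (auto simp: norm_mult cnj_trunc[symmetric] intro!: mult_right_mono)
      show "(\<lambda>\<xi>. ft (trunc R u) \<xi> * cnj (trunc R v \<xi>)) \<in> borel_measurable lborel"
        using square_integrable_measurable[OF ft_trunc(2)[OF u]] square_integrable_measurable[OF square_integrable_trunc[OF v]]
        by simp
    qed
    have int2: "integrable lborel (\<lambda>x. trunc R u x * ft (trunc R ?v) x)"
    proof (rule Bochner_Integration.integrable_bound)
      show "integrable lborel (\<lambda>\<xi>. (LINT x|lborel. norm (trunc R ?v x)) *\<^sub>R trunc R u \<xi>)"
        by (intro integrable_scaleR_right ft_trunc u)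
      show "AE x in lborel. norm (trunc R u x * ft (trunc R ?v) x)
          \<le> norm ((LINT x|lborel. norm (trunc R ?v x)) *\<^sub>R trunc R u x)"
        using norm_ft_le[OF ft_trunc(1)[OF v']]
        by (intro AE_I2) (auto simp: norm_mult mult.commute[of "norm (trunc R u _)"] intro!: mult_right_mono)
      show "(\<lambda>x. trunc R u x * ft (trunc R ?v) x) \<in> borel_measurable lborel"
        using square_integrable_measurable[OF ft_trunc(2)[OF v']] square_integrable_measurable[OF square_integrable_trunc[OF u]]
        by simp
    qed
    have "cls (ft (trunc R u)) \<bullet> cls (trunc R v) = Re (LINT \<xi>|lborel. ft (trunc R u) \<xi> * cnj (trunc R v \<xi>))"
      unfolding inner_cls[OF ft_trunc(2)[OF u] square_integrable_trunc[OF v]] inner_eq by (rule integral_Re[OF int1])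
    also have "(LINT \<xi>|lborel. ft (trunc R u) \<xi> * cnj (trunc R v \<xi>)) = (LINT x|lborel. trunc R u x * ft (trunc R ?v) x)"
      unfolding cnj_trunc by (intro ft_multiplication_formula ft_trunc u v')
    also have "Re \<dots> = cls (trunc R u) \<bullet> cls (\<lambda>x. cnj (ft (trunc R ?v) x))"
      unfolding inner_cls[OF square_integrable_trunc[OF u] square_integrable_cnj[OF ft_trunc(2)[OF v']]] inner_eq
        complex_cnj_cnj by (rule integral_Re[OF int2, symmetric])
    finally show ?thesis .
  qed
  have "((\<lambda>R. cls (\<lambda>x. cnj (ft (trunc R ?v) x))) \<longlongrightarrow> cls (\<lambda>x. cnj (fourier ?v x))) at_top"
  proof -
    have "norm (cls (\<lambda>x. cnj (ft (trunc R ?v) x)) - cls (\<lambda>x. cnj (fourier ?v x)))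
        = norm (cls (ft (trunc R ?v)) - cls (fourier ?v))" for R
    proof -
      have sqd: "square_integrable (\<lambda>x. ft (trunc R ?v) x - fourier ?v x)"
        by (intro square_integrable_diff ft_trunc v' square_integrable_fourier)
      have "cls (\<lambda>x. cnj (ft (trunc R ?v) x)) - cls (\<lambda>x. cnj (fourier ?v x)) = cls (\<lambda>x. cnj (ft (trunc R ?v) x - fourier ?v x))"
        by (simp add: cls_diff ft_trunc v' square_integrable_fourier square_integrable_cnj)
      moreover have "cls (ft (trunc R ?v)) - cls (fourier ?v) = cls (\<lambda>x. ft (trunc R ?v) x - fourier ?v x)"
        by (simp add: cls_diff ft_trunc v' square_integrable_fourier)
      ultimately show ?thesis
        using norm_cls[OF sqd] norm_cls[OF square_integrable_cnj[OF sqd]] by (simp only: complex_mod_cnj)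
    qed
    then show ?thesis
      using fourier_tendsto[OF v'] unfolding tendsto_dist_iff[of _ "cls _"] dist_norm by simp
  qed
  then show "((\<lambda>R. cls (ft (trunc R u)) \<bullet> cls (trunc R v)) \<longlongrightarrow> cls u \<bullet> cls (\<lambda>x. cnj (fourier ?v x))) at_top"
    unfolding eq by (intro tendsto_inner trunc_tendsto u)
qed

text \<open>The adjoint of a Fourier transform is an isometry up to the factor \<open>\<kappa>\<close> as well, so expanding
  \<open>\<parallel>\<F> u - V\<parallel>\<^sup>2\<close> for \<open>u = \<kappa>\<^sup>-\<^sup>2 \<F>\<^sup>* V\<close> yields \<open>0\<close>.\<close>

lemma fourier_surj:
  fixes V :: "real^'n \<Rightarrow> complex"
  assumes V: "square_integrable V"
  obtains u where "square_integrable u" "cls (fourier u) = cls V"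
proof -
  define \<kappa> where "\<kappa> = gauss_mass TYPE('n)"
  have \<kappa>: "\<kappa> > 0"
    by (simp add: \<kappa>_def gauss_mass_pos)
  define w where "w x = cnj (fourier (\<lambda>y. cnj (V y)) x)" for x
  have sq_V': "square_integrable (\<lambda>y. cnj (V y))"
    by (rule square_integrable_cnj[OF V])
  have w: "square_integrable w"
    unfolding w_def by (intro square_integrable_cnj square_integrable_fourier sq_V')
  have "norm (cls w) = norm (cls (fourier (\<lambda>y. cnj (V y))))"
    using norm_cls[OF w] norm_cls[OF square_integrable_fourier[OF sq_V']] by (simp add: w_def)
  also have "\<dots> = \<kappa> * norm (cls V)"
    using plancherel[OF sq_V'] norm_cls[OF V] norm_cls[OF sq_V'] by (simp add: \<kappa>_def)
  finally have norm_w: "norm (cls w) = \<kappa> * norm (cls V)" .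
  define u where "u x = (1 / \<kappa>\<^sup>2) *\<^sub>R w x" for x
  have u: "square_integrable u"
    unfolding u_def by (rule square_integrable_scaleR[OF w])
  have cls_u: "cls u = (1 / \<kappa>\<^sup>2) *\<^sub>R cls w"
    unfolding u_def by (rule cls_scaleR[OF w])
  have "(norm (cls (fourier u) - cls V))\<^sup>2
      = (norm (cls (fourier u)))\<^sup>2 - 2 * (cls (fourier u) \<bullet> cls V) + (norm (cls V))\<^sup>2"
    by (simp add: power2_norm_eq_inner inner_diff inner_commute)
  also have "cls (fourier u) \<bullet> cls V = (1 / \<kappa>\<^sup>2) * (norm (cls w))\<^sup>2"
    using fourier_adjoint[OF u V] unfolding w_def[symmetric] cls_u by (simp add: power2_norm_eq_inner)
  also have "norm (cls (fourier u)) = \<kappa> * ((1 / \<kappa>\<^sup>2) * norm (cls w))"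
    using plancherel[OF u] \<kappa> by (simp add: cls_u \<kappa>_def)
  also have "(\<kappa> * ((1 / \<kappa>\<^sup>2) * norm (cls w)))\<^sup>2 - 2 * ((1 / \<kappa>\<^sup>2) * (norm (cls w))\<^sup>2) + (norm (cls V))\<^sup>2 = 0"
    using \<kappa> unfolding norm_w by (simp add: field_simps power2_eq_square)
  finally have "cls (fourier u) = cls V"
    by simp
  with u show ?thesis
    by (rule that)
qed

section \<open>Convolution on the half-line\<close>

text \<open>The integral runs over the whole line: kernels vanish at \<tau> \<le> 0 and the second
  factors at negative arguments, which leaves the convolution over [0,t].\<close>

definition conv :: "(real \<Rightarrow> real) \<Rightarrow> (real \<Rightarrow> real) \<Rightarrow> real \<Rightarrow> real" where
  "conv a f t = (LINT \<tau>|lborel. a \<tau> * f (t - \<tau>))"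

text \<open>For a nonincreasing function a singularity at 0 is the only obstruction to local
  integrability, so integrability is demanded up to time 1. The value 0 at t = 0 is a
  normalisation.\<close>

definition kernel :: "(real \<Rightarrow> real) \<Rightarrow> bool" where
  "kernel a \<longleftrightarrow> a \<in> borel_measurable borel \<and> (\<forall>t\<le>0. a t = 0) \<and> (\<forall>t. 0 \<le> a t) \<and>
     (\<forall>t u. 0 < t \<longrightarrow> t \<le> u \<longrightarrow> a u \<le> a t) \<and> integrable lborel (\<lambda>t. a t * indicator {..1} t)"

text \<open>A jump at 0 is allowed: the solutions start there with the value 1.\<close>

definition causal :: "(real \<Rightarrow> real) \<Rightarrow> bool" where
  "causal f \<longleftrightarrow> (\<forall>t<0. f t = 0) \<and> continuous_on {0..} f"

abbreviation step :: "real \<Rightarrow> real" where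
  "step \<equiv> indicator {0..}"

lemma kernel_measurable: "kernel a \<Longrightarrow> a \<in> borel_measurable borel"
  by (simp add: kernel_def)

lemma kernel_zero: "kernel a \<Longrightarrow> t \<le> 0 \<Longrightarrow> a t = 0"
  by (simp add: kernel_def)

lemma kernel_nonneg: "kernel a \<Longrightarrow> 0 \<le> a t"
  by (simp add: kernel_def)

lemma kernel_antimono: "kernel a \<Longrightarrow> 0 < t \<Longrightarrow> t \<le> u \<Longrightarrow> a u \<le> a t"
  by (simp add: kernel_def)

lemma kernel_le: "kernel a \<Longrightarrow> a t \<le> a t * indicator {..1} t + a 1 * indicator {1..} t"
  using kernel_antimono[of a 1 t] kernel_nonneg[of a 1] kernel_nonneg[of a t] by (auto simp: indicator_def)

lemma kernel_integrable:
  assumes "kernel a"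
  shows "integrable lborel (\<lambda>t. a t * indicator {..T} t)"
proof (rule Bochner_Integration.integrable_bound)
  note [measurable] = kernel_measurable[OF assms]
  have "integrable lborel (indicator {1..T} :: real \<Rightarrow> real)"
    by (intro integrable_real_indicator) (auto simp: emeasure_lborel_Icc_eq)
  then show "integrable lborel (\<lambda>t. a t * indicator {..1} t + a 1 * indicator {1..T} t)"
    using assms by (intro Bochner_Integration.integrable_add integrable_mult_right) (auto simp: kernel_def)
  show "(\<lambda>t. a t * indicator {..T} t) \<in> borel_measurable lborel"
    by measurable
  have "norm (a t * indicator {..T} t) \<le> norm (a t * indicator {..1} t + a 1 * indicator {1..T} t)" for t
    using kernel_le[OF assms, of t] kernel_nonneg[OF assms, of 1] kernel_nonneg[OF assms, of t]
    by (auto simp: indicator_def split: if_splits)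
  then show "AE t in lborel. norm (a t * indicator {..T} t) \<le> norm (a t * indicator {..1} t + a 1 * indicator {1..T} t)"
    by simp
qed

lemma integrable_exp_halfline:
  assumes "c > 0"
  shows "integrable lborel (\<lambda>t. exp (- c * t) * indicator {0<..} t :: real)"
  using integrable_I0i_exp_mscale[OF assms] unfolding set_integrable_def by (simp add: mult.commute)

lemma kernel_exp_integrable:
  assumes a: "kernel a" and c: "c > 0"
  shows "integrable lborel (\<lambda>t. exp (- c * t) * a t)"
proof (rule Bochner_Integration.integrable_bound)
  note [measurable] = kernel_measurable[OF a]
  show "integrable lborel (\<lambda>t. a t * indicator {..1} t + a 1 * (exp (- c * t) * indicator {0<..} t))"
    by (intro Bochner_Integration.integrable_add integrable_mult_right kernel_integrable a integrable_exp_halfline c)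
  show "(\<lambda>t. exp (- c * t) * a t) \<in> borel_measurable lborel"
    by measurable
  have "norm (exp (- c * t) * a t) \<le> norm (a t * indicator {..1} t + a 1 * (exp (- c * t) * indicator {0<..} t))" for t
  proof (cases "t \<le> 0")
    case True
    then show ?thesis
      by (simp add: kernel_zero[OF a])
  next
    case False
    then have e: "exp (- c * t) \<le> 1"
      using c by simp
    have "exp (- c * t) * a t \<le> a t * indicator {..1} t + a 1 * (exp (- c * t) * indicator {0<..} t)"
    proof (cases "t \<le> 1")
      case True
      have "exp (- c * t) * a t \<le> 1 * a t"
        by (rule mult_right_mono[OF e kernel_nonneg[OF a]])
      moreover have "0 \<le> a 1 * (exp (- c * t) * indicator {0<..} t)"
        by (intro mult_nonneg_nonneg kernel_nonneg[OF a]) auto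
      ultimately show ?thesis
        using True by simp
    next
      case nle: False
      then show ?thesis
        using kernel_antimono[OF a, of 1 t] False by (simp add: mult.commute mult_right_mono)
    qed
    then show ?thesis
      using kernel_nonneg[OF a, of t] by (simp add: abs_le_iff)
  qed
  then show "AE t in lborel. norm (exp (- c * t) * a t) \<le> norm (a t * indicator {..1} t + a 1 * (exp (- c * t) * indicator {0<..} t))"
    by simp
qed

text \<open>Dominated convergence, since e^(-ct) tends to 0 at every t > 0 as c grows. This
  smallness is behind the contraction, the Gronwall constants and the later comparison of Laplace
  transforms.\<close>

lemma kernel_small_transform:
  assumes a: "kernel a" and e: "e > 0"
  obtains c where "c > 0" "(LINT t|lborel. exp (- c * t) * a t) \<le> e"
proof -
  note [measurable] = kernel_measurable[OF a]
  have "(\<lambda>n. LINT t|lborel. exp (- real (Suc n) * t) * a t) \<longlonglongrightarrow> (LINT t|(lborel :: real measure). (0::real))"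
  proof (rule integral_dominated_convergence[where w = "\<lambda>t. exp (- 1 * t) * a t"])
    show "integrable lborel (\<lambda>t. exp (- 1 * t) * a t)"
      by (rule kernel_exp_integrable[OF a]) simp
    show "AE t in lborel. norm (exp (- real (Suc n) * t) * a t) \<le> exp (- 1 * t) * a t" for n
    proof (rule AE_I2)
      fix t
      show "norm (exp (- real (Suc n) * t) * a t) \<le> exp (- 1 * t) * a t"
      proof (cases "t \<le> 0")
        case False
        then have "exp (- real (Suc n) * t) \<le> exp (- 1 * t)"
          using mult_nonneg_nonneg[of "real n" t] by (simp add: algebra_simps)
        then show ?thesis
          using kernel_nonneg[OF a, of t] by (simp add: abs_mult mult_right_mono)
      qed (simp add: kernel_zero[OF a])
    qed
    show "AE t in lborel. (\<lambda>n. exp (- real (Suc n) * t) * a t) \<longlonglongrightarrow> 0"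
    proof (rule AE_I2)
      fix t
      show "(\<lambda>n. exp (- real (Suc n) * t) * a t) \<longlonglongrightarrow> 0"
      proof (cases "t \<le> 0")
        case False
        then have "(\<lambda>n. exp (- t) ^ Suc n) \<longlonglongrightarrow> 0"
          by (intro LIMSEQ_Suc LIMSEQ_realpow_zero) auto
        then have "(\<lambda>n. exp (- t) ^ Suc n * a t) \<longlonglongrightarrow> 0"
          by (rule tendsto_mult_left_zero)
        then show ?thesis
          by (simp only: exp_of_nat_mult[symmetric] mult_minus_left mult_minus_right)
      qed (simp add: kernel_zero[OF a])
    qed
  qed measurable
  then have "\<forall>\<^sub>F n in sequentially. (LINT t|lborel. exp (- real (Suc n) * t) * a t) < e"
    using e by (intro order_tendstoD(2)) auto
  then obtain n where "(LINT t|lborel. exp (- real (Suc n) * t) * a t) < e"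
    by (auto simp: eventually_sequentially)
  then show ?thesis
    by (intro that[of "real (Suc n)"]) auto
qed

lemma causal_cont: "causal f \<Longrightarrow> A \<subseteq> {0..} \<Longrightarrow> continuous_on A f"
  unfolding causal_def by (blast intro: continuous_on_subset)

lemma causal_measurable:
  assumes "causal f"
  shows "f \<in> borel_measurable borel"
proof -
  have "(\<lambda>t. indicator {0..} t *\<^sub>R f t) \<in> borel_measurable borel"
    using assms by (intro borel_measurable_continuous_on_indicator) (auto simp: causal_def)
  moreover have "(\<lambda>t. indicator {0..} t *\<^sub>R f t) = f"
    using assms by (auto simp: causal_def indicator_def fun_eq_iff)
  ultimately show ?thesis
    by simp
qed

lemma causal_bounded:
  assumes "causal f"
  obtains B where "B \<ge> 0" "\<And>t. t \<le> T \<Longrightarrow> \<bar>f t\<bar> \<le> B"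
proof -
  have "compact (f ` {0..T})"
    by (intro compact_continuous_image causal_cont assms) auto
  then obtain B where B: "\<And>t. t \<in> {0..T} \<Longrightarrow> norm (f t) \<le> B"
    by (metis bounded_iff compact_imp_bounded imageI)
  have "\<bar>f t\<bar> \<le> max B 0" if "t \<le> T" for t
    using B[of t] that assms by (cases "t < 0") (auto simp: causal_def)
  then show ?thesis
    by (intro that[of "max B 0"]) auto
qed

lemma causal_isCont:
  assumes "causal f" "t \<noteq> 0"
  shows "isCont f t"
proof (cases "t < 0")
  case True
  have "f t = 0 \<and> (\<forall>\<^sub>F u in nhds t. f u = 0)"
    using assms True eventually_nhds_in_open[of "{..<0}" t] by (auto simp: causal_def elim: eventually_mono)
  then show ?thesis
    unfolding isCont_def by (intro tendsto_eventually) (auto simp: eventually_at_filter elim: eventually_mono)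
next
  case False
  then have "t \<in> interior {0..}"
    using assms by simp
  then show ?thesis
    using assms by (auto simp: causal_def continuous_on_interior)
qed

lemma conv_integrable:
  assumes a: "kernel a" and f: "f \<in> borel_measurable borel"
    and B: "\<And>u. u \<le> t \<Longrightarrow> \<bar>f u\<bar> \<le> B" and neg: "\<And>u. u < 0 \<Longrightarrow> f u = 0"
  shows "integrable lborel (\<lambda>\<tau>. a \<tau> * f (t - \<tau>))"
proof (rule Bochner_Integration.integrable_bound)
  note [measurable] = kernel_measurable[OF a] f
  show "integrable lborel (\<lambda>\<tau>. B * (a \<tau> * indicator {..t} \<tau>))"
    by (intro integrable_mult_right kernel_integrable a)
  show "(\<lambda>\<tau>. a \<tau> * f (t - \<tau>)) \<in> borel_measurable lborel"
    by measurable
  have "norm (a \<tau> * f (t - \<tau>)) \<le> norm (B * (a \<tau> * indicator {..t} \<tau>))" for \<tau>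
  proof (cases "0 < \<tau> \<and> \<tau> \<le> t")
    case True
    then have "a \<tau> * \<bar>f (t - \<tau>)\<bar> \<le> a \<tau> * B"
      by (intro mult_left_mono B kernel_nonneg[OF a]) auto
    then show ?thesis
      using True kernel_nonneg[OF a, of \<tau>] order_trans[OF abs_ge_zero B[of "t - \<tau>"]]
      by (simp add: abs_mult mult.commute[of B])
  next
    case False
    then have "a \<tau> * f (t - \<tau>) = 0"
      using neg kernel_zero[OF a] by auto
    then show ?thesis
      by (simp only: norm_zero norm_ge_zero)
  qed
  then show "AE \<tau> in lborel. norm (a \<tau> * f (t - \<tau>)) \<le> norm (B * (a \<tau> * indicator {..t} \<tau>))"
    by simp
qed

lemma conv_integrable_causal:
  assumes a: "kernel a" and f: "causal f"
  shows "integrable lborel (\<lambda>\<tau>. a \<tau> * f (t - \<tau>))"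
proof -
  obtain B where "\<And>u. u \<le> t \<Longrightarrow> \<bar>f u\<bar> \<le> B"
    using causal_bounded[OF f] by metis
  then show ?thesis
    using f by (intro conv_integrable[OF a causal_measurable[OF f]]) (auto simp: causal_def)
qed

text \<open>For given t the discontinuity of \<open>f\<close> at 0 is met at the single point \<tau>
  = t, a null set, so dominated convergence applies.\<close>

lemma conv_continuous_general:
  assumes a: "integrable lborel a" and f: "f \<in> borel_measurable borel"
    and B: "\<And>u. \<bar>f u\<bar> \<le> B" and cont: "\<And>u. u \<noteq> 0 \<Longrightarrow> isCont f u"
  shows "continuous_on UNIV (conv a f)"
proof (rule continuous_on_sequentiallyI)
  note [measurable] = borel_measurable_integrable[OF a] f
  fix u :: "nat \<Rightarrow> real" and t
  assume u: "u \<longlonglongrightarrow> t"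
  show "(\<lambda>n. conv a f (u n)) \<longlonglongrightarrow> conv a f t"
    unfolding conv_def
  proof (rule integral_dominated_convergence[where w = "\<lambda>\<tau>. B * \<bar>a \<tau>\<bar>"])
    show "integrable lborel (\<lambda>\<tau>. B * \<bar>a \<tau>\<bar>)"
      using a by (intro integrable_mult_right integrable_abs)
    show "AE \<tau> in lborel. norm (a \<tau> * f (u n - \<tau>)) \<le> B * \<bar>a \<tau>\<bar>" for n
      using mult_left_mono[OF B abs_ge_zero] by (intro AE_I2) (simp add: abs_mult mult.commute[of B])
    have "AE \<tau> in lborel. \<tau> \<noteq> t"
      by (rule AE_lborel_singleton)
    then show "AE \<tau> in lborel. (\<lambda>n. a \<tau> * f (u n - \<tau>)) \<longlonglongrightarrow> a \<tau> * f (t - \<tau>)"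
    proof eventually_elim
      case (elim \<tau>)
      then have c: "isCont f (t - \<tau>)"
        by (intro cont) simp
      have "(\<lambda>n. u n - \<tau>) \<longlonglongrightarrow> t - \<tau>"
        by (intro tendsto_intros u)
      from isCont_tendsto_compose[OF c this] show ?case
        by (rule tendsto_mult_left)
    qed
  qed measurable
qed

text \<open>Before time T the convolution is unchanged if the kernel is cut off at T and
  \<open>f\<close> is frozen at its value at T; the new factors are globally integrable and globally
  bounded.\<close>

lemma conv_continuous:
  assumes a: "kernel a" and f: "causal f"
  shows "continuous_on UNIV (conv a f)"
proof -
  have "continuous_on {..<T} (conv a f)" for T
  proof -
    define a' where "a' t = a t * indicator {..T} t" for t
    define f' where "f' t = f (min t T)" for t
    obtain B where B: "\<And>t. t \<le> T \<Longrightarrow> \<bar>f t\<bar> \<le> B"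
      using causal_bounded[OF f] by metis
    note [measurable] = causal_measurable[OF f]
    have "continuous_on UNIV (conv a' f')"
    proof (rule conv_continuous_general)
      show "integrable lborel a'"
        unfolding a'_def by (rule kernel_integrable[OF a])
      show "f' \<in> borel_measurable borel"
        unfolding f'_def by measurable
      show "\<bar>f' u\<bar> \<le> B" for u
        unfolding f'_def by (rule B) simp
      show "isCont f' u" if "u \<noteq> 0" for u
      proof (cases "u < T")
        case True
        show ?thesis
          unfolding f'_def using that True
          by (intro continuous_at_compose[unfolded o_def, of u "\<lambda>u. min u T" f] continuous_intros causal_isCont f) auto
      next
        case False
        show ?thesis
        proof (cases "T = 0")
          case False
          have "min u T \<noteq> 0"
            using False that by (auto simp: min_def)
          then show ?thesis
            unfolding f'_def
            by (intro continuous_at_compose[unfolded o_def, of u "\<lambda>u. min u T" f] continuous_intros causal_isCont f)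
        next
          case True
          then have "u > 0" using False that by simp
          then have "\<forall>\<^sub>F v in nhds u. v > 0"
            using eventually_nhds_in_open[of "{0<..}" u] by auto
          then have ev: "\<forall>\<^sub>F v in nhds u. f' v = f 0"
            by eventually_elim (simp add: f'_def True)
          then show ?thesis
            unfolding isCont_def using eventually_nhds_x_imp_x[OF ev]
            by (intro tendsto_eventually) (auto simp: eventually_at_filter elim: eventually_mono)
        qed
      qed
    qed
    moreover have "conv a' f' t = conv a f t" if "t < T" for t
    proof -
      have "a' \<tau> * f' (t - \<tau>) = a \<tau> * f (t - \<tau>)" for \<tau>
        using that f kernel_zero[OF a, of \<tau>]
        by (cases "\<tau> \<le> 0"; cases "\<tau> \<le> T") (auto simp: a'_def f'_def causal_def min_def)
      then show ?thesis
        by (simp add: conv_def)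
    qed
    ultimately show ?thesis
      by (metis (mono_tags, lifting) continuous_on_cong continuous_on_subset lessThan_iff subset_UNIV)
  qed
  then have "isCont (conv a f) t" for t
    using continuous_on_interior[of "{..<t + 1}" "conv a f" t] by (simp add: interior_open)
  then show ?thesis
    by (simp add: continuous_at_imp_continuous_on)
qed

lemma conv_neg:
  assumes "kernel a" "causal f" "t < 0"
  shows "conv a f t = 0"
proof -
  have z: "a \<tau> * f (t - \<tau>) = 0" for \<tau>
    using assms kernel_zero[OF assms(1), of \<tau>] by (cases "\<tau> \<le> 0") (auto simp: causal_def)
  show ?thesis
    unfolding conv_def z by simp
qed

lemma conv_zero:
  assumes "kernel a" "causal f"
  shows "conv a f 0 = 0"
proof -
  have z: "a \<tau> * f (0 - \<tau>) = 0" for \<tau>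
    using assms kernel_zero[OF assms(1), of \<tau>] by (cases "\<tau> \<le> 0") (auto simp: causal_def)
  show ?thesis
    unfolding conv_def z by simp
qed

lemma causal_conv: "kernel a \<Longrightarrow> causal f \<Longrightarrow> causal (conv a f)"
  using conv_neg[of a f] continuous_on_subset[OF conv_continuous[of a f], of "{0..}"] by (simp add: causal_def)

lemma causal_step [simp]: "causal step"
proof -
  have "continuous_on {0..} step \<longleftrightarrow> continuous_on {0..} (\<lambda>t::real. 1 :: real)"
    by (intro continuous_on_cong) auto
  then show ?thesis
    by (simp add: causal_def)
qed

lemma kernel_step: "kernel (indicator {0<..} :: real \<Rightarrow> real)"
proof -
  have eq: "(\<lambda>t::real. indicator {0<..} t * indicator {..1} t :: real) = indicator {0<..1}"
    by (auto simp: indicator_def fun_eq_iff)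
  have "integrable lborel (indicator {0<..1} :: real \<Rightarrow> real)"
    by (rule integrable_real_indicator) (auto simp: emeasure_lborel_Ioc)
  then have "integrable lborel (\<lambda>t::real. indicator {0<..} t * indicator {..1} t :: real)"
    unfolding eq .
  then show ?thesis
    unfolding kernel_def by (intro conjI) (auto simp: indicator_def)
qed

lemma kernel_lincomb:
  assumes "kernel a" "kernel b" "c \<ge> 0" "d \<ge> 0"
  shows "kernel (\<lambda>t. c * a t + d * b t)"
proof -
  have "(\<lambda>t. (c * a t + d * b t) * indicator {..1} t)
      = (\<lambda>t. c * (a t * indicator {..1} t) + d * (b t * indicator {..1} t))"
    by (auto simp: fun_eq_iff algebra_simps)
  with assms show ?thesis
    by (auto simp: kernel_def intro!: mult_left_mono add_mono)
qed

lemma conv_lincomb: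
  assumes "kernel a" "kernel b" "causal f"
  shows "conv (\<lambda>t. c * a t + d * b t) f t = c * conv a f t + d * conv b f t"
proof -
  have "conv (\<lambda>t. c * a t + d * b t) f t = (LINT \<tau>|lborel. c * (a \<tau> * f (t - \<tau>)) + d * (b \<tau> * f (t - \<tau>)))"
    unfolding conv_def by (intro Bochner_Integration.integral_cong) (auto simp: algebra_simps)
  also have "\<dots> = c * conv a f t + d * conv b f t"
    unfolding conv_def using assms by (subst Bochner_Integration.integral_add) (auto intro: conv_integrable_causal)
  finally show ?thesis .
qed

section \<open>Scalar Volterra equations\<close>

text \<open>In the unknown \<open>e\<^sup>-\<^sup>c\<^sup>t x(t)\<close> the equation is a fixed point problem for a contraction
  on the bounded continuous functions, once \<open>c\<close> is so large that the Laplace transform of the kernel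
  at \<open>c\<close> is at most \<open>\<beta>/2\<close>.\<close>

lemma volterra_exists:
  assumes a: "kernel a" and \<beta>: "\<beta> > 0"
  obtains x where "causal x" "\<And>t. t \<ge> 0 \<Longrightarrow> \<beta> * x t + conv a x t = 1"
proof -
  obtain c where c: "c > 0" "(LINT t|lborel. exp (- c * t) * a t) \<le> \<beta> / 2"
    using kernel_small_transform[OF a, of "\<beta> / 2"] \<beta> by auto
  define b where "b t = exp (- c * t) * a t" for t
  have b: "integrable lborel b"
    unfolding b_def by (rule kernel_exp_integrable[OF a c(1)])
  note [measurable] = borel_measurable_integrable[OF b, simplified]
  have b_nonneg: "b t \<ge> 0" for t
    by (simp add: b_def kernel_nonneg[OF a])
  \<comment> \<open>The fixed point is sought among bounded continuous functions on the whole line;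
    the restriction to nonnegative times makes such a function causal under the convolution.\<close>
  define plus where "plus w t = indicator {0..} t * w t" for w :: "real \<Rightarrow> real" and t
  have meas_plus: "plus (apply_bcontfun w) \<in> borel_measurable borel" for w :: "real \<Rightarrow>\<^sub>C real"
    unfolding plus_def by (intro borel_measurable_times borel_measurable_indicator
        borel_measurable_continuous_onI) auto
  have norm_plus: "\<bar>plus (apply_bcontfun w) t\<bar> \<le> norm w" for w :: "real \<Rightarrow>\<^sub>C real" and t
    using norm_bounded[of w t] by (auto simp: plus_def indicator_def)
  have int: "integrable lborel (\<lambda>\<tau>. b \<tau> * plus (apply_bcontfun w) (t - \<tau>))" for w :: "real \<Rightarrow>\<^sub>C real" and t
  proof (rule Bochner_Integration.integrable_bound)
    show "integrable lborel (\<lambda>\<tau>. norm w * b \<tau>)"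
      by (intro integrable_mult_right b)
    show "AE \<tau> in lborel. norm (b \<tau> * plus (apply_bcontfun w) (t - \<tau>)) \<le> norm (norm w * b \<tau>)"
      using mult_left_mono[OF norm_plus[of w] b_nonneg] b_nonneg
      by (intro AE_I2) (simp add: abs_mult mult.commute[of "norm w"])
    show "(\<lambda>\<tau>. b \<tau> * plus (apply_bcontfun w) (t - \<tau>)) \<in> borel_measurable lborel"
      using meas_plus[of w] by measurable
  qed
  have bound: "\<bar>conv b (plus (apply_bcontfun w)) t\<bar> \<le> \<beta> / 2 * norm w" for w :: "real \<Rightarrow>\<^sub>C real" and t
  proof -
    have "norm (conv b (plus (apply_bcontfun w)) t) \<le> (LINT \<tau>|lborel. b \<tau> * norm w)"
      unfolding conv_def using norm_plus[of w] b_nonneg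
      by (intro Bochner_Integration.integral_norm_bound_integral int integrable_mult_left b) (auto simp: abs_mult mult_left_mono)
    also have "\<dots> \<le> \<beta> / 2 * norm w"
      using mult_right_mono[OF c(2) norm_ge_zero[of w]] by (simp add: b_def)
    finally show ?thesis
      by simp
  qed
  have cont: "continuous_on UNIV (conv b (plus (apply_bcontfun w)))" for w :: "real \<Rightarrow>\<^sub>C real"
  proof (rule conv_continuous_general[OF b meas_plus norm_plus])
    fix u :: real assume u: "u \<noteq> 0"
    have "continuous_on {0..} (plus (apply_bcontfun w))"
      by (rule continuous_on_eq[of "{0..}" "apply_bcontfun w"]) (auto simp: plus_def)
    then have "causal (plus (apply_bcontfun w))"
      by (simp add: causal_def plus_def)
    then show "isCont (plus (apply_bcontfun w)) u"
      using u by (rule causal_isCont)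
  qed
  \<comment> \<open>\<open>max 0 t\<close> extends the right-hand side as a constant to negative
    times, which keeps it continuous; the solution extracted below reads it at t \<ge> 0.\<close>
  define T where "T w t = (exp (- c * max 0 t) - conv b (plus (apply_bcontfun w)) (max 0 t)) / \<beta>"
    for w :: "real \<Rightarrow>\<^sub>C real" and t
  have T: "T w \<in> bcontfun" for w
  proof (rule bcontfun_normI)
    show "continuous_on UNIV (T w)"
      unfolding T_def using \<beta>
      by (intro continuous_intros continuous_on_compose2[OF cont]) auto
    show "norm (T w t) \<le> (1 + \<beta> / 2 * norm w) / \<beta>" for t
    proof -
      have "exp (- c * max 0 t) \<le> 1"
        using c(1) by simp
      then have "\<bar>exp (- c * max 0 t) - conv b (plus (apply_bcontfun w)) (max 0 t)\<bar> \<le> 1 + \<beta> / 2 * norm w"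
        using bound[of w "max 0 t"] exp_gt_zero[of "- c * max 0 t"] by linarith
      then show ?thesis
        using \<beta> by (simp add: T_def divide_right_mono)
    qed
  qed
  have "\<exists>!w. Bcontfun (T w) = w"
  proof (rule banach_fix_type)
    show "\<forall>w v. dist (Bcontfun (T w)) (Bcontfun (T v)) \<le> 1 / 2 * dist w v"
    proof (intro allI dist_bound)
      fix w v :: "real \<Rightarrow>\<^sub>C real" and t
      have "conv b (plus (apply_bcontfun v)) u - conv b (plus (apply_bcontfun w)) u = conv b (plus (apply_bcontfun (v - w))) u" for u
      proof -
        have "conv b (plus (apply_bcontfun v)) u - conv b (plus (apply_bcontfun w)) u
            = (LINT \<tau>|lborel. b \<tau> * plus (apply_bcontfun v) (u - \<tau>) - b \<tau> * plus (apply_bcontfun w) (u - \<tau>))"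
          unfolding conv_def by (rule Bochner_Integration.integral_diff[symmetric]) (rule int)+
        also have "\<dots> = conv b (plus (apply_bcontfun (v - w))) u"
          unfolding conv_def
          by (intro Bochner_Integration.integral_cong refl) (simp add: plus_def algebra_simps)
        finally show ?thesis .
      qed
      then have "T w t - T v t = conv b (plus (apply_bcontfun (v - w))) (max 0 t) / \<beta>"
        by (simp add: T_def diff_divide_distrib[symmetric])
      also have "\<bar>\<dots>\<bar> \<le> (\<beta> / 2 * norm (v - w)) / \<beta>"
        unfolding abs_divide abs_of_pos[OF \<beta>]
        by (rule divide_right_mono[OF bound]) (use \<beta> in simp)
      finally show "dist (apply_bcontfun (Bcontfun (T w)) t) (apply_bcontfun (Bcontfun (T v)) t) \<le> 1 / 2 * dist w v"
        using \<beta> by (simp add: Bcontfun_inverse[OF T] dist_norm norm_minus_commute)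
    qed
  qed auto
  then obtain w where "Bcontfun (T w) = w"
    by blast
  then have w: "apply_bcontfun w t = T w t" for t
    by (metis Bcontfun_inverse[OF T])
  define x where "x t = indicator {0..} t * (exp (c * t) * apply_bcontfun w t)" for t
  have x: "causal x"
  proof -
    have "continuous_on {0..} (\<lambda>t. exp (c * t) * apply_bcontfun w t)"
      by (intro continuous_intros) auto
    then have "continuous_on {0..} x"
      by (rule continuous_on_eq) (simp add: x_def)
    then show ?thesis
      by (simp add: causal_def x_def)
  qed
  have "\<beta> * x t + conv a x t = 1" if t: "t \<ge> 0" for t
  proof -
    have "conv a x t = (LINT \<tau>|lborel. exp (c * t) * (b \<tau> * plus (apply_bcontfun w) (t - \<tau>)))"
      unfolding conv_def
    proof (intro Bochner_Integration.integral_cong refl)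
      fix \<tau>
      have "exp (c * (t - \<tau>)) = exp (c * t) * exp (- c * \<tau>)"
        by (simp add: algebra_simps flip: exp_add)
      then show "a \<tau> * x (t - \<tau>) = exp (c * t) * (b \<tau> * plus (apply_bcontfun w) (t - \<tau>))"
        by (simp add: x_def b_def plus_def)
    qed
    also have "\<dots> = exp (c * t) * conv b (plus (apply_bcontfun w)) t"
      by (simp add: conv_def)
    finally have "conv a x t = exp (c * t) * conv b (plus (apply_bcontfun w)) t" .
    moreover have "\<beta> * x t = exp (c * t) * (exp (- c * t) - conv b (plus (apply_bcontfun w)) t)"
      using t \<beta> w[of t] by (simp add: x_def T_def)
    ultimately show ?thesis
      by (simp add: algebra_simps flip: exp_add)
  qed
  with x show ?thesis
    by (rule that)
qed

lemma conv_nonneg: "(\<And>\<tau>. 0 \<le> a \<tau>) \<Longrightarrow> (\<And>\<tau>. 0 \<le> f \<tau>) \<Longrightarrow> 0 \<le> conv a f t"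
  unfolding conv_def by (intro Bochner_Integration.integral_nonneg) auto

text \<open>At the first zero \<open>t\<^sub>1\<close> of the solution the monotonicity of the kernel bounds \<open>x\<close> at any
  earlier time \<open>t\<close> by a small multiple of its maximum over \<open>[t, t\<^sub>1]\<close>.\<close>

lemma volterra_positive:
  assumes a: "kernel a" and \<beta>: "\<beta> > 0" and x: "causal x"
    and eq: "\<And>t. t \<ge> 0 \<Longrightarrow> \<beta> * x t + conv a x t = 1"
  shows "t \<ge> 0 \<Longrightarrow> x t > 0"
proof (rule ccontr)
  assume t: "t \<ge> 0" "\<not> x t > 0"
  define Z where "Z = {0..t} \<inter> x -` {..0}"
  have cont: "continuous_on {0..} x"
    by (rule causal_cont[OF x]) simp
  have "closed Z"
    unfolding Z_def by (intro continuous_closed_preimage continuous_on_subset[OF cont]) auto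
  then have "compact ({0..t} \<inter> Z)"
    by (intro compact_Int_closed) auto
  moreover have "{0..t} \<inter> Z = Z"
    by (auto simp: Z_def)
  ultimately have "compact Z"
    by simp
  moreover have "Z \<noteq> {}"
    using t by (auto simp: Z_def)
  ultimately obtain t1 where t1: "t1 \<in> Z" "\<And>u. u \<in> Z \<Longrightarrow> t1 \<le> u"
    by (meson compact_attains_inf)
  have pos: "x u > 0" if "0 \<le> u" "u < t1" for u
    using t1(1) t1(2)[of u] that by (force simp: Z_def)
  have x0: "x 0 > 0"
    using eq[of 0] \<beta> zero_less_mult_pos[of \<beta> "x 0"] by (simp add: conv_zero[OF a x])
  have t1_pos: "t1 > 0"
    using t1(1) x0 by (cases "t1 = 0") (auto simp: Z_def)
  have x_t1: "x t1 = 0"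
  proof (rule ccontr)
    assume "x t1 \<noteq> 0"
    then have "x t1 < 0"
      using t1(1) by (simp add: Z_def)
    then have "\<exists>u. 0 \<le> u \<and> u \<le> t1 \<and> x u = 0"
      using x0 t1_pos by (intro IVT2') (auto intro: causal_cont[OF x])
    then show False
      using pos \<open>x t1 \<noteq> 0\<close> by (metis less_le)
  qed
  have "conv a step \<midarrow>0\<rightarrow> 0"
  proof -
    have "isCont (conv a step) 0"
      using conv_continuous[OF a causal_step] by (simp add: continuous_on_eq_continuous_at)
    then show ?thesis
      unfolding isCont_def conv_zero[OF a causal_step] .
  qed
  \<comment> \<open>A time span on which the primitive of the kernel stays below \<beta> /
    2.\<close>
  then obtain e where e: "e > 0" "\<And>u. \<bar>u\<bar> < e \<Longrightarrow> u \<noteq> 0 \<Longrightarrow> \<bar>conv a step u\<bar> < \<beta> / 2"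
    using \<beta> by (force simp: LIM_def dest: spec[of _ "\<beta> / 2"])
  define d where "d = min t1 (e / 2)"
  have d: "d > 0" "d \<le> t1" "d < e"
    using e t1_pos by (auto simp: d_def)
  have "continuous_on {t1 - d..t1} x"
    using d by (intro continuous_on_subset[OF cont]) auto
  \<comment> \<open>The maximum over the last short interval before \<open>t1\<close> is taken at
    \<open>t2\<close>. It is positive, and t1 - t2 is short enough for the bound on the primitive of
    the kernel.\<close>
  then obtain t2 where t2: "t2 \<in> {t1 - d..t1}" "\<And>u. u \<in> {t1 - d..t1} \<Longrightarrow> x u \<le> x t2"
    using continuous_attains_sup[of "{t1 - d..t1}" x] d by auto
  have "x t2 \<ge> x (t1 - d)"
    using t2(2) d by simp
  then have x_t2: "x t2 > 0"
    using pos[of "t1 - d"] d by linarith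
  then have "t2 \<noteq> t1"
    using x_t1 by auto
  then have t2': "0 \<le> t2" "t2 < t1"
    using t2(1) d by auto
  let ?h = "t1 - t2"
  \<comment> \<open>For \<tau> \<le> h the point t1 - \<tau> lies in [t2,t1], where x \<le> x(t2);
    for \<tau> > h shifting the argument of the kernel back by h can only increase it, and the
    shifted integrand is that of the convolution at t2.\<close>
  have pointwise: "a \<tau> * x (t1 - \<tau>) \<le> x t2 * (a \<tau> * step (?h - \<tau>)) + a (\<tau> - ?h) * x (t2 - (\<tau> - ?h))" for \<tau>
  proof -
    consider "\<tau> \<le> 0" | "0 < \<tau>" "\<tau> \<le> ?h" | "?h < \<tau>" "\<tau> \<le> t1" | "\<tau> > t1"
      by linarith
    then show ?thesis
    proof cases
      case 2
      then have le: "x (t1 - \<tau>) \<le> x t2"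
        using t2(1) by (intro t2(2)) auto
      then show ?thesis
        using 2 mult_left_mono[OF le kernel_nonneg[OF a, of \<tau>]]
        by (simp add: kernel_zero[OF a] mult.commute)
    next
      case 3
      then have "a \<tau> \<le> a (\<tau> - ?h)"
        using t2' by (intro kernel_antimono[OF a]) auto
      moreover have "x (t1 - \<tau>) \<ge> 0"
        using pos[of "t1 - \<tau>"] 3 t2' by (simp add: less_imp_le)
      ultimately show ?thesis
        using 3 by (simp add: mult_right_mono)
    qed (use t2' x kernel_zero[OF a] in \<open>auto simp: causal_def\<close>)
  qed
  have int1: "integrable lborel (\<lambda>\<tau>. a (\<tau> - ?h) * x (t2 - (\<tau> - ?h)))"
    using lborel_integrable_real_affine[OF conv_integrable_causal[OF a x, of t2], of 1 "- ?h"]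
    by (simp add: algebra_simps)
  have "conv a x t1 \<le> (LINT \<tau>|lborel. x t2 * (a \<tau> * step (?h - \<tau>)) + a (\<tau> - ?h) * x (t2 - (\<tau> - ?h)))"
    unfolding conv_def
    by (intro integral_mono pointwise conv_integrable_causal a x Bochner_Integration.integrable_add
        integrable_mult_right int1 causal_step)
  also have "\<dots> = x t2 * conv a step ?h + conv a x t2"
  proof -
    have "(LINT \<tau>|lborel. a (\<tau> - ?h) * x (t2 - (\<tau> - ?h))) = conv a x t2"
      using lborel_integral_real_affine[of 1 "\<lambda>\<tau>. a \<tau> * x (t2 - \<tau>)" "- ?h"]
      by (simp add: conv_def algebra_simps)
    moreover have "(LINT \<tau>|lborel. x t2 * (a \<tau> * step (?h - \<tau>)) + a (\<tau> - ?h) * x (t2 - (\<tau> - ?h)))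
        = (LINT \<tau>|lborel. x t2 * (a \<tau> * step (?h - \<tau>))) + (LINT \<tau>|lborel. a (\<tau> - ?h) * x (t2 - (\<tau> - ?h)))"
      by (intro Bochner_Integration.integral_add integrable_mult_right conv_integrable_causal a causal_step int1)
    ultimately show ?thesis
      by (simp only: conv_def integral_mult_right_zero)
  qed
  finally have "1 \<le> x t2 * conv a step ?h + (1 - \<beta> * x t2)"
    using eq[of t1] eq[of t2] t1_pos t2' x_t1 by simp
  moreover have "x t2 * conv a step ?h \<le> x t2 * (\<beta> / 2)"
    using e(2)[of ?h] t2(1) d t2' x_t2 by (intro mult_left_mono) (auto simp: abs_less_iff)
  ultimately have "1 \<le> x t2 * (\<beta> / 2) + (1 - \<beta> * x t2)"
    by linarith
  then have "\<beta> * x t2 \<le> \<beta> * x t2 / 2"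
    by (simp add: mult.commute)
  then show False
    using \<beta> x_t2 by simp
qed

text \<open>For the supremum S of e^(-ct) D over [0,T] the convolution contributes at most S / 2, so
  S \<le> 2 E; removing the weight costs the factor e^(cT).\<close>

lemma volterra_gronwall:
  assumes a: "kernel a" and c: "(LINT t|lborel. exp (- c * t) * a t) \<le> 1 / 2" "c > 0"
    and D: "D \<in> borel_measurable borel" "\<And>t. D t \<ge> 0" "\<And>t. t < 0 \<Longrightarrow> D t = 0"
    and B: "\<And>t. t \<le> T \<Longrightarrow> D t \<le> B"
    and le: "\<And>t. 0 \<le> t \<Longrightarrow> t \<le> T \<Longrightarrow> D t \<le> E + conv a D t" and E: "E \<ge> 0"
    and t: "0 \<le> t" "t \<le> T"
  shows "D t \<le> 2 * E * exp (c * T)"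
proof -
  define S where "S = (SUP t\<in>{0..T}. exp (- c * t) * D t)"
  have bdd: "bdd_above ((\<lambda>t. exp (- c * t) * D t) ` {0..T})"
  proof (rule bdd_aboveI2)
    fix t assume "t \<in> {0..T}"
    then have "exp (- c * t) * D t \<le> 1 * B"
      using B[of t] D(2)[of t] c by (intro mult_mono) auto
    then show "exp (- c * t) * D t \<le> B"
      by simp
  qed
  have upper: "exp (- c * t) * D t \<le> S" if "t \<in> {0..T}" for t
    unfolding S_def by (rule cSUP_upper[OF that bdd])
  have "exp (- c * t) * D t \<ge> 0"
    using D(2) by simp
  then have S0: "S \<ge> 0"
    using upper[of t] t by simp
  have step: "exp (- c * t) * D t \<le> E + S / 2" if t: "t \<in> {0..T}" for t
  proof -
    have "conv a D t \<le> (LINT \<tau>|lborel. (S * exp (c * t)) * (exp (- c * \<tau>) * a \<tau>))"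
      unfolding conv_def
    proof (intro integral_mono integrable_mult_right kernel_exp_integrable a c)
      show "integrable lborel (\<lambda>\<tau>. a \<tau> * D (t - \<tau>))"
        using t B D(2,3) by (intro conv_integrable[OF a D(1), of t B]) auto
      show "a \<tau> * D (t - \<tau>) \<le> (S * exp (c * t)) * (exp (- c * \<tau>) * a \<tau>)" for \<tau>
      proof (cases "0 < \<tau> \<and> \<tau> \<le> t")
        case True
        then have "exp (- c * (t - \<tau>)) * D (t - \<tau>) \<le> S"
          using t by (intro upper) auto
        then have "D (t - \<tau>) \<le> S * exp (c * (t - \<tau>))"
          by (simp add: exp_diff exp_minus field_simps right_diff_distrib)
        also have "\<dots> = S * exp (c * t) * exp (- c * \<tau>)"
          by (simp add: algebra_simps flip: exp_add)
        finally have "a \<tau> * D (t - \<tau>) \<le> a \<tau> * (S * exp (c * t) * exp (- c * \<tau>))"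
          by (rule mult_left_mono[OF _ kernel_nonneg[OF a]])
        then show ?thesis
          by (simp add: mult_ac)
      next
        case False
        then have "a \<tau> * D (t - \<tau>) = 0"
          using kernel_zero[OF a] D(3) by auto
        moreover have "0 \<le> (S * exp (c * t)) * (exp (- c * \<tau>) * a \<tau>)"
          by (intro mult_nonneg_nonneg S0 kernel_nonneg[OF a]) auto
        ultimately show ?thesis
          by linarith
      qed
    qed
    also have "\<dots> \<le> S * exp (c * t) * (1 / 2)"
      unfolding integral_mult_right_zero using S0 c by (intro mult_left_mono) auto
    finally have "D t \<le> E + S * exp (c * t) / 2"
      using le[of t] t by simp
    then have "exp (- c * t) * D t \<le> exp (- c * t) * E + S / 2"
      by (simp add: exp_minus field_simps)
    moreover have "exp (- c * t) * E \<le> 1 * E"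
      using t c E by (intro mult_right_mono) auto
    ultimately show ?thesis
      by simp
  qed
  have "S \<le> E + S / 2"
    unfolding S_def using t by (intro cSUP_least step[unfolded S_def]) auto
  then have "S \<le> 2 * E"
    by simp
  then have "exp (- c * t) * D t \<le> 2 * E"
    using upper[of t] t by simp
  then have "D t \<le> 2 * E * exp (c * t)"
    by (simp add: exp_minus field_simps)
  also have "\<dots> \<le> 2 * E * exp (c * T)"
    using t c E by (intro mult_left_mono) auto
  finally show ?thesis .
qed

text \<open>Convolution of nonnegative functions with values in \<open>[0,\<infinity>]\<close> is associative and
  commutative without integrability conditions.\<close>

definition cv :: "(real \<Rightarrow> ennreal) \<Rightarrow> (real \<Rightarrow> ennreal) \<Rightarrow> real \<Rightarrow> ennreal" where
  "cv a b t = (\<integral>\<^sup>+\<tau>. a \<tau> * b (t - \<tau>) \<partial>lborel)"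

lemma cv_measurable [measurable]:
  assumes [measurable]: "a \<in> borel_measurable borel" "b \<in> borel_measurable borel"
  shows "cv a b \<in> borel_measurable borel"
  unfolding cv_def by measurable

lemma cv_commute:
  assumes [measurable]: "a \<in> borel_measurable borel" "b \<in> borel_measurable borel"
  shows "cv a b = cv b a"
proof
  fix t
  show "cv a b t = cv b a t"
    unfolding cv_def
    by (subst nn_integral_real_affine[where c = "-1" and t = t]) (auto simp: mult.commute)
qed

lemma cv_add:
  assumes [measurable]: "a \<in> borel_measurable borel" "b \<in> borel_measurable borel" "c \<in> borel_measurable borel"
  shows "cv a (\<lambda>t. b t + c t) = (\<lambda>t. cv a b t + cv a c t)"
  unfolding cv_def fun_eq_iff by (subst nn_integral_add[symmetric]) (auto simp: distrib_left)

lemma cv_cmult: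
  assumes [measurable]: "a \<in> borel_measurable borel" "b \<in> borel_measurable borel"
  shows "cv a (\<lambda>t. r * b t) = (\<lambda>t. r * cv a b t)"
  unfolding cv_def fun_eq_iff by (subst nn_integral_cmult[symmetric]) (auto simp: mult.left_commute)

lemma cv_assoc:
  assumes [measurable]: "a \<in> borel_measurable borel" "b \<in> borel_measurable borel" "c \<in> borel_measurable borel"
  shows "cv a (cv b c) = cv (cv a b) c"
proof
  fix t
  have "cv (cv a b) c t = (\<integral>\<^sup>+u. (\<integral>\<^sup>+\<tau>. a \<tau> * b (u - \<tau>) * c (t - u) \<partial>lborel) \<partial>lborel)"
    unfolding cv_def by (subst nn_integral_multc) auto
  also have "\<dots> = (\<integral>\<^sup>+\<tau>. (\<integral>\<^sup>+u. a \<tau> * b (u - \<tau>) * c (t - u) \<partial>lborel) \<partial>lborel)"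
    by (rule lborel_pair.Fubini') measurable
  also have "\<dots> = (\<integral>\<^sup>+\<tau>. a \<tau> * cv b c (t - \<tau>) \<partial>lborel)"
  proof (rule nn_integral_cong)
    fix \<tau>
    have "(\<integral>\<^sup>+u. a \<tau> * b (u - \<tau>) * c (t - u) \<partial>lborel) = (\<integral>\<^sup>+\<sigma>. a \<tau> * (b \<sigma> * c (t - \<tau> - \<sigma>)) \<partial>lborel)"
      by (subst nn_integral_real_affine[where c = 1 and t = \<tau>]) (auto simp: mult.assoc algebra_simps)
    also have "\<dots> = a \<tau> * cv b c (t - \<tau>)"
      unfolding cv_def by (rule nn_integral_cmult) measurable
    finally show "(\<integral>\<^sup>+u. a \<tau> * b (u - \<tau>) * c (t - u) \<partial>lborel) = a \<tau> * cv b c (t - \<tau>)" .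
  qed
  finally show "cv a (cv b c) t = cv (cv a b) c t"
    by (simp add: cv_def[of a])
qed

lemma cv_left_commute:
  assumes [measurable]: "a \<in> borel_measurable borel" "b \<in> borel_measurable borel" "c \<in> borel_measurable borel"
  shows "cv a (cv b c) = cv b (cv a c)"
  by (simp add: cv_assoc cv_commute[of a b])

lemma cv_eq_conv:
  assumes "integrable lborel (\<lambda>\<tau>. a \<tau> * f (t - \<tau>))" "\<And>\<tau>. 0 \<le> a \<tau>" "\<And>\<tau>. 0 \<le> f \<tau>"
  shows "cv (\<lambda>\<tau>. ennreal (a \<tau>)) (\<lambda>\<tau>. ennreal (f \<tau>)) t = ennreal (conv a f t)"
  unfolding cv_def conv_def using assms
  by (subst nn_integral_eq_integral[symmetric]) (auto simp: ennreal_mult)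

lemma cv_eq_conv_causal:
  assumes "kernel a" "causal f" "\<And>\<tau>. 0 \<le> f \<tau>"
  shows "cv (\<lambda>\<tau>. ennreal (a \<tau>)) (\<lambda>\<tau>. ennreal (f \<tau>)) = (\<lambda>t. ennreal (conv a f t))"
  using assms by (intro ext cv_eq_conv conv_integrable_causal kernel_nonneg[OF assms(1)])

text \<open>The two singularities sit at the opposite ends of [0,t]. Splitting at t / 2 leaves on
  each half one kernel bounded by its value at t / 2.\<close>

lemma conv_kernel_integrable:
  assumes a: "kernel a" and b: "kernel b"
  shows "integrable lborel (\<lambda>\<tau>. a \<tau> * b (t - \<tau>))"
proof (cases "t \<le> 0")
  case True
  have z: "a \<tau> * b (t - \<tau>) = 0" for \<tau>
    using True kernel_zero[OF a, of \<tau>] kernel_zero[OF b, of "t - \<tau>"] by (cases "\<tau> \<le> 0") auto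
  show ?thesis
    unfolding z by simp
next
  case False
  note [measurable] = kernel_measurable[OF a] kernel_measurable[OF b]
  show ?thesis
  proof (rule Bochner_Integration.integrable_bound)
    show "integrable lborel (\<lambda>\<tau>. b (t / 2) * (a \<tau> * indicator {..t} \<tau>) + a (t / 2) * (b (t - \<tau>) * indicator {..t} (t - \<tau>)))"
      using lborel_integrable_real_affine[OF kernel_integrable[OF b, of t], of "-1" t]
      by (intro Bochner_Integration.integrable_add integrable_mult_right kernel_integrable a) auto
    have "a \<tau> * b (t - \<tau>) \<le> b (t / 2) * (a \<tau> * indicator {..t} \<tau>) + a (t / 2) * (b (t - \<tau>) * indicator {..t} (t - \<tau>))" for \<tau>
    proof -
      have nn: "0 \<le> a \<tau>" "0 \<le> b (t - \<tau>)" "0 \<le> a (t / 2)" "0 \<le> b (t / 2)"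
        using a b by (auto intro: kernel_nonneg)
      consider "\<tau> \<le> 0 \<or> \<tau> \<ge> t" | "0 < \<tau>" "\<tau> \<le> t / 2" | "t / 2 < \<tau>" "\<tau> < t"
        by linarith
      then show ?thesis
      proof cases
        case 1
        then have "a \<tau> * b (t - \<tau>) = 0"
          using kernel_zero[OF a, of \<tau>] kernel_zero[OF b, of "t - \<tau>"] by auto
        moreover have "0 \<le> b (t / 2) * (a \<tau> * indicator {..t} \<tau>)" "0 \<le> a (t / 2) * (b (t - \<tau>) * indicator {..t} (t - \<tau>))"
          using nn by auto
        ultimately show ?thesis
          by linarith
      next
        case 2
        then have le: "b (t - \<tau>) \<le> b (t / 2)"
          using False by (intro kernel_antimono[OF b]) auto
        have "a \<tau> * b (t - \<tau>) \<le> b (t / 2) * a \<tau>"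
          using mult_left_mono[OF le nn(1)] by (simp add: mult.commute)
        moreover have i: "indicator {..t} \<tau> = (1::real)" "indicator {..t} (t - \<tau>) = (1::real)"
          using 2 False by auto
        ultimately show ?thesis
          unfolding i mult_1_right using mult_nonneg_nonneg[OF nn(3) nn(2)] by linarith
      next
        case 3
        then have "a \<tau> \<le> a (t / 2)"
          using False by (intro kernel_antimono[OF a]) auto
        then have "a \<tau> * b (t - \<tau>) \<le> a (t / 2) * b (t - \<tau>)"
          using nn by (simp add: mult_right_mono)
        moreover have i: "indicator {..t} \<tau> = (1::real)" "indicator {..t} (t - \<tau>) = (1::real)"
          using 3 False by auto
        ultimately show ?thesis
          unfolding i mult_1_right using mult_nonneg_nonneg[OF nn(4) nn(1)] by linarith
      qed
    qed
    then show "AE \<tau> in lborel. norm (a \<tau> * b (t - \<tau>))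
        \<le> norm (b (t / 2) * (a \<tau> * indicator {..t} \<tau>) + a (t / 2) * (b (t - \<tau>) * indicator {..t} (t - \<tau>)))"
      using kernel_nonneg[OF a] kernel_nonneg[OF b] by (intro AE_I2) (auto intro: order_trans[OF _ abs_ge_self])
  qed measurable
qed

text \<open>It differs from \<open>step\<close> at 0 only: a kernel has to vanish there, whereas the
  causal function 1 must not. Convolution with it is integration from 0.\<close>

abbreviation unit_kernel :: "real \<Rightarrow> real" where
  "unit_kernel \<equiv> indicator {0<..}"

lemma causal_lincomb: "causal f \<Longrightarrow> causal g \<Longrightarrow> causal (\<lambda>t. c * f t + d * g t)"
  by (auto simp: causal_def intro!: continuous_intros)

lemma causal_cmult: "causal f \<Longrightarrow> causal (\<lambda>t. c * f t)"
  by (auto simp: causal_def intro!: continuous_intros)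

lemma causal_diff: "causal f \<Longrightarrow> causal g \<Longrightarrow> causal (\<lambda>t. f t - g t)"
  by (auto simp: causal_def intro!: continuous_intros)

lemma conv_diff_right: "kernel a \<Longrightarrow> causal f \<Longrightarrow> causal g \<Longrightarrow> conv a (\<lambda>t. f t - g t) t = conv a f t - conv a g t"
  unfolding conv_def by (subst Bochner_Integration.integral_diff[symmetric])
    (auto intro: conv_integrable_causal simp: right_diff_distrib)

lemma conv_cmult_left: "conv (\<lambda>t. c * a t) f t = c * conv a f t"
  by (simp add: conv_def mult.assoc)

lemma conv_mono:
  assumes "kernel a" "causal f" "causal g" "\<And>t. f t \<le> g t"
  shows "conv a f t \<le> conv a g t"
  unfolding conv_def using assms
  by (intro integral_mono conv_integrable_causal mult_left_mono kernel_nonneg[OF assms(1)]) auto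

lemma abs_conv_le:
  assumes "kernel a" "causal f"
  shows "\<bar>conv a f t\<bar> \<le> conv a (\<lambda>t. \<bar>f t\<bar>) t"
proof -
  have "norm (conv a f t) \<le> (LINT \<tau>|lborel. norm (a \<tau> * f (t - \<tau>)))"
    unfolding conv_def by (rule integral_norm_bound)
  then show ?thesis
    using kernel_nonneg[OF assms(1)] by (simp add: conv_def abs_mult)
qed

lemma conv_unit_deriv:
  assumes f: "causal f" and t: "t > 0"
  shows "(conv unit_kernel f has_real_derivative f t) (at t)"
proof -
  have eq: "conv unit_kernel f u = integral {0..u} f" if "u \<ge> 0" for u
  proof -
    have "conv unit_kernel f u = (LINT \<tau>|lborel. unit_kernel (u - \<tau>) * f \<tau>)"
      unfolding conv_def
      by (subst lborel_integral_real_affine[where c = "-1" and t = u]) auto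
    also have "\<dots> = (LINT \<tau>:{0..u}|lborel. f \<tau>)"
      unfolding set_lebesgue_integral_def
    proof (rule integral_cong_AE)
      have "AE \<tau> in lborel. \<tau> \<noteq> u"
        by (rule AE_lborel_singleton)
      then show "AE \<tau> in lborel. unit_kernel (u - \<tau>) * f \<tau> = indicator {0..u} \<tau> *\<^sub>R f \<tau>"
        by eventually_elim (use f in \<open>auto simp: indicator_def causal_def\<close>)
    qed (use causal_measurable[OF f] in measurable)
    also have "\<dots> = integral {0..u} f"
      by (intro set_borel_integral_eq_integral borel_integrable_atLeastAtMost' causal_cont[OF f]) auto
    finally show ?thesis .
  qed
  have "((\<lambda>u. integral {0..u} f) has_real_derivative f t) (at t within {0..t + 1})"
    using t by (intro integral_has_real_derivative causal_cont[OF f]) auto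
  moreover have "at t within {0..t + 1} = at t"
    using t by (intro at_within_interior) auto
  ultimately have "((\<lambda>u. integral {0..u} f) has_real_derivative f t) (at t)"
    by simp
  moreover have "\<forall>\<^sub>F u in nhds t. integral {0..u} f = conv unit_kernel f u"
    using eventually_nhds_in_open[of "{0<..}" t] t by (auto simp: eq elim!: eventually_mono)
  ultimately show ?thesis
    by (subst (asm) DERIV_cong_ev[of t t _ "conv unit_kernel f" "f t" "f t"]) auto
qed

lemma conv_unit_mono:
  assumes f: "causal f" "\<And>t. f t \<ge> 0" and t: "0 \<le> t" "t \<le> u"
  shows "conv unit_kernel f t \<le> conv unit_kernel f u"
proof (rule DERIV_nonneg_imp_increasing_open[OF t(2)])
  show "continuous_on {t..u} (conv unit_kernel f)"
    by (rule continuous_on_subset[OF conv_continuous[OF kernel_step f(1)]]) simp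
  fix x assume "t < x" "x < u"
  then show "\<exists>y. (conv unit_kernel f has_real_derivative y) (at x) \<and> 0 \<le> y"
    using t f(2)[of x] by (intro exI[of _ "f x"] conjI conv_unit_deriv f) auto
qed

section \<open>Volterra equations whose kernel satisfies condition (H)\<close>

text \<open>\<open>p\<close> stands for m_\<gamma> extended by zero. Its nonnegativity is part of
  \<open>kernel p\<close> and is established when the locale is instantiated.\<close>

locale volterra =
  fixes p k :: "real \<Rightarrow> real" and \<beta> :: real
  assumes p: "kernel p" and k: "kernel k" and \<beta>: "\<beta> \<ge> 0" and p_cont: "continuous_on {0<..} p"
    and pk: "\<And>t. t > 0 \<Longrightarrow> \<beta> * p t + conv k p t = 1"
begin

definition solution :: "real \<Rightarrow> (real \<Rightarrow> real) \<Rightarrow> bool" where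
  "solution \<nu> s \<longleftrightarrow> causal s \<and> (\<forall>t\<ge>0. s t + \<nu> * conv p s t = 1)"

lemma solution_exists:
  assumes "\<nu> \<ge> 0"
  shows "\<exists>s. solution \<nu> s"
proof -
  have "kernel (\<lambda>t. \<nu> * p t + 0 * p t)"
    using assms by (intro kernel_lincomb p) auto
  then have a: "kernel (\<lambda>t. \<nu> * p t)"
    by simp
  obtain s where "causal s" "\<And>t. t \<ge> 0 \<Longrightarrow> 1 * s t + conv (\<lambda>t. \<nu> * p t) s t = 1"
    using volterra_exists[OF a, of 1] by auto
  then show ?thesis
    by (auto simp: solution_def conv_cmult_left)
qed

lemma kernel_cmult_p: "\<nu> \<ge> 0 \<Longrightarrow> kernel (\<lambda>t. \<nu> * p t)"
  using kernel_lincomb[OF p p, of \<nu> 0] by simp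

text \<open>Names a constant that works for all \<open>d\<close> and \<open>E\<close> at once.
  Convergence of the approximants, uniqueness and the dependence on \<nu> all use the estimate in
  this form.\<close>

definition gronwall :: "real \<Rightarrow> real \<Rightarrow> real \<Rightarrow> bool" where
  "gronwall \<nu> T C \<longleftrightarrow> (\<forall>d E t. causal d \<longrightarrow> E \<ge> 0 \<longrightarrow>
     (\<forall>u. 0 \<le> u \<longrightarrow> u \<le> T \<longrightarrow> \<bar>d u\<bar> \<le> E + \<nu> * conv p (\<lambda>t. \<bar>d t\<bar>) u) \<longrightarrow> 0 \<le> t \<longrightarrow> t \<le> T \<longrightarrow> \<bar>d t\<bar> \<le> C * E)"

lemma gronwall_le:
  assumes "gronwall \<nu> T C" "causal d" "E \<ge> 0"
    and "\<And>u. 0 \<le> u \<Longrightarrow> u \<le> T \<Longrightarrow> \<bar>d u\<bar> \<le> E + \<nu> * conv p (\<lambda>t. \<bar>d t\<bar>) u" "0 \<le> t" "t \<le> T"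
  shows "\<bar>d t\<bar> \<le> C * E"
  by (rule assms(1)[unfolded gronwall_def, rule_format, OF assms(2,3) _ assms(5,6)]) (rule assms(4))

lemma gronwall_exists:
  assumes "\<nu> \<ge> 0"
  shows "\<exists>C. gronwall \<nu> T C"
proof -
  note a = kernel_cmult_p[OF assms]
  obtain c where c: "c > 0" "(LINT t|lborel. exp (- c * t) * (\<nu> * p t)) \<le> 1 / 2"
    using kernel_small_transform[OF a, of "1 / 2"] by auto
  have "\<bar>d t\<bar> \<le> (2 * exp (c * T)) * E"
    if d: "causal d" and E: "E \<ge> 0" and le: "\<And>t. 0 \<le> t \<Longrightarrow> t \<le> T \<Longrightarrow> \<bar>d t\<bar> \<le> E + \<nu> * conv p (\<lambda>t. \<bar>d t\<bar>) t"
      and t: "0 \<le> t" "t \<le> T" for d E t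
  proof -
    obtain B where B: "\<And>t. t \<le> T \<Longrightarrow> \<bar>d t\<bar> \<le> B"
      using causal_bounded[OF d] by metis
    have "\<bar>d t\<bar> \<le> 2 * E * exp (c * T)"
      using volterra_gronwall[OF a c(2) c(1), of "\<lambda>t. \<bar>d t\<bar>" T B E t] causal_measurable[OF d] d B le E t
      by (auto simp: conv_cmult_left causal_def)
    then show ?thesis
      by (simp add: mult_ac)
  qed
  then show ?thesis
    unfolding gronwall_def by (intro exI[of _ "2 * exp (c * T)"]) blast
qed

text \<open>The primitives of the solutions for the perturbed kernels, for which \<open>\<beta> > 0\<close>, are concave and
  nondecreasing and converge to the primitive of the given solution.\<close>

lemma approximate_primitive:
  assumes \<nu>: "\<nu> \<ge> 0" and s: "solution \<nu> s"
  obtains S where "\<And>n. causal (S n)" "\<And>n t. S n t \<ge> 0" "\<And>n t u. 0 \<le> t \<Longrightarrow> t \<le> u \<Longrightarrow> S n u \<le> S n t"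
    "\<And>t. t \<ge> 0 \<Longrightarrow> (\<lambda>n. conv unit_kernel (S n) t) \<longlonglongrightarrow> conv unit_kernel s t"
proof -
  define \<epsilon> where "\<epsilon> n = inverse (real (Suc n))" for n
  have \<epsilon>: "\<epsilon> n > 0" for n
    by (simp add: \<epsilon>_def)
  have s_causal: "causal s" and s_eq: "\<And>t. t \<ge> 0 \<Longrightarrow> s t + \<nu> * conv p s t = 1"
    using s by (auto simp: solution_def)
  \<comment> \<open>Merging \<open>k\<close> and \<nu> times integration into one nonincreasing
    kernel puts the perturbed equation, with coefficient \<beta> + \<epsilon> > 0, within the scope
    of existence and positivity.\<close>
  have a: "kernel (\<lambda>t. 1 * k t + \<nu> * unit_kernel t)"
    using \<nu> by (intro kernel_lincomb k kernel_step) auto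
  have "\<exists>x. causal x \<and> (\<forall>t. x t \<ge> 0) \<and> (\<forall>t\<ge>0. (\<beta> + \<epsilon> n) * x t + conv k x t + \<nu> * conv unit_kernel x t = 1)" for n
  proof -
    have pos: "\<beta> + \<epsilon> n > 0"
      using \<beta> \<epsilon>[of n] by simp
    obtain x where x: "causal x" "\<And>t. t \<ge> 0 \<Longrightarrow> (\<beta> + \<epsilon> n) * x t + conv (\<lambda>t. 1 * k t + \<nu> * unit_kernel t) x t = 1"
      using volterra_exists[OF a pos] by blast
    have "x t \<ge> 0" for t
      using volterra_positive[OF a pos x, of t] x(1) by (cases "t < 0") (auto simp: causal_def less_imp_le)
    moreover have "conv (\<lambda>t. 1 * k t + \<nu> * unit_kernel t) x t = conv k x t + \<nu> * conv unit_kernel x t" for t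
      using conv_lincomb[OF k kernel_step x(1), of 1 \<nu> t] by simp
    ultimately show ?thesis
      using x by (auto simp: add.assoc)
  qed
  then obtain x where x: "\<And>n. causal (x n)" and x_nonneg: "\<And>n t. x n t \<ge> 0"
    and x_eq: "\<And>n t. t \<ge> 0 \<Longrightarrow> (\<beta> + \<epsilon> n) * x n t + conv k (x n) t + \<nu> * conv unit_kernel (x n) t = 1"
    by metis
  \<comment> \<open>By the equation for x this is 1 minus \<nu> times the primitive of x \<ge> 0,
    hence nonincreasing. For \<epsilon> = 0 condition (H) would turn p * S into the primitive of x,
    so that S + \<nu> p * S = 1.\<close>
  define S where "S n t = (\<beta> + \<epsilon> n) * x n t + conv k (x n) t" for n t
  have S: "causal (S n)" for n
    unfolding S_def using causal_lincomb[OF x causal_conv[OF k x], of "\<beta> + \<epsilon> n" n 1 n] by simp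
  have S_nonneg: "S n t \<ge> 0" for n t
    unfolding S_def using \<beta> \<epsilon>[of n] x_nonneg
    by (intro add_nonneg_nonneg mult_nonneg_nonneg conv_nonneg kernel_nonneg[OF k]) auto
  have S_eq: "S n t = 1 - \<nu> * conv unit_kernel (x n) t" if "t \<ge> 0" for n t
    using x_eq[OF that, of n] by (simp add: S_def)
  have S_step: "S n t \<le> step t" for n t
    using S_eq[of t n] S[of n] \<nu> conv_nonneg[of unit_kernel "x n" t] x_nonneg
    by (cases "t < 0") (auto simp: causal_def)
  have S_anti: "S n u \<le> S n t" if "0 \<le> t" "t \<le> u" for n t u
    using that S_eq[of t n] S_eq[of u n] conv_unit_mono[OF x x_nonneg that, of n] \<nu>
    by (simp add: mult_left_mono)
  \<comment> \<open>Multiple convolutions are rearranged in [0,\<infinity>] and the resulting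
    identities are transferred back by injectivity of \<open>ennreal\<close> on nonnegative
    reals.\<close>
  let ?E = "\<lambda>f t. ennreal (f t)"
  let ?H = "?E unit_kernel" and ?K = "?E k" and ?P = "?E p" and ?O = "?E step"
  note [measurable] = kernel_measurable[OF p] kernel_measurable[OF k] causal_measurable[OF x]
    causal_measurable[OF S] causal_measurable[OF s_causal]
  have PK: "(\<lambda>t. ennreal \<beta> * ?P t + cv ?K ?P t) = ?H"
  proof
    fix t
    have "cv ?K ?P t = ennreal (conv k p t)"
      by (intro cv_eq_conv conv_kernel_integrable k p kernel_nonneg[OF k] kernel_nonneg[OF p])
    moreover have "conv k p t = 0" if "t \<le> 0"
    proof -
      have z: "k \<tau> * p (t - \<tau>) = 0" for \<tau>
        using that kernel_zero[OF k, of \<tau>] kernel_zero[OF p, of "t - \<tau>"] by (cases "\<tau> \<le> 0") auto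
      show ?thesis
        unfolding conv_def z by simp
    qed
    ultimately show "ennreal \<beta> * ?P t + cv ?K ?P t = ?H t"
      using pk[of t] \<beta> kernel_zero[OF p, of t] conv_nonneg[of k p t] kernel_nonneg[OF p] kernel_nonneg[OF k]
      by (cases "t \<le> 0") (auto simp flip: ennreal_mult ennreal_plus)
  qed
  \<comment> \<open>Condition (H) convolved with \<open>U\<close>: integration amounts to applying
    \<beta> plus convolution with \<open>k\<close>, followed by convolution with
    \<open>p\<close>.\<close>
  have HU: "cv ?H U = (\<lambda>t. ennreal \<beta> * cv ?P U t + cv ?P (cv ?K U) t)"
    if [measurable]: "U \<in> borel_measurable borel" for U
  proof -
    have "cv ?H U = cv U (\<lambda>t. ennreal \<beta> * ?P t + cv ?K ?P t)"
      unfolding PK by (rule cv_commute) measurable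
    also have "\<dots> = (\<lambda>t. ennreal \<beta> * cv U ?P t + cv U (cv ?K ?P) t)"
      by (subst cv_add) (auto simp: cv_cmult)
    also have "cv U (cv ?K ?P) = cv ?K (cv U ?P)"
      by (rule cv_left_commute) measurable
    also have "cv U ?P = cv ?P U"
      by (rule cv_commute) measurable
    also have "cv ?K (cv ?P U) = cv ?P (cv ?K U)"
      by (rule cv_left_commute) measurable
    finally show ?thesis .
  qed
  \<comment> \<open>The equation satisfied by the primitive of the approximant; it differs from the
    one for the primitive of \<open>s\<close> only in terms carrying the factor \<epsilon>.\<close>
  have main: "conv unit_kernel (S n) t + \<epsilon> n * conv p (S n) t + \<nu> * conv p (conv unit_kernel (S n)) t
      = conv unit_kernel step t + \<epsilon> n * conv p step t" for n t
  proof -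
    let ?U = "?E (S n)" and ?X = "?E (x n)"
    have HX: "cv ?H ?X = ?E (conv unit_kernel (x n))" and KX: "cv ?K ?X = ?E (conv k (x n))"
      by (intro cv_eq_conv_causal kernel_step k x x_nonneg)+
    have e1: "(\<lambda>t. ?U t + ennreal \<nu> * cv ?H ?X t) = ?O"
    proof
      fix t
      show "?U t + ennreal \<nu> * cv ?H ?X t = ?O t"
      proof (cases "t < 0")
        case True
        then show ?thesis
          using S[of n] conv_neg[OF kernel_step x True, of n] by (simp add: HX causal_def)
      next
        case False
        then show ?thesis
          using S_eq[of t n] S_nonneg[of n t] \<nu> conv_nonneg[of unit_kernel "x n" t] x_nonneg
          by (simp add: HX flip: ennreal_mult ennreal_plus)
      qed
    qed
    have e2: "?U = (\<lambda>t. ennreal (\<beta> + \<epsilon> n) * ?X t + cv ?K ?X t)"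
      unfolding KX S_def using \<beta> \<epsilon>[of n] x_nonneg
      by (auto simp: conv_nonneg kernel_nonneg[OF k] ennreal_mult less_imp_le)
    have e3: "(\<lambda>t. ennreal (\<beta> + \<epsilon> n) * ?U t + cv ?K ?U t + ennreal \<nu> * cv ?H ?U t)
        = (\<lambda>t. ennreal (\<beta> + \<epsilon> n) * ?O t + cv ?K ?O t)"
    proof -
      have "cv ?H ?U = (\<lambda>t. ennreal (\<beta> + \<epsilon> n) * cv ?H ?X t + cv ?K (cv ?H ?X) t)"
        by (subst e2, subst cv_add) (auto simp: cv_cmult cv_left_commute[of ?H ?K])
      moreover have "cv ?K ?O = (\<lambda>t. cv ?K ?U t + ennreal \<nu> * cv ?K (cv ?H ?X) t)"
        by (subst e1[symmetric], subst cv_add) (auto simp: cv_cmult)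
      moreover have "?O t = ?U t + ennreal \<nu> * cv ?H ?X t" for t
        using e1[symmetric] by (rule fun_cong)
      ultimately show ?thesis
        by (simp add: fun_eq_iff distrib_left ac_simps)
    qed
    have e4: "cv ?P (\<lambda>t. ennreal (\<beta> + \<epsilon> n) * ?U t + cv ?K ?U t + ennreal \<nu> * cv ?H ?U t) t
        = cv ?P (\<lambda>t. ennreal (\<beta> + \<epsilon> n) * ?O t + cv ?K ?O t) t"
      unfolding e3 ..
    have exp: "cv ?P (\<lambda>t. ennreal (\<beta> + \<epsilon> n) * V t + cv ?K V t) t = cv ?H V t + ennreal (\<epsilon> n) * cv ?P V t"
      if [measurable]: "V \<in> borel_measurable borel" for V
    proof -
      have "cv ?P (\<lambda>t. ennreal (\<beta> + \<epsilon> n) * V t + cv ?K V t) t = ennreal (\<beta> + \<epsilon> n) * cv ?P V t + cv ?P (cv ?K V) t"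
        by (subst cv_add) (auto simp: cv_cmult)
      moreover have "ennreal (\<beta> + \<epsilon> n) = ennreal \<beta> + ennreal (\<epsilon> n)"
        using \<beta> \<epsilon>[of n] by (intro ennreal_plus) auto
      ultimately show ?thesis
        unfolding fun_cong[OF HU[OF that]] by (simp add: distrib_right ac_simps)
    qed
    have "cv ?H ?U t + ennreal (\<epsilon> n) * cv ?P ?U t + ennreal \<nu> * cv ?P (cv ?H ?U) t
        = cv ?H ?O t + ennreal (\<epsilon> n) * cv ?P ?O t"
    proof -
      have "cv ?P (\<lambda>t. ennreal (\<beta> + \<epsilon> n) * ?U t + cv ?K ?U t + ennreal \<nu> * cv ?H ?U t) t
          = cv ?P (\<lambda>t. ennreal (\<beta> + \<epsilon> n) * ?U t + cv ?K ?U t) t + ennreal \<nu> * cv ?P (cv ?H ?U) t"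
        by (subst cv_add) (auto simp: cv_cmult)
      moreover have "cv ?P (\<lambda>t. ennreal (\<beta> + \<epsilon> n) * ?U t + cv ?K ?U t) t = cv ?H ?U t + ennreal (\<epsilon> n) * cv ?P ?U t"
        by (rule exp) measurable
      moreover have "cv ?P (\<lambda>t. ennreal (\<beta> + \<epsilon> n) * ?O t + cv ?K ?O t) t = cv ?H ?O t + ennreal (\<epsilon> n) * cv ?P ?O t"
        by (rule exp) measurable
      ultimately show ?thesis
        using e4 by presburger
    qed
    moreover have "cv ?H ?U = ?E (conv unit_kernel (S n))" "cv ?P ?U = ?E (conv p (S n))"
      "cv ?H ?O = ?E (conv unit_kernel step)" "cv ?P ?O = ?E (conv p step)"
      by (intro cv_eq_conv_causal kernel_step p S S_nonneg causal_step; simp)+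
    moreover have "cv ?P (?E (conv unit_kernel (S n))) = ?E (conv p (conv unit_kernel (S n)))"
      by (intro cv_eq_conv_causal p causal_conv kernel_step S conv_nonneg S_nonneg) auto
    ultimately have "ennreal (conv unit_kernel (S n) t + \<epsilon> n * conv p (S n) t + \<nu> * conv p (conv unit_kernel (S n)) t)
        = ennreal (conv unit_kernel step t + \<epsilon> n * conv p step t)"
      using \<epsilon>[of n] \<nu> S_nonneg
      by (simp add: ennreal_plus ennreal_mult conv_nonneg kernel_nonneg[OF p] less_imp_le)
    moreover have "0 \<le> conv unit_kernel (S n) t + \<epsilon> n * conv p (S n) t + \<nu> * conv p (conv unit_kernel (S n)) t"
      "0 \<le> conv unit_kernel step t + \<epsilon> n * conv p step t"
      by (intro add_nonneg_nonneg mult_nonneg_nonneg conv_nonneg kernel_nonneg[OF p] less_imp_le[OF \<epsilon>] \<nu> S_nonneg; simp)+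
    ultimately show ?thesis
      by (simp only: ennreal_inj)
  qed
  define z where "z = conv unit_kernel s"
  have z: "causal z"
    unfolding z_def by (intro causal_conv kernel_step s_causal)
  have z_eq: "z t + \<nu> * conv p z t = conv unit_kernel step t" for t
  proof -
    \<comment> \<open>The sign of \<open>s\<close> is unknown at this stage, so its positive and
      negative parts are convolved separately and the negative terms are moved across the
      equation.\<close>
    define sp sm where "sp t = max (s t) 0" and "sm t = max (- s t) 0" for t
    have sp: "causal sp" "\<And>t. sp t \<ge> 0" and sm: "causal sm" "\<And>t. sm t \<ge> 0"
      using s_causal by (auto simp: sp_def sm_def causal_def intro!: continuous_intros)
    have s_split: "s = (\<lambda>t. sp t - sm t)"
      by (auto simp: sp_def sm_def fun_eq_iff)
    note [measurable] = causal_measurable[OF sp(1)] causal_measurable[OF sm(1)]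
    have Psp: "cv ?P (?E sp) = ?E (conv p sp)" and Psm: "cv ?P (?E sm) = ?E (conv p sm)"
      by (intro cv_eq_conv_causal p sp sm)+
    have e: "(\<lambda>t. ?E sp t + ennreal \<nu> * cv ?P (?E sp) t) = (\<lambda>t. ?O t + (?E sm t + ennreal \<nu> * cv ?P (?E sm) t))"
    proof
      fix t
      have "sp t + \<nu> * conv p sp t = step t + (sm t + \<nu> * conv p sm t)"
      proof (cases "t < 0")
        case True
        then show ?thesis
          using sp sm conv_neg[OF p sp(1) True] conv_neg[OF p sm(1) True] by (simp add: causal_def)
      next
        case False
        have "conv p s t = conv p sp t - conv p sm t"
          unfolding s_split by (rule conv_diff_right[OF p sp(1) sm(1)])
        then show ?thesis
          using s_eq[of t] False fun_cong[OF s_split, of t] by (simp add: right_diff_distrib)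
      qed
      then show "?E sp t + ennreal \<nu> * cv ?P (?E sp) t = ?O t + (?E sm t + ennreal \<nu> * cv ?P (?E sm) t)"
        unfolding Psp Psm using \<nu> sp sm
        by (simp add: conv_nonneg kernel_nonneg[OF p] flip: ennreal_mult ennreal_plus)
    qed
    have "cv ?H (\<lambda>t. ?E sp t + ennreal \<nu> * cv ?P (?E sp) t) t = cv ?H (\<lambda>t. ?O t + (?E sm t + ennreal \<nu> * cv ?P (?E sm) t)) t"
      unfolding e ..
    then have "cv ?H (?E sp) t + ennreal \<nu> * cv ?P (cv ?H (?E sp)) t
        = cv ?H ?O t + (cv ?H (?E sm) t + ennreal \<nu> * cv ?P (cv ?H (?E sm)) t)"
      by (simp add: cv_add cv_cmult cv_left_commute[of ?H ?P])
    moreover have "cv ?H (?E sp) = ?E (conv unit_kernel sp)" "cv ?H (?E sm) = ?E (conv unit_kernel sm)"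
      "cv ?H ?O = ?E (conv unit_kernel step)"
      by (intro cv_eq_conv_causal kernel_step sp sm causal_step; simp)+
    moreover have "cv ?P (?E (conv unit_kernel sp)) = ?E (conv p (conv unit_kernel sp))"
      "cv ?P (?E (conv unit_kernel sm)) = ?E (conv p (conv unit_kernel sm))"
      using sp sm by (intro cv_eq_conv_causal p causal_conv kernel_step conv_nonneg; simp)+
    ultimately have "ennreal (conv unit_kernel sp t + \<nu> * conv p (conv unit_kernel sp) t)
        = ennreal (conv unit_kernel step t + (conv unit_kernel sm t + \<nu> * conv p (conv unit_kernel sm) t))"
      using \<nu> sp sm by (simp add: ennreal_plus ennreal_mult conv_nonneg kernel_nonneg[OF p])
    moreover have "0 \<le> conv unit_kernel sp t + \<nu> * conv p (conv unit_kernel sp) t"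
      "0 \<le> conv unit_kernel step t + (conv unit_kernel sm t + \<nu> * conv p (conv unit_kernel sm) t)"
      by (intro add_nonneg_nonneg mult_nonneg_nonneg conv_nonneg kernel_nonneg[OF p] \<nu> sp(2) sm(2); simp)+
    ultimately have "conv unit_kernel sp t + \<nu> * conv p (conv unit_kernel sp) t
        = conv unit_kernel step t + (conv unit_kernel sm t + \<nu> * conv p (conv unit_kernel sm) t)"
      by (simp only: ennreal_inj)
    moreover have zs: "z = (\<lambda>t. conv unit_kernel sp t - conv unit_kernel sm t)"
      unfolding z_def s_split by (rule ext) (rule conv_diff_right[OF kernel_step sp(1) sm(1)])
    moreover have "conv p z t = conv p (conv unit_kernel sp) t - conv p (conv unit_kernel sm) t"
      unfolding zs by (intro conv_diff_right p causal_conv kernel_step sp sm)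
    ultimately show ?thesis
      by (simp add: right_diff_distrib)
  qed
  have "(\<lambda>n. conv unit_kernel (S n) T) \<longlonglongrightarrow> z T" if T: "T \<ge> 0" for T
  proof -
    obtain C where C: "gronwall \<nu> T C"
      using gronwall_exists[OF \<nu>] by blast
    obtain B where B: "B \<ge> 0" "\<And>t. t \<le> T \<Longrightarrow> \<bar>conv p step t\<bar> \<le> B"
      using causal_bounded[OF causal_conv[OF p causal_step], of T] by metis
    have bound: "\<bar>conv unit_kernel (S n) T - z T\<bar> \<le> C * (\<epsilon> n * B)" for n
    proof (rule gronwall_le[OF C, of "\<lambda>t. conv unit_kernel (S n) t - z t" "\<epsilon> n * B" T])
      show d: "causal (\<lambda>t. conv unit_kernel (S n) t - z t)"
        by (intro causal_diff causal_conv kernel_step S z)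
      show "\<epsilon> n * B \<ge> 0"
        using \<epsilon>[of n] B by simp
      fix t assume t: "0 \<le> t" "t \<le> T"
      have "conv unit_kernel (S n) t - z t + \<nu> * conv p (\<lambda>t. conv unit_kernel (S n) t - z t) t
          = \<epsilon> n * (conv p step t - conv p (S n) t)"
        using main[of n t] z_eq[of t]
        by (simp add: conv_diff_right[OF p causal_conv[OF kernel_step S] z] algebra_simps)
      moreover have "\<bar>conv p step t - conv p (S n) t\<bar> \<le> B"
        using conv_mono[OF p S causal_step S_step, of n t] conv_nonneg[of p "S n" t] S_nonneg kernel_nonneg[OF p] B(2)[OF t(2)]
        by auto
      then have "\<bar>\<epsilon> n * (conv p step t - conv p (S n) t)\<bar> \<le> \<epsilon> n * B"
        using \<epsilon>[of n] by (simp add: abs_mult mult_left_mono)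
      moreover have "\<bar>\<nu> * conv p (\<lambda>t. conv unit_kernel (S n) t - z t) t\<bar> \<le> \<nu> * conv p (\<lambda>t. \<bar>conv unit_kernel (S n) t - z t\<bar>) t"
        using abs_conv_le[OF p d, of t] \<nu> by (simp add: abs_mult mult_left_mono)
      ultimately show "\<bar>conv unit_kernel (S n) t - z t\<bar> \<le> \<epsilon> n * B + \<nu> * conv p (\<lambda>t. \<bar>conv unit_kernel (S n) t - z t\<bar>) t"
        by linarith
    qed (use T in auto)
    have "(\<lambda>n. C * (\<epsilon> n * B)) \<longlonglongrightarrow> C * (0 * B)"
      unfolding \<epsilon>_def by (intro tendsto_intros LIMSEQ_inverse_real_of_nat)
    then have "(\<lambda>n. conv unit_kernel (S n) T - z T) \<longlonglongrightarrow> 0"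
      using bound by (intro Lim_null_comparison[OF always_eventually, of "\<lambda>n. conv unit_kernel (S n) T - z T"]) auto
    then show ?thesis
      by (simp add: LIM_zero_iff)
  qed
  then show ?thesis
    using that[of S] S S_nonneg S_anti unfolding z_def by blast
qed

text \<open>The primitive of \<open>s\<close> inherits monotonicity and concavity from the
  approximants. At t > 0 its difference quotients converge to \<open>s\<close> and carry over the
  sign and the monotonicity.\<close>

lemma solution_bounds:
  assumes \<nu>: "\<nu> \<ge> 0" and s: "solution \<nu> s"
  shows solution_zero: "s 0 = 1"
    and solution_nonneg: "s t \<ge> 0"
    and solution_antimono: "0 \<le> t \<Longrightarrow> t \<le> u \<Longrightarrow> s u \<le> s t"
    and solution_le: "s t \<le> step t"
proof -
  have s_causal: "causal s" and s_eq: "\<And>t. t \<ge> 0 \<Longrightarrow> s t + \<nu> * conv p s t = 1"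
    using s by (auto simp: solution_def)
  show s0: "s 0 = 1"
    using s_eq[of 0] conv_zero[OF p s_causal] by simp
  obtain S where S: "\<And>n. causal (S n)" "\<And>n t. S n t \<ge> 0" "\<And>n t u. 0 \<le> t \<Longrightarrow> t \<le> u \<Longrightarrow> S n u \<le> S n t"
    "\<And>t. t \<ge> 0 \<Longrightarrow> (\<lambda>n. conv unit_kernel (S n) t) \<longlonglongrightarrow> conv unit_kernel s t"
    using approximate_primitive[OF assms] by blast
  let ?z = "conv unit_kernel s"
  have z_mono: "?z t \<le> ?z u" if "0 \<le> t" "t \<le> u" for t u
    using that by (intro LIMSEQ_le[OF S(4) S(4)] exI[of _ 0] allI impI conv_unit_mono S(1,2)) auto
  have z_conc: "?z (u + h) - ?z u \<le> ?z (t + h) - ?z t" if "0 \<le> t" "t \<le> u" "h > 0" for t u h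
  proof (rule LIMSEQ_le[OF tendsto_diff[OF S(4) S(4)] tendsto_diff[OF S(4) S(4)]])
    have "conv unit_kernel (S n) (u + h) - conv unit_kernel (S n) u
        \<le> conv unit_kernel (S n) (t + h) - conv unit_kernel (S n) t" for n
    proof (rule DERIV_nonpos_imp_decreasing_open[OF that(2)])
      fix v assume v: "t < v" "v < u"
      have "((\<lambda>v. conv unit_kernel (S n) (v + h) - conv unit_kernel (S n) v) has_real_derivative S n (v + h) - S n v) (at v)"
        using v that by (intro DERIV_diff conv_unit_deriv S(1) DERIV_shift[THEN iffD1]) auto
      moreover have "S n (v + h) - S n v \<le> 0"
        using S(3)[of v "v + h" n] v that by simp
      ultimately show "\<exists>y. ((\<lambda>v. conv unit_kernel (S n) (v + h) - conv unit_kernel (S n) v) has_real_derivative y) (at v) \<and> y \<le> 0"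
        by blast
    next
      have c: "continuous_on A (conv unit_kernel (S n))" for A
        by (rule continuous_on_subset[OF conv_continuous[OF kernel_step S(1)]]) simp
      show "continuous_on {t..u} (\<lambda>v. conv unit_kernel (S n) (v + h) - conv unit_kernel (S n) v)"
        by (rule continuous_on_diff[OF continuous_on_compose2[OF c[of UNIV]] c]) (auto intro!: continuous_intros)
    qed
    then show "\<exists>N. \<forall>n\<ge>N. conv unit_kernel (S n) (u + h) - conv unit_kernel (S n) u
        \<le> conv unit_kernel (S n) (t + h) - conv unit_kernel (S n) t"
      by blast
  qed (use that in auto)
  have quot: "((\<lambda>h. (?z (t + h) - ?z t) / h) \<longlongrightarrow> s t) (at_right 0)" if "t > 0" for t
    using conv_unit_deriv[OF s_causal that] unfolding DERIV_def
    by (rule tendsto_mono[rotated]) (simp add: at_le)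
  have pos: "s t \<ge> 0" if "t > 0" for t
  proof (rule tendsto_lowerbound[OF quot[OF that]])
    show "\<forall>\<^sub>F h in at_right 0. 0 \<le> (?z (t + h) - ?z t) / h"
      using eventually_at_right_less[of 0] by eventually_elim (use z_mono that in auto)
  qed simp
  then show nonneg: "s t \<ge> 0" for t
    using s0 s_causal by (cases "t < 0"; cases "t = 0") (auto simp: causal_def)
  have conv_s_nonneg: "0 \<le> \<nu> * conv p s t" for t
    by (intro mult_nonneg_nonneg \<nu> conv_nonneg kernel_nonneg[OF p] nonneg)
  show le: "s t \<le> step t" for t
    using s_eq[of t] s_causal conv_s_nonneg[of t] by (cases "t < 0") (simp_all add: causal_def)
  have anti: "s u \<le> s t" if "0 < t" "t \<le> u" for t u
  proof (rule tendsto_le[OF _ quot quot])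
    show "\<forall>\<^sub>F h in at_right 0. (?z (u + h) - ?z u) / h \<le> (?z (t + h) - ?z t) / h"
      using eventually_at_right_less[of 0]
    proof eventually_elim
      case (elim h)
      then show ?case
        using z_conc[OF less_imp_le[OF that(1)] that(2) elim] by (simp add: divide_right_mono)
    qed
  qed (use that in auto)
  show "s u \<le> s t" if "0 \<le> t" "t \<le> u"
  proof (cases "t = 0")
    case True
    have "s u \<le> 1"
      using le[of u] that True by simp
    then show ?thesis
      using True s0 by simp
  next
    case False
    then show ?thesis
      using anti that by simp
  qed
qed

lemma solution_unique:
  assumes \<nu>: "\<nu> \<ge> 0" and s: "solution \<nu> s" "solution \<nu> s'"
  shows "s = s'"
proof
  fix t
  have c: "causal s" "causal s'"
    using s by (auto simp: solution_def)
  show "s t = s' t"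
  proof (cases "t < 0")
    case False
    obtain C where C: "gronwall \<nu> t C"
      using gronwall_exists[OF \<nu>] by blast
    have "\<bar>s t - s' t\<bar> \<le> C * 0"
    proof (rule gronwall_le[OF C, of "\<lambda>t. s t - s' t" 0 t])
      fix u assume u: "0 \<le> u" "u \<le> t"
      have "s u - s' u = - (\<nu> * conv p (\<lambda>t. s t - s' t) u)"
        using s u by (simp add: solution_def conv_diff_right[OF p c] right_diff_distrib) (smt (verit))
      then have "\<bar>s u - s' u\<bar> = \<nu> * \<bar>conv p (\<lambda>t. s t - s' t) u\<bar>"
        using \<nu> by (simp add: abs_mult)
      also have "\<dots> \<le> \<nu> * conv p (\<lambda>t. \<bar>s t - s' t\<bar>) u"
        using \<nu> by (intro mult_left_mono abs_conv_le p causal_diff c)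
      finally show "\<bar>s u - s' u\<bar> \<le> 0 + \<nu> * conv p (\<lambda>t. \<bar>s t - s' t\<bar>) u"
        by simp
    qed (use False c in \<open>auto intro: causal_diff\<close>)
    then show ?thesis
      by simp
  qed (use c in \<open>auto simp: causal_def\<close>)
qed

definition sol :: "real \<Rightarrow> real \<Rightarrow> real" where
  "sol \<nu> = (SOME s. solution \<nu> s)"

lemma sol: "\<nu> \<ge> 0 \<Longrightarrow> solution \<nu> (sol \<nu>)"
  unfolding sol_def by (rule someI_ex[OF solution_exists])

lemma sol_causal: "\<nu> \<ge> 0 \<Longrightarrow> causal (sol \<nu>)"
  using sol[of \<nu>] by (simp add: solution_def)

lemma sol_eq: "\<nu> \<ge> 0 \<Longrightarrow> t \<ge> 0 \<Longrightarrow> sol \<nu> t + \<nu> * conv p (sol \<nu>) t = 1"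
  using sol[of \<nu>] by (simp add: solution_def)

lemma sol_zero: "\<nu> \<ge> 0 \<Longrightarrow> sol \<nu> 0 = 1"
  by (rule solution_zero[OF _ sol])

lemma sol_nonneg: "\<nu> \<ge> 0 \<Longrightarrow> 0 \<le> sol \<nu> t"
  by (rule solution_nonneg[OF _ sol])

lemma sol_antimono: "\<nu> \<ge> 0 \<Longrightarrow> 0 \<le> t \<Longrightarrow> t \<le> u \<Longrightarrow> sol \<nu> u \<le> sol \<nu> t"
  by (rule solution_antimono[OF _ sol])

lemma sol_le: "\<nu> \<ge> 0 \<Longrightarrow> sol \<nu> t \<le> step t"
  by (rule solution_le[OF _ sol])

section \<open>Decay of the solution and its dependence on the parameter\<close>

text \<open>The primitive M of the kernel, written as a convolution so that the facts on causal
  functions apply to it.\<close>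

definition mass :: "real \<Rightarrow> real" where
  "mass = conv p step"

lemma mass_causal: "causal mass"
  unfolding mass_def by (intro causal_conv p causal_step)

lemma mass_nonneg: "mass t \<ge> 0"
  unfolding mass_def by (intro conv_nonneg kernel_nonneg[OF p]) auto

text \<open>Since s is nonincreasing, s(t - \<tau>) \<ge> s(t) for 0 < \<tau> \<le> t; hence p * s
  is at least s(t) M(t) in the equation.\<close>

lemma sol_mass_bound:
  assumes \<nu>: "\<nu> \<ge> 0" and t: "t \<ge> 0"
  shows "sol \<nu> t * (1 + \<nu> * mass t) \<le> 1"
proof -
  have "sol \<nu> t * mass t = (LINT \<tau>|lborel. p \<tau> * (sol \<nu> t * step (t - \<tau>)))"
    unfolding mass_def conv_def by (simp flip: integral_mult_right_zero add: mult_ac)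
  also have "\<dots> \<le> conv p (sol \<nu>) t"
    unfolding conv_def
  proof (intro integral_mono)
    show "integrable lborel (\<lambda>\<tau>. p \<tau> * (sol \<nu> t * step (t - \<tau>)))"
      by (intro conv_integrable_causal p causal_cmult causal_step)
    show "integrable lborel (\<lambda>\<tau>. p \<tau> * sol \<nu> (t - \<tau>))"
      by (intro conv_integrable_causal p sol_causal \<nu>)
    show "p \<tau> * (sol \<nu> t * step (t - \<tau>)) \<le> p \<tau> * sol \<nu> (t - \<tau>)" for \<tau>
    proof (cases "0 < \<tau> \<and> \<tau> \<le> t")
      case True
      then show ?thesis
        using sol_antimono[OF \<nu>, of "t - \<tau>" t] kernel_nonneg[OF p, of \<tau>] by (auto intro!: mult_left_mono)
    next
      case False
      then show ?thesis
        using kernel_zero[OF p, of \<tau>] kernel_nonneg[OF p, of \<tau>] sol_nonneg[OF \<nu>] by (cases "\<tau> \<le> 0") auto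
    qed
  qed
  finally have "\<nu> * (sol \<nu> t * mass t) \<le> \<nu> * conv p (sol \<nu>) t"
    using \<nu> by (rule mult_left_mono)
  then show ?thesis
    using sol_eq[OF \<nu> t] by (simp add: algebra_simps)
qed

text \<open>The Gronwall constant belongs to the fixed \<nu>, and the forcing \<nu> - \<mu> times p
  * s_\<mu> is controlled through s_\<mu> \<le> 1, so \<open>L\<close> serves all \<mu> at
  once.\<close>

lemma sol_lipschitz:
  assumes \<nu>: "\<nu> \<ge> 0"
  obtains L where "\<And>\<mu> t. \<mu> \<ge> 0 \<Longrightarrow> 0 \<le> t \<Longrightarrow> t \<le> T \<Longrightarrow> \<bar>sol \<nu> t - sol \<mu> t\<bar> \<le> L * \<bar>\<nu> - \<mu>\<bar>"
proof -
  obtain C where C: "gronwall \<nu> T C"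
    using gronwall_exists[OF \<nu>] by blast
  obtain B where B: "B \<ge> 0" "\<And>t. t \<le> T \<Longrightarrow> \<bar>mass t\<bar> \<le> B"
    by (rule causal_bounded[OF mass_causal, of T]) (rule that)
  have "\<bar>sol \<nu> t - sol \<mu> t\<bar> \<le> C * (\<bar>\<nu> - \<mu>\<bar> * B)" if \<mu>: "\<mu> \<ge> 0" and t: "0 \<le> t" "t \<le> T" for \<mu> t
  proof (rule gronwall_le[OF C, of "\<lambda>t. sol \<nu> t - sol \<mu> t" "\<bar>\<nu> - \<mu>\<bar> * B" t])
    show d: "causal (\<lambda>t. sol \<nu> t - sol \<mu> t)"
      by (intro causal_diff sol_causal \<nu> \<mu>)
    show "\<bar>\<nu> - \<mu>\<bar> * B \<ge> 0"
      using B by simp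
    fix u assume u: "0 \<le> u" "u \<le> T"
    have "sol \<nu> u - sol \<mu> u = - (\<nu> * conv p (\<lambda>t. sol \<nu> t - sol \<mu> t) u) - (\<nu> - \<mu>) * conv p (sol \<mu>) u"
      using sol_eq[OF \<nu> u(1)] sol_eq[OF \<mu> u(1)]
      by (simp add: conv_diff_right[OF p sol_causal[OF \<nu>] sol_causal[OF \<mu>]] algebra_simps)
    moreover have "\<bar>\<nu> * conv p (\<lambda>t. sol \<nu> t - sol \<mu> t) u\<bar> \<le> \<nu> * conv p (\<lambda>t. \<bar>sol \<nu> t - sol \<mu> t\<bar>) u"
      using abs_conv_le[OF p d, of u] \<nu> by (simp add: abs_mult mult_left_mono)
    moreover have "\<bar>(\<nu> - \<mu>) * conv p (sol \<mu>) u\<bar> \<le> \<bar>\<nu> - \<mu>\<bar> * B"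
    proof -
      have "0 \<le> conv p (sol \<mu>) u"
        by (intro conv_nonneg kernel_nonneg[OF p] sol_nonneg \<mu>)
      moreover have "conv p (sol \<mu>) u \<le> mass u"
        unfolding mass_def by (intro conv_mono p sol_causal \<mu> causal_step sol_le)
      ultimately show ?thesis
        unfolding abs_mult using B(2)[OF u(2)] by (intro mult_left_mono) auto
    qed
    ultimately show "\<bar>sol \<nu> u - sol \<mu> u\<bar> \<le> \<bar>\<nu> - \<mu>\<bar> * B + \<nu> * conv p (\<lambda>t. \<bar>sol \<nu> t - sol \<mu> t\<bar>) u"
      by linarith
  qed (use t in auto)
  then have "\<And>\<mu> t. \<mu> \<ge> 0 \<Longrightarrow> 0 \<le> t \<Longrightarrow> t \<le> T \<Longrightarrow> \<bar>sol \<nu> t - sol \<mu> t\<bar> \<le> (C * B) * \<bar>\<nu> - \<mu>\<bar>"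
    by (simp add: mult_ac)
  then show ?thesis
    using that by blast
qed

text \<open>The Lipschitz bound in \<nu> is uniform in bounded times and combines with continuity in
  time. It is needed for joint measurability of the symbols in time and frequency.\<close>

lemma sol_jointly_continuous: "continuous_on ({0..} \<times> {0..}) (\<lambda>(\<nu>, t). sol \<nu> t)"
proof (rule continuous_on_sequentiallyI)
  fix u :: "nat \<Rightarrow> real \<times> real" and a
  assume u: "\<forall>n. u n \<in> {0..} \<times> {0..}" and a: "a \<in> {0..} \<times> {0..}" and lim: "u \<longlonglongrightarrow> a"
  obtain \<nu> t where at: "a = (\<nu>, t)" "\<nu> \<ge> 0" "t \<ge> 0"
    using a by auto
  have u': "fst (u n) \<ge> 0" "snd (u n) \<ge> 0" for n
    using u by (auto simp: mem_Times_iff)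
  have lims: "(\<lambda>n. fst (u n)) \<longlonglongrightarrow> \<nu>" "(\<lambda>n. snd (u n)) \<longlonglongrightarrow> t"
    using tendsto_fst[OF lim] tendsto_snd[OF lim] by (simp_all add: at)
  obtain L where L: "\<And>\<mu> v. \<mu> \<ge> 0 \<Longrightarrow> 0 \<le> v \<Longrightarrow> v \<le> t + 1 \<Longrightarrow> \<bar>sol \<nu> v - sol \<mu> v\<bar> \<le> L * \<bar>\<nu> - \<mu>\<bar>"
    by (rule sol_lipschitz[OF at(2), of "t + 1"]) (rule that)
  have "\<forall>\<^sub>F n in sequentially. norm (sol (fst (u n)) (snd (u n)) - sol \<nu> (snd (u n))) \<le> L * \<bar>\<nu> - fst (u n)\<bar>"
  proof -
    have "\<forall>\<^sub>F n in sequentially. snd (u n) < t + 1"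
      by (rule order_tendstoD[OF lims(2)]) simp
    then show ?thesis
    proof eventually_elim
      case (elim n)
      then show ?case
        using L[OF u'(1) u'(2), of n n] by (simp add: abs_minus_commute)
    qed
  qed
  moreover have "(\<lambda>n. L * \<bar>\<nu> - fst (u n)\<bar>) \<longlonglongrightarrow> L * \<bar>\<nu> - \<nu>\<bar>"
    by (intro tendsto_intros lims)
  ultimately have "(\<lambda>n. sol (fst (u n)) (snd (u n)) - sol \<nu> (snd (u n))) \<longlonglongrightarrow> 0"
    using Lim_null_comparison[of "\<lambda>n. sol (fst (u n)) (snd (u n)) - sol \<nu> (snd (u n))"] by simp
  moreover have "(\<lambda>n. sol \<nu> (snd (u n))) \<longlonglongrightarrow> sol \<nu> t"
    using sol_causal[OF at(2)] lims(2) at u'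
    by (intro continuous_on_tendsto_compose[of "{0..}" "sol \<nu>"]) (auto simp: causal_def)
  ultimately have "(\<lambda>n. (sol (fst (u n)) (snd (u n)) - sol \<nu> (snd (u n))) + sol \<nu> (snd (u n))) \<longlonglongrightarrow> 0 + sol \<nu> t"
    by (rule tendsto_add)
  then show "(\<lambda>n. case u n of (\<nu>, t) \<Rightarrow> sol \<nu> t) \<longlonglongrightarrow> (case a of (\<nu>, t) \<Rightarrow> sol \<nu> t)"
    by (simp add: at case_prod_unfold)
qed

end

section \<open>The time derivative of the solution\<close>

lemma conv_zero_right:
  assumes "kernel a" "\<And>u. u < 0 \<Longrightarrow> f u = 0" "f 0 = 0" "t \<le> 0"
  shows "conv a f t = 0"
proof -
  have z: "a \<tau> * f (t - \<tau>) = 0" for \<tau>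
    using assms kernel_zero[OF assms(1), of \<tau>] by (cases "\<tau> \<le> 0"; cases "t - \<tau> = 0") auto
  show ?thesis
    unfolding conv_def z by simp
qed

text \<open>As an integral against the measure with density \<open>a\<close>, the convolution is in
  the form to which Fatou's lemma and its reverse apply.\<close>

lemma cv_density:
  assumes [measurable]: "a \<in> borel_measurable borel" "f \<in> borel_measurable borel"
  shows "cv a f t = (\<integral>\<^sup>+\<tau>. f (t - \<tau>) \<partial>density lborel a)"
  unfolding cv_def by (subst nn_integral_density) auto

text \<open>Multiplicativity of the Laplace transform under convolution, stated in
  [0,\<infinity>].\<close>

lemma cv_weighted:
  fixes c :: real
  assumes [measurable]: "a \<in> borel_measurable borel" "f \<in> borel_measurable borel"
  shows "(\<integral>\<^sup>+t. ennreal (exp (- c * t)) * cv a f t \<partial>lborel)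
    = (\<integral>\<^sup>+t. ennreal (exp (- c * t)) * a t \<partial>lborel) * (\<integral>\<^sup>+t. ennreal (exp (- c * t)) * f t \<partial>lborel)"
proof -
  let ?W = "\<lambda>t. ennreal (exp (- c * t))"
  have split: "?W t = ?W \<tau> * ?W (t - \<tau>)" for t \<tau>
    by (simp add: algebra_simps flip: ennreal_mult exp_add)
  have "(\<integral>\<^sup>+t. ?W t * cv a f t \<partial>lborel) = (\<integral>\<^sup>+t. (\<integral>\<^sup>+\<tau>. (?W \<tau> * a \<tau>) * (?W (t - \<tau>) * f (t - \<tau>)) \<partial>lborel) \<partial>lborel)"
  proof (rule nn_integral_cong)
    fix t
    have "?W t * cv a f t = (\<integral>\<^sup>+\<tau>. ?W t * (a \<tau> * f (t - \<tau>)) \<partial>lborel)"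
      unfolding cv_def by (rule nn_integral_cmult[symmetric]) measurable
    also have "\<dots> = (\<integral>\<^sup>+\<tau>. (?W \<tau> * a \<tau>) * (?W (t - \<tau>) * f (t - \<tau>)) \<partial>lborel)"
    proof (rule nn_integral_cong)
      fix \<tau>
      show "?W t * (a \<tau> * f (t - \<tau>)) = (?W \<tau> * a \<tau>) * (?W (t - \<tau>) * f (t - \<tau>))"
        by (subst split[of t \<tau>]) (simp only: mult_ac)
    qed
    finally show "?W t * cv a f t = \<dots>" .
  qed
  also have "\<dots> = (\<integral>\<^sup>+\<tau>. (\<integral>\<^sup>+t. (?W \<tau> * a \<tau>) * (?W (t - \<tau>) * f (t - \<tau>)) \<partial>lborel) \<partial>lborel)"
    by (rule lborel_pair.Fubini') measurable
  also have "\<dots> = (\<integral>\<^sup>+\<tau>. (?W \<tau> * a \<tau>) * (\<integral>\<^sup>+t. ?W t * f t \<partial>lborel) \<partial>lborel)"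
  proof (rule nn_integral_cong)
    fix \<tau>
    have "(\<integral>\<^sup>+t. (?W \<tau> * a \<tau>) * (?W (t - \<tau>) * f (t - \<tau>)) \<partial>lborel) = (?W \<tau> * a \<tau>) * (\<integral>\<^sup>+t. ?W (t - \<tau>) * f (t - \<tau>) \<partial>lborel)"
      by (rule nn_integral_cmult) measurable
    also have "(\<integral>\<^sup>+t. ?W (t - \<tau>) * f (t - \<tau>) \<partial>lborel) = (\<integral>\<^sup>+t. ?W t * f t \<partial>lborel)"
      by (subst nn_integral_real_affine[where c = 1 and t = "- \<tau>"]) (auto simp: algebra_simps)
    finally show "(\<integral>\<^sup>+t. (?W \<tau> * a \<tau>) * (?W (t - \<tau>) * f (t - \<tau>)) \<partial>lborel) = (?W \<tau> * a \<tau>) * (\<integral>\<^sup>+t. ?W t * f t \<partial>lborel)" .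
  qed
  also have "\<dots> = (\<integral>\<^sup>+t. ?W t * a t \<partial>lborel) * (\<integral>\<^sup>+t. ?W t * f t \<partial>lborel)"
    by (rule nn_integral_multc) measurable
  finally show ?thesis .
qed

lemma AE_reflect:
  assumes "AE u in lborel. P u" "Measurable.pred borel P"
  shows "AE \<tau> in lborel. P (t - \<tau> :: real)"
  using AE_borel_affine[of "-1" P t] assms by simp

context volterra
begin

text \<open>Difference quotient of -s with step 1 / (n + 1). It is set to 0 at t \<le> 0, where the
  jump of s at 0 would enter.\<close>

definition quotient :: "real \<Rightarrow> nat \<Rightarrow> real \<Rightarrow> real" where
  "quotient \<nu> n t = (if t > 0 then real (Suc n) * (sol \<nu> t - sol \<nu> (t + 1 / Suc n)) else 0)"

lemma quotient_measurable [measurable]: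
  assumes "\<nu> \<ge> 0"
  shows "quotient \<nu> n \<in> borel_measurable borel"
proof -
  note [measurable] = causal_measurable[OF sol_causal[OF assms]]
  show ?thesis
    unfolding quotient_def by measurable
qed

lemma quotient_nonneg: "\<nu> \<ge> 0 \<Longrightarrow> 0 \<le> quotient \<nu> n t"
  using sol_antimono[of \<nu> t "t + 1 / Suc n"] by (auto simp: quotient_def)

lemma quotient_bounded: "\<nu> \<ge> 0 \<Longrightarrow> \<bar>quotient \<nu> n t\<bar> \<le> real (Suc n)"
  using sol_nonneg[of \<nu> "t + 1 / Suc n"] sol_le[of \<nu> t] quotient_nonneg[of \<nu> n t]
  by (cases "t > 0") (auto simp: quotient_def indicator_def intro!: mult_left_le)

lemma conv_quotient_integrable: "\<nu> \<ge> 0 \<Longrightarrow> integrable lborel (\<lambda>\<tau>. p \<tau> * quotient \<nu> n (t - \<tau>))"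
  by (rule conv_integrable[OF p quotient_measurable quotient_bounded]) (auto simp: quotient_def)

text \<open>In p * s at time t + h the part \<tau> < t, compared with p * s at time t, yields the
  convolution of the quotient. What remains is the integral over \<tau> between t and t + h, in
  which s is evaluated on [0,h].\<close>

lemma quotient_equation:
  assumes \<nu>: "\<nu> \<ge> 0" and t: "t > 0"
  shows "quotient \<nu> n t + \<nu> * conv p (quotient \<nu> n) t
    = \<nu> * (real (Suc n) * (LINT \<tau>|lborel. p \<tau> * (sol \<nu> (t + 1 / Suc n - \<tau>) * indicator {t<..} \<tau>)))"
    and "integrable lborel (\<lambda>\<tau>. p \<tau> * (sol \<nu> (t + 1 / Suc n - \<tau>) * indicator {t<..} \<tau>))"
proof -
  let ?h = "1 / real (Suc n)" and ?N = "real (Suc n)"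
  note s = sol_causal[OF \<nu>]
  note [measurable] = causal_measurable[OF s] kernel_measurable[OF p]
  have int: "integrable lborel (\<lambda>\<tau>. p \<tau> * sol \<nu> (u - \<tau>))" for u
    by (rule conv_integrable_causal[OF p s])
  show int2: "integrable lborel (\<lambda>\<tau>. p \<tau> * (sol \<nu> (t + ?h - \<tau>) * indicator {t<..} \<tau>))"
    by (rule Bochner_Integration.integrable_bound[OF int[of "t + ?h"]])
      (measurable, auto simp: indicator_def)
  have "sol \<nu> t - sol \<nu> (t + ?h) = \<nu> * (conv p (sol \<nu>) (t + ?h) - conv p (sol \<nu>) t)"
    using sol_eq[OF \<nu>, of t] sol_eq[OF \<nu>, of "t + ?h"] t by (simp add: right_diff_distrib)
  also have "conv p (sol \<nu>) (t + ?h) - conv p (sol \<nu>) t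
      = (LINT \<tau>|lborel. p \<tau> * sol \<nu> (t + ?h - \<tau>) - p \<tau> * sol \<nu> (t - \<tau>))"
    unfolding conv_def by (rule Bochner_Integration.integral_diff[symmetric]) (rule int)+
  also have "\<dots> = (LINT \<tau>|lborel. p \<tau> * (sol \<nu> (t + ?h - \<tau>) * indicator {t<..} \<tau>) - ?h * (p \<tau> * quotient \<nu> n (t - \<tau>)))"
  proof (rule integral_cong_AE)
    have "AE \<tau> in lborel. \<tau> \<noteq> t"
      by (rule AE_lborel_singleton)
    then show "AE \<tau> in lborel. p \<tau> * sol \<nu> (t + ?h - \<tau>) - p \<tau> * sol \<nu> (t - \<tau>)
        = p \<tau> * (sol \<nu> (t + ?h - \<tau>) * indicator {t<..} \<tau>) - ?h * (p \<tau> * quotient \<nu> n (t - \<tau>))"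
    proof eventually_elim
      case (elim \<tau>)
      show ?case
      proof (cases "\<tau> < t")
        case True
        then have "quotient \<nu> n (t - \<tau>) = ?N * (sol \<nu> (t - \<tau>) - sol \<nu> (t + ?h - \<tau>))"
          by (simp add: quotient_def algebra_simps)
        then have "?h * quotient \<nu> n (t - \<tau>) = sol \<nu> (t - \<tau>) - sol \<nu> (t + ?h - \<tau>)"
          by simp
        then have "?h * (p \<tau> * quotient \<nu> n (t - \<tau>)) = p \<tau> * (sol \<nu> (t - \<tau>) - sol \<nu> (t + ?h - \<tau>))"
          by (metis mult.left_commute)
        then show ?thesis
          using True by (simp add: algebra_simps)
      next
        case False
        then show ?thesis
          using elim s by (simp add: quotient_def causal_def)
      qed
    qed
  qed (use quotient_measurable[OF \<nu>] in measurable)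
  also have "\<dots> = (LINT \<tau>|lborel. p \<tau> * (sol \<nu> (t + ?h - \<tau>) * indicator {t<..} \<tau>)) - ?h * conv p (quotient \<nu> n) t"
    unfolding conv_def integral_mult_right_zero[symmetric]
    by (rule Bochner_Integration.integral_diff) (intro int2 integrable_mult_right conv_quotient_integrable \<nu>)+
  finally have eq: "sol \<nu> t - sol \<nu> (t + ?h)
      = \<nu> * ((LINT \<tau>|lborel. p \<tau> * (sol \<nu> (t + ?h - \<tau>) * indicator {t<..} \<tau>)) - ?h * conv p (quotient \<nu> n) t)" .
  have "quotient \<nu> n t = ?N * (sol \<nu> t - sol \<nu> (t + ?h))"
    using t by (simp add: quotient_def)
  also have "\<dots> = \<nu> * (?N * (LINT \<tau>|lborel. p \<tau> * (sol \<nu> (t + ?h - \<tau>) * indicator {t<..} \<tau>))) - \<nu> * conv p (quotient \<nu> n) t"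
    unfolding eq by (simp add: right_diff_distrib del: of_nat_Suc)
  finally show "quotient \<nu> n t + \<nu> * conv p (quotient \<nu> n) t
    = \<nu> * (?N * (LINT \<tau>|lborel. p \<tau> * (sol \<nu> (t + ?h - \<tau>) * indicator {t<..} \<tau>)))"
    by simp
qed

text \<open>The forcing is \<nu> times a mean of p over (t,t + h], weighted by values of s on [0,h],
  and therefore lies between \<nu> p(t + h) s(h) and \<nu> p(t).\<close>

lemma quotient_forcing:
  assumes \<nu>: "\<nu> \<ge> 0" and t: "t > 0"
  shows quotient_forcing_le: "quotient \<nu> n t + \<nu> * conv p (quotient \<nu> n) t \<le> \<nu> * p t"
    and quotient_forcing_tendsto: "(\<lambda>n. quotient \<nu> n t + \<nu> * conv p (quotient \<nu> n) t) \<longlonglongrightarrow> \<nu> * p t"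
proof -
  define h where "h n = 1 / real (Suc n)" for n
  define G where "G n = real (Suc n) * (LINT \<tau>|lborel. p \<tau> * (sol \<nu> (t + h n - \<tau>) * indicator {t<..} \<tau>))" for n
  have h: "h n > 0" for n
    by (simp add: h_def)
  have Nh: "real (Suc n) * h n = 1" for n
    by (simp add: h_def)
  have int_ind: "integrable lborel (\<lambda>\<tau>. c * indicator {t<..t + h n} \<tau> :: real)"
    and LINT_ind: "(LINT \<tau>|lborel. c * indicator {t<..t + h n} \<tau>) = c * h n" for c n
    using h[of n] by (auto simp: emeasure_lborel_Ioc intro!: integrable_mult_right integrable_real_indicator)
  have up: "G n \<le> p t" for n
  proof -
    have "(LINT \<tau>|lborel. p \<tau> * (sol \<nu> (t + h n - \<tau>) * indicator {t<..} \<tau>)) \<le> (LINT \<tau>|lborel. p t * indicator {t<..t + h n} \<tau>)"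
    proof (rule integral_mono)
      show "p \<tau> * (sol \<nu> (t + h n - \<tau>) * indicator {t<..} \<tau>) \<le> p t * indicator {t<..t + h n} \<tau>" for \<tau>
      proof (cases "t < \<tau> \<and> \<tau> \<le> t + h n")
        case True
        then have "p \<tau> * sol \<nu> (t + h n - \<tau>) \<le> p t * 1"
          using t sol_le[OF \<nu>, of "t + h n - \<tau>"] sol_nonneg[OF \<nu>] kernel_nonneg[OF p]
          by (intro mult_mono kernel_antimono[OF p]) auto
        then show ?thesis
          using True by simp
      next
        case False
        then show ?thesis
          using sol_causal[OF \<nu>] by (auto simp: causal_def)
      qed
    qed (use quotient_equation(2)[OF \<nu> t, of n] int_ind in \<open>simp_all add: h_def\<close>)
    then have "G n \<le> real (Suc n) * (p t * h n)"
      unfolding G_def LINT_ind by (rule mult_left_mono) simp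
    then show ?thesis
      using Nh[of n] by (simp add: mult.left_commute[of "real (Suc n)"] del: of_nat_Suc)
  qed
  have low: "p (t + h n) * sol \<nu> (h n) \<le> G n" for n
  proof -
    have "(LINT \<tau>|lborel. (p (t + h n) * sol \<nu> (h n)) * indicator {t<..t + h n} \<tau>) \<le> (LINT \<tau>|lborel. p \<tau> * (sol \<nu> (t + h n - \<tau>) * indicator {t<..} \<tau>))"
    proof (rule integral_mono)
      show "(p (t + h n) * sol \<nu> (h n)) * indicator {t<..t + h n} \<tau> \<le> p \<tau> * (sol \<nu> (t + h n - \<tau>) * indicator {t<..} \<tau>)" for \<tau>
      proof (cases "t < \<tau> \<and> \<tau> \<le> t + h n")
        case True
        then have "p (t + h n) * sol \<nu> (h n) \<le> p \<tau> * sol \<nu> (t + h n - \<tau>)"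
          using t sol_antimono[OF \<nu>, of "t + h n - \<tau>" "h n"] sol_nonneg[OF \<nu>] kernel_nonneg[OF p]
          by (intro mult_mono kernel_antimono[OF p]) auto
        then show ?thesis
          using True by simp
      next
        case False
        then show ?thesis
          using sol_nonneg[OF \<nu>] kernel_nonneg[OF p] by auto
      qed
    qed (use quotient_equation(2)[OF \<nu> t, of n] int_ind in \<open>simp_all add: h_def\<close>)
    then have "real (Suc n) * (p (t + h n) * sol \<nu> (h n) * h n) \<le> G n"
      unfolding G_def LINT_ind by (rule mult_left_mono) simp
    then show ?thesis
      using Nh[of n] by (simp add: mult.left_commute[of "real (Suc n)"] del: of_nat_Suc)
  qed
  have eq: "quotient \<nu> n t + \<nu> * conv p (quotient \<nu> n) t = \<nu> * G n" for n
    using quotient_equation(1)[OF \<nu> t, of n] by (simp add: G_def h_def)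
  show "quotient \<nu> n t + \<nu> * conv p (quotient \<nu> n) t \<le> \<nu> * p t"
    unfolding eq by (intro mult_left_mono up \<nu>)
  have h_lim: "h \<longlonglongrightarrow> 0"
    using LIMSEQ_inverse_real_of_nat by (simp add: h_def[abs_def] inverse_eq_divide)
  have "G \<longlonglongrightarrow> p t"
  proof (rule tendsto_sandwich[OF _ _ _ tendsto_const])
    have "(\<lambda>n. p (t + h n)) \<longlonglongrightarrow> p (t + 0)"
      using t h by (intro continuous_on_tendsto_compose[OF p_cont] tendsto_intros h_lim) (auto simp: add_pos_pos always_eventually)
    moreover have "(\<lambda>n. sol \<nu> (h n)) \<longlonglongrightarrow> sol \<nu> 0"
      using h less_imp_le[OF h]
      by (intro continuous_on_tendsto_compose[OF causal_cont[OF sol_causal[OF \<nu>] order_refl]] h_lim) (auto intro: always_eventually)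
    ultimately have "(\<lambda>n. p (t + h n) * sol \<nu> (h n)) \<longlonglongrightarrow> p (t + 0) * sol \<nu> 0"
      by (rule tendsto_mult)
    then show "(\<lambda>n. p (t + h n) * sol \<nu> (h n)) \<longlonglongrightarrow> p t"
      by (simp add: sol_zero[OF \<nu>])
  qed (use up low in auto)
  then show "(\<lambda>n. quotient \<nu> n t + \<nu> * conv p (quotient \<nu> n) t) \<longlonglongrightarrow> \<nu> * p t"
    unfolding eq by (intro tendsto_intros)
qed

lemma conv_quotient_nonneg: "\<nu> \<ge> 0 \<Longrightarrow> 0 \<le> conv p (quotient \<nu> n) t"
  by (intro conv_nonneg kernel_nonneg[OF p] quotient_nonneg)

lemma quotient_le: "\<nu> \<ge> 0 \<Longrightarrow> quotient \<nu> n t \<le> \<nu> * p t"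
  using quotient_forcing_le[of \<nu> t n] mult_nonneg_nonneg[OF _ conv_quotient_nonneg[of \<nu> n t], of \<nu>]
    kernel_nonneg[OF p, of t]
  by (cases "t > 0") (auto simp: quotient_def[of \<nu> n t] split: if_splits)

text \<open>Upper and lower limits \<open>h, l\<close> of the difference quotients satisfy
  \<open>h + \<nu> p * l \<le> \<nu> p \<le> l + \<nu> p * h\<close> by Fatou's lemma; comparing Laplace transforms shows that they
  agree.\<close>

lemma quotient_convergent:
  assumes \<nu>: "\<nu> \<ge> 0"
  shows "convergent (\<lambda>n. quotient \<nu> n t)"
proof -
  let ?P = "\<lambda>t. ennreal (p t)"
  let ?D = "\<lambda>n t. ennreal (quotient \<nu> n t)"
  define hi lo where "hi t = limsup (\<lambda>n. ?D n t)" and "lo t = liminf (\<lambda>n. ?D n t)" for t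
  note [measurable] = kernel_measurable[OF p] quotient_measurable[OF \<nu>]
  have meas [measurable]: "hi \<in> borel_measurable borel" "lo \<in> borel_measurable borel"
    unfolding hi_def lo_def by measurable
  have D_le: "?D n t \<le> ennreal (\<nu> * p t)" for n t
    by (intro ennreal_leI quotient_le \<nu>)
  have hi_le: "hi t \<le> ennreal (\<nu> * p t)" for t
    unfolding hi_def by (intro Limsup_bounded always_eventually allI D_le)
  have lo_hi: "lo t \<le> hi t" for t
    unfolding lo_def hi_def by (rule Liminf_le_Limsup) simp
  have conv_eq: "cv ?P (?D n) t = ennreal (conv p (quotient \<nu> n) t)" for n t
    by (intro cv_eq_conv conv_quotient_integrable \<nu> kernel_nonneg[OF p] quotient_nonneg)
  \<comment> \<open>Both Fatou estimates are needed along arbitrary subsequences, because the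
    subsequence realising a limit point of the quotient depends on t.\<close>
  have fatou_lo: "cv ?P lo t \<le> liminf (\<lambda>n. cv ?P (?D (r n)) t)" if r: "strict_mono r" for r t
  proof -
    have "cv ?P lo t \<le> cv ?P (\<lambda>t. liminf (\<lambda>n. ?D (r n) t)) t"
      unfolding cv_def lo_def using liminf_subseq_mono[OF r]
      by (intro nn_integral_mono mult_left_mono) (auto simp: o_def)
    also have "\<dots> \<le> liminf (\<lambda>n. cv ?P (?D (r n)) t)"
      by (subst (1 2) cv_density) (auto intro!: nn_integral_liminf)
    finally show ?thesis .
  qed
  \<comment> \<open>Finiteness of p * p provides the majorant for the reverse Fatou lemma.\<close>
  have cv_pp: "cv ?P (\<lambda>t. ennreal (\<nu> * p t)) t < top" for t
    using cv_eq_conv[OF conv_kernel_integrable[OF p kernel_cmult_p[OF \<nu>]] kernel_nonneg[OF p] kernel_nonneg[OF kernel_cmult_p[OF \<nu>]]]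
    by simp
  have fatou_hi: "limsup (\<lambda>n. cv ?P (?D (r n)) t) \<le> cv ?P hi t" if r: "strict_mono r" for r t
  proof -
    have "limsup (\<lambda>n. cv ?P (?D (r n)) t) \<le> cv ?P (\<lambda>t. limsup (\<lambda>n. ?D (r n) t)) t"
      using cv_pp[of t]
      by (subst (1 2) cv_density, measurable, subst (asm) cv_density, measurable)
        (auto intro!: nn_integral_limsup[where w = "\<lambda>\<tau>. ennreal (\<nu> * p (t - \<tau>))"] D_le)
    also have "\<dots> \<le> cv ?P hi t"
      unfolding cv_def hi_def using limsup_subseq_mono[OF r]
      by (intro nn_integral_mono mult_left_mono) (auto simp: o_def)
    finally show ?thesis .
  qed
  have ineqs: "hi t + ennreal \<nu> * cv ?P lo t \<le> ennreal (\<nu> * p t)" (is ?A)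
    "ennreal (\<nu> * p t) \<le> lo t + ennreal \<nu> * cv ?P hi t" (is ?B) if t: "t > 0" for t
  proof -
    \<comment> \<open>Along a subsequence on which the quotient converges to x, the equation forces
      \<nu> times the convolution to converge to the remainder \<nu> p(t) - x.\<close>
    have lim: "(\<lambda>n. ennreal \<nu> * cv ?P (?D (r n)) t) \<longlonglongrightarrow> ennreal (\<nu> * p t - x)"
      if r: "strict_mono r" and x: "(\<lambda>n. ?D (r n) t) \<longlonglongrightarrow> ennreal x" "x \<ge> 0" for r x
    proof -
      have "(\<lambda>n. quotient \<nu> (r n) t) \<longlonglongrightarrow> x"
        using x quotient_nonneg[OF \<nu>] by (subst (asm) tendsto_ennreal_iff) auto
      moreover have "(\<lambda>n. quotient \<nu> (r n) t + \<nu> * conv p (quotient \<nu> (r n)) t) \<longlonglongrightarrow> \<nu> * p t"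
        using LIMSEQ_subseq_LIMSEQ[OF quotient_forcing_tendsto[OF \<nu> t] r] by (simp add: o_def)
      ultimately have "(\<lambda>n. (quotient \<nu> (r n) t + \<nu> * conv p (quotient \<nu> (r n)) t) - quotient \<nu> (r n) t) \<longlonglongrightarrow> \<nu> * p t - x"
        by (intro tendsto_diff)
      then show ?thesis
        unfolding conv_eq using \<nu> conv_quotient_nonneg[OF \<nu>]
        by (auto simp flip: ennreal_mult intro!: tendsto_ennrealI)
    qed
    have fin: "y = ennreal (enn2real y) \<and> enn2real y \<le> \<nu> * p t" if "y \<le> ennreal (\<nu> * p t)" for y
      using that \<nu> kernel_nonneg[OF p, of t] le_less_trans[OF that ennreal_less_top]
      by (auto simp: enn2real_leI)
    have cmult: "ennreal \<nu> * liminf X = liminf (\<lambda>n. ennreal \<nu> * X n)" "ennreal \<nu> * limsup X = limsup (\<lambda>n. ennreal \<nu> * X n)" for X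
      by (rule Liminf_compose_continuous_mono[symmetric] Limsup_compose_continuous_mono[symmetric];
          auto intro!: ennreal_continuous_on_cmult continuous_on_id monoI mult_left_mono)+
    show ?A
    proof -
      obtain r where r: "strict_mono r" "(\<lambda>n. ?D (r n) t) \<longlonglongrightarrow> hi t"
        using limsup_subseq_lim[of "\<lambda>n. ?D n t"] by (auto simp: hi_def o_def)
      define x where "x = enn2real (hi t)"
      have x: "hi t = ennreal x" "x \<le> \<nu> * p t" "x \<ge> 0"
        using fin[OF hi_le[of t]] by (auto simp: x_def)
      have "ennreal \<nu> * cv ?P lo t \<le> ennreal \<nu> * liminf (\<lambda>n. cv ?P (?D (r n)) t)"
        by (intro mult_left_mono fatou_lo r) simp
      also have "\<dots> = ennreal (\<nu> * p t - x)"
        unfolding cmult using lim[OF r(1)] r(2) x by (intro lim_imp_Liminf) auto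
      finally have "hi t + ennreal \<nu> * cv ?P lo t \<le> ennreal x + ennreal (\<nu> * p t - x)"
        unfolding x(1) by (rule add_left_mono)
      then show ?thesis
        using x by (simp flip: ennreal_plus)
    qed
    show ?B
    proof -
      obtain r where r: "strict_mono r" "(\<lambda>n. ?D (r n) t) \<longlonglongrightarrow> lo t"
        using liminf_subseq_lim[of "\<lambda>n. ?D n t"] by (auto simp: lo_def o_def)
      define x where "x = enn2real (lo t)"
      have x: "lo t = ennreal x" "x \<le> \<nu> * p t" "x \<ge> 0"
        using fin[OF order_trans[OF lo_hi hi_le[of t]]] by (auto simp: x_def)
      have "ennreal (\<nu> * p t - x) = ennreal \<nu> * limsup (\<lambda>n. cv ?P (?D (r n)) t)"
        unfolding cmult using lim[OF r(1)] r(2) x by (intro lim_imp_Limsup[symmetric]) auto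
      also have "\<dots> \<le> ennreal \<nu> * cv ?P hi t"
        by (intro mult_left_mono fatou_hi r) simp
      finally have "ennreal x + ennreal (\<nu> * p t - x) \<le> lo t + ennreal \<nu> * cv ?P hi t"
        unfolding x(1) by (rule add_left_mono)
      then show ?thesis
        using x by (simp flip: ennreal_plus)
    qed
  qed
  obtain c where c: "c > 0" "(LINT t|lborel. exp (- c * t) * (\<nu> * p t)) \<le> 1 / 2"
    using kernel_small_transform[OF kernel_cmult_p[OF \<nu>], of "1 / 2"] by auto
  let ?W = "\<lambda>t. ennreal (exp (- c * t))"
  \<comment> \<open>Laplace transforms at \<open>c\<close> of the upper limit, of the lower limit
    and of the majorant; B \<le> A \<le> \<pi> \<le> 1/2 makes all three finite.\<close>
  define A B \<pi> where "A = (\<integral>\<^sup>+t. ?W t * hi t \<partial>lborel)" and "B = (\<integral>\<^sup>+t. ?W t * lo t \<partial>lborel)"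
    and "\<pi> = (\<integral>\<^sup>+t. ?W t * ennreal (\<nu> * p t) \<partial>lborel)"
  have \<pi>_le: "\<pi> \<le> ennreal (1 / 2)"
  proof -
    have "\<pi> = (\<integral>\<^sup>+t. ennreal (exp (- c * t) * (\<nu> * p t)) \<partial>lborel)"
      unfolding \<pi>_def using \<nu> kernel_nonneg[OF p] by (simp add: ennreal_mult)
    also have "\<dots> = ennreal (LINT t|lborel. exp (- c * t) * (\<nu> * p t))"
      using \<nu> kernel_nonneg[OF p]
      by (intro nn_integral_eq_integral kernel_exp_integrable kernel_cmult_p c) auto
    finally show ?thesis
      using c(2) by (simp only: ennreal_leI)
  qed
  have hi_neg: "hi t = 0" "lo t = 0" if "t \<le> 0" for t
    using that by (simp_all add: hi_def lo_def quotient_def Limsup_const Liminf_const)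
  have le: "hi t + ennreal \<nu> * cv ?P lo t \<le> lo t + ennreal \<nu> * cv ?P hi t" for t
  proof (cases "t > 0")
    case True
    then show ?thesis
      using order_trans[OF ineqs] by blast
  next
    case False
    have "cv ?P lo t \<le> cv ?P hi t"
      unfolding cv_def by (intro nn_integral_mono mult_left_mono lo_hi) auto
    then show ?thesis
      using False by (simp add: hi_neg mult_left_mono)
  qed
  have trans: "(\<integral>\<^sup>+t. ?W t * (ennreal \<nu> * cv ?P f t) \<partial>lborel) = \<pi> * (\<integral>\<^sup>+t. ?W t * f t \<partial>lborel)"
    if [measurable]: "f \<in> borel_measurable borel" for f
  proof -
    have "(\<integral>\<^sup>+t. ?W t * (ennreal \<nu> * cv ?P f t) \<partial>lborel) = (\<integral>\<^sup>+t. ennreal \<nu> * (?W t * cv ?P f t) \<partial>lborel)"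
      by (simp only: mult.left_commute)
    also have "\<dots> = ennreal \<nu> * ((\<integral>\<^sup>+t. ?W t * ?P t \<partial>lborel) * (\<integral>\<^sup>+t. ?W t * f t \<partial>lborel))"
      by (subst nn_integral_cmult) (measurable, subst cv_weighted, auto)
    also have "\<dots> = \<pi> * (\<integral>\<^sup>+t. ?W t * f t \<partial>lborel)"
    proof -
      have "ennreal \<nu> * (\<integral>\<^sup>+t. ?W t * ?P t \<partial>lborel) = (\<integral>\<^sup>+t. ennreal \<nu> * (?W t * ?P t) \<partial>lborel)"
        by (rule nn_integral_cmult[symmetric]) measurable
      also have "\<dots> = \<pi>"
        unfolding \<pi>_def using \<nu> kernel_nonneg[OF p] by (simp add: ennreal_mult mult.left_commute)
      finally show ?thesis
        by (simp only: mult.assoc[symmetric])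
    qed
    finally show ?thesis .
  qed
  have "(\<integral>\<^sup>+t. ?W t * (hi t + ennreal \<nu> * cv ?P lo t) \<partial>lborel) \<le> (\<integral>\<^sup>+t. ?W t * (lo t + ennreal \<nu> * cv ?P hi t) \<partial>lborel)"
    by (intro nn_integral_mono mult_left_mono le) auto
  moreover have "(\<integral>\<^sup>+t. ?W t * (f t + ennreal \<nu> * cv ?P g t) \<partial>lborel)
      = (\<integral>\<^sup>+t. ?W t * f t \<partial>lborel) + \<pi> * (\<integral>\<^sup>+t. ?W t * g t \<partial>lborel)"
    if [measurable]: "f \<in> borel_measurable borel" and g [measurable]: "g \<in> borel_measurable borel" for f g
    unfolding distrib_left trans[OF g, symmetric] by (rule nn_integral_add) measurable
  note this[OF meas] this[OF meas(2,1)]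
  ultimately have AB: "A + \<pi> * B \<le> B + \<pi> * A"
    unfolding A_def B_def by (simp only:)
  have W_mono: "?W t * x \<le> ?W t * y" if "x \<le> y" for x y t
    using that by (rule mult_left_mono) simp
  have "A \<le> \<pi>"
    unfolding A_def \<pi>_def by (rule nn_integral_mono[OF W_mono[OF hi_le]])
  then have A_fin: "A < top"
    by (rule le_less_trans[OF order_trans[OF _ \<pi>_le] ennreal_less_top])
  have BA: "B \<le> A"
    unfolding A_def B_def by (rule nn_integral_mono[OF W_mono[OF lo_hi]])
  obtain a b q where abq: "A = ennreal a" "B = ennreal b" "\<pi> = ennreal q" "a \<ge> 0" "b \<ge> 0" "q \<ge> 0"
    by (rule that[of "enn2real A" "enn2real B" "enn2real \<pi>"])
      (simp_all add: A_fin le_less_trans[OF BA A_fin] le_less_trans[OF \<pi>_le ennreal_less_top])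
  have "ennreal (a + q * b) \<le> ennreal (b + q * a)"
    using AB abq(4-6) unfolding abq(1-3) by (simp add: ennreal_mult)
  then have "a + q * b \<le> b + q * a"
    using abq(4-6) by (subst (asm) ennreal_le_iff) auto
  moreover have q: "q \<le> 1 / 2"
    using \<pi>_le unfolding abq(3) by (subst (asm) ennreal_le_iff) auto
  \<comment> \<open>From a + q b \<le> b + q a; finiteness permits the cancellation, and q \<le> 1/2
    makes the factor 1 - q positive.\<close>
  ultimately have "(1 - q) * (a - b) \<le> 0"
    by (simp add: algebra_simps)
  then have "a \<le> b"
    using q by (simp add: mult_le_0_iff)
  then have "A = B"
    using BA abq by (simp add: antisym ennreal_leI)
  have "(\<integral>\<^sup>+t. ?W t * hi t - ?W t * lo t \<partial>lborel) = A - B"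
    unfolding A_def B_def
    by (rule nn_integral_diff) (use abq in \<open>auto simp: B_def intro!: AE_I2 mult_left_mono lo_hi\<close>)
  then have "(\<integral>\<^sup>+t. ?W t * hi t - ?W t * lo t \<partial>lborel) = 0"
    using \<open>A = B\<close> abq by simp
  then have "AE t in lborel. ?W t * hi t - ?W t * lo t = 0"
    by (subst (asm) nn_integral_0_iff_AE) auto
  then have AE_eq: "AE t in lborel. hi t = lo t"
  proof eventually_elim
    case (elim t)
    obtain x y where xy: "hi t = ennreal x" "lo t = ennreal y" "x \<ge> 0" "y \<ge> 0"
      by (rule that[of "enn2real (hi t)" "enn2real (lo t)"])
        (simp_all add: le_less_trans[OF hi_le ennreal_less_top] le_less_trans[OF order_trans[OF lo_hi hi_le] ennreal_less_top])
    have "ennreal (exp (- c * t) * x - exp (- c * t) * y) = 0"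
      using elim xy by (simp add: ennreal_minus flip: ennreal_mult)
    then have "exp (- c * t) * x - exp (- c * t) * y \<le> 0"
      by (simp only: ennreal_eq_0_iff)
    then have "x \<le> y"
      by simp
    then show ?case
      using lo_hi[of t] xy by (simp add: antisym ennreal_leI)
  qed
  \<comment> \<open>Convolution does not see null sets. With equal convolution terms the inequality
    \<open>le\<close> compares the two limits at each t > 0, which upgrades equality almost
    everywhere to equality everywhere.\<close>
  have cv_eq: "cv ?P hi t = cv ?P lo t" for t
    unfolding cv_def using AE_reflect[OF AE_eq, of t]
    by (intro nn_integral_cong_AE) (auto elim!: AE_mp)
  show ?thesis
  proof (cases "t > 0")
    case False
    then show ?thesis
      by (simp add: quotient_def convergent_const)
  next
    case True
    have "ennreal \<nu> * cv ?P lo t < top"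
      using le_less_trans[OF order_trans[OF _ ineqs(1)[OF True]] ennreal_less_top, of "ennreal \<nu> * cv ?P lo t"] by simp
    moreover have "ennreal \<nu> * cv ?P lo t + hi t \<le> ennreal \<nu> * cv ?P lo t + lo t"
      using le[of t] unfolding cv_eq by (simp only: add.commute)
    then have "ennreal \<nu> * cv ?P lo t = top \<or> hi t \<le> lo t"
      by (simp only: ennreal_add_left_cancel_le infinity_ennreal_def)
    ultimately have "hi t = lo t"
      using lo_hi[of t] by (auto simp del: ennreal_mult_eq_top_iff)
    then have "(\<lambda>n. ?D n t) \<longlonglongrightarrow> lo t"
      by (subst tendsto_iff_Liminf_eq_Limsup) (auto simp: hi_def lo_def)
    moreover have "lo t = ennreal (enn2real (lo t))"
      by (simp add: le_less_trans[OF order_trans[OF lo_hi hi_le] ennreal_less_top])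
    ultimately have "(\<lambda>n. ?D n t) \<longlonglongrightarrow> ennreal (enn2real (lo t))"
      by simp
    then have "(\<lambda>n. quotient \<nu> n t) \<longlonglongrightarrow> enn2real (lo t)"
      by (subst (asm) tendsto_ennreal_iff) (simp_all add: quotient_nonneg[OF \<nu>])
    then show ?thesis
      by (rule convergentI)
  qed
qed

text \<open>The function r, which by \<open>res_eq\<close> is the resolvent kernel of \<nu>
  p.\<close>

definition res :: "real \<Rightarrow> real \<Rightarrow> real" where
  "res \<nu> t = lim (\<lambda>n. quotient \<nu> n t)"

lemma quotient_tendsto: "\<nu> \<ge> 0 \<Longrightarrow> (\<lambda>n. quotient \<nu> n t) \<longlonglongrightarrow> res \<nu> t"
  unfolding res_def using quotient_convergent by (simp add: convergent_LIMSEQ_iff)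

lemma res_measurable [measurable]: "\<nu> \<ge> 0 \<Longrightarrow> res \<nu> \<in> borel_measurable borel"
  by (rule borel_measurable_LIMSEQ_metric[OF quotient_measurable quotient_tendsto])

lemma res_nonneg: "\<nu> \<ge> 0 \<Longrightarrow> 0 \<le> res \<nu> t"
  by (rule LIMSEQ_le_const[OF quotient_tendsto]) (auto intro: quotient_nonneg)

lemma res_le: "\<nu> \<ge> 0 \<Longrightarrow> res \<nu> t \<le> \<nu> * p t"
  by (rule LIMSEQ_le_const2[OF quotient_tendsto]) (auto intro: quotient_le)

lemma res_zero: "\<nu> \<ge> 0 \<Longrightarrow> t \<le> 0 \<Longrightarrow> res \<nu> t = 0"
  using res_le[of \<nu> t] res_nonneg[of \<nu> t] kernel_zero[OF p, of t] by simp

lemma conv_res_integrable: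
  assumes \<nu>: "\<nu> \<ge> 0" and a: "kernel a"
  shows "integrable lborel (\<lambda>\<tau>. a \<tau> * res \<nu> (t - \<tau>))"
proof (rule Bochner_Integration.integrable_bound[OF conv_kernel_integrable[OF a kernel_cmult_p[OF \<nu>], of t]])
  show "AE \<tau> in lborel. norm (a \<tau> * res \<nu> (t - \<tau>)) \<le> norm (a \<tau> * (\<nu> * p (t - \<tau>)))"
    using res_le[OF \<nu>] res_nonneg[OF \<nu>] kernel_nonneg[OF a] \<nu> kernel_nonneg[OF p]
    by (intro AE_I2) (auto simp: abs_mult intro!: mult_left_mono)
qed (use kernel_measurable[OF a] res_measurable[OF \<nu>] in measurable)

lemma res_eq:
  assumes \<nu>: "\<nu> \<ge> 0"
  shows "res \<nu> t + \<nu> * conv p (res \<nu>) t = \<nu> * p t"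
proof (cases "t > 0")
  case True
  have "(\<lambda>n. conv p (quotient \<nu> n) t) \<longlonglongrightarrow> conv p (res \<nu>) t"
    unfolding conv_def
  proof (rule integral_dominated_convergence[where w = "\<lambda>\<tau>. p \<tau> * (\<nu> * p (t - \<tau>))"])
    show "integrable lborel (\<lambda>\<tau>. p \<tau> * (\<nu> * p (t - \<tau>)))"
      by (rule conv_kernel_integrable[OF p kernel_cmult_p[OF \<nu>]])
    show "AE \<tau> in lborel. (\<lambda>n. p \<tau> * quotient \<nu> n (t - \<tau>)) \<longlonglongrightarrow> p \<tau> * res \<nu> (t - \<tau>)"
      by (intro AE_I2 tendsto_intros quotient_tendsto \<nu>)
    show "AE \<tau> in lborel. norm (p \<tau> * quotient \<nu> n (t - \<tau>)) \<le> p \<tau> * (\<nu> * p (t - \<tau>))" for n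
      using quotient_le[OF \<nu>] quotient_nonneg[OF \<nu>] kernel_nonneg[OF p]
      by (intro AE_I2) (auto simp: abs_mult intro!: mult_left_mono)
  qed (use kernel_measurable[OF p] res_measurable[OF \<nu>] quotient_measurable[OF \<nu>] in measurable)
  then have "(\<lambda>n. quotient \<nu> n t + \<nu> * conv p (quotient \<nu> n) t) \<longlonglongrightarrow> res \<nu> t + \<nu> * conv p (res \<nu>) t"
    by (intro tendsto_intros quotient_tendsto \<nu>)
  then show ?thesis
    using quotient_forcing_tendsto[OF \<nu> True] LIMSEQ_unique by blast
next
  case False
  then have "conv p (res \<nu>) t = 0"
    by (intro conv_zero_right p res_zero \<nu>) auto
  then show ?thesis
    using False res_zero[OF \<nu>, of t] kernel_zero[OF p, of t] by simp
qed

text \<open>Integrating the resolvent equation shows that 1 minus the primitive of r solves the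
  equation of s, and uniqueness identifies the two. This recovers s from r without differentiating
  s.\<close>

lemma integral_res:
  assumes \<nu>: "\<nu> \<ge> 0"
  shows "causal (conv unit_kernel (res \<nu>))" "t \<ge> 0 \<Longrightarrow> conv unit_kernel (res \<nu>) t = 1 - sol \<nu> t"
proof -
  note [measurable] = kernel_measurable[OF p] res_measurable[OF \<nu>]
  let ?I = "conv unit_kernel (res \<nu>)"
  have comm: "?I t = (LINT \<tau>|lborel. res \<nu> \<tau> * step (t - \<tau>))" for t
  proof -
    have "?I t = (LINT \<tau>|lborel. unit_kernel (t - \<tau>) * res \<nu> \<tau>)"
      unfolding conv_def by (subst lborel_integral_real_affine[where c = "-1" and t = t]) auto
    also have "\<dots> = (LINT \<tau>|lborel. res \<nu> \<tau> * step (t - \<tau>))"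
    proof (rule integral_cong_AE)
      have "AE \<tau> in lborel. \<tau> \<noteq> t"
        by (rule AE_lborel_singleton)
      then show "AE \<tau> in lborel. unit_kernel (t - \<tau>) * res \<nu> \<tau> = res \<nu> \<tau> * step (t - \<tau>)"
        by eventually_elim (auto simp: indicator_def)
    qed measurable
    finally show ?thesis .
  qed
  have neg: "?I t = 0" if "t \<le> 0" for t
    using that by (intro conv_zero_right kernel_step res_zero \<nu>) auto
  have "continuous_on {..<T} ?I" for T
  proof -
    have "integrable lborel (\<lambda>\<tau>. res \<nu> \<tau> * indicator {..T} \<tau>)"
    proof (rule Bochner_Integration.integrable_bound[OF kernel_integrable[OF kernel_cmult_p[OF \<nu>], of T]])
      show "AE \<tau> in lborel. norm (res \<nu> \<tau> * indicator {..T} \<tau>) \<le> norm (\<nu> * p \<tau> * indicator {..T} \<tau>)"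
        using res_le[OF \<nu>] res_nonneg[OF \<nu>] \<nu> kernel_nonneg[OF p]
        by (intro AE_I2) (auto simp: indicator_def abs_mult)
    qed measurable
    then have c: "continuous_on UNIV (conv (\<lambda>\<tau>. res \<nu> \<tau> * indicator {..T} \<tau>) step)"
      by (rule conv_continuous_general[where B = 1]) (auto simp: causal_isCont indicator_def)
    have "conv (\<lambda>\<tau>. res \<nu> \<tau> * indicator {..T} \<tau>) step t = ?I t" if "t < T" for t
      unfolding comm unfolding conv_def using that
      by (intro Bochner_Integration.integral_cong) (auto simp: indicator_def)
    then show ?thesis
      by (intro continuous_on_eq[OF continuous_on_subset[OF c subset_UNIV]]) simp
  qed
  then have "isCont ?I t" for t
    using continuous_on_interior[of "{..<t + 1}" ?I t] by (simp add: interior_open)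
  then have "continuous_on {0..} ?I"
    by (simp add: continuous_at_imp_continuous_on)
  then show causal_I: "causal ?I"
    using neg by (simp add: causal_def)
  let ?P = "\<lambda>t. ennreal (p t)" and ?R = "\<lambda>t. ennreal (res \<nu> t)" and ?H = "\<lambda>t. ennreal (unit_kernel t)"
  have HR: "cv ?H ?R = (\<lambda>t. ennreal (?I t))"
    by (intro ext cv_eq_conv conv_res_integrable kernel_step \<nu> res_nonneg) auto
  have I_nonneg: "?I t \<ge> 0" for t
    by (intro conv_nonneg res_nonneg \<nu>) auto
  have PI: "cv ?P (cv ?H ?R) = (\<lambda>t. ennreal (conv p ?I t))"
    unfolding HR by (intro cv_eq_conv_causal p causal_I I_nonneg)
  have "cv ?H (\<lambda>t. ?R t + ennreal \<nu> * cv ?P ?R t) = cv ?H (\<lambda>t. ennreal \<nu> * ?P t)"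
  proof (rule arg_cong[where f = "cv ?H"], rule ext)
    fix t
    have "cv ?P ?R t = ennreal (conv p (res \<nu>) t)"
      by (intro cv_eq_conv conv_res_integrable p \<nu> res_nonneg kernel_nonneg[OF p])
    moreover have "0 \<le> conv p (res \<nu>) t"
      by (intro conv_nonneg res_nonneg \<nu> kernel_nonneg[OF p])
    ultimately show "?R t + ennreal \<nu> * cv ?P ?R t = ennreal \<nu> * ?P t"
      using res_eq[OF \<nu>, of t] res_nonneg[OF \<nu>, of t] \<nu> kernel_nonneg[OF p, of t]
      by (simp flip: ennreal_mult ennreal_plus)
  qed
  then have "cv ?H ?R t + ennreal \<nu> * cv ?P (cv ?H ?R) t = ennreal \<nu> * cv ?H ?P t" for t
    by (subst (asm) cv_add) (auto simp: cv_cmult cv_left_commute[of ?H ?P] fun_eq_iff)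
  moreover have "cv ?H ?P t = ennreal (mass t)" for t
  proof -
    have "cv ?H ?P t = cv ?P ?H t"
      by (subst cv_commute) auto
    also have "\<dots> = (\<integral>\<^sup>+\<tau>. ennreal (p \<tau>) * ennreal (step (t - \<tau>)) \<partial>lborel)"
      unfolding cv_def
    proof (rule nn_integral_cong_AE)
      have "AE \<tau> in lborel. \<tau> \<noteq> t"
        by (rule AE_lborel_singleton)
      then show "AE \<tau> in lborel. ennreal (p \<tau>) * ennreal (unit_kernel (t - \<tau>)) = ennreal (p \<tau>) * ennreal (step (t - \<tau>))"
        by eventually_elim (auto simp: indicator_def)
    qed
    also have "\<dots> = ennreal (mass t)"
      using fun_cong[OF cv_eq_conv_causal[OF p causal_step], of t] by (simp add: cv_def mass_def)
    finally show ?thesis .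
  qed
  ultimately have *: "ennreal (?I t) + ennreal \<nu> * ennreal (conv p ?I t) = ennreal \<nu> * ennreal (mass t)" for t
    unfolding PI unfolding HR by simp
  have I_eq: "?I t + \<nu> * conv p ?I t = \<nu> * mass t" for t
  proof -
    have cn: "0 \<le> \<nu> * conv p ?I t"
      by (intro mult_nonneg_nonneg \<nu> conv_nonneg kernel_nonneg[OF p] I_nonneg)
    have "ennreal (?I t + \<nu> * conv p ?I t) = ennreal (\<nu> * mass t)"
      using * \<nu> by (simp only: ennreal_plus[OF I_nonneg cn] ennreal_mult')
    then show ?thesis
      using I_nonneg[of t] cn \<nu> mass_nonneg[of t] by (subst (asm) ennreal_inj) auto
  qed
  have "solution \<nu> (\<lambda>t. step t - ?I t)"
    unfolding solution_def
  proof (intro conjI allI impI)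
    show "causal (\<lambda>t. step t - ?I t)"
      by (intro causal_diff causal_step causal_I)
    fix t :: real assume "t \<ge> 0"
    then show "step t - ?I t + \<nu> * conv p (\<lambda>t. step t - ?I t) t = 1"
      using I_eq[of t] by (simp add: conv_diff_right[OF p causal_step causal_I] mass_def[symmetric] algebra_simps)
  qed
  from solution_unique[OF \<nu> this sol[OF \<nu>]] have "step t - ?I t = sol \<nu> t" for t
    by (rule fun_cong)
  from this[of t] show "t \<ge> 0 \<Longrightarrow> ?I t = 1 - sol \<nu> t"
    by simp
qed

text \<open>Since p(\<tau>) \<ge> p(t) for 0 < \<tau> \<le> t, the convolution p * r is at least
  p(t) times 1 - s(t); the resolvent equation turns this into an upper bound for r.\<close>

lemma res_sol_bound:
  assumes \<nu>: "\<nu> \<ge> 0" and t: "t > 0"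
  shows "res \<nu> t \<le> \<nu> * p t * sol \<nu> t"
proof -
  have "p t * conv unit_kernel (res \<nu>) t = (LINT \<tau>|lborel. (p t * unit_kernel \<tau>) * res \<nu> (t - \<tau>))"
    by (simp add: conv_def mult.assoc)
  also have "\<dots> \<le> conv p (res \<nu>) t"
    unfolding conv_def
  proof (rule integral_mono)
    show "integrable lborel (\<lambda>\<tau>. (p t * unit_kernel \<tau>) * res \<nu> (t - \<tau>))"
      unfolding mult.assoc by (intro integrable_mult_right conv_res_integrable \<nu> kernel_step)
    show "integrable lborel (\<lambda>\<tau>. p \<tau> * res \<nu> (t - \<tau>))"
      by (rule conv_res_integrable[OF \<nu> p])
    show "(p t * unit_kernel \<tau>) * res \<nu> (t - \<tau>) \<le> p \<tau> * res \<nu> (t - \<tau>)" for \<tau>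
      using kernel_antimono[OF p, of \<tau> t] res_nonneg[OF \<nu>] res_zero[OF \<nu>, of "t - \<tau>"] kernel_nonneg[OF p, of \<tau>]
      by (cases "\<tau> \<le> 0"; cases "\<tau> \<le> t") (auto intro!: mult_right_mono)
  qed
  finally have "\<nu> * (p t * (1 - sol \<nu> t)) \<le> \<nu> * conv p (res \<nu>) t"
    using integral_res(2)[OF \<nu>, of t] t \<nu> by (intro mult_left_mono) auto
  then show ?thesis
    using res_eq[OF \<nu>, of t] by (simp add: algebra_simps)
qed

text \<open>By the resolvent equation it suffices to treat p * r near a time t0. The truncation
  min(p,K) gives a continuous convolution; the excess of p over K lives near 0, where it meets r
  away from the singularity of r, so the error is uniformly small.\<close>

lemma res_continuous:
  assumes \<nu>: "\<nu> \<ge> 0"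
  shows "continuous_on {0<..} (res \<nu>)"
proof -
  note [measurable] = kernel_measurable[OF p] res_measurable[OF \<nu>]
  have "isCont (conv p (res \<nu>)) t0" if t0: "t0 > 0" for t0
  proof -
    define pk where "pk K u = min (p u) (real K)" for K u
    define qk where "qk K u = p u - pk K u" for K u
    have pk: "0 \<le> pk K u" "pk K u \<le> K" "pk K u \<le> p u" and qk: "0 \<le> qk K u" "qk K u \<le> p u" for K u
      using kernel_nonneg[OF p, of u] by (auto simp: pk_def qk_def min_def)
    have [measurable]: "pk K \<in> borel_measurable borel" "qk K \<in> borel_measurable borel" for K
      unfolding pk_def qk_def by measurable
    define S where "S = {t0 / 2<..<2 * t0}"
    define r where "r \<tau> = res \<nu> \<tau> * indicator {..2 * t0} \<tau>" for \<tau>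
    have r: "integrable lborel r"
      unfolding r_def
    proof (rule Bochner_Integration.integrable_bound[OF kernel_integrable[OF kernel_cmult_p[OF \<nu>], of "2 * t0"]])
      show "AE \<tau> in lborel. norm (res \<nu> \<tau> * indicator {..2 * t0} \<tau>) \<le> norm (\<nu> * p \<tau> * indicator {..2 * t0} \<tau>)"
        using res_le[OF \<nu>] res_nonneg[OF \<nu>] \<nu> kernel_nonneg[OF p]
        by (intro AE_I2) (auto simp: indicator_def abs_mult)
    qed measurable
    have cont_K: "continuous_on S (conv r (pk K))" for K
    proof -
      have "isCont (pk K) u" if "u \<noteq> 0" for u
      proof (cases "u < 0")
        case True
        then have "\<forall>\<^sub>F v in nhds u. v < 0"
          using eventually_nhds_in_open[of "{..<0}" u] by auto
        then have ev: "\<forall>\<^sub>F v in nhds u. pk K v = 0"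
          by eventually_elim (simp add: pk_def kernel_zero[OF p])
        then show ?thesis
          unfolding isCont_def using eventually_nhds_x_imp_x[OF ev]
          by (intro tendsto_eventually) (auto simp: eventually_at_filter elim: eventually_mono)
      next
        case False
        then have "isCont p u"
          using that p_cont by (simp add: continuous_on_eq_continuous_at)
        then show ?thesis
          unfolding pk_def by (intro continuous_intros)
      qed
      moreover have "\<bar>pk K u\<bar> \<le> real K" for u
        using pk[where K = K and u = u] by simp
      ultimately have "continuous_on UNIV (conv r (pk K))"
        by (intro conv_continuous_general[OF r]) measurable
      then show ?thesis
        by (rule continuous_on_subset) simp
    qed
    have int_bound: "integrable lborel (\<lambda>\<tau>. r \<tau> * f (t - \<tau>))"
      if [measurable]: "f \<in> borel_measurable borel" and f: "\<And>u. 0 \<le> f u" "\<And>u. f u \<le> p u" and t: "t \<in> S" for f t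
    proof -
      have "integrable lborel (\<lambda>\<tau>. p (t - \<tau>) * res \<nu> \<tau>)"
        using lborel_integrable_real_affine[OF conv_res_integrable[OF \<nu> p, of t], of "-1" t] by simp
      then show ?thesis
      proof (rule Bochner_Integration.integrable_bound)
        have "\<bar>r \<tau>\<bar> * \<bar>f (t - \<tau>)\<bar> \<le> \<bar>res \<nu> \<tau>\<bar> * \<bar>p (t - \<tau>)\<bar>" for \<tau>
          using f[of "t - \<tau>"] by (intro mult_mono) (auto simp: r_def indicator_def)
        then show "AE \<tau> in lborel. norm (r \<tau> * f (t - \<tau>)) \<le> norm (p (t - \<tau>) * res \<nu> \<tau>)"
          by (simp add: abs_mult mult.commute)
        show "(\<lambda>\<tau>. r \<tau> * f (t - \<tau>)) \<in> borel_measurable lborel"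
          unfolding r_def by measurable
      qed
    qed
    have eq: "conv p (res \<nu>) t = conv r (pk K) t + conv r (qk K) t" if t: "t \<in> S" for t K
    proof -
      have "conv p (res \<nu>) t = (LINT \<tau>|lborel. p (t - \<tau>) * res \<nu> \<tau>)"
        unfolding conv_def by (subst lborel_integral_real_affine[where c = "-1" and t = t]) auto
      also have "\<dots> = (LINT \<tau>|lborel. r \<tau> * pk K (t - \<tau>) + r \<tau> * qk K (t - \<tau>))"
      proof (intro Bochner_Integration.integral_cong refl)
        fix \<tau>
        have "\<tau> > 2 * t0 \<Longrightarrow> p (t - \<tau>) = 0"
          using t by (intro kernel_zero[OF p]) (auto simp: S_def)
        then show "p (t - \<tau>) * res \<nu> \<tau> = r \<tau> * pk K (t - \<tau>) + r \<tau> * qk K (t - \<tau>)"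
          by (cases "\<tau> \<le> 2 * t0") (auto simp: r_def qk_def algebra_simps)
      qed
      also have "\<dots> = conv r (pk K) t + conv r (qk K) t"
        unfolding conv_def using pk qk t by (intro Bochner_Integration.integral_add int_bound) auto
      finally show ?thesis .
    qed
    \<comment> \<open>\<nu> p(t0/4) bounds r beyond t0/4, and the integral is the excess of p over K
      near 0, which vanishes as K grows.\<close>
    define err where "err K = \<nu> * p (t0 / 4) * (LINT u|lborel. qk K u * indicator {..t0 / 4} u)" for K
    have int_q: "integrable lborel (\<lambda>u. qk K u * indicator {..t0 / 4} u)" for K
      by (rule Bochner_Integration.integrable_bound[OF kernel_integrable[OF p, of "t0 / 4"]])
        (measurable, use qk kernel_nonneg[OF p] in \<open>auto simp: indicator_def\<close>)
    have err_lim: "err \<longlonglongrightarrow> 0"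
    proof -
      have "(\<lambda>K. LINT u|lborel. qk K u * indicator {..t0 / 4} u) \<longlonglongrightarrow> (LINT u|(lborel :: real measure). 0)"
      proof (rule integral_dominated_convergence[OF _ _ kernel_integrable[OF p, of "t0 / 4"]])
        show "AE u in lborel. (\<lambda>K. qk K u * indicator {..t0 / 4} u) \<longlonglongrightarrow> 0"
        proof (intro AE_I2 tendsto_eventually)
          fix u
          have "\<forall>\<^sub>F K in sequentially. p u \<le> real K"
            using filterlim_real_sequentially by (auto simp: filterlim_at_top)
          then show "\<forall>\<^sub>F K in sequentially. qk K u * indicator {..t0 / 4} u = 0"
            by eventually_elim (simp add: qk_def pk_def)
        qed
        show "AE u in lborel. norm (qk K u * indicator {..t0 / 4} u) \<le> p u * indicator {..t0 / 4} u" for K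
          using qk by (intro AE_I2) (auto simp: indicator_def)
      qed measurable
      from tendsto_mult_right_zero[OF this[simplified], of "\<nu> * p (t0 / 4)"] show ?thesis
        by (simp add: err_def[abs_def])
    qed
    obtain K0 :: nat where K0: "p (t0 / 4) \<le> real K0"
      using real_arch_simple by blast
    have err: "\<bar>conv r (qk K) t\<bar> \<le> err K" if K: "K \<ge> K0" and t: "t \<in> S" for K t
    proof -
      have le: "r \<tau> * qk K (t - \<tau>) \<le> (\<nu> * p (t0 / 4)) * (qk K (t - \<tau>) * indicator {..t0 / 4} (t - \<tau>))" for \<tau>
      proof (cases "t - \<tau> \<le> t0 / 4")
        case True
        then have "\<tau> \<ge> t0 / 4"
          using t by (auto simp: S_def)
        then have "res \<nu> \<tau> \<le> \<nu> * p (t0 / 4)"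
          using t0 \<nu> by (intro order_trans[OF res_le[OF \<nu>]] mult_left_mono kernel_antimono[OF p]) auto
        then have "r \<tau> \<le> \<nu> * p (t0 / 4)"
          using \<nu> kernel_nonneg[OF p, of "t0 / 4"] by (auto simp: r_def indicator_def)
        then show ?thesis
          using True qk by (simp add: mult_right_mono)
      next
        case False
        then have "p (t - \<tau>) \<le> real K0"
          using kernel_antimono[OF p, of "t0 / 4" "t - \<tau>"] t0 K0 by simp
        then have "qk K (t - \<tau>) = 0"
          using K by (simp add: qk_def pk_def)
        then show ?thesis
          by simp
      qed
      have "conv r (qk K) t \<le> (LINT \<tau>|lborel. (\<nu> * p (t0 / 4)) * (qk K (t - \<tau>) * indicator {..t0 / 4} (t - \<tau>)))"
        unfolding conv_def
      proof (rule integral_mono[OF int_bound _ le])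
        show "integrable lborel (\<lambda>\<tau>. (\<nu> * p (t0 / 4)) * (qk K (t - \<tau>) * indicator {..t0 / 4} (t - \<tau>)))"
          using lborel_integrable_real_affine[OF int_q[of K], of "-1" t] by (intro integrable_mult_right) simp
      qed (use qk t in auto)
      also have "\<dots> = err K"
      proof -
        have "(LINT \<tau>|lborel. qk K (t - \<tau>) * indicator {..t0 / 4} (t - \<tau>)) = (LINT u|lborel. qk K u * indicator {..t0 / 4} u)"
          by (subst (2) lborel_integral_real_affine[where c = "-1" and t = t]) auto
        then show ?thesis
          by (simp add: err_def)
      qed
      finally have "conv r (qk K) t \<le> err K" .
      moreover have "0 \<le> conv r (qk K) t"
        using res_nonneg[OF \<nu>] qk by (intro conv_nonneg) (auto simp: r_def)
      ultimately show ?thesis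
        by simp
    qed
    have "uniform_limit S (\<lambda>K. conv r (pk K)) (conv p (res \<nu>)) sequentially"
    proof (rule uniform_limitI)
      fix e :: real assume "e > 0"
      then have "\<forall>\<^sub>F K in sequentially. err K < e"
        by (intro order_tendstoD(2)[OF err_lim])
      then show "\<forall>\<^sub>F K in sequentially. \<forall>t\<in>S. dist (conv r (pk K) t) (conv p (res \<nu>) t) < e"
        using eventually_ge_at_top[of K0]
      proof eventually_elim
        case (elim K)
        then show ?case
          using err[of K] by (auto simp: eq[where K = K] dist_real_def) (smt (verit, best))
      qed
    qed
    then have "continuous_on S (conv p (res \<nu>))"
      by (intro uniform_limit_theorem[of _ "\<lambda>K. conv r (pk K)" sequentially]) (simp_all add: cont_K)
    then show ?thesis
      using t0 by (simp add: continuous_on_eq_continuous_at S_def)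
  qed
  then have "continuous_on {0<..} (conv p (res \<nu>))"
    by (intro continuous_at_imp_continuous_on) auto
  then have "continuous_on {0<..} (\<lambda>t. \<nu> * p t - \<nu> * conv p (res \<nu>) t)"
    by (intro continuous_intros p_cont)
  then show ?thesis
    by (rule continuous_on_eq) (use res_eq[OF \<nu>] in \<open>simp add: algebra_simps eq_diff_eq\<close>)
qed

end

section \<open>Convolution with operator families\<close>

text \<open>The bound \<open>b\<close> may be singular at 0 as long as it is integrable there.
  Linearity is recorded through differences.\<close>

definition operator_family :: "(real \<Rightarrow> 'a::real_normed_vector \<Rightarrow> 'a) \<Rightarrow> (real \<Rightarrow> real) \<Rightarrow> bool" where
  "operator_family B b \<longleftrightarrow>
     (\<forall>\<sigma>>0. \<forall>x y. B \<sigma> (x - y) = B \<sigma> x - B \<sigma> y) \<and> (\<forall>\<sigma>>0. \<forall>x. norm (B \<sigma> x) \<le> b \<sigma> * norm x) \<and>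
     (\<forall>x. continuous_on {0<..} (\<lambda>\<sigma>. B \<sigma> x)) \<and> continuous_on {0<..} b \<and> (\<forall>\<sigma>. 0 \<le> b \<sigma>) \<and>
     (\<forall>t. integrable lborel (\<lambda>\<sigma>. indicator {0<..<t} \<sigma> * b \<sigma>))"

definition opconv :: "(real \<Rightarrow> 'a \<Rightarrow> 'a) \<Rightarrow> (real \<Rightarrow> 'a) \<Rightarrow> real \<Rightarrow> 'a::{banach, second_countable_topology}" where
  "opconv B G t = (LINT \<sigma>|lborel. indicator {0<..<t} \<sigma> *\<^sub>R B \<sigma> (G (t - \<sigma>)))"

text \<open>Strong continuity together with a locally bounded operator norm is joint continuity in
  time and argument.\<close>

lemma operator_family_tendsto:
  assumes B: "operator_family B b" and u: "u \<longlonglongrightarrow> \<sigma>" "\<sigma> > 0" and x: "x \<longlonglongrightarrow> y"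
  shows "(\<lambda>n. B (u n) (x n)) \<longlonglongrightarrow> B \<sigma> y"
proof -
  have ev: "\<forall>\<^sub>F n in sequentially. u n > 0"
    by (rule order_tendstoD(1)[OF u])
  have cont: "(\<lambda>n. f (u n)) \<longlonglongrightarrow> f \<sigma>" if "continuous_on {0<..} f" for f :: "real \<Rightarrow> 'c::topological_space"
    using continuous_on_tendsto_compose[OF that u(1)] u(2) ev by simp
  have "\<forall>\<^sub>F n in sequentially. norm (B (u n) (x n) - B (u n) y) \<le> b (u n) * norm (x n - y)"
    using ev
  proof eventually_elim
    case (elim n)
    have "B (u n) (x n) - B (u n) y = B (u n) (x n - y)"
      using B elim by (simp add: operator_family_def)
    moreover have "norm (B (u n) (x n - y)) \<le> b (u n) * norm (x n - y)"
      using B elim unfolding operator_family_def by blast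
    ultimately show ?case
      by (simp only:)
  qed
  moreover have "(\<lambda>n. b (u n) * norm (x n - y)) \<longlonglongrightarrow> b \<sigma> * norm (y - y)"
    using B by (intro tendsto_intros cont x) (auto simp: operator_family_def)
  ultimately have "(\<lambda>n. B (u n) (x n) - B (u n) y) \<longlonglongrightarrow> 0"
    using Lim_null_comparison[of "\<lambda>n. B (u n) (x n) - B (u n) y"] by simp
  moreover have "(\<lambda>n. B (u n) y) \<longlonglongrightarrow> B \<sigma> y"
    using B by (intro cont) (auto simp: operator_family_def)
  ultimately have "(\<lambda>n. (B (u n) (x n) - B (u n) y) + B (u n) y) \<longlonglongrightarrow> 0 + B \<sigma> y"
    by (rule tendsto_add)
  then show ?thesis
    by simp
qed

lemma operator_family_continuous:
  fixes f :: "'z::metric_space \<Rightarrow> real"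
  assumes B: "operator_family B b"
    and f: "continuous_on A f" "\<And>z. z \<in> A \<Longrightarrow> f z > 0" and g: "continuous_on A g"
  shows "continuous_on A (\<lambda>z. B (f z) (g z))"
proof (rule continuous_on_sequentiallyI)
  fix u z assume u: "\<forall>n. u n \<in> A" "z \<in> A" "u \<longlonglongrightarrow> z"
  show "(\<lambda>n. B (f (u n)) (g (u n))) \<longlonglongrightarrow> B (f z) (g z)"
    by (intro operator_family_tendsto[OF B] continuous_on_tendsto_compose[OF f(1)]
        continuous_on_tendsto_compose[OF g] f(2) u always_eventually)
qed

locale forcing =
  fixes G :: "real \<Rightarrow> 'a::{banach, second_countable_topology}" and T K :: real
  assumes T: "T > 0" and G_cont: "continuous_on {0<..T} G" and G_bound: "\<And>t. 0 < t \<Longrightarrow> t \<le> T \<Longrightarrow> norm (G t) \<le> K"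
begin

lemma K_nonneg: "K \<ge> 0"
  using order_trans[OF norm_ge_zero G_bound[of T]] T by simp

lemma opconv_measurable:
  assumes B: "operator_family B b" and t: "t \<le> T"
  shows "(\<lambda>\<sigma>. indicator {0<..<t} \<sigma> *\<^sub>R B \<sigma> (G (t - \<sigma>))) \<in> borel_measurable borel"
  using t
  by (intro borel_measurable_continuous_on_indicator operator_family_continuous[OF B]
      continuous_on_compose2[OF G_cont] continuous_intros) auto

lemma opconv_bound:
  assumes B: "operator_family B b" and t: "t \<le> T"
  shows "norm (indicator {0<..<t} \<sigma> *\<^sub>R B \<sigma> (G (t - \<sigma>))) \<le> K * (indicator {0<..<T} \<sigma> * b \<sigma>)"
proof (cases "0 < \<sigma> \<and> \<sigma> < t")
  case True
  then have "norm (B \<sigma> (G (t - \<sigma>))) \<le> b \<sigma> * norm (G (t - \<sigma>))"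
    using B by (auto simp: operator_family_def)
  also have "\<dots> \<le> b \<sigma> * K"
    using B True t by (intro mult_left_mono G_bound) (auto simp: operator_family_def)
  finally show ?thesis
    using True t by (simp add: mult.commute)
next
  case False
  then show ?thesis
    using B K_nonneg by (auto simp: operator_family_def)
qed

lemma opconv_integrable:
  assumes B: "operator_family B b" and t: "t \<le> T"
  shows "integrable lborel (\<lambda>\<sigma>. indicator {0<..<t} \<sigma> *\<^sub>R B \<sigma> (G (t - \<sigma>)))"
proof (rule Bochner_Integration.integrable_bound)
  show "integrable lborel (\<lambda>\<sigma>. K * (indicator {0<..<T} \<sigma> * b \<sigma>))"
    using B by (intro integrable_mult_right) (auto simp: operator_family_def)
  show "AE \<sigma> in lborel. norm (indicator {0<..<t} \<sigma> *\<^sub>R B \<sigma> (G (t - \<sigma>))) \<le> norm (K * (indicator {0<..<T} \<sigma> * b \<sigma>))"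
    using order_trans[OF opconv_bound[OF assms] abs_ge_self] by (intro AE_I2) simp
qed (use opconv_measurable[OF assms] in simp)

text \<open>With the shift placed on \<open>G\<close>, the singular operator factor stays fixed
  while t moves, so the single majorant K b serves all t.\<close>

lemma opconv_continuous:
  assumes B: "operator_family B b"
  shows "continuous_on {0..T} (opconv B G)"
proof (rule continuous_on_sequentiallyI)
  fix u t assume u: "\<forall>n. u n \<in> {0..T}" "t \<in> {0..T}" "u \<longlonglongrightarrow> t"
  show "(\<lambda>n. opconv B G (u n)) \<longlonglongrightarrow> opconv B G t"
    unfolding opconv_def
  proof (rule integral_dominated_convergence[where w = "\<lambda>\<sigma>. K * (indicator {0<..<T} \<sigma> * b \<sigma>)"])
    show "integrable lborel (\<lambda>\<sigma>. K * (indicator {0<..<T} \<sigma> * b \<sigma>))"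
      using B by (intro integrable_mult_right) (auto simp: operator_family_def)
    have "AE \<sigma> in lborel. \<sigma> \<noteq> t"
      by (rule AE_lborel_singleton)
    then show "AE \<sigma> in lborel. (\<lambda>n. indicator {0<..<u n} \<sigma> *\<^sub>R B \<sigma> (G (u n - \<sigma>)))
        \<longlonglongrightarrow> indicator {0<..<t} \<sigma> *\<^sub>R B \<sigma> (G (t - \<sigma>))"
    proof eventually_elim
      case (elim \<sigma>)
      show ?case
      proof (cases "0 < \<sigma> \<and> \<sigma> < t")
        case True
        then have ev: "\<forall>\<^sub>F n in sequentially. \<sigma> < u n"
          by (intro order_tendstoD(1)[OF u(3)]) simp
        have "(\<lambda>n. G (u n - \<sigma>)) \<longlonglongrightarrow> G (t - \<sigma>)"
        proof (rule continuous_on_tendsto_compose[OF G_cont])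
          show "(\<lambda>n. u n - \<sigma>) \<longlonglongrightarrow> t - \<sigma>"
            by (intro tendsto_intros u)
          show "t - \<sigma> \<in> {0<..T}"
            using True u(2) by auto
          show "\<forall>\<^sub>F n in sequentially. u n - \<sigma> \<in> {0<..T}"
            using ev
          proof eventually_elim
            case (elim n)
            then show ?case
              using True u(1)[rule_format, of n] by auto
          qed
        qed
        then have "(\<lambda>n. B \<sigma> (G (u n - \<sigma>))) \<longlonglongrightarrow> B \<sigma> (G (t - \<sigma>))"
          using True by (intro operator_family_tendsto[OF B tendsto_const]) auto
        moreover have "\<forall>\<^sub>F n in sequentially. indicator {0<..<u n} \<sigma> *\<^sub>R B \<sigma> (G (u n - \<sigma>)) = B \<sigma> (G (u n - \<sigma>))"
          using ev by eventually_elim (use True in simp)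
        ultimately show ?thesis
          using True by (simp add: tendsto_cong)
      next
        case False
        have "\<forall>\<^sub>F n in sequentially. indicator {0<..<u n} \<sigma> *\<^sub>R B \<sigma> (G (u n - \<sigma>)) = 0"
        proof (cases "\<sigma> \<le> 0")
          case False
          then have "\<forall>\<^sub>F n in sequentially. u n < \<sigma>"
            using \<open>\<not> (0 < \<sigma> \<and> \<sigma> < t)\<close> elim by (intro order_tendstoD(2)[OF u(3)]) auto
          then show ?thesis
            by eventually_elim simp
        qed simp
        then show ?thesis
          using False by (simp add: tendsto_eventually)
      qed
    qed
    show "AE \<sigma> in lborel. norm (indicator {0<..<u n} \<sigma> *\<^sub>R B \<sigma> (G (u n - \<sigma>))) \<le> K * (indicator {0<..<T} \<sigma> * b \<sigma>)" for n
      using u(1) by (intro AE_I2 opconv_bound[OF B]) auto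
  qed (use opconv_measurable[OF B] u in auto)
qed

text \<open>Associativity a * (B * G) = (a * B) * G. The interchange of integrals is justified by
  the majorant K |a| times the integral of b.\<close>

lemma opconv_fubini:
  assumes B: "operator_family B b" and t: "0 < t" "t \<le> T"
    and a: "continuous_on {0<..} a" "integrable lborel (\<lambda>\<tau>. indicator {0<..<t} \<tau> * \<bar>a \<tau>\<bar>)"
  shows "integrable lborel (\<lambda>\<tau>. indicator {0<..<t} \<tau> *\<^sub>R a (t - \<tau>) *\<^sub>R opconv B G \<tau>)" (is ?int)
    and "(LINT \<tau>|lborel. indicator {0<..<t} \<tau> *\<^sub>R a (t - \<tau>) *\<^sub>R opconv B G \<tau>)
      = opconv (\<lambda>\<sigma> x. LINT u|lborel. indicator {0<..<\<sigma>} u *\<^sub>R a (\<sigma> - u) *\<^sub>R B u x) G t" (is ?eq)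
proof -
  define f where "f = (\<lambda>(\<tau>, w). indicator {(\<tau>, w). 0 < w \<and> w < \<tau> \<and> \<tau> < t} (\<tau>, w) *\<^sub>R a (t - \<tau>) *\<^sub>R B (\<tau> - w) (G w))"
  let ?A = "{(\<tau>, w). 0 < w \<and> w < \<tau> \<and> \<tau> < t}"
  \<comment> \<open>The singular times of \<open>a\<close>, \<open>B\<close> and \<open>G\<close>
    all lie outside this open triangle, on which the integrand is therefore continuous.\<close>
  have op: "open ?A"
  proof -
    have "?A = {z. 0 < snd z} \<inter> {z. snd z < fst z} \<inter> {z. fst z < t}"
      by auto
    then show ?thesis
      by (simp only:) (intro open_Int open_Collect_less continuous_intros)
  qed
  have "(\<lambda>z. indicator ?A z *\<^sub>R (a (t - fst z) *\<^sub>R B (fst z - snd z) (G (snd z)))) \<in> borel_measurable borel"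
  proof (rule borel_measurable_continuous_on_indicator)
    show "?A \<in> sets borel"
      using op by simp
    show "continuous_on ?A (\<lambda>z. a (t - fst z) *\<^sub>R B (fst z - snd z) (G (snd z)))"
      using t by (intro continuous_on_scaleR continuous_on_compose2[OF a(1)] operator_family_continuous[OF B]
          continuous_on_compose2[OF G_cont] continuous_intros) auto
  qed
  then have meas: "f \<in> borel_measurable (lborel \<Otimes>\<^sub>M lborel)"
    unfolding f_def lborel_prod by (simp add: case_prod_unfold)
  define Bt where "Bt = (LINT \<sigma>|lborel. indicator {0<..<T} \<sigma> * b \<sigma>)"
  have inner: "(\<lambda>w. f (\<tau>, w)) = (\<lambda>w. (indicator {0<..<t} \<tau> * a (t - \<tau>)) *\<^sub>R (indicator {0<..<\<tau>} w *\<^sub>R B (\<tau> - w) (G w)))" for \<tau>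
    by (auto simp: f_def indicator_def fun_eq_iff)
  note inner_pt = fun_cong[OF inner]
  have flip: "(LINT w|lborel. indicator {0<..<\<tau>} w *\<^sub>R B (\<tau> - w) (G w)) = opconv B G \<tau>"
    "integrable lborel (\<lambda>w. indicator {0<..<\<tau>} w *\<^sub>R B (\<tau> - w) (G w))" if "\<tau> \<le> T" for \<tau>
  proof -
    have eq: "(\<lambda>\<sigma>. indicator {0<..<\<tau>} (\<tau> - \<sigma>) *\<^sub>R B (\<tau> - \<sigma>) (G (\<tau> - (\<tau> - \<sigma>)))) = (\<lambda>w. indicator {0<..<\<tau>} w *\<^sub>R B (\<tau> - w) (G w))"
      by (auto simp: indicator_def fun_eq_iff)
    show "(LINT w|lborel. indicator {0<..<\<tau>} w *\<^sub>R B (\<tau> - w) (G w)) = opconv B G \<tau>"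
      unfolding opconv_def eq[symmetric]
      using lborel_integral_real_affine[of "-1" "\<lambda>\<sigma>. indicator {0<..<\<tau>} \<sigma> *\<^sub>R B \<sigma> (G (\<tau> - \<sigma>))" \<tau>] by simp
    show "integrable lborel (\<lambda>w. indicator {0<..<\<tau>} w *\<^sub>R B (\<tau> - w) (G w))"
      unfolding eq[symmetric]
      using lborel_integrable_real_affine[OF opconv_integrable[OF B that], of "-1" \<tau>] by simp
  qed
  have int_w: "integrable lborel (\<lambda>w. f (\<tau>, w))" for \<tau>
  proof (cases "\<tau> < t")
    case True
    then show ?thesis
      unfolding inner using t by (intro integrable_scaleR_right flip(2)) simp
  next
    case False
    have z: "f (\<tau>, w) = 0" for w
      using False by (simp add: f_def)
    show ?thesis
      unfolding z by simp
  qed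
  have int: "integrable (lborel \<Otimes>\<^sub>M lborel) f"
  proof (rule lborel_pair.Fubini_integrable[OF meas])
    show "integrable lborel (\<lambda>\<tau>. LINT w|lborel. norm (f (\<tau>, w)))"
    proof (rule Bochner_Integration.integrable_bound)
      show "integrable lborel (\<lambda>\<tau>. (K * Bt) * (indicator {0<..<t} (t - \<tau>) * \<bar>a (t - \<tau>)\<bar>))"
        using lborel_integrable_real_affine[OF a(2), of "-1" t] by (intro integrable_mult_right) simp
      show "(\<lambda>\<tau>. LINT w|lborel. norm (f (\<tau>, w))) \<in> borel_measurable lborel"
        using meas by measurable
      have "(LINT w|lborel. norm (f (\<tau>, w))) \<le> (K * Bt) * (indicator {0<..<t} (t - \<tau>) * \<bar>a (t - \<tau>)\<bar>)" for \<tau>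
      proof (cases "0 < \<tau> \<and> \<tau> < t")
        case True
        have "(LINT w|lborel. norm (f (\<tau>, w))) = \<bar>a (t - \<tau>)\<bar> * (LINT w|lborel. norm (indicator {0<..<\<tau>} w *\<^sub>R B (\<tau> - w) (G w)))"
          unfolding inner_pt using True by (simp add: abs_mult mult.assoc)
        also have "(LINT w|lborel. norm (indicator {0<..<\<tau>} w *\<^sub>R B (\<tau> - w) (G w)))
            = (LINT \<sigma>|lborel. norm (indicator {0<..<\<tau>} \<sigma> *\<^sub>R B \<sigma> (G (\<tau> - \<sigma>))))"
        proof -
          have "norm (indicator {0<..<\<tau>} w *\<^sub>R B (\<tau> - w) (G w)) = norm (indicator {0<..<\<tau>} (\<tau> - w) *\<^sub>R B (\<tau> - w) (G (\<tau> - (\<tau> - w))))" for w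
            by (auto simp: indicator_def)
          note eq = this
          show ?thesis
            unfolding eq
            using lborel_integral_real_affine[of "-1" "\<lambda>\<sigma>. norm (indicator {0<..<\<tau>} \<sigma> *\<^sub>R B \<sigma> (G (\<tau> - \<sigma>)))" \<tau>] by simp
        qed
        also have "\<dots> \<le> (LINT \<sigma>|lborel. K * (indicator {0<..<T} \<sigma> * b \<sigma>))"
          using True t B
          by (intro integral_mono integrable_norm opconv_integrable opconv_bound integrable_mult_right)
            (auto simp: operator_family_def)
        also have "\<dots> = K * Bt"
          by (simp add: Bt_def)
        \<comment> \<open>The chain estimates one factor of a product, so it ends with monotonicity
          of multiplication by |a(t - \<tau>)| as an open premise, discharged in the next
          line.\<close>
        finally have "(\<And>x y :: real. x \<le> y \<Longrightarrow> \<bar>a (t - \<tau>)\<bar> * x \<le> \<bar>a (t - \<tau>)\<bar> * y)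
            \<Longrightarrow> (LINT w|lborel. norm (f (\<tau>, w))) \<le> \<bar>a (t - \<tau>)\<bar> * (K * Bt)" .
        from this[OF mult_left_mono[OF _ abs_ge_zero]] show ?thesis
          using True by (simp add: mult.commute)
      next
        case False
        then have z: "f (\<tau>, w) = 0" for w
          by (auto simp: f_def)
        have "0 \<le> Bt"
          unfolding Bt_def using B by (intro Bochner_Integration.integral_nonneg) (auto simp: operator_family_def)
        then show ?thesis
          unfolding z using K_nonneg by simp
      qed
      then show "AE \<tau> in lborel. norm (LINT w|lborel. norm (f (\<tau>, w))) \<le> norm ((K * Bt) * (indicator {0<..<t} (t - \<tau>) * \<bar>a (t - \<tau>)\<bar>))"
        by (intro AE_I2) (auto intro: order_trans[OF _ abs_ge_self])
    qed
    show "AE \<tau> in lborel. integrable lborel (\<lambda>w. f (\<tau>, w))"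
      using int_w by simp
  qed
  have outer: "(LINT w|lborel. f (\<tau>, w)) = indicator {0<..<t} \<tau> *\<^sub>R a (t - \<tau>) *\<^sub>R opconv B G \<tau>" for \<tau>
  proof (cases "\<tau> < t")
    case True
    then show ?thesis
      unfolding inner using t flip[of \<tau>]
      by (subst Bochner_Integration.integral_scaleR_right) simp_all
  next
    case False
    then have z: "f (\<tau>, w) = 0" for w
      by (simp add: f_def)
    show ?thesis
      unfolding z using False by simp
  qed
  show ?int
    using lborel_pair.integrable_fst'[OF int] by (simp add: outer)
  have "(LINT \<tau>|lborel. indicator {0<..<t} \<tau> *\<^sub>R a (t - \<tau>) *\<^sub>R opconv B G \<tau>) = (LINT w|lborel. LINT \<tau>|lborel. f (\<tau>, w))"
    unfolding outer[symmetric] using int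
    by (intro lborel_pair.Fubini_integral[symmetric]) (simp add: case_prod_unfold)
  also have "\<dots> = (LINT w|lborel. indicator {0<..<t} w *\<^sub>R (LINT u|lborel. indicator {0<..<t - w} u *\<^sub>R a (t - w - u) *\<^sub>R B u (G w)))"
  proof (intro Bochner_Integration.integral_cong refl)
    fix w
    have "(LINT \<tau>|lborel. f (\<tau>, w)) = (LINT u|lborel. f (w + 1 * u, w))"
      using lborel_integral_real_affine[of 1 "\<lambda>\<tau>. f (\<tau>, w)" w] by simp
    also have "\<dots> = (LINT u|lborel. indicator {0<..<t} w *\<^sub>R (indicator {0<..<t - w} u *\<^sub>R a (t - w - u) *\<^sub>R B u (G w)))"
      by (intro Bochner_Integration.integral_cong) (auto simp: f_def indicator_def algebra_simps)
    finally show "(LINT \<tau>|lborel. f (\<tau>, w)) = indicator {0<..<t} w *\<^sub>R (LINT u|lborel. indicator {0<..<t - w} u *\<^sub>R a (t - w - u) *\<^sub>R B u (G w))"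
      by (cases "0 < w \<and> w < t") simp_all
  qed
  also have "\<dots> = opconv (\<lambda>\<sigma> x. LINT u|lborel. indicator {0<..<\<sigma>} u *\<^sub>R a (\<sigma> - u) *\<^sub>R B u x) G t"
    unfolding opconv_def
    by (subst lborel_integral_real_affine[where c = "-1" and t = t])
      (auto simp: indicator_def intro!: Bochner_Integration.integral_cong)
  finally show ?eq .
qed

end

section \<open>Differentiation of integrals with values in a Banach space\<close>

lemma integral_indicator_Ico:
  fixes c :: "'a::{banach, second_countable_topology}"
  assumes "u < v"
  shows "integrable lborel (\<lambda>\<tau>::real. indicator {u..<v} \<tau> *\<^sub>R c)"
    and "(LINT \<tau>|lborel. indicator {u..<v} \<tau> *\<^sub>R c) = (v - u) *\<^sub>R c"
  using assms by (auto simp: emeasure_lborel_Ico intro!: integrable_scaleR_left integrable_real_indicator)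

text \<open>Means over [u,v) are compared with f(t) on either side of t. Continuity enters from
  within (0,T] only, so the one-sided derivative at t = T is included.\<close>

lemma FTC_quotient:
  fixes f :: "real \<Rightarrow> 'a::{banach, second_countable_topology}"
  assumes cont: "continuous_on {0<..T} f" and int: "integrable lborel (\<lambda>\<tau>. indicator {0<..<T} \<tau> *\<^sub>R f \<tau>)"
    and t: "t \<in> {0<..T}"
  shows "((\<lambda>u. (1 / (u - t)) *\<^sub>R ((LINT \<tau>|lborel. indicator {0<..<u} \<tau> *\<^sub>R f \<tau>) - (LINT \<tau>|lborel. indicator {0<..<t} \<tau> *\<^sub>R f \<tau>)))
    \<longlongrightarrow> f t) (at t within {0<..T})"
proof (rule tendstoI)
  fix e :: real assume e: "e > 0"
  define F where "F u = (LINT \<tau>|lborel. indicator {0<..<u} \<tau> *\<^sub>R f \<tau>)" for u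
  have int_u: "integrable lborel (\<lambda>\<tau>. indicator {0<..<u} \<tau> *\<^sub>R f \<tau>)" if "u \<le> T" for u
  proof (rule Bochner_Integration.integrable_bound[OF int])
    have "(\<lambda>\<tau>. indicator {0<..<u} \<tau> *\<^sub>R f \<tau>) \<in> borel_measurable borel"
      using that by (intro borel_measurable_continuous_on_indicator continuous_on_subset[OF cont]) auto
    then show "(\<lambda>\<tau>. indicator {0<..<u} \<tau> *\<^sub>R f \<tau>) \<in> borel_measurable lborel"
      by simp
    show "AE \<tau> in lborel. norm (indicator {0<..<u} \<tau> *\<^sub>R f \<tau>) \<le> norm (indicator {0<..<T} \<tau> *\<^sub>R f \<tau>)"
      using that by (intro AE_I2) (auto simp: indicator_def)
  qed
  have "(f \<longlongrightarrow> f t) (at t within {0<..T})"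
    using cont t by (simp add: continuous_on_def)
  then obtain d where d: "d > 0" "\<And>u. u \<in> {0<..T} \<Longrightarrow> \<bar>u - t\<bar> < d \<Longrightarrow> norm (f u - f t) < e / 2"
  proof -
    assume a: "\<And>d. 0 < d \<Longrightarrow> (\<And>u. u \<in> {0<..T} \<Longrightarrow> \<bar>u - t\<bar> < d \<Longrightarrow> norm (f u - f t) < e / 2) \<Longrightarrow> thesis"
    have "\<forall>\<^sub>F u in at t within {0<..T}. dist (f u) (f t) < e / 2"
      using tendstoD[OF \<open>(f \<longlongrightarrow> f t) (at t within {0<..T})\<close>, of "e / 2"] e by simp
    then obtain d where d: "d > 0" "\<forall>u\<in>{0<..T}. u \<noteq> t \<and> dist u t < d \<longrightarrow> dist (f u) (f t) < e / 2"
      unfolding eventually_at by blast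
    show thesis
    proof (rule a[OF d(1)])
      fix u assume "u \<in> {0<..T}" "\<bar>u - t\<bar> < d"
      then show "norm (f u - f t) < e / 2"
        using d(2) e by (cases "u = t") (auto simp: dist_norm)
    qed
  qed
  have est: "norm ((1 / (v - u)) *\<^sub>R (F v - F u) - f t) \<le> e / 2"
    if uv: "0 < u" "u < v" "v \<le> T" and near: "\<And>\<tau>. u \<le> \<tau> \<Longrightarrow> \<tau> < v \<Longrightarrow> norm (f \<tau> - f t) \<le> e / 2" for u v
  proof -
    have split: "indicator {0<..<v} \<tau> *\<^sub>R f \<tau> - indicator {0<..<u} \<tau> *\<^sub>R f \<tau> = indicator {u..<v} \<tau> *\<^sub>R f \<tau>" for \<tau>
      using uv by (auto simp: indicator_def)
    have Fd: "F v - F u = (LINT \<tau>|lborel. indicator {u..<v} \<tau> *\<^sub>R f \<tau>)"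
      unfolding F_def split[symmetric] using uv by (intro Bochner_Integration.integral_diff[symmetric] int_u) auto
    have int_uv: "integrable lborel (\<lambda>\<tau>. indicator {u..<v} \<tau> *\<^sub>R f \<tau>)"
      unfolding split[symmetric] using uv by (intro Bochner_Integration.integrable_diff int_u) auto
    have "F v - F u - (v - u) *\<^sub>R f t = (LINT \<tau>|lborel. indicator {u..<v} \<tau> *\<^sub>R f \<tau> - indicator {u..<v} \<tau> *\<^sub>R f t)"
      unfolding Fd integral_indicator_Ico(2)[OF uv(2), symmetric]
      by (intro Bochner_Integration.integral_diff[symmetric] int_uv integral_indicator_Ico(1)[OF uv(2)])
    also have "norm \<dots> \<le> (LINT \<tau>|lborel. indicator {u..<v} \<tau> *\<^sub>R (e / 2))"
    proof (rule Bochner_Integration.integral_norm_bound_integral)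
      show "integrable lborel (\<lambda>\<tau>. indicator {u..<v} \<tau> *\<^sub>R f \<tau> - indicator {u..<v} \<tau> *\<^sub>R f t)"
        by (intro Bochner_Integration.integrable_diff int_uv integral_indicator_Ico(1)[OF uv(2)])
      show "integrable lborel (\<lambda>\<tau>. indicator {u..<v} \<tau> *\<^sub>R (e / 2))"
        by (rule integral_indicator_Ico(1)[OF uv(2)])
      show "norm (indicator {u..<v} \<tau> *\<^sub>R f \<tau> - indicator {u..<v} \<tau> *\<^sub>R f t) \<le> indicator {u..<v} \<tau> *\<^sub>R (e / 2)" for \<tau>
        using near[of \<tau>] by (auto simp: indicator_def)
    qed
    also have "\<dots> = (v - u) * (e / 2)"
      using integral_indicator_Ico(2)[OF uv(2), of "e / 2"] by simp
    finally have le: "norm (F v - F u - (v - u) *\<^sub>R f t) \<le> (v - u) * (e / 2)" .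
    have "(1 / (v - u)) *\<^sub>R (F v - F u) - f t = (1 / (v - u)) *\<^sub>R (F v - F u - (v - u) *\<^sub>R f t)"
      using uv by (simp add: scaleR_diff_right)
    also have "norm \<dots> \<le> (1 / (v - u)) * ((v - u) * (e / 2))"
      unfolding norm_scaleR using uv le by (intro mult_mono) auto
    finally show ?thesis
      using uv by simp
  qed
  have "dist ((1 / (u - t)) *\<^sub>R (F u - F t)) (f t) < e" if u: "u \<in> {0<..T}" "u \<noteq> t" "dist u t < d" for u
  proof (cases "u < t")
    case True
    have "norm ((1 / (t - u)) *\<^sub>R (F t - F u) - f t) \<le> e / 2"
      using True u t by (intro est less_imp_le[OF d(2)]) (auto simp: dist_real_def)
    moreover have "(1 / (u - t)) *\<^sub>R (F u - F t) = (1 / (t - u)) *\<^sub>R (F t - F u)"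
      using minus_divide_right[of 1 "t - u"] scaleR_minus_left[of "1 / (t - u)" "F u - F t"] scaleR_minus_right[of "1 / (t - u)" "F u - F t"]
      by simp
    ultimately show ?thesis
      using e by (simp add: dist_norm)
  next
    case False
    then have "norm ((1 / (u - t)) *\<^sub>R (F u - F t) - f t) \<le> e / 2"
      using u t by (intro est less_imp_le[OF d(2)]) (auto simp: dist_real_def)
    then show ?thesis
      using e by (simp add: dist_norm)
  qed
  then show "\<forall>\<^sub>F u in at t within {0<..T}. dist ((1 / (u - t)) *\<^sub>R ((LINT \<tau>|lborel. indicator {0<..<u} \<tau> *\<^sub>R f \<tau>) - (LINT \<tau>|lborel. indicator {0<..<t} \<tau> *\<^sub>R f \<tau>))) (f t) < e"
    unfolding eventually_at F_def using d(1) by blast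
qed

section \<open>Sobolev spaces as copies of the space of square-integrable functions\<close>

text \<open>The symbol of the Bessel potential; its square is the weight in the norm of H^s, hence
  the exponent s / 2.\<close>

definition bessel :: "real \<Rightarrow> real^'n \<Rightarrow> real" where
  "bessel s \<xi> = (1 + (norm \<xi>)\<^sup>2) powr (s / 2)"

text \<open>The isometry of H^s onto L2. The norm of H^s is defined through the same transform, so
  no power of 2 \<pi> appears.\<close>

definition J :: "real \<Rightarrow> (real^'n \<Rightarrow> complex) \<Rightarrow> 'n L2" where
  "J s u = cls (\<lambda>\<xi>. bessel s \<xi> *\<^sub>R fourier u \<xi>)"

lemma bessel_measurable [measurable]: "bessel s \<in> borel_measurable borel"
  unfolding bessel_def by measurable

lemma bessel_pos: "bessel s \<xi> > 0"
proof -
  have "0 < 1 + (norm \<xi>)\<^sup>2"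
    by (simp add: add_pos_nonneg)
  then show ?thesis
    by (simp add: bessel_def)
qed

lemma bessel_neq_0: "bessel s \<xi> \<noteq> 0"
  using bessel_pos[of s \<xi>] by simp

lemma bessel_add: "bessel (s + t) \<xi> = bessel s \<xi> * bessel t \<xi>"
  by (simp add: bessel_def add_divide_distrib powr_add)

lemma bessel_0 [simp]: "bessel 0 \<xi> = 1"
proof -
  have "1 + (norm \<xi>)\<^sup>2 \<noteq> 0"
    by (metis add_pos_nonneg less_irrefl zero_le_power2 zero_less_one)
  then show ?thesis
    by (simp add: bessel_def)
qed

lemma bessel_mono: "s \<le> t \<Longrightarrow> bessel s \<xi> \<le> bessel t \<xi>"
  unfolding bessel_def by (intro powr_mono) auto

lemma bounded_symbol_bessel: "s \<ge> 0 \<Longrightarrow> bounded_symbol (bessel (- s) :: real^'n \<Rightarrow> real) 1"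
  using bessel_mono[of "- s" 0 "_ :: real^'n"] by (simp add: bounded_symbol_def abs_of_pos bessel_pos)

lemma bessel_norm_power2: "(norm (bessel s \<xi> *\<^sub>R z))\<^sup>2 = (1 + (norm \<xi>)\<^sup>2) powr s * (norm z)\<^sup>2" for z :: complex
proof -
  have "(bessel s \<xi>)\<^sup>2 = (1 + (norm \<xi>)\<^sup>2) powr s"
    by (simp add: bessel_def power2_eq_square flip: powr_add)
  then show ?thesis
    by (simp add: power_mult_distrib)
qed

lemma Hs_iff: "u \<in> Hs s \<longleftrightarrow> square_integrable u \<and> square_integrable (\<lambda>\<xi>. bessel s \<xi> *\<^sub>R fourier u \<xi>)"
proof (cases "square_integrable u")
  case True
  note [measurable] = square_integrable_measurable[OF square_integrable_fourier[OF True]]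
  show ?thesis
    using True unfolding Hs_def square_integrable_def[of "\<lambda>\<xi>. bessel s \<xi> *\<^sub>R fourier u \<xi>"] bessel_norm_power2
    by simp
qed (simp add: Hs_def)

lemma Hs_square_integrable: "u \<in> Hs s \<Longrightarrow> square_integrable u"
  and Hs_weighted: "u \<in> Hs s \<Longrightarrow> square_integrable (\<lambda>\<xi>. bessel s \<xi> *\<^sub>R fourier u \<xi>)"
  by (auto simp: Hs_iff)

lemma Hs_norm_eq: "u \<in> Hs s \<Longrightarrow> Hs_norm s u = norm (J s u)"
  unfolding Hs_norm_def J_def by (subst norm_cls[OF Hs_weighted]) (simp_all only: bessel_norm_power2)

lemma fourier_AE_add:
  assumes "square_integrable u" "square_integrable v"
  shows "AE \<xi> in lborel. fourier (\<lambda>x. u x + v x) \<xi> = fourier u \<xi> + fourier v \<xi>"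
  using fourier_add[OF assms] assms
  by (subst cls_eq_iff[symmetric])
    (auto simp: cls_add square_integrable_add square_integrable_fourier)

lemma fourier_AE_scaleR:
  assumes "square_integrable u"
  shows "AE \<xi> in lborel. fourier (\<lambda>x. r *\<^sub>R u x) \<xi> = r *\<^sub>R fourier u \<xi>"
  using fourier_scaleR[OF assms] assms
  by (subst cls_eq_iff[symmetric])
    (auto simp: cls_scaleR square_integrable_scaleR square_integrable_fourier)

lemma Hs_add:
  assumes "u \<in> Hs s" "v \<in> Hs s"
  shows "(\<lambda>x. u x + v x) \<in> Hs s" "J s (\<lambda>x. u x + v x) = J s u + J s v"
proof -
  note sq = Hs_square_integrable[OF assms(1)] Hs_square_integrable[OF assms(2)]
  note w = Hs_weighted[OF assms(1)] Hs_weighted[OF assms(2)]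
  have sq_add: "square_integrable (\<lambda>x. u x + v x)"
    by (rule square_integrable_add[OF sq])
  note [measurable] = square_integrable_measurable[OF square_integrable_fourier[OF sq_add]]
  have ae: "AE \<xi> in lborel. bessel s \<xi> *\<^sub>R fourier (\<lambda>x. u x + v x) \<xi> = bessel s \<xi> *\<^sub>R fourier u \<xi> + bessel s \<xi> *\<^sub>R fourier v \<xi>"
    using fourier_AE_add[OF sq] by eventually_elim (simp add: scaleR_add_right)
  have "square_integrable (\<lambda>\<xi>. bessel s \<xi> *\<^sub>R fourier (\<lambda>x. u x + v x) \<xi>)"
    by (rule square_integrable_cong_AE[OF square_integrable_add[OF w] _ ae]) measurable
  then show "(\<lambda>x. u x + v x) \<in> Hs s"
    using sq_add by (simp add: Hs_iff)
  show "J s (\<lambda>x. u x + v x) = J s u + J s v"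
    unfolding J_def using cls_eqI[OF ae] cls_add[OF w] by simp
qed

lemma Hs_scaleR:
  assumes "u \<in> Hs s"
  shows "(\<lambda>x. r *\<^sub>R u x) \<in> Hs s" "J s (\<lambda>x. r *\<^sub>R u x) = r *\<^sub>R J s u"
proof -
  note sq = Hs_square_integrable[OF assms(1)]
  note w = Hs_weighted[OF assms(1)]
  have sq_r: "square_integrable (\<lambda>x. r *\<^sub>R u x)"
    by (rule square_integrable_scaleR[OF sq])
  note [measurable] = square_integrable_measurable[OF square_integrable_fourier[OF sq_r]]
  have ae: "AE \<xi> in lborel. bessel s \<xi> *\<^sub>R fourier (\<lambda>x. r *\<^sub>R u x) \<xi> = r *\<^sub>R bessel s \<xi> *\<^sub>R fourier u \<xi>"
    using fourier_AE_scaleR[OF sq, of r] by eventually_elim (simp only: scaleR_left_commute)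
  have "square_integrable (\<lambda>\<xi>. bessel s \<xi> *\<^sub>R fourier (\<lambda>x. r *\<^sub>R u x) \<xi>)"
    by (rule square_integrable_cong_AE[OF square_integrable_scaleR[OF w] _ ae]) measurable
  then show "(\<lambda>x. r *\<^sub>R u x) \<in> Hs s"
    using sq_r by (simp add: Hs_iff)
  show "J s (\<lambda>x. r *\<^sub>R u x) = r *\<^sub>R J s u"
    unfolding J_def using cls_eqI[OF ae] cls_scaleR[OF w, of r] by simp
qed

lemma Hs_diff:
  assumes "u \<in> Hs s" "v \<in> Hs s"
  shows "(\<lambda>x. u x - v x) \<in> Hs s" "J s (\<lambda>x. u x - v x) = J s u - J s v"
  using Hs_add[OF assms(1) Hs_scaleR(1)[OF assms(2), of "-1"]] Hs_scaleR(2)[OF assms(2), of "-1"] by simp_all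

lemma Hs_zero: "(\<lambda>x. 0) \<in> Hs s" "J s (\<lambda>x. 0) = 0"
proof -
  have "cls (fourier (\<lambda>x. 0 *\<^sub>R 0)) = 0 *\<^sub>R cls (fourier (\<lambda>x. 0))"
    by (rule fourier_scaleR) simp
  then have "cls (fourier (\<lambda>x. 0)) = cls (\<lambda>x. 0)"
    by (simp add: zero_L2_def)
  then have ae: "AE \<xi> in lborel. fourier (\<lambda>x. 0) \<xi> = 0"
    by (subst (asm) cls_eq_iff) (auto simp: square_integrable_fourier)
  note [measurable] = square_integrable_measurable[OF square_integrable_fourier[OF square_integrable_zero]]
  have ae': "AE \<xi> in lborel. bessel s \<xi> *\<^sub>R fourier (\<lambda>x. 0) \<xi> = 0"
    using ae by eventually_elim simp
  show "(\<lambda>x. 0) \<in> Hs s"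
    unfolding Hs_iff by (intro conjI square_integrable_zero square_integrable_cong_AE[OF square_integrable_zero _ ae']) measurable
  show "J s (\<lambda>x. 0) = 0"
    unfolding J_def zero_L2_def by (rule cls_eqI[OF ae'])
qed

lemma Hs_sum:
  assumes "\<And>i. i \<in> I \<Longrightarrow> u i \<in> Hs s"
  shows "(\<lambda>x. \<Sum>i\<in>I. u i x) \<in> Hs s" "J s (\<lambda>x. \<Sum>i\<in>I. u i x) = (\<Sum>i\<in>I. J s (u i))"
proof -
  have "(\<lambda>x. \<Sum>i\<in>I. u i x) \<in> Hs s \<and> J s (\<lambda>x. \<Sum>i\<in>I. u i x) = (\<Sum>i\<in>I. J s (u i))"
    using assms by (induction I rule: infinite_finite_induct) (auto simp: Hs_zero Hs_add)
  then show "(\<lambda>x. \<Sum>i\<in>I. u i x) \<in> Hs s" "J s (\<lambda>x. \<Sum>i\<in>I. u i x) = (\<Sum>i\<in>I. J s (u i))"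
    by auto
qed

lemma Hs_dist_eq: "u \<in> Hs s \<Longrightarrow> v \<in> Hs s \<Longrightarrow> Hs_dist s u v = norm (J s u - J s v)"
  unfolding Hs_dist_def by (simp add: Hs_norm_eq Hs_diff)

text \<open>The weight vanishes nowhere, and Plancherel makes the transform injective on
  classes.\<close>

lemma J_eq_iff:
  fixes u v :: "real^'n \<Rightarrow> complex"
  assumes "u \<in> Hs s" "v \<in> Hs s"
  shows "J s u = J s v \<longleftrightarrow> (AE x in lborel. u x = v x)"
proof -
  note sq = Hs_square_integrable[OF assms(1)] Hs_square_integrable[OF assms(2)]
  have "J s u = J s v \<longleftrightarrow> (AE \<xi> in lborel. fourier u \<xi> = fourier v \<xi>)"
    unfolding J_def cls_eq_iff[OF Hs_weighted[OF assms(1)] Hs_weighted[OF assms(2)]]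
    by (simp add: bessel_neq_0)
  also have "\<dots> \<longleftrightarrow> cls (fourier u) = cls (fourier v)"
    by (simp add: cls_eq_iff square_integrable_fourier sq)
  also have "\<dots> \<longleftrightarrow> cls u = cls v"
  proof -
    have "cls (fourier u) - cls (fourier v) = cls (fourier (\<lambda>x. u x - v x))"
      using fourier_add[OF sq(1) square_integrable_scaleR[OF sq(2)], of "-1"] fourier_scaleR[OF sq(2), of "-1"] by simp
    then have "norm (cls (fourier u) - cls (fourier v)) = gauss_mass TYPE('n) * norm (cls u - cls v)"
      by (simp add: plancherel square_integrable_diff sq cls_diff)
    moreover have "gauss_mass TYPE('n) \<noteq> 0"
      using gauss_mass_pos[where 'n='n] by simp
    ultimately have "norm (cls (fourier u) - cls (fourier v)) = 0 \<longleftrightarrow> norm (cls u - cls v) = 0"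
      by simp
    then show ?thesis
      by simp
  qed
  also have "\<dots> \<longleftrightarrow> (AE x in lborel. u x = v x)"
    by (rule cls_eq_iff[OF sq])
  finally show ?thesis .
qed

text \<open>For s \<ge> 0 the reciprocal weight is bounded, so dividing by the weight stays in L2,
  where the transform is onto.\<close>

lemma J_surj:
  fixes F :: "'n::finite L2"
  assumes s: "s \<ge> 0"
  shows "\<exists>u\<in>Hs s. J s u = F"
proof -
  have b: "bounded_symbol (bessel (- s) :: real^'n \<Rightarrow> real) 1"
    by (rule bounded_symbol_bessel[OF s])
  obtain u where u: "square_integrable u" "cls (fourier u) = cls (\<lambda>\<xi>. bessel (- s) \<xi> *\<^sub>R fn F \<xi>)"
    by (rule fourier_surj[OF square_integrable_symbol[OF b square_integrable_fn]])
  then have "AE \<xi> in lborel. fourier u \<xi> = bessel (- s) \<xi> *\<^sub>R fn F \<xi>"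
    by (subst (asm) cls_eq_iff) (auto simp: square_integrable_fourier square_integrable_symbol[OF b])
  then have ae: "AE \<xi> in lborel. bessel s \<xi> *\<^sub>R fourier u \<xi> = fn F \<xi>"
  proof eventually_elim
    case (elim \<xi>)
    have "bessel s \<xi> * bessel (- s) \<xi> = 1"
      by (simp flip: bessel_add)
    then show ?case
      by (simp add: elim)
  qed
  note [measurable] = square_integrable_measurable[OF square_integrable_fourier[OF u(1)]]
  have "square_integrable (\<lambda>\<xi>. bessel s \<xi> *\<^sub>R fourier u \<xi>)"
    by (rule square_integrable_cong_AE[OF square_integrable_fn[of F] _ ae]) measurable
  then have "u \<in> Hs s"
    using u by (simp add: Hs_iff)
  moreover have "J s u = F"
    unfolding J_def using cls_eqI[OF ae] by simp
  ultimately show ?thesis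
    by blast
qed

definition Jinv :: "real \<Rightarrow> 'n L2 \<Rightarrow> real^'n::finite \<Rightarrow> complex" where
  "Jinv s F = (SOME u. u \<in> Hs s \<and> J s u = F)"

lemma Jinv:
  assumes "s \<ge> 0"
  shows Jinv_in: "Jinv s F \<in> Hs s" and J_Jinv: "J s (Jinv s F) = F"
proof -
  have "\<exists>u. u \<in> Hs s \<and> J s u = F"
    using J_surj[OF assms, of F] by blast
  then have "Jinv s F \<in> Hs s \<and> J s (Jinv s F) = F"
    unfolding Jinv_def by (rule someI_ex)
  then show "Jinv s F \<in> Hs s" "J s (Jinv s F) = F"
    by auto
qed

lemma Hs_shift:
  fixes u :: "real^'n \<Rightarrow> complex"
  assumes u: "u \<in> Hs (s + \<theta>)" and \<theta>: "\<theta> \<ge> 0"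
  shows "u \<in> Hs s" "J s u = mul (bessel (- \<theta>)) (J (s + \<theta>) u)"
proof -
  have b: "bounded_symbol (bessel (- \<theta>) :: real^'n \<Rightarrow> real) 1"
    by (rule bounded_symbol_bessel[OF \<theta>])
  have eq: "bessel s \<xi> *\<^sub>R fourier u \<xi> = bessel (- \<theta>) \<xi> *\<^sub>R bessel (s + \<theta>) \<xi> *\<^sub>R fourier u \<xi>" for \<xi>
    using bessel_add[of "- \<theta>" "s + \<theta>" \<xi>] by simp
  show "u \<in> Hs s"
    unfolding Hs_iff eq using Hs_square_integrable[OF u] square_integrable_symbol[OF b Hs_weighted[OF u]] by simp
  show "J s u = mul (bessel (- \<theta>)) (J (s + \<theta>) u)"
    unfolding J_def eq by (rule mul_cls[OF Hs_weighted[OF u], symmetric])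
qed

text \<open>One class decides everything about a possibly unbounded multiplier: once the symbol
  times the weighted transform is represented by \<open>F\<close> in L2, both membership in the
  domain and the value follow.\<close>

lemma multiplier_J:
  fixes u :: "real^'n \<Rightarrow> complex"
  assumes s: "s \<ge> 0" and u: "u \<in> Hs s" and a: "a \<in> borel_measurable borel"
    and F: "AE \<xi> in lborel. fn F \<xi> = a \<xi> *\<^sub>R bessel s \<xi> *\<^sub>R fourier u \<xi>"
  shows "u \<in> multiplier_domain a" "multiplier a u \<in> Hs s" "J s (multiplier a u) = F"
proof -
  note [measurable] = a square_integrable_measurable[OF square_integrable_fourier[OF Hs_square_integrable[OF u]]]
  define v where "v = Jinv s F"
  have v: "v \<in> Hs s" "J s v = F"
    unfolding v_def using Jinv[OF s] by auto
  have "AE \<xi> in lborel. bessel s \<xi> *\<^sub>R fourier v \<xi> = fn F \<xi>"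
    using v(2) unfolding J_def by (metis cls_eq_iff cls_fn Hs_weighted square_integrable_fn v(1))
  with F have vf: "AE \<xi> in lborel. fourier v \<xi> = complex_of_real (a \<xi>) * fourier u \<xi>"
  proof eventually_elim
    case (elim \<xi>)
    then have "bessel s \<xi> *\<^sub>R fourier v \<xi> = bessel s \<xi> *\<^sub>R (complex_of_real (a \<xi>) * fourier u \<xi>)"
      by (simp add: scaleR_conv_of_real mult.left_commute)
    then show ?case
      using bessel_pos[of s \<xi>] by simp
  qed
  have vf': "AE \<xi> in lborel. complex_of_real (a \<xi>) * fourier u \<xi> = fourier v \<xi>"
    using vf by eventually_elim simp
  have "square_integrable (\<lambda>\<xi>. complex_of_real (a \<xi>) * fourier u \<xi>)"
    by (rule square_integrable_cong_AE[OF square_integrable_fourier[OF Hs_square_integrable[OF v(1)]] _ vf']) measurable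
  then show "u \<in> multiplier_domain a"
    using Hs_square_integrable[OF u] by (simp add: multiplier_domain_def)
  have "square_integrable (multiplier a u) \<and> (AE \<xi> in lborel. fourier (multiplier a u) \<xi> = complex_of_real (a \<xi>) * fourier u \<xi>)"
    unfolding multiplier_def by (rule someI[where x = v]) (use v vf Hs_square_integrable in auto)
  then have m: "square_integrable (multiplier a u)" "AE \<xi> in lborel. fourier (multiplier a u) \<xi> = complex_of_real (a \<xi>) * fourier u \<xi>"
    by auto
  note [measurable] = square_integrable_measurable[OF square_integrable_fourier[OF m(1)]]
  have ae: "AE \<xi> in lborel. bessel s \<xi> *\<^sub>R fourier (multiplier a u) \<xi> = bessel s \<xi> *\<^sub>R fourier v \<xi>"
    using m(2) vf by eventually_elim simp
  have "square_integrable (\<lambda>\<xi>. bessel s \<xi> *\<^sub>R fourier (multiplier a u) \<xi>)"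
    by (rule square_integrable_cong_AE[OF Hs_weighted[OF v(1)] _ ae]) measurable
  then show "multiplier a u \<in> Hs s"
    using m by (simp add: Hs_iff)
  show "J s (multiplier a u) = F"
    unfolding v(2)[symmetric] unfolding J_def by (rule cls_eqI[OF ae])
qed

lemma Hs_continuous_on_iff: "Hs_continuous_on s I f \<longleftrightarrow> (\<forall>t\<in>I. f t \<in> Hs s) \<and> continuous_on I (\<lambda>t. J s (f t))"
proof (cases "\<forall>t\<in>I. f t \<in> Hs s")
  case True
  have "((\<lambda>\<tau>. Hs_dist s (f \<tau>) (f t)) \<longlongrightarrow> 0) (at t within I) \<longleftrightarrow> ((\<lambda>\<tau>. J s (f \<tau>)) \<longlongrightarrow> J s (f t)) (at t within I)"
    if "t \<in> I" for t
  proof -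
    have "((\<lambda>\<tau>. Hs_dist s (f \<tau>) (f t)) \<longlongrightarrow> 0) (at t within I) \<longleftrightarrow> ((\<lambda>\<tau>. norm (J s (f \<tau>) - J s (f t))) \<longlongrightarrow> 0) (at t within I)"
      using True that by (intro filterlim_cong refl) (auto simp: eventually_at_filter Hs_dist_eq)
    then show ?thesis
      by (simp add: tendsto_norm_zero_iff LIM_zero_iff)
  qed
  then show ?thesis
    using True by (auto simp: Hs_continuous_on_def continuous_on_def)
next
  case False
  then show ?thesis
    unfolding Hs_continuous_on_def by blast
qed

lemma has_Hs_derivative_iff:
  assumes t: "t \<in> I"
  shows "has_Hs_derivative s I f d t \<longleftrightarrow> (\<forall>\<tau>\<in>I. f \<tau> \<in> Hs s) \<and> d \<in> Hs s \<and>
    ((\<lambda>\<tau>. (1 / (\<tau> - t)) *\<^sub>R (J s (f \<tau>) - J s (f t))) \<longlongrightarrow> J s d) (at t within I)"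
proof (cases "(\<forall>\<tau>\<in>I. f \<tau> \<in> Hs s) \<and> d \<in> Hs s")
  case True
  have "Hs_dist s (\<lambda>x. (f \<tau> x - f t x) / complex_of_real (\<tau> - t)) d = norm ((1 / (\<tau> - t)) *\<^sub>R (J s (f \<tau>) - J s (f t)) - J s d)"
    if "\<tau> \<in> I" for \<tau>
  proof -
    have fd: "(\<lambda>x. f \<tau> x - f t x) \<in> Hs s"
      using True that t by (intro Hs_diff) auto
    have "(\<lambda>x. (f \<tau> x - f t x) / complex_of_real (\<tau> - t)) = (\<lambda>x. (1 / (\<tau> - t)) *\<^sub>R (f \<tau> x - f t x))"
      by (simp add: fun_eq_iff scaleR_conv_of_real divide_inverse mult.commute)
    then show ?thesis
      using Hs_scaleR[OF fd, of "1 / (\<tau> - t)"] True that t by (simp add: Hs_dist_eq Hs_diff)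
  qed
  then have "((\<lambda>\<tau>. Hs_dist s (\<lambda>x. (f \<tau> x - f t x) / complex_of_real (\<tau> - t)) d) \<longlongrightarrow> 0) (at t within I)
      \<longleftrightarrow> ((\<lambda>\<tau>. norm ((1 / (\<tau> - t)) *\<^sub>R (J s (f \<tau>) - J s (f t)) - J s d)) \<longlongrightarrow> 0) (at t within I)"
    by (intro filterlim_cong refl) (auto simp: eventually_at_filter)
  then show ?thesis
    using True by (auto simp: has_Hs_derivative_def tendsto_norm_zero_iff LIM_zero_iff)
next
  case False
  then show ?thesis
    unfolding has_Hs_derivative_def by blast
qed

section \<open>The Bochner integral in Sobolev spaces\<close>

text \<open>J is linear on H^s, so it takes the explicit sum over level sets to the simple Bochner
  integral. The level sets of \<phi> may be finer than those of its image, whence the passage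
  through a partition.\<close>

lemma J_simple_integral_fun:
  assumes \<phi>: "Hs_simple s t \<phi>"
  shows "simple_integral_fun t \<phi> \<in> Hs s"
    and "J s (simple_integral_fun t \<phi>) = Bochner_Integration.simple_bochner_integral (lebesgue_on {0..t}) (\<lambda>\<tau>. J s (\<phi> \<tau>))"
    and "Bochner_Integration.simple_bochner_integrable (lebesgue_on {0..t}) (\<lambda>\<tau>. J s (\<phi> \<tau>))"
proof -
  let ?M = "lebesgue_on {0..t}"
  have sf: "simple_function ?M \<phi>" and sub: "\<phi> ` {0..t} \<subseteq> Hs s"
    using \<phi> by (auto simp: Hs_simple_def)
  have fin: "finite (\<phi> ` {0..t})"
    using simple_functionD(1)[OF sf] by simp
  have sf': "simple_function ?M (\<lambda>\<tau>. J s (\<phi> \<tau>))"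
    using simple_function_compose[OF sf, of "J s"] by (simp add: o_def)
  have finite_M: "emeasure ?M A < \<infinity>" for A
  proof -
    have "emeasure ?M A \<le> emeasure ?M (space ?M)"
      by (rule emeasure_space)
    also have "\<dots> < \<infinity>"
      by (simp add: emeasure_restrict_space emeasure_lborel_Icc_eq)
    finally show ?thesis .
  qed
  show sbi: "Bochner_Integration.simple_bochner_integrable ?M (\<lambda>\<tau>. J s (\<phi> \<tau>))"
    by (rule simple_bochner_integrable.intros[OF sf']) (use finite_M in \<open>simp add: less_top[symmetric]\<close>)
  have eq: "simple_integral_fun t \<phi> = (\<lambda>x. \<Sum>u\<in>\<phi> ` {0..t}. measure lebesgue {\<tau>\<in>{0..t}. \<phi> \<tau> = u} *\<^sub>R u x)"
    by (simp add: fun_eq_iff simple_integral_fun_def scaleR_conv_of_real)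
  show "simple_integral_fun t \<phi> \<in> Hs s"
    unfolding eq using sub by (intro Hs_sum Hs_scaleR) auto
  have "J s (simple_integral_fun t \<phi>) = (\<Sum>u\<in>\<phi> ` {0..t}. measure lebesgue {\<tau>\<in>{0..t}. \<phi> \<tau> = u} *\<^sub>R J s u)"
  proof -
    have "J s (simple_integral_fun t \<phi>) = (\<Sum>u\<in>\<phi> ` {0..t}. J s (\<lambda>x. measure lebesgue {\<tau>\<in>{0..t}. \<phi> \<tau> = u} *\<^sub>R u x))"
      unfolding eq using sub by (intro Hs_sum Hs_scaleR) auto
    also have "\<dots> = (\<Sum>u\<in>\<phi> ` {0..t}. measure lebesgue {\<tau>\<in>{0..t}. \<phi> \<tau> = u} *\<^sub>R J s u)"
      using sub by (intro sum.cong refl Hs_scaleR) auto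
    finally show ?thesis .
  qed
  also have "\<dots> = (\<Sum>u\<in>\<phi> ` space ?M. measure ?M {\<tau>\<in>space ?M. \<phi> \<tau> = u} *\<^sub>R J s u)"
  proof (intro sum.cong)
    fix u
    have "{\<tau>\<in>{0..t}. \<phi> \<tau> = u} = \<phi> -` {u} \<inter> space ?M"
      by auto
    then have "{\<tau>\<in>{0..t}. \<phi> \<tau> = u} \<in> sets ?M"
      using simple_functionD(2)[OF sf, of "{u}"] by simp
    then show "measure lebesgue {\<tau>\<in>{0..t}. \<phi> \<tau> = u} *\<^sub>R J s u = measure ?M {\<tau>\<in>space ?M. \<phi> \<tau> = u} *\<^sub>R J s u"
      using measure_restrict_space[of "{0..t}" lebesgue "{\<tau>\<in>{0..t}. \<phi> \<tau> = u}"] by (simp add: subset_eq)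
  qed auto
  also have "\<dots> = Bochner_Integration.simple_bochner_integral ?M (\<lambda>\<tau>. J s (\<phi> \<tau>))"
    by (intro simple_bochner_integral_partition[symmetric] sbi sf) auto
  finally show "J s (simple_integral_fun t \<phi>) = Bochner_Integration.simple_bochner_integral ?M (\<lambda>\<tau>. J s (\<phi> \<tau>))" .
qed

text \<open>Completeness of Lebesgue measure: a change on a null set keeps preimages
  measurable.\<close>

lemma borel_measurable_lebesgue_on_cong_AE:
  fixes h g :: "real \<Rightarrow> 'b::topological_space"
  assumes S: "S \<in> sets lebesgue" and h: "h \<in> borel_measurable (lebesgue_on S)"
    and ae: "AE \<tau> in lebesgue_on S. h \<tau> = g \<tau>"
  shows "g \<in> borel_measurable (lebesgue_on S)"
proof (rule borel_measurableI)
  fix U :: "'b set" assume "open U"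
  then have hU: "h -` U \<inter> S \<in> sets lebesgue"
    using measurable_sets[OF h, of U] S by (simp add: sets_restrict_space_iff)
  have "AE \<tau> in lebesgue. \<tau> \<in> S \<longrightarrow> h \<tau> = g \<tau>"
    using ae S by (simp add: AE_restrict_space_iff)
  then have "AE \<tau> in lebesgue. \<tau> \<in> h -` U \<inter> S \<longleftrightarrow> \<tau> \<in> g -` U \<inter> S"
    by eventually_elim auto
  then have "g -` U \<inter> S \<in> sets lebesgue"
    by (rule completion.in_sets_AE[OF _ hU]) simp
  then show "g -` U \<inter> space (lebesgue_on S) \<in> sets (lebesgue_on S)"
    using S by (simp add: sets_restrict_space_iff)
qed

text \<open>Together with \<open>has_Hs_integralI\<close> this identifies integration in H^s with
  Bochner integration of the transported function, whose measurability comes from the almost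
  everywhere limit of simple functions.\<close>

lemma has_Hs_integral_imp:
  assumes int: "has_Hs_integral s t f w"
  shows "has_bochner_integral (lebesgue_on {0..t}) (\<lambda>\<tau>. J s (f \<tau>)) (J s w)"
proof -
  let ?M = "lebesgue_on {0..t}"
  obtain \<phi> where w: "w \<in> Hs s" and f: "AE \<tau> in ?M. f \<tau> \<in> Hs s" and \<phi>: "\<And>i. Hs_simple s t (\<phi> i)"
    and lim: "AE \<tau> in ?M. (\<lambda>i. Hs_dist s (f \<tau>) (\<phi> i \<tau>)) \<longlonglongrightarrow> 0"
    and L1: "(\<lambda>i. \<integral>\<^sup>+\<tau>. ennreal (Hs_dist s (f \<tau>) (\<phi> i \<tau>)) \<partial>?M) \<longlonglongrightarrow> 0"
    and lim_w: "(\<lambda>i. Hs_dist s (simple_integral_fun t (\<phi> i)) w) \<longlonglongrightarrow> 0"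
    using int unfolding has_Hs_integral_def by blast
  have \<phi>_Hs: "\<phi> i \<tau> \<in> Hs s" if "\<tau> \<in> {0..t}" for i \<tau>
    using \<phi>[of i] that by (auto simp: Hs_simple_def)
  have AE_space: "AE \<tau> in ?M. \<tau> \<in> {0..t}"
    using AE_space[of ?M] by simp
  have meas_\<phi>: "(\<lambda>\<tau>. J s (\<phi> i \<tau>)) \<in> borel_measurable ?M" for i
    using J_simple_integral_fun(3)[OF \<phi>[of i]] by (auto elim: simple_bochner_integrable.cases intro: borel_measurable_simple_function)
  have dist_eq: "AE \<tau> in ?M. Hs_dist s (f \<tau>) (\<phi> i \<tau>) = norm (J s (f \<tau>) - J s (\<phi> i \<tau>))" for i
    using f AE_space by eventually_elim (simp add: Hs_dist_eq \<phi>_Hs)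
  have lim': "AE \<tau> in ?M. (\<lambda>i. J s (\<phi> i \<tau>)) \<longlonglongrightarrow> J s (f \<tau>)"
    using lim f AE_space
  proof eventually_elim
    case (elim \<tau>)
    then have "(\<lambda>i. norm (J s (\<phi> i \<tau>) - J s (f \<tau>))) \<longlonglongrightarrow> 0"
      by (simp add: Hs_dist_eq \<phi>_Hs norm_minus_commute)
    then show ?case
      by (simp add: tendsto_norm_zero_iff LIM_zero_iff)
  qed
  have meas_f: "(\<lambda>\<tau>. J s (f \<tau>)) \<in> borel_measurable ?M"
  proof -
    define h where "h \<tau> = lim (\<lambda>i. J s (\<phi> i \<tau>))" for \<tau>
    have "h \<in> borel_measurable ?M"
      unfolding h_def by (rule borel_measurable_lim_metric[OF meas_\<phi>])
    moreover have "AE \<tau> in ?M. h \<tau> = J s (f \<tau>)"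
      using lim' by eventually_elim (simp add: h_def limI)
    ultimately show ?thesis
      by (rule borel_measurable_lebesgue_on_cong_AE[rotated]) simp
  qed
  show ?thesis
  proof (rule has_bochner_integral.intros[OF meas_f, where s = "\<lambda>i \<tau>. J s (\<phi> i \<tau>)"])
    show "Bochner_Integration.simple_bochner_integrable ?M (\<lambda>\<tau>. J s (\<phi> i \<tau>))" for i
      by (rule J_simple_integral_fun(3)[OF \<phi>])
    have "(\<integral>\<^sup>+\<tau>. ennreal (Hs_dist s (f \<tau>) (\<phi> i \<tau>)) \<partial>?M) = (\<integral>\<^sup>+\<tau>. ennreal (norm (J s (f \<tau>) - J s (\<phi> i \<tau>))) \<partial>?M)" for i
      using dist_eq[of i] by (intro nn_integral_cong_AE) (auto elim!: AE_mp)
    then show "(\<lambda>i. \<integral>\<^sup>+\<tau>. ennreal (norm (J s (f \<tau>) - J s (\<phi> i \<tau>))) \<partial>?M) \<longlonglongrightarrow> 0"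
      using L1 by simp
    have "(\<lambda>i. norm (J s (simple_integral_fun t (\<phi> i)) - J s w)) \<longlonglongrightarrow> 0"
      using lim_w by (simp add: Hs_dist_eq J_simple_integral_fun(1)[OF \<phi>] w)
    then show "(\<lambda>i. Bochner_Integration.simple_bochner_integral ?M (\<lambda>\<tau>. J s (\<phi> i \<tau>))) \<longlonglongrightarrow> J s w"
      by (simp add: tendsto_norm_zero_iff LIM_zero_iff J_simple_integral_fun(2)[OF \<phi>])
  qed
qed

lemma has_Hs_integralI:
  assumes s: "s \<ge> 0" and w: "w \<in> Hs s" and f: "AE \<tau> in lebesgue_on {0..t}. f \<tau> \<in> Hs s"
    and int: "has_bochner_integral (lebesgue_on {0..t}) (\<lambda>\<tau>. J s (f \<tau>)) (J s w)"
  shows "has_Hs_integral s t f w"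
proof -
  let ?M = "lebesgue_on {0..t}"
  have intf: "integrable ?M (\<lambda>\<tau>. J s (f \<tau>))"
    using int by (rule integrable.intros)
  obtain S where S0: "\<forall>i. simple_function ?M (S i)" "\<forall>x\<in>space ?M. (\<lambda>i. S i x) \<longlonglongrightarrow> J s (f x)"
    "\<forall>i. \<forall>x\<in>space ?M. dist (S i x) 0 \<le> 2 * dist (J s (f x)) 0"
    using borel_measurable_implies_sequence_metric[OF borel_measurable_integrable[OF intf], of 0] by blast
  then have S: "\<And>i. simple_function ?M (S i)" "\<And>\<tau>. \<tau> \<in> space ?M \<Longrightarrow> (\<lambda>i. S i \<tau>) \<longlonglongrightarrow> J s (f \<tau>)"
    "\<And>i \<tau>. \<tau> \<in> space ?M \<Longrightarrow> norm (S i \<tau>) \<le> 2 * norm (J s (f \<tau>))"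
    by auto
  \<comment> \<open>\<open>Jinv\<close> fixes one function per class, so pulling back a simple
    function keeps its range finite.\<close>
  define \<phi> where "\<phi> i \<tau> = Jinv s (S i \<tau>)" for i \<tau>
  have J\<phi>: "J s (\<phi> i \<tau>) = S i \<tau>" and \<phi>_Hs: "\<phi> i \<tau> \<in> Hs s" for i \<tau>
    unfolding \<phi>_def using Jinv[OF s] by auto
  have \<phi>: "Hs_simple s t (\<phi> i)" for i
    unfolding Hs_simple_def \<phi>_def using simple_function_compose[OF S(1), of "Jinv s" i] Jinv_in[OF s] by (auto simp: o_def)
  have dist_eq: "AE \<tau> in ?M. Hs_dist s (f \<tau>) (\<phi> i \<tau>) = norm (J s (f \<tau>) - S i \<tau>)" for i
    using f by eventually_elim (simp add: Hs_dist_eq \<phi>_Hs J\<phi>)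
  have AE_space: "AE \<tau> in ?M. \<tau> \<in> space ?M"
    by (rule AE_space)
  have meas_S: "S i \<in> borel_measurable ?M" for i
    by (rule borel_measurable_simple_function[OF S(1)])
  have int_S: "integrable ?M (S i)" for i
    using S(3)[of _ i] by (intro Bochner_Integration.integrable_bound[OF integrable_norm[OF integrable_scaleR_right[OF intf, of 2]] meas_S]) auto
  have L1: "(\<lambda>i. LINT \<tau>|?M. norm (J s (f \<tau>) - S i \<tau>)) \<longlonglongrightarrow> (LINT \<tau>|?M. 0)"
  proof (rule integral_dominated_convergence[where w = "\<lambda>\<tau>. 3 * norm (J s (f \<tau>))"])
    show "integrable ?M (\<lambda>\<tau>. 3 * norm (J s (f \<tau>)))"
      by (intro integrable_mult_right integrable_norm intf)
    show "AE \<tau> in ?M. (\<lambda>i. norm (J s (f \<tau>) - S i \<tau>)) \<longlonglongrightarrow> 0"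
      using AE_space
    proof eventually_elim
      case (elim \<tau>)
      then have "(\<lambda>i. norm (J s (f \<tau>) - S i \<tau>)) \<longlonglongrightarrow> norm (J s (f \<tau>) - J s (f \<tau>))"
        by (intro tendsto_intros S)
      then show ?case by simp
    qed
    show "AE \<tau> in ?M. norm (norm (J s (f \<tau>) - S i \<tau>)) \<le> 3 * norm (J s (f \<tau>))" for i
      using AE_space
    proof eventually_elim
      case (elim \<tau>)
      then show ?case
        using S(3)[OF elim, of i] norm_triangle_ineq4[of "J s (f \<tau>)" "S i \<tau>"] by simp
    qed
  qed (use meas_S borel_measurable_integrable[OF intf] in measurable)
  have nn: "(\<integral>\<^sup>+\<tau>. ennreal (Hs_dist s (f \<tau>) (\<phi> i \<tau>)) \<partial>?M) = ennreal (LINT \<tau>|?M. norm (J s (f \<tau>) - S i \<tau>))" for i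
  proof -
    have "(\<integral>\<^sup>+\<tau>. ennreal (Hs_dist s (f \<tau>) (\<phi> i \<tau>)) \<partial>?M) = (\<integral>\<^sup>+\<tau>. ennreal (norm (J s (f \<tau>) - S i \<tau>)) \<partial>?M)"
      using dist_eq[of i] by (intro nn_integral_cong_AE) (auto elim!: AE_mp)
    also have "\<dots> = ennreal (LINT \<tau>|?M. norm (J s (f \<tau>) - S i \<tau>))"
      by (intro nn_integral_eq_integral integrable_norm Bochner_Integration.integrable_diff intf int_S) auto
    finally show ?thesis .
  qed
  show ?thesis
    unfolding has_Hs_integral_def
  proof (intro conjI exI[of _ \<phi>] allI \<phi> w f)
    show "AE \<tau> in ?M. (\<lambda>i. Hs_dist s (f \<tau>) (\<phi> i \<tau>)) \<longlonglongrightarrow> 0"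
      using f AE_space
    proof eventually_elim
      case (elim \<tau>)
      have "(\<lambda>i. norm (J s (f \<tau>) - S i \<tau>)) \<longlonglongrightarrow> norm (J s (f \<tau>) - J s (f \<tau>))"
        by (intro tendsto_intros S elim)
      then show ?case
        by (simp add: Hs_dist_eq elim \<phi>_Hs J\<phi>)
    qed
    show "(\<lambda>i. \<integral>\<^sup>+\<tau>. ennreal (Hs_dist s (f \<tau>) (\<phi> i \<tau>)) \<partial>?M) \<longlonglongrightarrow> 0"
      unfolding nn using tendsto_ennrealI[OF L1] by simp
    have "J s (simple_integral_fun t (\<phi> i)) = integral\<^sup>L ?M (S i)" for i
      using J_simple_integral_fun(2,3)[OF \<phi>, of i] by (simp add: J\<phi> simple_bochner_integrable_eq_integral)
    moreover have "J s w = (LINT \<tau>|?M. J s (f \<tau>))"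
      using int by (simp add: has_bochner_integral_integral_eq)
    ultimately have le: "norm (Hs_dist s (simple_integral_fun t (\<phi> i)) w) \<le> (LINT \<tau>|?M. norm (J s (f \<tau>) - S i \<tau>))" for i
      using integral_norm_bound[of ?M "\<lambda>\<tau>. S i \<tau> - J s (f \<tau>)"]
      by (simp add: Hs_dist_eq J_simple_integral_fun(1)[OF \<phi>] w Bochner_Integration.integral_diff intf int_S norm_minus_commute)
    have "(\<lambda>i. LINT \<tau>|?M. norm (J s (f \<tau>) - S i \<tau>)) \<longlonglongrightarrow> 0"
      using L1 by simp
    then show "(\<lambda>i. Hs_dist s (simple_integral_fun t (\<phi> i)) w) \<longlonglongrightarrow> 0"
      by (rule Lim_null_comparison[OF always_eventually[OF allI[OF le]]])
  qed
qed

text \<open>The integrand is prescribed at interior times only: kernels may be singular at the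
  endpoints, and v(0) need not lie in the domain of the fractional Laplacian. The choice made by
  \<open>Hs_integral\<close> disappears under J.\<close>

lemma Hs_integral_eq:
  assumes s: "s \<ge> 0" and t: "t > 0" and f: "\<And>\<tau>. 0 < \<tau> \<Longrightarrow> \<tau> < t \<Longrightarrow> f \<tau> \<in> Hs s \<and> J s (f \<tau>) = F \<tau>"
    and int: "integrable lborel (\<lambda>\<tau>. indicator {0<..<t} \<tau> *\<^sub>R F \<tau>)"
  shows "Hs_integrable s t f" "Hs_integral s t f \<in> Hs s"
    "J s (Hs_integral s t f) = (LINT \<tau>|lborel. indicator {0<..<t} \<tau> *\<^sub>R F \<tau>)"
proof -
  let ?M = "lebesgue_on {0..t}"
  let ?I = "LINT \<tau>|lborel. indicator {0<..<t} \<tau> *\<^sub>R F \<tau>"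
  have "AE \<tau> in lebesgue. \<tau> \<noteq> 0 \<and> \<tau> \<noteq> t"
    using AE_lborel_singleton[of "0::real"] AE_lborel_singleton[of t] by (simp add: AE_completion_iff)
  then have interior: "AE \<tau> in ?M. 0 < \<tau> \<and> \<tau> < t"
    by (subst AE_restrict_space_iff) (auto elim!: AE_mp)
  have f_Hs: "AE \<tau> in ?M. f \<tau> \<in> Hs s"
    using interior by eventually_elim (simp add: f)
  have "has_bochner_integral lebesgue (\<lambda>\<tau>. indicator {0<..<t} \<tau> *\<^sub>R F \<tau>) ?I"
    using int by (simp add: has_bochner_integral_iff integrable_completion integral_completion borel_measurable_integrable)
  moreover have eq: "(\<lambda>\<tau>. indicator {0..t} \<tau> *\<^sub>R (indicator {0<..<t} \<tau> *\<^sub>R F \<tau>)) = (\<lambda>\<tau>. indicator {0<..<t} \<tau> *\<^sub>R F \<tau>)"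
    by (auto simp: indicator_def fun_eq_iff)
  moreover have cond: "{0..t} \<inter> space lebesgue \<in> sets lebesgue"
    by simp
  ultimately have "has_bochner_integral ?M (\<lambda>\<tau>. indicator {0<..<t} \<tau> *\<^sub>R F \<tau>) ?I"
    unfolding has_bochner_integral_restrict_space[OF cond] eq by blast
  moreover have AE_eq: "AE \<tau> in ?M. indicator {0<..<t} \<tau> *\<^sub>R F \<tau> = J s (f \<tau>)"
    using interior by eventually_elim (simp add: f)
  ultimately have hb: "has_bochner_integral ?M (\<lambda>\<tau>. J s (f \<tau>)) ?I"
    by (subst has_bochner_integral_cong_AE[symmetric])
      (auto intro: borel_measurable_lebesgue_on_cong_AE borel_measurable_has_bochner_integral)
  have ex: "has_Hs_integral s t f (Jinv s ?I)"
    using hb by (intro has_Hs_integralI[OF s Jinv_in[OF s] f_Hs]) (simp add: J_Jinv[OF s])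
  then show "Hs_integrable s t f"
    unfolding Hs_integrable_def by blast
  have some: "has_Hs_integral s t f (Hs_integral s t f)"
    unfolding Hs_integral_def by (rule someI[of "has_Hs_integral s t f", OF ex])
  then show "Hs_integral s t f \<in> Hs s"
    by (simp add: has_Hs_integral_def)
  show "J s (Hs_integral s t f) = ?I"
    using has_Hs_integral_imp[OF some] hb by (rule has_bochner_integral_eq)
qed

section \<open>Kernels satisfying condition (H)\<close>

lemma integral_reflect:
  fixes f :: "real \<Rightarrow> 'a::{banach, second_countable_topology}"
  shows "(LINT \<tau>|lborel. f (t - \<tau>)) = (LINT \<tau>|lborel. f \<tau>)"
  using lborel_integral_real_affine[of "-1" f t] by simp

lemma integrable_reflect:
  fixes f :: "real \<Rightarrow> 'a::{banach, second_countable_topology}"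
  shows "integrable lborel f \<Longrightarrow> integrable lborel (\<lambda>\<tau>. f (t - \<tau>))"
  using lborel_integrable_real_affine[of f "-1" t] by simp

text \<open>Measurability of \<open>f\<close> follows from completeness of Lebesgue measure, so an
  integrand known almost everywhere can be replaced by a Borel one.\<close>

lemma lebesgue_integral_cong_borel:
  fixes f g :: "real \<Rightarrow> real"
  assumes g: "g \<in> borel_measurable borel" and ae: "AE t in lborel. f t = g t"
  shows "(LINT t|lebesgue. f t) = (LINT t|lborel. g t)"
proof -
  have g': "g \<in> borel_measurable lebesgue"
    using g by (intro measurable_completion) simp
  have "AE t in lborel. g t = f t"
    using ae by eventually_elim simp
  then have "AE t in lebesgue_on UNIV. g t = f t"
    unfolding lebesgue_on_UNIV_eq by (rule AE_completion)
  then have "f \<in> borel_measurable (lebesgue_on UNIV)"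
    using g' by (intro borel_measurable_lebesgue_on_cong_AE[of UNIV g f]) (simp_all only: lebesgue_on_UNIV_eq, simp)
  then have "f \<in> borel_measurable lebesgue"
    by (simp only: lebesgue_on_UNIV_eq)
  then have "(LINT t|lebesgue. f t) = (LINT t|lebesgue. g t)"
    by (rule integral_cong_AE[OF _ g' AE_completion[OF ae]])
  also have "\<dots> = (LINT t|lborel. g t)"
    using g by (intro integral_completion) simp
  finally show ?thesis .
qed

text \<open>Bridges two conventions: the Lebesgue integral over [0,t] with arbitrary kernel values
  at t \<le> 0, and the Borel integral over the line with extension by zero. The integrands may
  differ only at \<tau> = 0 and \<tau> = t.\<close>

lemma time_conv_eq_conv:
  assumes a: "a \<in> borel_measurable borel" and f: "f \<in> borel_measurable borel"
    and eq: "\<And>t. t > 0 \<Longrightarrow> a0 t = a t" "\<And>t. t > 0 \<Longrightarrow> f0 t = f t"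
    and z: "\<And>t. t \<le> 0 \<Longrightarrow> a t = 0" "\<And>t. t < 0 \<Longrightarrow> f t = 0"
  shows "time_conv a0 f0 t = conv a f t"
proof -
  note [measurable] = a f
  have "time_conv a0 f0 t = (LINT \<tau>|lborel. a (t - \<tau>) * f \<tau>)"
    unfolding time_conv_def set_lebesgue_integral_def
  proof (rule lebesgue_integral_cong_borel)
    have "AE \<tau> in lborel. \<tau> \<noteq> 0" "AE \<tau> in lborel. \<tau> \<noteq> t"
      by (rule AE_lborel_singleton)+
    then show "AE \<tau> in lborel. indicator {0..t} \<tau> *\<^sub>R (a0 (t - \<tau>) * f0 \<tau>) = a (t - \<tau>) * f \<tau>"
    proof eventually_elim
      case (elim \<tau>)
      then consider "\<tau> < 0" | "0 < \<tau>" "\<tau> < t" | "t < \<tau>" "0 < \<tau>"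
        by linarith
      then show ?case
        by cases (simp_all add: eq z)
    qed
  qed measurable
  also have "\<dots> = conv a f t"
    using integral_reflect[of "\<lambda>\<tau>. a \<tau> * f (t - \<tau>)" t] by (simp add: conv_def)
  finally show ?thesis .
qed

lemma antimono_on_halfline_measurable:
  fixes a0 :: "real \<Rightarrow> real"
  assumes "antimono_on {0<..} a0"
  shows "(\<lambda>t. if t > 0 then a0 t else 0) \<in> borel_measurable borel"
proof -
  have "mono_on {0<..} (\<lambda>t. - a0 t)"
    using assms by (auto simp: monotone_on_def)
  then have "(\<lambda>t. - a0 t) \<in> borel_measurable (restrict_space borel {0<..})"
    by (rule borel_measurable_mono_on_fnc)
  then have "(\<lambda>t. indicator {0<..} t *\<^sub>R (- a0 t)) \<in> borel_measurable borel"
    by (subst (asm) borel_measurable_restrict_space_iff) simp_all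
  then have "(\<lambda>t. - (indicator {0<..} t *\<^sub>R (- a0 t))) \<in> borel_measurable borel"
    by (rule borel_measurable_uminus)
  moreover have "(\<lambda>t. - (indicator {0<..} t *\<^sub>R (- a0 t))) = (\<lambda>t. if t > 0 then a0 t else 0)"
    by (auto simp: fun_eq_iff)
  ultimately show ?thesis
    by (simp only:)
qed

lemma L1_loc_halfline_integrable:
  assumes a0: "L1_loc_halfline a0" and meas: "(\<lambda>t. if t > 0 then a0 t else 0) \<in> borel_measurable borel"
  shows "integrable lborel (\<lambda>t. (if t > 0 then a0 t else 0) * indicator {..1} t)" (is "integrable lborel ?f")
proof -
  have b: "?f \<in> borel_measurable lborel"
    using borel_measurable_times[OF meas borel_measurable_indicator[of "{..1}"]] by simp
  have "integrable lebesgue (\<lambda>t. indicator {0..1} t *\<^sub>R a0 t)"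
    using a0[unfolded L1_loc_halfline_def, rule_format, of 1] unfolding set_integrable_def by simp
  then have "integrable lebesgue ?f"
  proof (rule Bochner_Integration.integrable_bound)
    show "?f \<in> borel_measurable lebesgue"
      by (rule measurable_completion[OF b])
    show "AE t in lebesgue. norm (?f t) \<le> norm (indicator {0..1} t *\<^sub>R a0 t)"
      by (intro AE_I2) (auto simp: indicator_def)
  qed
  then show ?thesis
    using integrable_completion[OF b] by blast
qed

text \<open>Serves before the sign of \<open>p\<close> is known: up to a time T the function p -
  p(T) is a nonnegative kernel, and the constant p(T) is a multiple of the unit kernel.\<close>

lemma conv_integrable_antimono:
  assumes k: "kernel k" and p: "p \<in> borel_measurable borel" "\<And>t. t \<le> 0 \<Longrightarrow> p t = 0"
      "\<And>t u. 0 < t \<Longrightarrow> t \<le> u \<Longrightarrow> p u \<le> p t"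
    and int: "integrable lborel (\<lambda>t. p t * indicator {..1} t)"
  shows "integrable lborel (\<lambda>\<tau>. k \<tau> * p (t - \<tau>))"
proof -
  note [measurable] = p(1)
  define T where "T = max t 1"
  define q where "q u = (if u \<le> 0 then 0 else p (min u T) - p T)" for u
  have T: "T \<ge> 1" "t \<le> T"
    by (simp_all add: T_def)
  have q: "kernel q"
    unfolding kernel_def
  proof (intro conjI allI impI)
    show "q \<in> borel_measurable borel"
      unfolding q_def by measurable
    show "q u = 0" if "u \<le> 0" for u
      using that by (simp add: q_def)
    show "0 \<le> q u" for u
      using p(3)[of "min u T" T] T by (simp add: q_def)
    show "q v \<le> q u" if "0 < u" "u \<le> v" for u v
    proof -
      have "p (min v T) \<le> p (min u T)"
        using that T by (intro p(3)) auto
      then show ?thesis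
        using that by (simp add: q_def)
    qed
    have "q u * indicator {..1} u = p u * indicator {..1} u - p T * (unit_kernel u * indicator {..1} u)" for u
      using T p(2)[of u] by (cases "u \<le> 0"; cases "u \<le> 1") (simp_all add: q_def min_absorb1)
    then show "integrable lborel (\<lambda>u. q u * indicator {..1} u)"
      using kernel_step int by (simp add: kernel_def)
  qed
  have eq: "k \<tau> * p (t - \<tau>) = k \<tau> * q (t - \<tau>) + p T * (k \<tau> * unit_kernel (t - \<tau>))" for \<tau>
  proof (cases "0 < \<tau> \<and> \<tau> < t")
    case True
    then have "min (t - \<tau>) T = t - \<tau>"
      using T by simp
    then show ?thesis
      using True by (simp add: q_def algebra_simps)
  next
    case False
    then show ?thesis
      using kernel_zero[OF k, of \<tau>] p(2)[of "t - \<tau>"] by (cases "\<tau> \<le> 0") (simp_all add: q_def)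
  qed
  show ?thesis
    unfolding eq by (intro Bochner_Integration.integrable_add integrable_mult_right conv_kernel_integrable k q kernel_step)
qed

text \<open>Nonnegativity of \<open>m\<^sub>\<gamma>\<close> is not assumed: if \<open>m\<^sub>\<gamma>\<close> had a zero \<open>t\<^sub>1\<close> beyond which it becomes
  negative, the identity in condition (H) could not hold both at \<open>t\<^sub>1\<close> and at later times.\<close>

lemma condition_H_volterra:
  assumes \<gamma>: "\<gamma> > 0" and H: "condition_H \<gamma> m" and anti: "antimono_on {0<..} m" and cont: "continuous_on {0<..} m"
  shows "\<exists>k \<beta>. volterra (\<lambda>t. if t > 0 then m_gamma \<gamma> m t else 0) k \<beta>"
proof -
  define p where "p = (\<lambda>t. if t > 0 then m_gamma \<gamma> m t else 0)"
  obtain k0 \<beta> where k0: "L1_loc_halfline k0" "\<forall>t>0. k0 t \<ge> 0" "antimono_on {0<..} k0" and \<beta>: "\<beta> \<ge> 0"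
    and eq0: "\<forall>t>0. \<beta> * m_gamma \<gamma> m t + time_conv k0 (m_gamma \<gamma> m) t = 1"
    using H unfolding condition_H_def by blast
  define k where "k = (\<lambda>t. if t > 0 then k0 t else 0)"
  have k_anti: "k u \<le> k t" if "0 < t" "t \<le> u" for t u
    using k0(3) that by (auto simp: k_def monotone_on_def)
  have k: "kernel k"
    unfolding kernel_def
  proof (intro conjI allI impI)
    show "k \<in> borel_measurable borel"
      unfolding k_def by (rule antimono_on_halfline_measurable[OF k0(3)])
    show "k t = 0" if "t \<le> 0" for t
      using that by (simp add: k_def)
    show "0 \<le> k t" for t
      using k0(2) by (simp add: k_def)
    show "integrable lborel (\<lambda>t. k t * indicator {..1} t)"
      unfolding k_def by (rule L1_loc_halfline_integrable[OF k0(1) antimono_on_halfline_measurable[OF k0(3)]])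
  qed (rule k_anti)
  have anti': "antimono_on {0<..} (m_gamma \<gamma> m)"
    using anti \<gamma> by (auto simp: monotone_on_def m_gamma_def)
  have p_anti: "p u \<le> p t" if "0 < t" "t \<le> u" for t u
    using anti' that by (auto simp: p_def monotone_on_def)
  have p0: "p t = 0" if "t \<le> 0" for t
    using that by (simp add: p_def)
  have p_meas: "p \<in> borel_measurable borel"
    unfolding p_def by (rule antimono_on_halfline_measurable[OF anti'])
  have "L1_loc_halfline (m_gamma \<gamma> m)"
    unfolding L1_loc_halfline_def set_integrable_def
  proof (intro allI impI)
    fix b :: real assume b: "b > 0"
    have eq: "(\<lambda>t. indicator {0..b} t *\<^sub>R m_gamma \<gamma> m t) = (\<lambda>t. indicator {0..b} t + \<gamma> * (indicator {0..b} t *\<^sub>R m t))"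
      by (auto simp: m_gamma_def fun_eq_iff indicator_def)
    have "integrable lebesgue (\<lambda>t. indicator {0..b} t *\<^sub>R m t)"
      using H b unfolding condition_H_def L1_loc_halfline_def set_integrable_def by blast
    moreover have "integrable lebesgue (indicator {0..b} :: real \<Rightarrow> real)"
      using b by (intro integrable_real_indicator) auto
    ultimately show "integrable lebesgue (\<lambda>t. indicator {0..b} t *\<^sub>R m_gamma \<gamma> m t)"
      unfolding eq by (intro Bochner_Integration.integrable_add integrable_mult_right)
  qed
  then have p_int: "integrable lborel (\<lambda>t. p t * indicator {..1} t)"
    unfolding p_def by (rule L1_loc_halfline_integrable[OF _ antimono_on_halfline_measurable[OF anti']])
  have p_cont: "continuous_on {0<..} p"
  proof (rule continuous_on_eq)
    show "continuous_on {0<..} (\<lambda>t. 1 + \<gamma> * m t)"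
      by (intro continuous_intros cont)
  qed (simp add: p_def m_gamma_def)
  have eq: "\<beta> * p t + conv k p t = 1" if "t > 0" for t
  proof -
    have "time_conv k0 (m_gamma \<gamma> m) t = conv k p t"
      by (rule time_conv_eq_conv[OF kernel_measurable[OF k] p_meas]) (simp_all add: k_def p_def)
    moreover have "p t = m_gamma \<gamma> m t"
      using that by (simp add: p_def)
    ultimately show ?thesis
      using eq0[rule_format, OF that] by (simp only:)
  qed
  have conv_eq: "conv k p t = (LINT u|lborel. k (t - u) * p u)" for t
    using integral_reflect[of "\<lambda>\<tau>. k \<tau> * p (t - \<tau>)" t] by (simp add: conv_def)
  have int: "integrable lborel (\<lambda>u. k (t - u) * p u)" for t
    using integrable_reflect[OF conv_integrable_antimono[OF k p_meas p0 p_anti p_int], of t t] by simp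
  have p_nonneg: "p t \<ge> 0" for t
  proof (rule ccontr)
    assume "\<not> p t \<ge> 0"
    then have t: "t > 0" "p t < 0"
      using p0[of t] by force+
    \<comment> \<open>Were p negative throughout (0,t), both terms of the identity at t would be
      nonpositive, yet their sum is 1.\<close>
    have "\<exists>a. 0 < a \<and> a < t \<and> p a \<ge> 0"
    proof (rule ccontr)
      assume n: "\<nexists>a. 0 < a \<and> a < t \<and> p a \<ge> 0"
      have le0: "k (t - u) * p u \<le> 0" for u
      proof (cases "0 < u \<and> u < t")
        case True
        then have "p u \<le> 0"
          using n by force
        then show ?thesis
          using kernel_nonneg[OF k] by (simp add: mult_nonneg_nonpos)
      next
        case False
        then show ?thesis
          using kernel_zero[OF k, of "t - u"] p0[of u] by (cases "u \<le> 0") simp_all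
      qed
      have "conv k p t \<le> (LINT u|(lborel :: real measure). 0)"
        unfolding conv_eq by (rule integral_mono[OF int]) (use le0 in simp_all)
      moreover have "\<beta> * p t \<le> 0"
        using \<beta> t by (simp add: mult_nonneg_nonpos)
      ultimately show False
        using eq[OF t(1)] by simp
    qed
    then obtain a where a: "0 < a" "a < t" "p a \<ge> 0"
      by blast
    have "continuous_on {a..t} p"
      by (rule continuous_on_subset[OF p_cont]) (use a in auto)
    then obtain t1 where t1: "a \<le> t1" "t1 \<le> t" "p t1 = 0"
      using IVT2'[of p t 0 a] a t by auto
    \<comment> \<open>At the zero t1 of p the whole value 1 comes from the convolution, so k does
      not vanish identically.\<close>
    have "\<exists>\<sigma>>0. k \<sigma> > 0"
    proof (rule ccontr)
      assume n: "\<not> (\<exists>\<sigma>>0. k \<sigma> > 0)"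
      have "k u = 0" for u
      proof (cases "u > 0")
        case True
        then have "\<not> k u > 0"
          using n by blast
        then show ?thesis
          using kernel_nonneg[OF k, of u] by linarith
      next
        case False
        then show ?thesis
          using kernel_zero[OF k, of u] by simp
      qed
      then have "conv k p t1 = 0"
        by (simp add: conv_def)
      then show False
        using eq[of t1] t1 a by simp
    qed
    then obtain \<sigma> where \<sigma>: "\<sigma> > 0" "k \<sigma> > 0"
      by blast
    \<comment> \<open>Passing from time t1 to t + \<sigma>: before t1, where p \<ge> 0, the values
      of k only decrease; after t1 contributions are nonpositive; on (t,t + \<sigma>) they are at
      most k(\<sigma>) p(t) < 0.\<close>
    have pt: "k (t + \<sigma> - u) * p u \<le> k (t1 - u) * p u + (k \<sigma> * p t) * indicator {t<..<t + \<sigma>} u" for u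
    proof -
      consider "u \<le> 0" | "0 < u" "u < t1" | "t1 \<le> u" "u \<le> t" | "t < u" "u < t + \<sigma>" | "t + \<sigma> \<le> u"
        by linarith
      then show ?thesis
      proof cases
        case 1
        then show ?thesis
          using t by (simp add: p0)
      next
        case 2
        have "p u \<ge> 0"
          using p_anti[of u t1] 2 t1 by simp
        moreover have "k (t + \<sigma> - u) \<le> k (t1 - u)"
          using 2 t1 \<sigma> by (intro k_anti) auto
        ultimately show ?thesis
          using 2 t1 by (simp add: mult_right_mono)
      next
        case 3
        have "p u \<le> 0"
          using p_anti[of t1 u] 3 t1 a by simp
        then have "k (t + \<sigma> - u) * p u \<le> 0"
          using kernel_nonneg[OF k] by (simp add: mult_nonneg_nonpos)
        then show ?thesis
          using 3 kernel_zero[OF k, of "t1 - u"] by simp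
      next
        case 4
        have pu: "p u \<le> p t"
          using p_anti[of t u] 4 t by simp
        have "k (t + \<sigma> - u) * p u \<le> k \<sigma> * p u"
          using 4 pu t by (intro mult_right_mono_neg k_anti) auto
        also have "\<dots> \<le> k \<sigma> * p t"
          using pu \<sigma> by (intro mult_left_mono) auto
        finally show ?thesis
          using 4 t1 kernel_zero[OF k, of "t1 - u"] by simp
      next
        case 5
        then show ?thesis
          using t1 \<sigma> kernel_zero[OF k, of "t1 - u"] kernel_zero[OF k, of "t + \<sigma> - u"] by simp
      qed
    qed
    have ind: "integrable lborel (indicator {t<..<t + \<sigma>} :: real \<Rightarrow> real)"
      using \<sigma> by (intro integrable_real_indicator) (auto simp: emeasure_lborel_Ioo)
    have "conv k p (t + \<sigma>) \<le> (LINT u|lborel. k (t1 - u) * p u + (k \<sigma> * p t) * indicator {t<..<t + \<sigma>} u)"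
      unfolding conv_eq
      by (rule integral_mono[OF int _ pt]) (intro Bochner_Integration.integrable_add int integrable_mult_right ind)
    also have "\<dots> = (LINT u|lborel. k (t1 - u) * p u) + (LINT u|lborel. (k \<sigma> * p t) * indicator {t<..<t + \<sigma>} u)"
      by (intro Bochner_Integration.integral_add int integrable_mult_right ind)
    also have "\<dots> = conv k p t1 + k \<sigma> * p t * \<sigma>"
      unfolding conv_eq using \<sigma> by simp
    finally have "conv k p (t + \<sigma>) \<le> conv k p t1 + k \<sigma> * p t * \<sigma>" .
    moreover have "k \<sigma> * p t * \<sigma> < 0"
      by (intro mult_neg_pos mult_pos_neg \<sigma> t)
    moreover have "\<beta> * p (t + \<sigma>) \<le> 0"
      using \<beta> p_anti[of t "t + \<sigma>"] t \<sigma> by (simp add: mult_nonneg_nonpos)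
    ultimately show False
      using eq[of t1] eq[of "t + \<sigma>"] t1 a t \<sigma> by simp
  qed
  have "kernel p"
    unfolding kernel_def using p_meas p0 p_nonneg p_anti p_int by blast
  then have "volterra p k \<beta>"
    using k \<beta> p_cont eq by (intro volterra.intro)
  then show ?thesis
    unfolding p_def by blast
qed

section \<open>The primitive of the kernel and its powers\<close>

text \<open>The integrand is the derivative of M^\<epsilon> / \<epsilon>, which tends to 0 at 0;
  because the derivative is nonnegative, the fundamental theorem delivers integrability along with
  the value.\<close>

lemma integrable_powr_deriv:
  fixes M q :: "real \<Rightarrow> real"
  assumes M0: "(M \<longlongrightarrow> 0) (at_right 0)" and pos: "\<And>t. t > 0 \<Longrightarrow> M t > 0"
    and der: "\<And>t. t > 0 \<Longrightarrow> (M has_real_derivative q t) (at t)"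
    and q: "continuous_on {0<..} q" "\<And>t. t > 0 \<Longrightarrow> q t \<ge> 0" and \<epsilon>: "\<epsilon> > 0"
  shows "integrable lborel (\<lambda>\<tau>. indicator {0<..<T} \<tau> * (q \<tau> * M \<tau> powr (\<epsilon> - 1)))"
proof (cases "T > 0")
  case True
  let ?f = "\<lambda>\<tau>. q \<tau> * M \<tau> powr (\<epsilon> - 1)" and ?F = "\<lambda>\<tau>. M \<tau> powr \<epsilon> / \<epsilon>"
  have "continuous_on {0<..} M"
    using der by (intro continuous_at_imp_continuous_on ballI DERIV_isCont) auto
  moreover have "\<forall>x\<in>{0<..}. M x \<noteq> 0"
    using pos by (metis greaterThan_iff less_irrefl)
  ultimately have "continuous_on {0<..} ?f"
    by (intro continuous_on_mult q continuous_on_powr continuous_on_const)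
  then have isC: "isCont ?f \<tau>" if "\<tau> > 0" for \<tau>
    using that by (simp add: continuous_on_eq_continuous_at)
  have derF: "(?F has_real_derivative ?f x) (at x)" if x: "x > 0" for x
    using DERIV_cdivide[OF DERIV_fun_powr[OF der[OF x] pos[OF x], of \<epsilon>], of \<epsilon>] \<epsilon> by (simp add: mult.commute)
  have "set_integrable lborel (einterval (ereal 0) (ereal T)) ?f"
  proof (rule interval_integral_FTC_nonneg(1)[where F = ?F and A = 0 and B = "?F T"])
    show "ereal 0 < ereal T"
      using True by simp
    show "DERIV ?F x :> ?f x" if "ereal 0 < ereal x" "ereal x < ereal T" for x
      using that by (intro derF) simp
    show "isCont ?f x" if "ereal 0 < ereal x" "ereal x < ereal T" for x
      using that by (intro isC) simp
    show "AE x in lborel. ereal 0 < ereal x \<longrightarrow> ereal x < ereal T \<longrightarrow> 0 \<le> ?f x"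
      using q(2) by (intro AE_I2) simp
    have "\<forall>\<^sub>F x in at_right 0. M x \<ge> 0"
      using eventually_at_right_less[of "0::real"] by eventually_elim (use pos less_imp_le in blast)
    then have "((\<lambda>\<tau>. M \<tau> powr \<epsilon>) \<longlongrightarrow> 0 powr \<epsilon>) (at_right 0)"
      using \<epsilon> by (intro tendsto_powr'[OF M0 tendsto_const]) simp
    then have "(?F \<longlongrightarrow> 0 powr \<epsilon> / \<epsilon>) (at_right 0)"
      using \<epsilon> by (intro tendsto_divide tendsto_const) simp_all
    then show "((?F \<circ> real_of_ereal) \<longlongrightarrow> 0) (at_right (ereal 0))"
      unfolding ereal_tendsto_simps1 by simp
    have "(?F \<longlongrightarrow> ?F T) (at T)"
      using DERIV_isCont[OF derF[OF True]] by (simp only: isCont_def)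
    then show "((?F \<circ> real_of_ereal) \<longlongrightarrow> ?F T) (at_left (ereal T))"
      unfolding ereal_tendsto_simps1 by (rule tendsto_mono[OF at_le[OF subset_UNIV]])
  qed
  then show ?thesis
    unfolding set_integrable_def einterval_eq by simp
next
  case False
  then show ?thesis
    by simp
qed

context volterra
begin

lemma s_gamma_eq_sol:
  assumes mg: "\<And>t. t > 0 \<Longrightarrow> p t = m_gamma \<gamma> m t" and \<nu>: "\<nu> \<ge> 0"
  shows "s_gamma \<gamma> m \<nu> = sol \<nu>"
proof -
  have tc: "time_conv (m_gamma \<gamma> m) f t = conv p f t" if f: "causal f" for f t
    by (rule time_conv_eq_conv[OF kernel_measurable[OF p] causal_measurable[OF f]])
      (use f kernel_zero[OF p] mg in \<open>simp_all add: causal_def\<close>)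
  have iff: "(continuous_on {0..} f \<and> (\<forall>t<0. f t = 0) \<and> (\<forall>t\<ge>0. f t + \<nu> * time_conv (m_gamma \<gamma> m) f t = 1))
      \<longleftrightarrow> solution \<nu> f" for f
  proof (cases "causal f")
    case True
    then have "continuous_on {0..} f" "\<forall>t<0. f t = 0"
      by (auto simp: causal_def)
    then show ?thesis
      using True by (simp add: solution_def tc)
  next
    case False
    then show ?thesis
      by (auto simp: solution_def causal_def)
  qed
  show ?thesis
    unfolding s_gamma_def iff
  proof (rule the_equality)
    show "solution \<nu> (sol \<nu>)"
      by (rule sol[OF \<nu>])
    show "f = sol \<nu>" if "solution \<nu> f" for f
      by (rule solution_unique[OF \<nu> that sol[OF \<nu>]])
  qed
qed

lemma mass_mono: "t \<le> u \<Longrightarrow> mass t \<le> mass u"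
  unfolding mass_def conv_def
  by (intro integral_mono conv_integrable_causal p causal_step mult_left_mono kernel_nonneg[OF p])
    (auto simp: indicator_def)

lemma mass_zero: "t \<le> 0 \<Longrightarrow> mass t = 0"
  using conv_neg[OF p causal_step, of t] conv_zero[OF p causal_step] by (cases "t = 0") (simp_all add: mass_def)

lemma mass_ge:
  assumes u: "u > 0"
  shows "u * p u \<le> mass u"
proof -
  have "(LINT \<tau>|lborel. p u * indicator {0<..u} \<tau>) \<le> mass u"
    unfolding mass_def conv_def
  proof (rule integral_mono)
    show "integrable lborel (\<lambda>\<tau>. p u * indicator {0<..u} \<tau>)"
      using u by (intro integrable_mult_right integrable_real_indicator) (auto simp: emeasure_lborel_Ioc)
    show "integrable lborel (\<lambda>\<tau>. p \<tau> * step (u - \<tau>))"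
      by (rule conv_integrable_causal[OF p causal_step])
    show "p u * indicator {0<..u} \<tau> \<le> p \<tau> * step (u - \<tau>)" for \<tau>
      using kernel_antimono[OF p, of \<tau> u] kernel_nonneg[OF p, of \<tau>] by (cases "0 < \<tau> \<and> \<tau> \<le> u") auto
  qed
  then show ?thesis
    using u by (simp add: mult.commute)
qed

text \<open>By condition (H) the kernel is positive somewhere, hence at all earlier times, so M
  grows at least linearly at first and does not decrease afterwards. This compares powers of M with
  powers of time.\<close>

lemma mass_linear_bound: "\<exists>c>0. \<forall>\<tau>. 0 < \<tau> \<longrightarrow> \<tau> \<le> T \<longrightarrow> c * \<tau> \<le> mass \<tau>"
proof -
  have "\<exists>t>0. p t > 0"
  proof (rule ccontr)
    assume n: "\<not> (\<exists>t>0. p t > 0)"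
    have "p t = 0" for t
    proof (cases "t > 0")
      case True
      then have "\<not> p t > 0"
        using n by blast
      then show ?thesis
        using kernel_nonneg[OF p, of t] by linarith
    next
      case False
      then show ?thesis
        using kernel_zero[OF p, of t] by simp
    qed
    then show False
      using pk[of 1] by (simp add: conv_def)
  qed
  then obtain t where t: "t > 0" "p t > 0"
    by blast
  \<comment> \<open>The slope p(t) works up to time t; for t < \<tau> \<le> T it is lowered so that
    the line stays below t p(t), a lower bound of M(t).\<close>
  define c where "c = p t * min 1 (t / max T t)"
  have "c * \<tau> \<le> mass \<tau>" if \<tau>: "0 < \<tau>" "\<tau> \<le> T" for \<tau>
  proof (cases "\<tau> \<le> t")
    case True
    have "c \<le> p t * 1"
      unfolding c_def using t by (intro mult_left_mono) auto
    then have "c * \<tau> \<le> p t * \<tau>"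
      using \<tau> by (simp add: mult_right_mono)
    also have "\<dots> \<le> \<tau> * p \<tau>"
      using kernel_antimono[OF p \<tau>(1) True] \<tau> by simp
    also have "\<dots> \<le> mass \<tau>"
      by (rule mass_ge[OF \<tau>(1)])
    finally show ?thesis .
  next
    case False
    have "c * \<tau> \<le> (p t * (t / max T t)) * max T t"
      unfolding c_def using t \<tau> by (intro mult_mono mult_left_mono) auto
    also have "\<dots> = t * p t"
      using t by simp
    also have "\<dots> \<le> mass t"
      by (rule mass_ge[OF t(1)])
    also have "\<dots> \<le> mass \<tau>"
      using False by (intro mass_mono) simp
    finally show ?thesis .
  qed
  moreover have "c > 0"
    using t by (simp add: c_def)
  ultimately show ?thesis
    by blast
qed

lemma mass_pos: "t > 0 \<Longrightarrow> mass t > 0"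
proof -
  assume t: "t > 0"
  obtain c where "c > 0" "c * t \<le> mass t"
    using mass_linear_bound[of t] t by blast
  then show "mass t > 0"
    using t by (meson less_le_trans mult_pos_pos)
qed

lemma mass_deriv:
  assumes t: "t > 0"
  shows "(mass has_real_derivative p t) (at t)"
proof -
  define \<delta> where "\<delta> = t / 2"
  have \<delta>: "0 < \<delta>" "\<delta> < t"
    using t by (simp_all add: \<delta>_def)
  note [measurable] = kernel_measurable[OF p]
  have pc: "continuous_on {\<delta>..u} p" for u
    by (rule continuous_on_subset[OF p_cont]) (use \<delta> in auto)
  have eq: "mass \<delta> + integral {\<delta>..u} p = mass u" if u: "u \<ge> \<delta>" for u
  proof -
    have "mass u - mass \<delta> = (LINT \<tau>|lborel. p \<tau> * step (u - \<tau>) - p \<tau> * step (\<delta> - \<tau>))"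
      unfolding mass_def conv_def
      by (intro Bochner_Integration.integral_diff[symmetric] conv_integrable_causal p causal_step)
    also have "\<dots> = (LINT \<tau>:{\<delta>..u}|lborel. p \<tau>)"
      unfolding set_lebesgue_integral_def
    proof (rule integral_cong_AE)
      have "AE \<tau> in lborel. \<tau> \<noteq> \<delta>"
        by (rule AE_lborel_singleton)
      then show "AE \<tau> in lborel. p \<tau> * step (u - \<tau>) - p \<tau> * step (\<delta> - \<tau>) = indicator {\<delta>..u} \<tau> *\<^sub>R p \<tau>"
        by eventually_elim (use u in \<open>auto simp: indicator_def\<close>)
    qed measurable
    also have "\<dots> = integral {\<delta>..u} p"
      by (intro set_borel_integral_eq_integral borel_integrable_atLeastAtMost' pc)
    finally show ?thesis
      by simp
  qed
  have "((\<lambda>u. integral {\<delta>..u} p) has_real_derivative p t) (at t within {\<delta>..t + 1})"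
    using \<delta> by (intro integral_has_real_derivative pc) auto
  moreover have "at t within {\<delta>..t + 1} = at t"
    using \<delta> by (intro at_within_interior) auto
  ultimately have "((\<lambda>u. mass \<delta> + integral {\<delta>..u} p) has_real_derivative 0 + p t) (at t)"
    by (intro DERIV_add DERIV_const) simp
  moreover have "\<forall>\<^sub>F u in nhds t. mass \<delta> + integral {\<delta>..u} p = mass u"
    using eventually_nhds_in_open[of "{\<delta><..}" t] \<delta> by (auto simp: eq elim!: eventually_mono)
  ultimately show ?thesis
    by (subst (asm) DERIV_cong_ev[of t t _ mass "0 + p t" "p t"]) auto
qed

lemma p_mass_powr_integrable:
  assumes "\<epsilon> > 0"
  shows "integrable lborel (\<lambda>\<tau>. indicator {0<..<T} \<tau> * (p \<tau> * mass \<tau> powr (\<epsilon> - 1)))"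
proof (rule integrable_powr_deriv[OF _ mass_pos mass_deriv p_cont kernel_nonneg[OF p] assms])
  have "(mass \<longlongrightarrow> mass 0) (at 0 within {0..})"
    using causal_cont[OF mass_causal order_refl] by (simp add: continuous_on_def)
  then show "(mass \<longlongrightarrow> 0) (at_right 0)"
    unfolding mass_zero[OF order_refl] by (rule tendsto_mono[OF at_le, rotated]) auto
qed

text \<open>The nonpositive exponent makes the power nonincreasing, and the linear lower bound for M
  dominates it near 0 by a multiple of \<tau>^(\<epsilon>-1).\<close>

lemma mass_powr_kernel:
  assumes \<epsilon>: "0 < \<epsilon>" "\<epsilon> \<le> 1"
  shows "kernel (\<lambda>t. mass t powr (\<epsilon> - 1))"
  unfolding kernel_def
proof (intro conjI allI impI)
  note [measurable] = causal_measurable[OF mass_causal]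
  show meas: "(\<lambda>t. mass t powr (\<epsilon> - 1)) \<in> borel_measurable borel"
    by measurable
  \<comment> \<open>\<open>powr\<close> with base 0 is 0 for every exponent, so the power already
    has the value that a kernel must take at t \<le> 0.\<close>
  show "mass t powr (\<epsilon> - 1) = 0" if "t \<le> 0" for t
    using mass_zero[OF that] by simp
  show "mass u powr (\<epsilon> - 1) \<le> mass t powr (\<epsilon> - 1)" if "0 < t" "t \<le> u" for t u
    using \<epsilon> that by (intro powr_mono2' mass_pos mass_mono) auto
  obtain c where c: "c > 0" "\<And>\<tau>. 0 < \<tau> \<Longrightarrow> \<tau> \<le> 1 \<Longrightarrow> c * \<tau> \<le> mass \<tau>"
    using mass_linear_bound[of 1] by blast
  have "integrable lborel (\<lambda>\<tau>. indicator {0<..<2} \<tau> * (1 * \<tau> powr (\<epsilon> - 1)))"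
    by (rule integrable_powr_deriv[of "\<lambda>\<tau>. \<tau>" "\<lambda>_. 1"]) (use \<epsilon> in \<open>auto intro!: tendsto_ident_at DERIV_ident\<close>)
  then have "integrable lborel (\<lambda>\<tau>. c powr (\<epsilon> - 1) * (indicator {0<..<2} \<tau> * (1 * \<tau> powr (\<epsilon> - 1))))"
    by (rule integrable_mult_right)
  then show "integrable lborel (\<lambda>t. mass t powr (\<epsilon> - 1) * indicator {..1} t)"
  proof (rule Bochner_Integration.integrable_bound)
    show "(\<lambda>t. mass t powr (\<epsilon> - 1) * indicator {..1} t) \<in> borel_measurable lborel"
      by measurable
    have "mass \<tau> powr (\<epsilon> - 1) * indicator {..1} \<tau> \<le> c powr (\<epsilon> - 1) * (indicator {0<..<2} \<tau> * (1 * \<tau> powr (\<epsilon> - 1)))" for \<tau>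
    proof (cases "0 < \<tau> \<and> \<tau> \<le> 1")
      case True
      then have "mass \<tau> powr (\<epsilon> - 1) \<le> (c * \<tau>) powr (\<epsilon> - 1)"
        using \<epsilon> c by (intro powr_mono2') auto
      then show ?thesis
        using True by (simp add: powr_mult)
    next
      case False
      then show ?thesis
        using mass_zero[of \<tau>] by (cases "\<tau> \<le> 0") auto
    qed
    then show "AE \<tau> in lborel. norm (mass \<tau> powr (\<epsilon> - 1) * indicator {..1} \<tau>)
        \<le> norm (c powr (\<epsilon> - 1) * (indicator {0<..<2} \<tau> * (1 * \<tau> powr (\<epsilon> - 1))))"
      by (intro AE_I2) (simp add: abs_mult)
  qed
qed simp

end

text \<open>Interpolation: \<nu> s c splits into \<nu>^\<epsilon> c, at most 1, and
  \<nu>^(1-\<epsilon>) s. As 0 \<le> 1 - \<epsilon> \<le> 1, the power (\<nu> M)^(1-\<epsilon>) is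
  at most 1 + \<nu> M, which the decay of s absorbs; the factor M^(\<epsilon>-1) is left
  over.\<close>

lemma symbol_bound:
  fixes \<nu> M s c \<epsilon> :: real
  assumes \<nu>: "\<nu> \<ge> 0" and M: "M > 0" and \<epsilon>: "0 < \<epsilon>" "\<epsilon> \<le> 1" and s: "s \<ge> 0" "s * (1 + \<nu> * M) \<le> 1"
    and c: "c \<ge> 0" "\<nu> powr \<epsilon> * c \<le> 1"
  shows "\<nu> * s * c \<le> M powr (\<epsilon> - 1)"
proof (cases "\<nu> = 0")
  case False
  then have \<nu>: "\<nu> > 0"
    using \<nu> by simp
  have x: "(\<nu> * M) powr (1 - \<epsilon>) \<le> 1 + \<nu> * M"
  proof (cases "\<nu> * M \<le> 1")
    case True
    have "(\<nu> * M) powr (1 - \<epsilon>) \<le> 1"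
      using True \<nu> M \<epsilon> by (intro powr_le1) auto
    also have "\<dots> \<le> 1 + \<nu> * M"
      using \<nu> M by simp
    finally show ?thesis .
  next
    case False
    then have "(\<nu> * M) powr (1 - \<epsilon>) \<le> (\<nu> * M) powr 1"
      using \<epsilon> by (intro powr_mono) auto
    then show ?thesis
      using \<nu> M by simp
  qed
  have "\<nu> = \<nu> powr \<epsilon> * \<nu> powr (1 - \<epsilon>)"
    using \<nu> by (simp flip: powr_add)
  then have "\<nu> * s * c = (\<nu> powr \<epsilon> * c) * (\<nu> powr (1 - \<epsilon>) * s)"
    by (metis mult.assoc mult.commute)
  also have "\<dots> \<le> 1 * (\<nu> powr (1 - \<epsilon>) * s)"
    using c s by (intro mult_right_mono) auto
  also have "\<nu> powr (1 - \<epsilon>) = (\<nu> * M) powr (1 - \<epsilon>) * M powr (\<epsilon> - 1)"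
    using M by (simp add: powr_mult mult.assoc flip: powr_add)
  also have "1 * ((\<nu> * M) powr (1 - \<epsilon>) * M powr (\<epsilon> - 1) * s) = ((\<nu> * M) powr (1 - \<epsilon>) * s) * M powr (\<epsilon> - 1)"
    by simp
  also have "\<dots> \<le> ((1 + \<nu> * M) * s) * M powr (\<epsilon> - 1)"
    using x s by (intro mult_right_mono) auto
  also have "\<dots> \<le> 1 * M powr (\<epsilon> - 1)"
    using s by (intro mult_right_mono) (auto simp: mult.commute)
  finally show ?thesis
    by simp
qed simp

section \<open>Multiplication operators with Volterra symbols\<close>

lemma bounded_symbol_mono: "bounded_symbol a K \<Longrightarrow> K \<le> L \<Longrightarrow> bounded_symbol a L"
  unfolding bounded_symbol_def using order_trans by blast

lemma mul_cmult:
  assumes "bounded_symbol a K"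
  shows "mul (\<lambda>\<xi>. r * a \<xi>) F = r *\<^sub>R mul a F"
proof -
  have "mul (\<lambda>\<xi>. r * a \<xi>) F = cls (\<lambda>\<xi>. r *\<^sub>R (a \<xi> *\<^sub>R fn F \<xi>))"
    by (simp add: mul_def)
  also have "\<dots> = r *\<^sub>R mul a F"
    unfolding mul_def by (rule cls_scaleR[OF square_integrable_symbol[OF assms square_integrable_fn]])
  finally show ?thesis .
qed

lemma mul_zero_symbol: "mul (\<lambda>\<xi>. 0) F = 0"
  using mul_cmult[of "\<lambda>_. 0" 0 0 F] by (simp add: bounded_symbol_def)

lemma mul_symbol_diff:
  assumes "bounded_symbol a K" "bounded_symbol b L"
  shows "mul (\<lambda>\<xi>. a \<xi> - b \<xi>) F = mul a F - mul b F"
proof -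
  have "mul (\<lambda>\<xi>. a \<xi> - b \<xi>) F = cls (\<lambda>\<xi>. a \<xi> *\<^sub>R fn F \<xi> - b \<xi> *\<^sub>R fn F \<xi>)"
    by (simp add: mul_def scaleR_diff_left)
  also have "\<dots> = mul a F - mul b F"
    unfolding mul_def by (intro cls_diff square_integrable_symbol[OF assms(1)] square_integrable_symbol[OF assms(2)] square_integrable_fn)
  finally show ?thesis .
qed

lemma bounded_linear_mul:
  assumes "bounded_symbol a K"
  shows "bounded_linear (mul a)"
proof (rule bounded_linear_intro[where K = K])
  show "norm (mul a F) \<le> norm F * K" for F
    using norm_mul_le[OF assms, of F] by (simp add: mult.commute)
qed (rule mul_add[OF assms] mul_scaleR[OF assms])+

lemma operator_family_mul:
  fixes a :: "real \<Rightarrow> real^'n \<Rightarrow> real"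
  assumes a: "\<And>\<sigma>. \<sigma> > 0 \<Longrightarrow> bounded_symbol (a \<sigma>) (b \<sigma>)" and cont: "\<And>\<xi>. continuous_on {0<..} (\<lambda>\<sigma>. a \<sigma> \<xi>)"
    and b: "continuous_on {0<..} b" "\<And>\<sigma>. 0 \<le> b \<sigma>" "\<And>t. integrable lborel (\<lambda>\<sigma>. indicator {0<..<t} \<sigma> * b \<sigma>)"
  shows "operator_family (\<lambda>\<sigma>. mul (a \<sigma>)) b"
  unfolding operator_family_def
proof (intro conjI allI impI b)
  show "mul (a \<sigma>) (x - y) = mul (a \<sigma>) x - mul (a \<sigma>) y" if "\<sigma> > 0" for \<sigma> x y
    by (rule mul_diff[OF a[OF that]])
  show "norm (mul (a \<sigma>) x) \<le> b \<sigma> * norm x" if "\<sigma> > 0" for \<sigma> x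
    by (rule norm_mul_le[OF a[OF that]])
  show "continuous_on {0<..} (\<lambda>\<sigma>. mul (a \<sigma>) x)" for x
  proof (rule continuous_on_sequentiallyI)
    fix u :: "nat \<Rightarrow> real" and \<sigma> :: real
    assume u: "\<forall>n. u n \<in> {0<..}" "\<sigma> \<in> {0<..}" "u \<longlonglongrightarrow> \<sigma>"
    have "(\<lambda>n. b (u n)) \<longlonglongrightarrow> b \<sigma>"
      by (intro continuous_on_tendsto_compose[OF b(1)] u always_eventually)
    then have "Bseq (\<lambda>n. b (u n))"
      by (rule convergent_imp_Bseq[OF convergentI])
    then obtain K where K: "\<forall>n. norm (b (u n)) \<le> K"
      by (rule BseqE)
    show "(\<lambda>n. mul (a (u n)) x) \<longlonglongrightarrow> mul (a \<sigma>) x"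
    proof (rule mul_tendsto)
      show "bounded_symbol (a (u n)) K" for n
        using u(1) K[rule_format, of n] by (intro bounded_symbol_mono[OF a]) auto
      show "bounded_symbol (a \<sigma>) (b \<sigma>)"
        using u(2) by (intro a) simp
      show "(\<lambda>n. a (u n) \<xi>) \<longlonglongrightarrow> a \<sigma> \<xi>" for \<xi>
        by (intro continuous_on_tendsto_compose[OF cont] u always_eventually)
    qed
  qed
qed

text \<open>Tested against an arbitrary element, both sides are the same double integral over time
  and frequency; Fubini applies because the symbols are bounded by the integrable
  \<open>b\<close>.\<close>

lemma mul_integral:
  fixes a :: "real \<Rightarrow> real^'n \<Rightarrow> real" and x :: "'n L2"
  assumes meas: "(\<lambda>z. a (fst z) (snd z)) \<in> borel_measurable borel"
    and bound: "\<And>u \<xi>. \<bar>a u \<xi>\<bar> \<le> b u" and b: "integrable lborel b"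
    and int: "integrable lborel (\<lambda>u. mul (a u) x)"
  shows "(LINT u|lborel. mul (a u) x) = mul (\<lambda>\<xi>. LINT u|lborel. a u \<xi>) x"
proof -
  let ?A = "\<lambda>\<xi>. LINT u|lborel. a u \<xi>"
  have sect: "(\<lambda>\<xi>. (u, \<xi>)) \<in> borel_measurable borel" for u :: real
    by (intro borel_measurable_continuous_onI continuous_intros)
  have sect': "(\<lambda>u. (u, \<xi>)) \<in> borel_measurable borel" for \<xi> :: "real^'n"
    by (intro borel_measurable_continuous_onI continuous_intros)
  have flip: "(\<lambda>z. (snd z, fst z)) \<in> borel_measurable (borel :: ((real^'n) \<times> real) measure)"
    by (intro borel_measurable_continuous_onI continuous_intros)
  have a_\<xi>: "a u \<in> borel_measurable borel" for u
    using measurable_compose[OF sect meas, of u] by simp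
  have a_u: "(\<lambda>u. a u \<xi>) \<in> borel_measurable borel" for \<xi>
    using measurable_compose[OF sect' meas, of \<xi>] by simp
  have sym: "bounded_symbol (a u) (b u)" for u
    using a_\<xi> bound by (simp add: bounded_symbol_def)
  have le: "\<bar>a u \<xi>\<bar> \<le> \<bar>b u\<bar>" for u \<xi>
    by (rule order_trans[OF bound abs_ge_self])
  have intu: "integrable lborel (\<lambda>u. a u \<xi>)" for \<xi>
    by (rule Bochner_Integration.integrable_bound[OF b]) (use a_u le in simp_all)
  have "(\<lambda>z. a (snd z) (fst z)) \<in> borel_measurable (borel :: ((real^'n) \<times> real) measure)"
    using measurable_compose[OF flip meas] by simp
  then have "case_prod (\<lambda>\<xi> u. a u \<xi>) \<in> borel_measurable (lborel \<Otimes>\<^sub>M lborel)"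
    by (simp add: case_prod_unfold lborel_prod)
  then have "?A \<in> borel_measurable lborel"
    by (rule lborel.borel_measurable_lebesgue_integral)
  then have A_meas: "?A \<in> borel_measurable borel"
    by simp
  have A_bound: "\<bar>?A \<xi>\<bar> \<le> integral\<^sup>L lborel b" for \<xi>
  proof -
    have "\<bar>?A \<xi>\<bar> \<le> (LINT u|lborel. \<bar>a u \<xi>\<bar>)"
      by (rule integral_abs_bound)
    also have "\<dots> \<le> integral\<^sup>L lborel b"
      by (intro integral_mono integrable_abs intu b bound)
    finally show ?thesis .
  qed
  have symA: "bounded_symbol ?A (integral\<^sup>L lborel b)"
    using A_meas A_bound by (simp add: bounded_symbol_def)
  have "(LINT u|lborel. mul (a u) x) \<bullet> y = mul ?A x \<bullet> y" for y
  proof -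
    define h where "h \<xi> = fn x \<xi> \<bullet> fn y \<xi>" for \<xi>
    have h: "integrable lborel h"
      unfolding h_def by (rule square_integrable_inner) simp_all
    have h_meas: "h \<in> borel_measurable lborel"
      by (rule borel_measurable_integrable[OF h])
    have ip: "mul c x \<bullet> y = (LINT \<xi>|lborel. c \<xi> * h \<xi>)" if "bounded_symbol c L" for c L
      using inner_cls[OF square_integrable_symbol[OF that square_integrable_fn[of x]] square_integrable_fn[of y]]
      by (simp add: mul_def h_def)
    define f where "f = (\<lambda>z. a (fst z) (snd z) * h (snd z))"
    have f_pt: "f (u, \<xi>) = a u \<xi> * h \<xi>" for u \<xi>
      by (simp add: f_def)
    have meas_f: "f \<in> borel_measurable (lborel \<Otimes>\<^sub>M lborel)"
      unfolding f_def
    proof (rule borel_measurable_times)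
      show "(\<lambda>z. a (fst z) (snd z)) \<in> borel_measurable (lborel \<Otimes>\<^sub>M lborel)"
        using meas by (simp add: lborel_prod)
      show "(\<lambda>z. h (snd z)) \<in> borel_measurable (lborel \<Otimes>\<^sub>M lborel)"
        by (rule measurable_compose[OF measurable_snd h_meas])
    qed
    have f_le: "\<bar>a u \<xi> * h \<xi>\<bar> \<le> \<bar>b u\<bar> * \<bar>h \<xi>\<bar>" for u \<xi>
      unfolding abs_mult by (rule mult_right_mono[OF le abs_ge_zero])
    have int_w: "integrable lborel (\<lambda>\<xi>. a u \<xi> * h \<xi>)" for u
    proof (rule Bochner_Integration.integrable_bound)
      show "integrable lborel (\<lambda>\<xi>. b u * \<bar>h \<xi>\<bar>)"
        by (intro integrable_mult_right integrable_abs h)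
      show "(\<lambda>\<xi>. a u \<xi> * h \<xi>) \<in> borel_measurable lborel"
        using a_\<xi>[of u] h_meas by (intro borel_measurable_times) simp_all
      show "AE \<xi> in lborel. norm (a u \<xi> * h \<xi>) \<le> norm (b u * \<bar>h \<xi>\<bar>)"
        using f_le by (intro AE_I2) (simp add: abs_mult)
    qed
    have int_f: "integrable (lborel \<Otimes>\<^sub>M lborel) f"
    proof (rule lborel_pair.Fubini_integrable[OF meas_f])
      show "AE u in lborel. integrable lborel (\<lambda>\<xi>. f (u, \<xi>))"
        unfolding f_pt using int_w by simp
      show "integrable lborel (\<lambda>u. LINT \<xi>|lborel. norm (f (u, \<xi>)))"
      proof (rule Bochner_Integration.integrable_bound)
        show "integrable lborel (\<lambda>u. b u * (LINT \<xi>|lborel. \<bar>h \<xi>\<bar>))"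
          by (intro integrable_mult_left b)
        show "(\<lambda>u. LINT \<xi>|lborel. norm (f (u, \<xi>))) \<in> borel_measurable lborel"
          using meas_f by measurable
        show "AE u in lborel. norm (LINT \<xi>|lborel. norm (f (u, \<xi>))) \<le> norm (b u * (LINT \<xi>|lborel. \<bar>h \<xi>\<bar>))"
        proof (rule AE_I2)
          fix u :: real
          have "(LINT \<xi>|lborel. norm (f (u, \<xi>))) \<le> (LINT \<xi>|lborel. \<bar>b u\<bar> * \<bar>h \<xi>\<bar>)"
            unfolding f_pt real_norm_def
            by (intro integral_mono integrable_abs int_w integrable_mult_right h f_le)
          then show "norm (LINT \<xi>|lborel. norm (f (u, \<xi>))) \<le> norm (b u * (LINT \<xi>|lborel. \<bar>h \<xi>\<bar>))"
            by (simp add: abs_mult)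
        qed
      qed
    qed
    have "(LINT u|lborel. mul (a u) x) \<bullet> y = (LINT u|lborel. mul (a u) x \<bullet> y)"
      using int by simp
    also have "\<dots> = (LINT u|lborel. LINT \<xi>|lborel. f (u, \<xi>))"
      by (simp only: ip[OF sym] f_pt)
    also have "\<dots> = (LINT \<xi>|lborel. LINT u|lborel. f (u, \<xi>))"
      using int_f by (intro lborel_pair.Fubini_integral[symmetric]) (simp add: case_prod_unfold)
    also have "\<dots> = (LINT \<xi>|lborel. ?A \<xi> * h \<xi>)"
      by (simp add: f_pt)
    also have "\<dots> = mul ?A x \<bullet> y"
      by (rule ip[OF symA, symmetric])
    finally show ?thesis .
  qed
  then show ?thesis
    using vector_eq_rdot by blast
qed

text \<open>The weight \<open>w\<close> vanishes at nonpositive times, where neither a bound on the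
  symbols nor continuity is available.\<close>

lemma operator_family_integral:
  fixes a :: "real \<Rightarrow> real^'n \<Rightarrow> real" and x :: "'n L2"
  assumes a_meas: "(\<lambda>z. a (fst z) (snd z)) \<in> borel_measurable borel"
    and fam: "operator_family (\<lambda>\<sigma>. mul (a \<sigma>)) b" and bound: "\<And>\<sigma>. \<sigma> > 0 \<Longrightarrow> bounded_symbol (a \<sigma>) (b \<sigma>)"
    and w: "w \<in> borel_measurable borel" "\<And>u. u \<le> 0 \<Longrightarrow> w u = 0" and int: "integrable lborel (\<lambda>u. \<bar>w u\<bar> * b u)"
  shows "integrable lborel (\<lambda>u. w u *\<^sub>R mul (a u) x)" (is ?int)
    and "(LINT u|lborel. w u *\<^sub>R mul (a u) x) = mul (\<lambda>\<xi>. LINT u|lborel. w u * a u \<xi>) x" (is ?eq)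
proof -
  have eq: "w u *\<^sub>R mul (a u) x = mul (\<lambda>\<xi>. w u * a u \<xi>) x" for u
  proof (cases "u > 0")
    case True
    then show ?thesis
      by (rule mul_cmult[OF bound, symmetric])
  next
    case False
    then show ?thesis
      by (simp add: w(2) mul_zero_symbol)
  qed
  show ?int
  proof (rule Bochner_Integration.integrable_bound)
    show "integrable lborel (\<lambda>u. (\<bar>w u\<bar> * b u) * norm x)"
      by (rule integrable_mult_left[OF int])
    have "continuous_on {0<..} (\<lambda>\<sigma>. mul (a \<sigma>) x)"
      using fam by (simp add: operator_family_def)
    then have "(\<lambda>u. w u *\<^sub>R (indicator {0<..} u *\<^sub>R mul (a u) x)) \<in> borel_measurable borel"
      by (intro borel_measurable_scaleR w(1) borel_measurable_continuous_on_indicator) auto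
    moreover have "w u *\<^sub>R (indicator {0<..} u *\<^sub>R mul (a u) x) = w u *\<^sub>R mul (a u) x" for u
      using w(2)[of u] by (cases "u > 0") simp_all
    ultimately have "(\<lambda>u. w u *\<^sub>R mul (a u) x) \<in> borel_measurable borel"
      by (simp only:)
    then show "(\<lambda>u. w u *\<^sub>R mul (a u) x) \<in> borel_measurable lborel"
      by simp
    show "AE u in lborel. norm (w u *\<^sub>R mul (a u) x) \<le> norm ((\<bar>w u\<bar> * b u) * norm x)"
    proof (rule AE_I2)
      fix u :: real
      show "norm (w u *\<^sub>R mul (a u) x) \<le> norm ((\<bar>w u\<bar> * b u) * norm x)"
      proof (cases "u > 0")
        case True
        have "\<bar>w u\<bar> * norm (mul (a u) x) \<le> \<bar>w u\<bar> * (b u * norm x)"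
          by (rule mult_left_mono[OF norm_mul_le[OF bound[OF True]] abs_ge_zero])
        also have "\<dots> = (\<bar>w u\<bar> * b u) * norm x"
          by (simp only: mult.assoc)
        finally show ?thesis
          unfolding norm_scaleR real_norm_def by (rule order_trans[OF _ abs_ge_self])
      next
        case False
        then show ?thesis
          by (simp add: w(2))
      qed
    qed
  qed
  then have int': "integrable lborel (\<lambda>u. mul (\<lambda>\<xi>. w u * a u \<xi>) x)"
    unfolding eq .
  have w_fst: "(\<lambda>z :: real \<times> (real^'n). w (fst z)) \<in> borel_measurable borel"
    by (rule measurable_compose[OF _ w(1)]) (intro borel_measurable_continuous_onI continuous_intros)
  have le: "\<bar>w u * a u \<xi>\<bar> \<le> \<bar>w u\<bar> * b u" for u \<xi>
  proof (cases "u > 0")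
    case True
    then have "\<bar>a u \<xi>\<bar> \<le> b u"
      using bound[OF True] by (simp add: bounded_symbol_def)
    then show ?thesis
      by (simp add: abs_mult mult_left_mono)
  next
    case False
    then show ?thesis
      by (simp add: w(2))
  qed
  show ?eq
    unfolding eq by (rule mul_integral[OF borel_measurable_times[OF w_fst a_meas] le int int'])
qed

section \<open>Symbols of the solution operators\<close>

text \<open>To be used with \<nu> = |\<xi>|^\<alpha>, c = (1 + |\<xi>|^2)^(-\<theta>/2) and
  \<epsilon> = \<theta> / \<alpha>: c takes data of order s + \<theta> to order s, and the last
  assumption says that it absorbs the power \<nu>^\<epsilon>.\<close>

locale resolvent = volterra p k \<beta> for p k \<beta> +
  fixes \<nu> c :: "real^'n \<Rightarrow> real" and \<epsilon> :: real
  assumes \<nu>_cont: "continuous_on UNIV \<nu>" and \<nu>: "\<And>\<xi>. \<nu> \<xi> \<ge> 0"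
    and c_meas: "c \<in> borel_measurable borel" and c: "\<And>\<xi>. 0 \<le> c \<xi>" "\<And>\<xi>. c \<xi> \<le> 1"
    and \<epsilon>: "0 < \<epsilon>" "\<epsilon> \<le> 1" and \<nu>c: "\<And>\<xi>. \<nu> \<xi> powr \<epsilon> * c \<xi> \<le> 1"
begin

text \<open>\<open>S\<close>, \<open>A\<close> and \<open>R\<close> are s, \<nu> s and r, each after
  smoothing by c.\<close>

definition S :: "real \<Rightarrow> real^'n \<Rightarrow> real" where
  "S \<sigma> \<xi> = sol (\<nu> \<xi>) \<sigma> * c \<xi>"

definition A :: "real \<Rightarrow> real^'n \<Rightarrow> real" where
  "A \<sigma> \<xi> = \<nu> \<xi> * sol (\<nu> \<xi>) \<sigma> * c \<xi>"

definition R :: "real \<Rightarrow> real^'n \<Rightarrow> real" where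
  "R \<sigma> \<xi> = res (\<nu> \<xi>) \<sigma> * c \<xi>"

lemma fst_measurable: "(fst :: real \<times> (real^'n) \<Rightarrow> real) \<in> borel_measurable borel"
  by (intro borel_measurable_continuous_onI continuous_intros)

lemma snd_measurable: "(snd :: real \<times> (real^'n) \<Rightarrow> real^'n) \<in> borel_measurable borel"
  by (intro borel_measurable_continuous_onI continuous_intros)

lemma section_measurable:
  fixes f :: "real \<times> (real^'n) \<Rightarrow> real"
  assumes f: "f \<in> borel_measurable borel"
  shows "(\<lambda>\<xi>. f (\<sigma>, \<xi>)) \<in> borel_measurable borel"
proof -
  have "(\<lambda>\<xi> :: real^'n. (\<sigma>, \<xi>)) \<in> borel_measurable borel"
    by (intro borel_measurable_continuous_onI continuous_intros)
  from measurable_compose[OF this f] show ?thesis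
    by simp
qed

text \<open>Joint continuity is available for nonnegative times; clamping the time at 0 and
  multiplying by an indicator extends measurability to the whole line.\<close>

lemma sol_measurable2: "(\<lambda>z. sol (\<nu> (snd z)) (fst z)) \<in> borel_measurable (borel :: (real \<times> (real^'n)) measure)"
proof -
  have "continuous_on UNIV (\<lambda>z :: real \<times> (real^'n). (\<nu> (snd z), max (fst z) 0))"
    by (intro continuous_intros continuous_on_compose2[OF \<nu>_cont]) auto
  then have "continuous_on UNIV (\<lambda>z :: real \<times> (real^'n). (\<lambda>(\<nu>, t). sol \<nu> t) (\<nu> (snd z), max (fst z) 0))"
    by (rule continuous_on_compose2[OF sol_jointly_continuous]) (auto simp: \<nu>)
  then have "(\<lambda>z :: real \<times> (real^'n). indicator {0..} (fst z) * sol (\<nu> (snd z)) (max (fst z) 0)) \<in> borel_measurable borel"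
    by (intro borel_measurable_times measurable_compose[OF fst_measurable borel_measurable_indicator])
      (auto intro: borel_measurable_continuous_onI)
  moreover have "indicator {0..} (fst z) * sol (\<nu> (snd z)) (max (fst z) 0) = sol (\<nu> (snd z)) (fst z)" for z
    using sol_causal[OF \<nu>, of "snd z"] by (cases "fst z < 0") (simp_all add: causal_def max_absorb1)
  ultimately show ?thesis
    by simp
qed

lemma res_measurable2: "(\<lambda>z. res (\<nu> (snd z)) (fst z)) \<in> borel_measurable (borel :: (real \<times> (real^'n)) measure)"
proof (rule borel_measurable_LIMSEQ_metric)
  fix n
  have "(\<lambda>z :: real \<times> (real^'n). (fst z + 1 / Suc n, snd z)) \<in> borel_measurable borel"
    by (intro borel_measurable_continuous_onI continuous_intros)
  from measurable_compose[OF this sol_measurable2]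
  have "(\<lambda>z. indicator {0<..} (fst z) * (real (Suc n) * (sol (\<nu> (snd z)) (fst z) - sol (\<nu> (snd z)) (fst z + 1 / Suc n))))
      \<in> borel_measurable (borel :: (real \<times> (real^'n)) measure)"
    by (intro borel_measurable_times borel_measurable_const borel_measurable_diff sol_measurable2
        measurable_compose[OF fst_measurable borel_measurable_indicator]) simp_all
  moreover have "indicator {0<..} (fst z) * (real (Suc n) * (sol (\<nu> (snd z)) (fst z) - sol (\<nu> (snd z)) (fst z + 1 / Suc n)))
      = quotient (\<nu> (snd z)) n (fst z)" for z
    by (simp add: quotient_def)
  ultimately show "(\<lambda>z. quotient (\<nu> (snd z)) n (fst z)) \<in> borel_measurable (borel :: (real \<times> (real^'n)) measure)"
    by (simp only:)
qed (rule quotient_tendsto[OF \<nu>])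

lemma \<nu>_measurable: "\<nu> \<in> borel_measurable borel"
  by (rule borel_measurable_continuous_onI[OF \<nu>_cont])

lemma symbol_measurable:
  shows S_measurable: "(\<lambda>z. S (fst z) (snd z)) \<in> borel_measurable (borel :: (real \<times> (real^'n)) measure)"
    and A_measurable: "(\<lambda>z. A (fst z) (snd z)) \<in> borel_measurable (borel :: (real \<times> (real^'n)) measure)"
    and R_measurable: "(\<lambda>z. R (fst z) (snd z)) \<in> borel_measurable (borel :: (real \<times> (real^'n)) measure)"
  unfolding S_def A_def R_def
  by (intro borel_measurable_times sol_measurable2 res_measurable2 measurable_compose[OF snd_measurable c_meas]
      measurable_compose[OF snd_measurable \<nu>_measurable])+

lemma S_symbol: "bounded_symbol (S \<sigma>) 1"
proof -
  have "\<bar>S \<sigma> \<xi>\<bar> \<le> 1" for \<xi>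
  proof -
    have "sol (\<nu> \<xi>) \<sigma> \<le> 1"
      by (rule order_trans[OF sol_le[OF \<nu>]]) (simp add: indicator_def)
    then have "sol (\<nu> \<xi>) \<sigma> * c \<xi> \<le> 1 * 1"
      using c by (intro mult_mono) auto
    then show ?thesis
      using sol_nonneg[OF \<nu>] c by (simp add: S_def)
  qed
  then show ?thesis
    using section_measurable[OF S_measurable, of \<sigma>] by (simp add: bounded_symbol_def)
qed

lemma c_symbol: "bounded_symbol c 1"
  using c c_meas by (simp add: bounded_symbol_def)

lemma A_nonneg: "0 \<le> A \<sigma> \<xi>"
  unfolding A_def by (intro mult_nonneg_nonneg \<nu> sol_nonneg c)

lemma A_le: "\<sigma> > 0 \<Longrightarrow> A \<sigma> \<xi> \<le> mass \<sigma> powr (\<epsilon> - 1)"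
  unfolding A_def by (intro symbol_bound[OF \<nu> mass_pos \<epsilon> sol_nonneg[OF \<nu>] sol_mass_bound[OF \<nu>] c(1) \<nu>c]) auto

lemma A_symbol:
  assumes "\<sigma> > 0"
  shows "bounded_symbol (A \<sigma>) (mass \<sigma> powr (\<epsilon> - 1))"
  using A_nonneg A_le[OF assms] section_measurable[OF A_measurable, of \<sigma>] by (simp add: bounded_symbol_def)

lemma R_symbol:
  assumes \<sigma>: "\<sigma> > 0"
  shows "bounded_symbol (R \<sigma>) (p \<sigma> * mass \<sigma> powr (\<epsilon> - 1))"
proof -
  have "\<bar>R \<sigma> \<xi>\<bar> \<le> p \<sigma> * mass \<sigma> powr (\<epsilon> - 1)" for \<xi>
  proof -
    have "R \<sigma> \<xi> \<le> \<nu> \<xi> * p \<sigma> * sol (\<nu> \<xi>) \<sigma> * c \<xi>"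
      unfolding R_def by (intro mult_right_mono res_sol_bound \<nu> \<sigma> c)
    also have "\<dots> = p \<sigma> * A \<sigma> \<xi>"
      by (simp add: A_def)
    also have "\<dots> \<le> p \<sigma> * mass \<sigma> powr (\<epsilon> - 1)"
      by (intro mult_left_mono A_le \<sigma> kernel_nonneg[OF p])
    finally show ?thesis
      using res_nonneg[OF \<nu>] c by (simp add: R_def)
  qed
  then show ?thesis
    using section_measurable[OF R_measurable, of \<sigma>] by (simp add: bounded_symbol_def)
qed

lemma sol_continuous: "continuous_on {0<..} (sol (\<nu> \<xi>))"
  by (rule causal_cont[OF sol_causal[OF \<nu>]]) auto

lemma mass_powr_continuous: "continuous_on {0<..} (\<lambda>\<sigma>. mass \<sigma> powr (\<epsilon> - 1))"
proof (rule continuous_on_powr)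
  show "continuous_on {0<..} mass"
    by (rule causal_cont[OF mass_causal]) auto
  show "\<forall>x\<in>{0<..}. mass x \<noteq> 0"
    using mass_pos by (metis greaterThan_iff less_irrefl)
qed (rule continuous_on_const)

lemma one_integrable: "integrable lborel (\<lambda>\<sigma>. indicator {0<..<t :: real} \<sigma> * 1 :: real)"
proof (cases "t > 0")
  case True
  then have "integrable lborel (indicator {0<..<t} :: real \<Rightarrow> real)"
    by (intro integrable_real_indicator) (simp_all add: emeasure_lborel_Ioo)
  then show ?thesis
    by simp
next
  case False
  then show ?thesis
    by simp
qed

lemma S_family: "operator_family (\<lambda>\<sigma>. mul (S \<sigma>)) (\<lambda>_. 1)"
  by (rule operator_family_mul[OF S_symbol _ continuous_on_const _ one_integrable])
    (auto simp: S_def intro!: continuous_on_mult sol_continuous continuous_on_const)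

lemma C_family: "operator_family (\<lambda>\<sigma>. mul c) (\<lambda>_. 1)"
  by (rule operator_family_mul[OF c_symbol continuous_on_const continuous_on_const _ one_integrable]) simp

lemma A_family: "operator_family (\<lambda>\<sigma>. mul (A \<sigma>)) (\<lambda>\<sigma>. mass \<sigma> powr (\<epsilon> - 1))"
proof (rule operator_family_mul[OF A_symbol _ mass_powr_continuous])
  show "continuous_on {0<..} (\<lambda>\<sigma>. A \<sigma> \<xi>)" for \<xi>
    unfolding A_def by (intro continuous_on_mult sol_continuous continuous_on_const)
  note k = mass_powr_kernel[OF \<epsilon>]
  show "integrable lborel (\<lambda>\<sigma>. indicator {0<..<t} \<sigma> * mass \<sigma> powr (\<epsilon> - 1))" for t
  proof (rule Bochner_Integration.integrable_bound[OF kernel_integrable[OF k, of t]])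
    show "(\<lambda>\<sigma>. indicator {0<..<t} \<sigma> * mass \<sigma> powr (\<epsilon> - 1)) \<in> borel_measurable lborel"
      using borel_measurable_times[OF borel_measurable_indicator[of "{0<..<t}"] kernel_measurable[OF k]] by simp
    show "AE \<sigma> in lborel. norm (indicator {0<..<t} \<sigma> * mass \<sigma> powr (\<epsilon> - 1)) \<le> norm (mass \<sigma> powr (\<epsilon> - 1) * indicator {..t} \<sigma>)"
      by (intro AE_I2) (auto simp: indicator_def)
  qed
qed simp_all

lemma R_family: "operator_family (\<lambda>\<sigma>. mul (R \<sigma>)) (\<lambda>\<sigma>. p \<sigma> * mass \<sigma> powr (\<epsilon> - 1))"
proof (rule operator_family_mul[OF R_symbol])
  show "continuous_on {0<..} (\<lambda>\<sigma>. R \<sigma> \<xi>)" for \<xi>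
    unfolding R_def by (intro continuous_on_mult res_continuous \<nu> continuous_on_const)
  show "continuous_on {0<..} (\<lambda>\<sigma>. p \<sigma> * mass \<sigma> powr (\<epsilon> - 1))"
    by (intro continuous_on_mult p_cont mass_powr_continuous)
  show "0 \<le> p \<sigma> * mass \<sigma> powr (\<epsilon> - 1)" for \<sigma>
    using kernel_nonneg[OF p] by simp
qed (assumption | rule p_mass_powr_integrable[OF \<epsilon>(1)])+

lemma S_0: "S 0 = c"
  by (simp add: S_def fun_eq_iff sol_zero[OF \<nu>])

lemma S_continuous: "continuous_on {0..} (\<lambda>t. mul (S t) x)"
proof (rule continuous_on_sequentiallyI)
  fix u :: "nat \<Rightarrow> real" and \<sigma> :: real
  assume u: "\<forall>n. u n \<in> {0..}" "\<sigma> \<in> {0..}" "u \<longlonglongrightarrow> \<sigma>"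
  show "(\<lambda>n. mul (S (u n)) x) \<longlonglongrightarrow> mul (S \<sigma>) x"
  proof (rule mul_tendsto[OF S_symbol S_symbol])
    show "(\<lambda>n. S (u n) \<xi>) \<longlonglongrightarrow> S \<sigma> \<xi>" for \<xi>
      unfolding S_def
      by (intro tendsto_mult tendsto_const continuous_on_tendsto_compose[OF causal_cont[OF sol_causal[OF \<nu>] order_refl]] u always_eventually)
  qed
qed

lemma one_minus_sol_symbol: "mul (\<lambda>\<xi>. (1 - sol (\<nu> \<xi>) t) * c \<xi>) x = mul c x - mul (S t) x"
  using mul_symbol_diff[OF c_symbol S_symbol, of t x] by (simp add: S_def left_diff_distrib)

text \<open>Frequency by frequency this is 1 - s = integral of r, multiplied by c.\<close>

lemma R_integral:
  assumes t: "t > 0"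
  shows "(LINT u|lborel. indicator {0<..<t} u *\<^sub>R mul (R u) x) = mul c x - mul (S t) x"
proof -
  have "(LINT u|lborel. indicator {0<..<t} u *\<^sub>R mul (R u) x) = mul (\<lambda>\<xi>. LINT u|lborel. indicator {0<..<t} u * R u \<xi>) x"
    using p_mass_powr_integrable[OF \<epsilon>(1), of t]
    by (intro operator_family_integral[OF R_measurable R_family R_symbol]) auto
  also have "(\<lambda>\<xi>. LINT u|lborel. indicator {0<..<t} u * R u \<xi>) = (\<lambda>\<xi>. (1 - sol (\<nu> \<xi>) t) * c \<xi>)"
  proof
    fix \<xi>
    have "(1 - sol (\<nu> \<xi>) t) = conv unit_kernel (res (\<nu> \<xi>)) t"
      using integral_res(2)[OF \<nu>, of t \<xi>] t by simp
    also have "\<dots> = (LINT u|lborel. unit_kernel (t - u) * res (\<nu> \<xi>) u)"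
      using integral_reflect[of "\<lambda>\<tau>. unit_kernel \<tau> * res (\<nu> \<xi>) (t - \<tau>)" t] by (simp add: conv_def)
    also have "\<dots> = (LINT u|lborel. indicator {0<..<t} u * res (\<nu> \<xi>) u)"
      using res_zero[OF \<nu>] by (intro Bochner_Integration.integral_cong refl) (auto simp: indicator_def)
    finally show "(LINT u|lborel. indicator {0<..<t} u * R u \<xi>) = (1 - sol (\<nu> \<xi>) t) * c \<xi>"
      by (simp add: R_def mult.assoc[symmetric])
  qed
  finally show ?thesis
    unfolding one_minus_sol_symbol .
qed

text \<open>Frequency by frequency this is the Volterra equation 1 - s = \<nu> p * s. The right-hand
  side agrees with that of \<open>R_integral\<close>, so p * A is the primitive of R.\<close>

lemma A_integral:
  assumes t: "t > 0"
  shows "(LINT u|lborel. indicator {0<..<t} u *\<^sub>R p (t - u) *\<^sub>R mul (A u) x) = mul c x - mul (S t) x"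
proof -
  define w where "w u = indicator {0<..<t} u * p (t - u)" for u
  note [measurable] = kernel_measurable[OF p]
  have w: "w \<in> borel_measurable borel"
    unfolding w_def by measurable
  note k = mass_powr_kernel[OF \<epsilon>]
  have "\<bar>w u\<bar> * mass u powr (\<epsilon> - 1) = p (t - u) * mass u powr (\<epsilon> - 1)" for u
    using kernel_zero[OF k, of u] kernel_zero[OF p, of "t - u"] kernel_nonneg[OF p, of "t - u"]
    by (cases "0 < u"; cases "u < t") (simp_all add: w_def)
  moreover have "integrable lborel (\<lambda>u. p (t - u) * mass u powr (\<epsilon> - 1))"
    using integrable_reflect[OF conv_kernel_integrable[OF p k, of t], of t] by simp
  ultimately have int: "integrable lborel (\<lambda>u. \<bar>w u\<bar> * mass u powr (\<epsilon> - 1))"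
    by (simp only:)
  have "(LINT u|lborel. w u *\<^sub>R mul (A u) x) = mul (\<lambda>\<xi>. LINT u|lborel. w u * A u \<xi>) x"
    by (rule operator_family_integral[OF A_measurable A_family A_symbol w _ int]) (auto simp: w_def)
  also have "(\<lambda>\<xi>. LINT u|lborel. w u * A u \<xi>) = (\<lambda>\<xi>. (1 - sol (\<nu> \<xi>) t) * c \<xi>)"
  proof
    fix \<xi>
    note [measurable] = causal_measurable[OF sol_causal[OF \<nu>], of \<xi>]
    have "(1 - sol (\<nu> \<xi>) t) = \<nu> \<xi> * conv p (sol (\<nu> \<xi>)) t"
      using sol_eq[OF \<nu>, of t \<xi>] t by simp
    also have "conv p (sol (\<nu> \<xi>)) t = (LINT u|lborel. p (t - u) * sol (\<nu> \<xi>) u)"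
      using integral_reflect[of "\<lambda>\<tau>. p \<tau> * sol (\<nu> \<xi>) (t - \<tau>)" t] by (simp add: conv_def)
    also have "\<dots> = (LINT u|lborel. w u * sol (\<nu> \<xi>) u)"
    proof (rule integral_cong_AE)
      have "AE u in lborel. u \<noteq> (0::real)"
        by (rule AE_lborel_singleton)
      then show "AE u in lborel. p (t - u) * sol (\<nu> \<xi>) u = w u * sol (\<nu> \<xi>) u"
      proof eventually_elim
        case (elim u)
        then show ?case
          using sol_causal[OF \<nu>, of \<xi>] kernel_zero[OF p, of "t - u"]
          by (cases "u < 0"; cases "u < t") (simp_all add: w_def causal_def)
      qed
    qed (use w in measurable)
    finally have "(1 - sol (\<nu> \<xi>) t) * c \<xi> = (LINT u|lborel. (w u * sol (\<nu> \<xi>) u) * (\<nu> \<xi> * c \<xi>))"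
      by simp
    also have "\<dots> = (LINT u|lborel. w u * A u \<xi>)"
      by (simp only: A_def mult_ac)
    finally show "(LINT u|lborel. w u * A u \<xi>) = (1 - sol (\<nu> \<xi>) t) * c \<xi>"
      by simp
  qed
  finally show ?thesis
    unfolding one_minus_sol_symbol by (simp add: w_def)
qed

end

section \<open>The abstract evolution problem\<close>

text \<open>\<open>x\<^sub>0\<close> and \<open>G\<close> will be the images of the initial value
  and of g under J of order s + \<theta>; the smoothing contained in S, A and R brings the results
  to order s.\<close>

locale evolution = resolvent p k \<beta> \<nu> c \<epsilon> + forcing G T K
  for p k \<beta> and \<nu> c :: "real^'n \<Rightarrow> real" and \<epsilon> and G :: "real \<Rightarrow> 'n L2" and T K +
  fixes x\<^sub>0 :: "'n L2"
begin

text \<open>\<open>V\<close>, \<open>W\<close> and \<open>Y\<close> will be the images under J of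
  order s of v, of (-\<Delta>)^(\<alpha>/2) v and of the time derivative of m_\<gamma> *
  (-\<Delta>)^(\<alpha>/2) v.\<close>

definition V :: "real \<Rightarrow> 'n L2" where
  "V t = mul (S t) x\<^sub>0 + opconv (\<lambda>\<sigma>. mul (S \<sigma>)) G t"

definition W :: "real \<Rightarrow> 'n L2" where
  "W t = mul (A t) x\<^sub>0 + opconv (\<lambda>\<sigma>. mul (A \<sigma>)) G t"

definition Y :: "real \<Rightarrow> 'n L2" where
  "Y t = mul (R t) x\<^sub>0 + opconv (\<lambda>\<sigma>. mul (R \<sigma>)) G t"

lemma opconv_flip:
  "opconv B G t = (LINT \<tau>|lborel. indicator {0<..<t} \<tau> *\<^sub>R B (t - \<tau>) (G \<tau>))"
  and opconv_flip_integrable: "integrable lborel (\<lambda>\<sigma>. indicator {0<..<t} \<sigma> *\<^sub>R B \<sigma> (G (t - \<sigma>)))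
    \<Longrightarrow> integrable lborel (\<lambda>\<tau>. indicator {0<..<t} \<tau> *\<^sub>R B (t - \<tau>) (G \<tau>))"
proof -
  have eq: "(\<lambda>\<tau>. indicator {0<..<t} (t - \<tau>) *\<^sub>R B (t - \<tau>) (G (t - (t - \<tau>)))) = (\<lambda>\<tau>. indicator {0<..<t} \<tau> *\<^sub>R B (t - \<tau>) (G \<tau>))"
    by (auto simp: indicator_def fun_eq_iff)
  show "opconv B G t = (LINT \<tau>|lborel. indicator {0<..<t} \<tau> *\<^sub>R B (t - \<tau>) (G \<tau>))"
    unfolding opconv_def eq[symmetric] by (rule integral_reflect[symmetric])
  show "integrable lborel (\<lambda>\<tau>. indicator {0<..<t} \<tau> *\<^sub>R B (t - \<tau>) (G \<tau>))"
    if "integrable lborel (\<lambda>\<sigma>. indicator {0<..<t} \<sigma> *\<^sub>R B \<sigma> (G (t - \<sigma>)))"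
    unfolding eq[symmetric] by (rule integrable_reflect[OF that])
qed

lemma orbit_continuous:
  assumes B: "operator_family B b"
  shows "continuous_on {0<..T} (\<lambda>t. B t x\<^sub>0 + opconv B G t)"
proof (intro continuous_on_add)
  show "continuous_on {0<..T} (\<lambda>t. B t x\<^sub>0)"
    by (rule operator_family_continuous[OF B continuous_on_id _ continuous_on_const]) simp
  show "continuous_on {0<..T} (opconv B G)"
    by (rule continuous_on_subset[OF opconv_continuous[OF B]]) auto
qed

lemma V_continuous: "continuous_on {0..T} V"
  unfolding V_def
  by (intro continuous_on_add continuous_on_subset[OF S_continuous] opconv_continuous[OF S_family]) auto

lemma W_continuous: "continuous_on {0<..T} W"
  unfolding W_def by (rule orbit_continuous[OF A_family])

lemma Y_continuous: "continuous_on {0<..T} Y"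
  unfolding Y_def by (rule orbit_continuous[OF R_family])

lemma V_0: "V 0 = mul c x\<^sub>0"
  by (simp add: V_def S_0 opconv_def)

lemma forcing_continuous: "continuous_on {0<..T} (\<lambda>t. mul c (G t))"
  by (rule bounded_linear.continuous_on[OF bounded_linear_mul[OF c_symbol] G_cont])

lemma forcing_integrable: "t \<le> T \<Longrightarrow> integrable lborel (\<lambda>\<tau>. indicator {0<..<t} \<tau> *\<^sub>R mul c (G \<tau>))"
  by (rule opconv_flip_integrable[where B = "\<lambda>\<sigma>. mul c"]) (rule opconv_integrable[OF C_family])

text \<open>The instances \<open>a = 1, B = R\<close> and \<open>a = m\<^sub>\<gamma>, B = A\<close> show that \<open>1 * Y = m\<^sub>\<gamma> * W\<close>.\<close>

lemma orbit_integral: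
  assumes B: "operator_family B b" and t: "0 < t" "t \<le> T"
    and a: "continuous_on {0<..} a" "\<And>t. integrable lborel (\<lambda>\<tau>. indicator {0<..<t} \<tau> * \<bar>a \<tau>\<bar>)"
    and eq: "\<And>\<sigma> x. \<sigma> > 0 \<Longrightarrow> (LINT u|lborel. indicator {0<..<\<sigma>} u *\<^sub>R a (\<sigma> - u) *\<^sub>R B u x) = mul c x - mul (S \<sigma>) x"
    and int: "integrable lborel (\<lambda>u. indicator {0<..<t} u *\<^sub>R a (t - u) *\<^sub>R B u x\<^sub>0)"
  shows "integrable lborel (\<lambda>\<tau>. indicator {0<..<t} \<tau> *\<^sub>R a (t - \<tau>) *\<^sub>R (B \<tau> x\<^sub>0 + opconv B G \<tau>))" (is ?int)
    and "(LINT \<tau>|lborel. indicator {0<..<t} \<tau> *\<^sub>R a (t - \<tau>) *\<^sub>R (B \<tau> x\<^sub>0 + opconv B G \<tau>))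
      = mul c x\<^sub>0 + (LINT \<tau>|lborel. indicator {0<..<t} \<tau> *\<^sub>R mul c (G \<tau>)) - V t" (is ?eq)
proof -
  note f = opconv_fubini[OF B t a(1) a(2)]
  show ?int
    unfolding scaleR_add_right by (intro Bochner_Integration.integrable_add int f)
  have "(LINT \<tau>|lborel. indicator {0<..<t} \<tau> *\<^sub>R a (t - \<tau>) *\<^sub>R (B \<tau> x\<^sub>0 + opconv B G \<tau>))
      = (LINT \<tau>|lborel. indicator {0<..<t} \<tau> *\<^sub>R a (t - \<tau>) *\<^sub>R B \<tau> x\<^sub>0)
        + (LINT \<tau>|lborel. indicator {0<..<t} \<tau> *\<^sub>R a (t - \<tau>) *\<^sub>R opconv B G \<tau>)"
    unfolding scaleR_add_right by (intro Bochner_Integration.integral_add int f)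
  also have "(LINT \<tau>|lborel. indicator {0<..<t} \<tau> *\<^sub>R a (t - \<tau>) *\<^sub>R B \<tau> x\<^sub>0) = mul c x\<^sub>0 - mul (S t) x\<^sub>0"
    by (rule eq[OF t(1)])
  also have "(LINT \<tau>|lborel. indicator {0<..<t} \<tau> *\<^sub>R a (t - \<tau>) *\<^sub>R opconv B G \<tau>)
      = opconv (\<lambda>\<sigma>. mul c) G t - opconv (\<lambda>\<sigma>. mul (S \<sigma>)) G t"
  proof -
    have "(LINT \<tau>|lborel. indicator {0<..<t} \<tau> *\<^sub>R a (t - \<tau>) *\<^sub>R opconv B G \<tau>)
        = (LINT \<sigma>|lborel. indicator {0<..<t} \<sigma> *\<^sub>R mul c (G (t - \<sigma>)) - indicator {0<..<t} \<sigma> *\<^sub>R mul (S \<sigma>) (G (t - \<sigma>)))"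
      unfolding f(2) unfolding opconv_def
    proof (intro Bochner_Integration.integral_cong refl)
      fix \<sigma> :: real
      show "indicator {0<..<t} \<sigma> *\<^sub>R (LINT u|lborel. indicator {0<..<\<sigma>} u *\<^sub>R a (\<sigma> - u) *\<^sub>R B u (G (t - \<sigma>)))
        = indicator {0<..<t} \<sigma> *\<^sub>R mul c (G (t - \<sigma>)) - indicator {0<..<t} \<sigma> *\<^sub>R mul (S \<sigma>) (G (t - \<sigma>))"
      proof (cases "\<sigma> > 0")
        case True
        show ?thesis
          unfolding eq[OF True] by (simp only: scaleR_diff_right)
      next
        case False
        then show ?thesis
          by simp
      qed
    qed
    also have "\<dots> = opconv (\<lambda>\<sigma>. mul c) G t - opconv (\<lambda>\<sigma>. mul (S \<sigma>)) G t"
      unfolding opconv_def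
      by (intro Bochner_Integration.integral_diff opconv_integrable[OF C_family t(2)] opconv_integrable[OF S_family t(2)])
    finally show ?thesis .
  qed
  finally show ?eq
    by (simp add: V_def opconv_flip[of "\<lambda>\<sigma>. mul c"])
qed

lemma Y_integral:
  assumes t: "0 < t" "t \<le> T"
  shows "integrable lborel (\<lambda>\<tau>. indicator {0<..<t} \<tau> *\<^sub>R Y \<tau>)"
    and "(LINT \<tau>|lborel. indicator {0<..<t} \<tau> *\<^sub>R Y \<tau>)
      = mul c x\<^sub>0 + (LINT \<tau>|lborel. indicator {0<..<t} \<tau> *\<^sub>R mul c (G \<tau>)) - V t"
proof -
  have i: "integrable lborel (\<lambda>u. indicator {0<..<t} u *\<^sub>R mul (R u) x\<^sub>0)"
    using p_mass_powr_integrable[OF \<epsilon>(1), of t]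
    by (intro operator_family_integral[OF R_measurable R_family R_symbol]) auto
  have eq: "(LINT u|lborel. indicator {0<..<\<sigma>} u *\<^sub>R 1 *\<^sub>R mul (R u) x) = mul c x - mul (S \<sigma>) x" if "\<sigma> > 0" for \<sigma> x
    using R_integral[OF that, of x] by simp
  have one: "integrable lborel (\<lambda>\<tau>. indicator {0<..<t} \<tau> * \<bar>1::real\<bar>)" for t :: real
    using one_integrable[of t] by simp
  have i': "integrable lborel (\<lambda>u. indicator {0<..<t} u *\<^sub>R 1 *\<^sub>R mul (R u) x\<^sub>0)"
    using i by simp
  note o = orbit_integral[OF R_family t continuous_on_const one eq i']
  show "integrable lborel (\<lambda>\<tau>. indicator {0<..<t} \<tau> *\<^sub>R Y \<tau>)"
    using o(1) by (simp add: Y_def)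
  show "(LINT \<tau>|lborel. indicator {0<..<t} \<tau> *\<^sub>R Y \<tau>)
      = mul c x\<^sub>0 + (LINT \<tau>|lborel. indicator {0<..<t} \<tau> *\<^sub>R mul c (G \<tau>)) - V t"
    using o(2) by (simp add: Y_def)
qed

lemma p_integrable: "integrable lborel (\<lambda>\<tau>. indicator {0<..<t} \<tau> * \<bar>p \<tau>\<bar>)"
proof (rule Bochner_Integration.integrable_bound[OF kernel_integrable[OF p, of t]])
  show "(\<lambda>\<tau>. indicator {0<..<t} \<tau> * \<bar>p \<tau>\<bar>) \<in> borel_measurable lborel"
    using kernel_measurable[OF p] by (intro borel_measurable_times borel_measurable_abs) simp_all
  show "AE \<tau> in lborel. norm (indicator {0<..<t} \<tau> * \<bar>p \<tau>\<bar>) \<le> norm (p \<tau> * indicator {..t} \<tau>)"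
    by (intro AE_I2) (auto simp: indicator_def)
qed

lemma W_p_integral:
  assumes t: "0 < t" "t \<le> T"
  shows "integrable lborel (\<lambda>\<tau>. indicator {0<..<t} \<tau> *\<^sub>R p (t - \<tau>) *\<^sub>R W \<tau>)"
    and "(LINT \<tau>|lborel. indicator {0<..<t} \<tau> *\<^sub>R p (t - \<tau>) *\<^sub>R W \<tau>) = (LINT \<tau>|lborel. indicator {0<..<t} \<tau> *\<^sub>R Y \<tau>)"
proof -
  note k = mass_powr_kernel[OF \<epsilon>]
  have "integrable lborel (\<lambda>u. p (t - u) * mass u powr (\<epsilon> - 1))"
    using integrable_reflect[OF conv_kernel_integrable[OF p k, of t], of t] by simp
  moreover have "\<bar>indicator {0<..<t} u * p (t - u)\<bar> * mass u powr (\<epsilon> - 1) = p (t - u) * mass u powr (\<epsilon> - 1)" for u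
    using kernel_zero[OF k, of u] kernel_zero[OF p, of "t - u"] kernel_nonneg[OF p, of "t - u"]
    by (cases "0 < u"; cases "u < t") simp_all
  ultimately have int: "integrable lborel (\<lambda>u. \<bar>indicator {0<..<t} u * p (t - u)\<bar> * mass u powr (\<epsilon> - 1))"
    by (simp only:)
  have w: "(\<lambda>u. indicator {0<..<t} u * p (t - u)) \<in> borel_measurable borel"
    using kernel_measurable[OF p] by measurable
  have "integrable lborel (\<lambda>u. (indicator {0<..<t} u * p (t - u)) *\<^sub>R mul (A u) x\<^sub>0)"
    by (rule operator_family_integral(1)[OF A_measurable A_family A_symbol w _ int]) simp_all
  then have i: "integrable lborel (\<lambda>u. indicator {0<..<t} u *\<^sub>R p (t - u) *\<^sub>R mul (A u) x\<^sub>0)"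
    by simp
  note o = orbit_integral[OF A_family t p_cont p_integrable A_integral i]
  show "integrable lborel (\<lambda>\<tau>. indicator {0<..<t} \<tau> *\<^sub>R p (t - \<tau>) *\<^sub>R W \<tau>)"
    using o(1) by (simp add: W_def)
  show "(LINT \<tau>|lborel. indicator {0<..<t} \<tau> *\<^sub>R p (t - \<tau>) *\<^sub>R W \<tau>) = (LINT \<tau>|lborel. indicator {0<..<t} \<tau> *\<^sub>R Y \<tau>)"
    using o(2) Y_integral(2)[OF t] by (simp add: W_def)
qed

lemma W_integrable:
  assumes t: "0 < t" "t \<le> T"
  shows "integrable lborel (\<lambda>\<tau>. indicator {0<..<t} \<tau> *\<^sub>R W \<tau>)"
proof -
  have one: "integrable lborel (\<lambda>\<tau>. indicator {0<..<t} \<tau> * \<bar>1::real\<bar>)"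
    using one_integrable[of t] by simp
  have "integrable lborel (\<lambda>\<tau>. indicator {0<..<t} \<tau> *\<^sub>R opconv (\<lambda>\<sigma>. mul (A \<sigma>)) G \<tau>)"
    using opconv_fubini(1)[OF A_family t continuous_on_const one] by simp
  moreover have "integrable lborel (\<lambda>u. \<bar>indicator {0<..<t} u\<bar> * mass u powr (\<epsilon> - 1))"
    using A_family by (simp add: operator_family_def)
  then have "integrable lborel (\<lambda>u. indicator {0<..<t} u *\<^sub>R mul (A u) x\<^sub>0)"
    by (intro operator_family_integral(1)[OF A_measurable A_family A_symbol]) auto
  ultimately show ?thesis
    unfolding W_def scaleR_add_right by (intro Bochner_Integration.integrable_add)
qed

text \<open>\<open>Y_integral\<close> exhibits V as a constant plus the primitive of the continuous
  function c G - Y, which avoids differentiating under the Duhamel integral.\<close>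

lemma V_derivative:
  assumes t: "t \<in> {0<..T}"
  shows "((\<lambda>u. (1 / (u - t)) *\<^sub>R (V u - V t)) \<longlongrightarrow> mul c (G t) - Y t) (at t within {0<..T})"
proof -
  let ?I = "\<lambda>u. LINT \<tau>|lborel. indicator {0<..<u} \<tau> *\<^sub>R (mul c (G \<tau>) - Y \<tau>)"
  have int: "integrable lborel (\<lambda>\<tau>. indicator {0<..<u} \<tau> *\<^sub>R (mul c (G \<tau>) - Y \<tau>))"
    and V_eq: "V u = mul c x\<^sub>0 + ?I u" if "u \<in> {0<..T}" for u
  proof -
    have u: "0 < u" "u \<le> T"
      using that by auto
    show "integrable lborel (\<lambda>\<tau>. indicator {0<..<u} \<tau> *\<^sub>R (mul c (G \<tau>) - Y \<tau>))"
      unfolding scaleR_diff_right by (intro Bochner_Integration.integrable_diff forcing_integrable u Y_integral)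
    have "?I u = (LINT \<tau>|lborel. indicator {0<..<u} \<tau> *\<^sub>R mul c (G \<tau>)) - (LINT \<tau>|lborel. indicator {0<..<u} \<tau> *\<^sub>R Y \<tau>)"
      unfolding scaleR_diff_right by (intro Bochner_Integration.integral_diff forcing_integrable u Y_integral)
    then show "V u = mul c x\<^sub>0 + ?I u"
      using Y_integral(2)[OF u] by simp
  qed
  have "((\<lambda>u. (1 / (u - t)) *\<^sub>R (?I u - ?I t)) \<longlongrightarrow> mul c (G t) - Y t) (at t within {0<..T})"
    using T by (intro FTC_quotient continuous_on_diff forcing_continuous Y_continuous int t) simp
  moreover have "\<forall>\<^sub>F u in at t within {0<..T}. (1 / (u - t)) *\<^sub>R (?I u - ?I t) = (1 / (u - t)) *\<^sub>R (V u - V t)"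
    unfolding eventually_at_filter by (intro always_eventually allI impI) (simp add: V_eq V_eq[OF t])
  ultimately show ?thesis
    by (rule Lim_transform_eventually)
qed

text \<open>The image of m * (-\<Delta>)^(\<alpha>/2) v. From \<gamma> m = m_\<gamma> - 1, and since
  m_\<gamma> * W is the primitive of Y, the memory term becomes a primitive, hence
  differentiable.\<close>

definition Mem :: "real \<Rightarrow> real \<Rightarrow> 'n L2" where
  "Mem \<gamma> t = (1 / \<gamma>) *\<^sub>R (LINT \<tau>|lborel. indicator {0<..<t} \<tau> *\<^sub>R (Y \<tau> - W \<tau>))"

lemma Mem_eq:
  assumes t: "0 < t" "t \<le> T" and \<gamma>: "\<gamma> > 0" and m: "\<And>\<tau>. \<tau> > 0 \<Longrightarrow> p \<tau> = 1 + \<gamma> * m \<tau>"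
  shows "integrable lborel (\<lambda>\<tau>. indicator {0<..<t} \<tau> *\<^sub>R m (t - \<tau>) *\<^sub>R W \<tau>)"
    and "(LINT \<tau>|lborel. indicator {0<..<t} \<tau> *\<^sub>R m (t - \<tau>) *\<^sub>R W \<tau>) = Mem \<gamma> t"
proof -
  have eq: "indicator {0<..<t} \<tau> *\<^sub>R m (t - \<tau>) *\<^sub>R W \<tau>
      = (1 / \<gamma>) *\<^sub>R (indicator {0<..<t} \<tau> *\<^sub>R p (t - \<tau>) *\<^sub>R W \<tau> - indicator {0<..<t} \<tau> *\<^sub>R W \<tau>)" for \<tau>
  proof (cases "0 < \<tau> \<and> \<tau> < t")
    case True
    then have "p (t - \<tau>) *\<^sub>R W \<tau> - W \<tau> = (\<gamma> * m (t - \<tau>)) *\<^sub>R W \<tau>"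
      using m[of "t - \<tau>"] by (simp add: scaleR_add_left)
    then show ?thesis
      using True \<gamma> by simp
  next
    case False
    then show ?thesis
      by auto
  qed
  show "integrable lborel (\<lambda>\<tau>. indicator {0<..<t} \<tau> *\<^sub>R m (t - \<tau>) *\<^sub>R W \<tau>)"
    unfolding eq by (intro integrable_scaleR_right Bochner_Integration.integrable_diff W_p_integral W_integrable t)
  have "(LINT \<tau>|lborel. indicator {0<..<t} \<tau> *\<^sub>R p (t - \<tau>) *\<^sub>R W \<tau> - indicator {0<..<t} \<tau> *\<^sub>R W \<tau>)
      = (LINT \<tau>|lborel. indicator {0<..<t} \<tau> *\<^sub>R Y \<tau>) - (LINT \<tau>|lborel. indicator {0<..<t} \<tau> *\<^sub>R W \<tau>)"
    unfolding W_p_integral(2)[OF t, symmetric]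
    by (intro Bochner_Integration.integral_diff W_p_integral W_integrable t)
  also have "\<dots> = (LINT \<tau>|lborel. indicator {0<..<t} \<tau> *\<^sub>R (Y \<tau> - W \<tau>))"
    unfolding scaleR_diff_right by (intro Bochner_Integration.integral_diff[symmetric] Y_integral W_integrable t)
  finally show "(LINT \<tau>|lborel. indicator {0<..<t} \<tau> *\<^sub>R m (t - \<tau>) *\<^sub>R W \<tau>) = Mem \<gamma> t"
    unfolding eq Mem_def
    by (subst Bochner_Integration.integral_scaleR_right)
      (auto intro!: Bochner_Integration.integrable_diff W_p_integral W_integrable t)
qed

lemma Mem_derivative:
  assumes t: "t \<in> {0<..T}"
  shows "((\<lambda>u. (1 / (u - t)) *\<^sub>R (Mem \<gamma> u - Mem \<gamma> t)) \<longlongrightarrow> (1 / \<gamma>) *\<^sub>R (Y t - W t)) (at t within {0<..T})"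
proof -
  let ?I = "\<lambda>u. LINT \<tau>|lborel. indicator {0<..<u} \<tau> *\<^sub>R (Y \<tau> - W \<tau>)"
  have "integrable lborel (\<lambda>\<tau>. indicator {0<..<T} \<tau> *\<^sub>R (Y \<tau> - W \<tau>))"
    unfolding scaleR_diff_right by (intro Bochner_Integration.integrable_diff Y_integral W_integrable T order_refl)
  then have "((\<lambda>u. (1 / (u - t)) *\<^sub>R (?I u - ?I t)) \<longlongrightarrow> Y t - W t) (at t within {0<..T})"
    by (intro FTC_quotient continuous_on_diff Y_continuous W_continuous t)
  then have "((\<lambda>u. (1 / \<gamma>) *\<^sub>R ((1 / (u - t)) *\<^sub>R (?I u - ?I t))) \<longlongrightarrow> (1 / \<gamma>) *\<^sub>R (Y t - W t)) (at t within {0<..T})"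
    by (intro tendsto_scaleR tendsto_const)
  then show ?thesis
    by (simp add: Mem_def scaleR_diff_right mult.commute)
qed

text \<open>\<open>W\<close> is obtained from \<open>V\<close> by applying the unbounded symbol \<open>\<nu>\<close>; dividing by \<open>1 + \<nu>\<close> makes the
  relation one between bounded operators.\<close>

lemma W_V:
  assumes t: "0 < t" "t \<le> T"
  shows "mul (\<lambda>\<xi>. 1 / (1 + \<nu> \<xi>)) (W t) = mul (\<lambda>\<xi>. \<nu> \<xi> * (1 / (1 + \<nu> \<xi>))) (V t)"
proof -
  let ?b = "\<lambda>\<xi>. 1 / (1 + \<nu> \<xi>)" and ?d = "\<lambda>\<xi>. \<nu> \<xi> * (1 / (1 + \<nu> \<xi>))"
  have b_meas: "?b \<in> borel_measurable borel"
    by (intro borel_measurable_divide borel_measurable_const borel_measurable_add \<nu>_measurable)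
  have b: "bounded_symbol ?b 1"
    unfolding bounded_symbol_def
  proof (intro conjI allI b_meas)
    show "\<bar>1 / (1 + \<nu> \<xi>)\<bar> \<le> 1" for \<xi>
      using \<nu>[of \<xi>] by (simp add: divide_le_eq)
  qed
  have d: "bounded_symbol ?d 1"
    unfolding bounded_symbol_def
  proof (intro conjI allI borel_measurable_times \<nu>_measurable b_meas)
    show "\<bar>\<nu> \<xi> * (1 / (1 + \<nu> \<xi>))\<bar> \<le> 1" for \<xi>
      using \<nu>[of \<xi>] by (simp add: divide_le_eq)
  qed
  have rel: "mul ?b (mul (A \<sigma>) x) = mul ?d (mul (S \<sigma>) x)" if "\<sigma> > 0" for \<sigma> x
    unfolding mul_mul[OF A_symbol[OF that]] mul_mul[OF S_symbol] by (simp add: A_def S_def mult_ac)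
  note lin = bounded_linear_mul[OF b] bounded_linear_mul[OF d]
  have "mul ?b (opconv (\<lambda>\<sigma>. mul (A \<sigma>)) G t) = (LINT \<sigma>|lborel. mul ?b (indicator {0<..<t} \<sigma> *\<^sub>R mul (A \<sigma>) (G (t - \<sigma>))))"
    unfolding opconv_def by (rule integral_bounded_linear[OF lin(1) opconv_integrable[OF A_family t(2)], symmetric])
  also have "\<dots> = (LINT \<sigma>|lborel. mul ?d (indicator {0<..<t} \<sigma> *\<^sub>R mul (S \<sigma>) (G (t - \<sigma>))))"
  proof (intro Bochner_Integration.integral_cong refl)
    fix \<sigma>
    show "mul ?b (indicator {0<..<t} \<sigma> *\<^sub>R mul (A \<sigma>) (G (t - \<sigma>))) = mul ?d (indicator {0<..<t} \<sigma> *\<^sub>R mul (S \<sigma>) (G (t - \<sigma>)))"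
      unfolding mul_scaleR[OF b] mul_scaleR[OF d] by (cases "\<sigma> > 0") (simp_all only: rel, simp)
  qed
  also have "\<dots> = mul ?d (opconv (\<lambda>\<sigma>. mul (S \<sigma>)) G t)"
    unfolding opconv_def by (rule integral_bounded_linear[OF lin(2) opconv_integrable[OF S_family t(2)]])
  finally show ?thesis
    unfolding W_def V_def mul_add[OF b] mul_add[OF d] rel[OF t(1)] by simp
qed

end

section \<open>Classical solutions in Sobolev spaces\<close>

lemma multiplier_shift:
  fixes u :: "real^'n \<Rightarrow> complex"
  assumes s: "s \<ge> 0" and \<theta>: "\<theta> \<ge> 0" and u: "u \<in> Hs (s + \<theta>)"
    and a: "a \<in> borel_measurable borel" "bounded_symbol (\<lambda>\<xi>. a \<xi> * bessel (- \<theta>) \<xi>) K"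
  shows "multiplier a u \<in> Hs s" "J s (multiplier a u) = mul (\<lambda>\<xi>. a \<xi> * bessel (- \<theta>) \<xi>) (J (s + \<theta>) u)"
proof -
  let ?F = "mul (\<lambda>\<xi>. a \<xi> * bessel (- \<theta>) \<xi>) (J (s + \<theta>) u)"
  have "AE \<xi> in lborel. fn (J (s + \<theta>) u) \<xi> = bessel (s + \<theta>) \<xi> *\<^sub>R fourier u \<xi>"
    unfolding J_def by (rule fn_cls[OF Hs_weighted[OF u]])
  moreover have "AE \<xi> in lborel. fn ?F \<xi> = (a \<xi> * bessel (- \<theta>) \<xi>) *\<^sub>R fn (J (s + \<theta>) u) \<xi>"
    unfolding mul_def by (rule fn_cls[OF square_integrable_symbol[OF a(2) square_integrable_fn]])
  ultimately have F: "AE \<xi> in lborel. fn ?F \<xi> = a \<xi> *\<^sub>R bessel s \<xi> *\<^sub>R fourier u \<xi>"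
  proof eventually_elim
    case (elim \<xi>)
    have "bessel (- \<theta>) \<xi> * bessel (s + \<theta>) \<xi> = bessel s \<xi>"
      by (simp flip: bessel_add)
    then show ?case
      unfolding elim by (simp add: mult.assoc)
  qed
  note M = multiplier_J[OF s Hs_shift(1)[OF u \<theta>] a(1) F]
  show "multiplier a u \<in> Hs s" "J s (multiplier a u) = ?F"
    by (rule M(2), rule M(3))
qed

text \<open>Cancelling the positive factor 1 / (1 + \<nu>) pointwise recovers the unbounded
  multiplier, including membership in its domain, from a relation between bounded operators.\<close>

lemma multiplier_of_quotient:
  fixes u :: "real^'n \<Rightarrow> complex"
  assumes s: "s \<ge> 0" and u: "u \<in> Hs s" and \<nu>: "\<nu> \<in> borel_measurable borel" "\<And>\<xi>. \<nu> \<xi> \<ge> 0"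
    and eq: "mul (\<lambda>\<xi>. 1 / (1 + \<nu> \<xi>)) F = mul (\<lambda>\<xi>. \<nu> \<xi> * (1 / (1 + \<nu> \<xi>))) (J s u)"
  shows "u \<in> multiplier_domain \<nu>" "multiplier \<nu> u \<in> Hs s" "J s (multiplier \<nu> u) = F"
proof -
  have pos: "1 + \<nu> \<xi> > 0" for \<xi>
    using \<nu>(2)[of \<xi>] by simp
  have b: "bounded_symbol (\<lambda>\<xi>. 1 / (1 + \<nu> \<xi>)) 1"
    unfolding bounded_symbol_def
  proof (intro conjI allI borel_measurable_divide borel_measurable_const borel_measurable_add \<nu>(1))
    show "\<bar>1 / (1 + \<nu> \<xi>)\<bar> \<le> 1" for \<xi>
      using \<nu>(2)[of \<xi>] by (simp add: divide_le_eq)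
  qed
  have d: "bounded_symbol (\<lambda>\<xi>. \<nu> \<xi> * (1 / (1 + \<nu> \<xi>))) 1"
    unfolding bounded_symbol_def
  proof (intro conjI allI borel_measurable_times borel_measurable_divide borel_measurable_const borel_measurable_add \<nu>(1))
    show "\<bar>\<nu> \<xi> * (1 / (1 + \<nu> \<xi>))\<bar> \<le> 1" for \<xi>
      using \<nu>(2)[of \<xi>] by (simp add: divide_le_eq)
  qed
  have "AE \<xi> in lborel. fn (J s u) \<xi> = bessel s \<xi> *\<^sub>R fourier u \<xi>"
    unfolding J_def by (rule fn_cls[OF Hs_weighted[OF u]])
  moreover have "AE \<xi> in lborel. (1 / (1 + \<nu> \<xi>)) *\<^sub>R fn F \<xi> = (\<nu> \<xi> * (1 / (1 + \<nu> \<xi>))) *\<^sub>R fn (J s u) \<xi>"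
    using eq unfolding mul_def
      cls_eq_iff[OF square_integrable_symbol[OF b square_integrable_fn] square_integrable_symbol[OF d square_integrable_fn]] .
  ultimately have F: "AE \<xi> in lborel. fn F \<xi> = \<nu> \<xi> *\<^sub>R bessel s \<xi> *\<^sub>R fourier u \<xi>"
  proof eventually_elim
    case (elim \<xi>)
    have "(1 / (1 + \<nu> \<xi>)) *\<^sub>R fn F \<xi> = (1 / (1 + \<nu> \<xi>)) *\<^sub>R (\<nu> \<xi> *\<^sub>R bessel s \<xi> *\<^sub>R fourier u \<xi>)"
      unfolding elim(2) elim(1) by (simp add: mult.commute)
    then show ?case
      unfolding scaleR_cancel_left using pos[of \<xi>] by simp
  qed
  show "u \<in> multiplier_domain \<nu>" "multiplier \<nu> u \<in> Hs s" "J s (multiplier \<nu> u) = F"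
    by (rule multiplier_J[OF s u \<nu>(1) F])+
qed

lemma has_Hs_derivativeI:
  assumes s: "s \<ge> 0" and t: "t \<in> I" and f: "\<And>\<tau>. \<tau> \<in> I \<Longrightarrow> f \<tau> \<in> Hs s \<and> J s (f \<tau>) = F \<tau>"
    and D: "((\<lambda>\<tau>. (1 / (\<tau> - t)) *\<^sub>R (F \<tau> - F t)) \<longlongrightarrow> D) (at t within I)"
  shows "has_Hs_derivative s I f (Jinv s D) t"
proof -
  have "\<forall>\<^sub>F \<tau> in at t within I. (1 / (\<tau> - t)) *\<^sub>R (F \<tau> - F t) = (1 / (\<tau> - t)) *\<^sub>R (J s (f \<tau>) - J s (f t))"
    unfolding eventually_at_filter using f t by (intro always_eventually) simp
  with D have "((\<lambda>\<tau>. (1 / (\<tau> - t)) *\<^sub>R (J s (f \<tau>) - J s (f t))) \<longlongrightarrow> D) (at t within I)"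
    by (rule Lim_transform_eventually)
  then show ?thesis
    unfolding has_Hs_derivative_iff[OF t] using f Jinv_in[OF s] by (simp add: J_Jinv[OF s])
qed

lemma Hs_continuous_onI:
  assumes f: "\<And>\<tau>. \<tau> \<in> I \<Longrightarrow> f \<tau> \<in> Hs s \<and> J s (f \<tau>) = F \<tau>" and F: "continuous_on I F"
  shows "Hs_continuous_on s I f"
proof -
  have "continuous_on I (\<lambda>t. J s (f t))"
    by (rule continuous_on_eq[OF F]) (simp add: f)
  then show ?thesis
    using f by (simp add: Hs_continuous_on_iff)
qed

lemma frac_symbol_nonneg: "0 \<le> frac_symbol \<alpha> \<xi>"
  by (simp add: frac_symbol_def)

lemma frac_symbol_continuous: "\<alpha> > 0 \<Longrightarrow> continuous_on UNIV (frac_symbol \<alpha> :: real^'n \<Rightarrow> real)"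
  unfolding frac_symbol_def[abs_def] by (intro continuous_on_powr' continuous_intros) auto

text \<open>The exponent \<theta> / \<alpha> gives |\<xi>|^\<alpha> the order \<theta>, and
  |\<xi>|^\<theta> \<le> (1 + |\<xi>|^2)^(\<theta>/2).\<close>

lemma frac_symbol_bessel:
  assumes "\<alpha> > 0" "\<theta> \<ge> 0"
  shows "frac_symbol \<alpha> \<xi> powr (\<theta> / \<alpha>) * bessel (- \<theta>) \<xi> \<le> 1"
proof -
  have "frac_symbol \<alpha> \<xi> powr (\<theta> / \<alpha>) = norm \<xi> powr \<theta>"
    using assms by (simp add: frac_symbol_def powr_powr)
  also have "\<dots> = ((norm \<xi>)\<^sup>2) powr (\<theta> / 2)"
    by (simp add: power2_eq_square powr_mult flip: powr_add)
  also have "\<dots> \<le> bessel \<theta> \<xi>"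
    unfolding bessel_def using assms by (intro powr_mono2) auto
  finally have "frac_symbol \<alpha> \<xi> powr (\<theta> / \<alpha>) * bessel (- \<theta>) \<xi> \<le> bessel \<theta> \<xi> * bessel (- \<theta>) \<xi>"
    using less_imp_le[OF bessel_pos] by (rule mult_right_mono)
  also have "\<dots> = 1"
    by (simp flip: bessel_add)
  finally show ?thesis .
qed

theorem theorem4p1:
  fixes \<gamma> \<alpha> s T \<theta>\<^sub>1 :: real
    and m :: "real \<Rightarrow> real"
    and g :: "real \<Rightarrow> real^'n \<Rightarrow> complex"
  assumes "\<gamma> > 0" and "1 < \<alpha>" and "\<alpha> \<le> 2"
    and "condition_H \<gamma> m"
    and "antimono_on {0<..} m" and "continuous_on {0<..} m"
    and "s \<ge> 0" and "T > 0" and "\<theta>\<^sub>1 > 0"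
    and "Hs_continuous_on (s + \<theta>\<^sub>1) {0<..T} g"
    and "\<exists>C. \<forall>t\<in>{0<..T}. Hs_norm (s + \<theta>\<^sub>1) (g t) \<le> C"
  shows "\<forall>\<theta>\<^sub>2>0. \<forall>v\<^sub>0 \<in> Hs (s + \<theta>\<^sub>2).
    \<exists>v. classical_solution \<gamma> \<alpha> m s T v\<^sub>0 g v \<and> solves_problem \<gamma> \<alpha> m s T v\<^sub>0 g v \<and>
      (\<forall>w. classical_solution \<gamma> \<alpha> m s T v\<^sub>0 g w \<longrightarrow>
         (\<forall>t\<in>{0..T}. AE x in lborel. w t x = v t x))"
proof (intro allI impI ballI)
  fix \<theta>\<^sub>2 :: real and v\<^sub>0 :: "real^'n \<Rightarrow> complex"
  assume \<theta>\<^sub>2: "\<theta>\<^sub>2 > 0" and v\<^sub>0: "v\<^sub>0 \<in> Hs (s + \<theta>\<^sub>2)"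
  note \<gamma> = assms(1) and s = assms(7) and T0 = assms(8)
  have \<alpha>: "\<alpha> > 0"
    using assms(2) by simp
  \<comment> \<open>\<theta> must not exceed the excess regularity of g or of the initial value, and
    \<theta> \<le> \<alpha> gives \<epsilon> = \<theta> / \<alpha> \<le> 1.\<close>
  define \<theta> where "\<theta> = min \<theta>\<^sub>1 (min \<theta>\<^sub>2 \<alpha>)"
  have \<theta>: "\<theta> > 0" "\<theta> \<le> \<theta>\<^sub>1" "\<theta> \<le> \<theta>\<^sub>2" "\<theta> \<le> \<alpha>"
    using assms(9) \<theta>\<^sub>2 \<alpha> by (auto simp: \<theta>_def)
  then have \<theta>0: "\<theta> \<ge> 0"
    by simp
  define p where "p = (\<lambda>t. if t > 0 then m_gamma \<gamma> m t else 0)"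
  have p_eq: "p t = m_gamma \<gamma> m t" if "t > 0" for t
    using that by (simp add: p_def)
  have p_eq': "p t = 1 + \<gamma> * m t" if "t > 0" for t
    using that by (simp add: p_def m_gamma_def)
  obtain k \<beta> where vol: "volterra p k \<beta>"
    unfolding p_def using condition_H_volterra[OF \<gamma> assms(4-6)] by blast
  let ?\<nu> = "frac_symbol \<alpha> :: real^'n \<Rightarrow> real" and ?c = "bessel (- \<theta>) :: real^'n \<Rightarrow> real"
  have c_bounded: "bounded_symbol ?c 1"
    by (rule bounded_symbol_bessel[OF \<theta>0])
  have res: "resolvent p k \<beta> ?\<nu> ?c (\<theta> / \<alpha>)"
  proof (intro resolvent.intro resolvent_axioms.intro vol)
    show "?c \<xi> \<le> 1" for \<xi>
      using bessel_mono[of "- \<theta>" 0 \<xi>] \<theta>0 by simp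
    show "0 \<le> ?c \<xi>" for \<xi>
      by (rule less_imp_le[OF bessel_pos])
  qed (use \<theta> \<alpha> in \<open>auto intro: frac_symbol_continuous frac_symbol_nonneg frac_symbol_bessel\<close>)
  have shift: "u \<in> Hs (s + \<theta>)" "J (s + \<theta>) u = mul (bessel (- (\<theta>' - \<theta>))) (J (s + \<theta>') u)"
    if "u \<in> Hs (s + \<theta>')" "\<theta> \<le> \<theta>'" for u :: "real^'n \<Rightarrow> complex" and \<theta>'
    using Hs_shift[of u "s + \<theta>" "\<theta>' - \<theta>"] that by simp_all
  have g_in: "g t \<in> Hs (s + \<theta>\<^sub>1)" if "t \<in> {0<..T}" for t
    using assms(10) that by (simp add: Hs_continuous_on_iff)
  note g_Hs = shift[OF g_in \<theta>(2)]
  note v\<^sub>0_Hs = shift(1)[OF v\<^sub>0 \<theta>(3)]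
  define G where "G t = J (s + \<theta>) (g t)" for t
  obtain K where K: "\<And>t. t \<in> {0<..T} \<Longrightarrow> Hs_norm (s + \<theta>\<^sub>1) (g t) \<le> K"
    using assms(11) by blast
  have b: "bounded_symbol (bessel (- (\<theta>\<^sub>1 - \<theta>)) :: real^'n \<Rightarrow> real) 1"
    using \<theta>(2) by (intro bounded_symbol_bessel) simp
  have forc: "forcing G T K"
  proof
    show "T > 0"
      by (rule T0)
    have "continuous_on {0<..T} (\<lambda>t. mul (bessel (- (\<theta>\<^sub>1 - \<theta>))) (J (s + \<theta>\<^sub>1) (g t)))"
      using assms(10) by (intro bounded_linear.continuous_on[OF bounded_linear_mul[OF b]]) (simp add: Hs_continuous_on_iff)
    then show "continuous_on {0<..T} G"
      by (rule continuous_on_eq) (simp add: G_def g_Hs(2))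
    show "norm (G t) \<le> K" if "0 < t" "t \<le> T" for t
    proof -
      have t: "t \<in> {0<..T}"
        using that by simp
      have "norm (G t) \<le> 1 * norm (J (s + \<theta>\<^sub>1) (g t))"
        unfolding G_def g_Hs(2)[OF t] by (rule norm_mul_le[OF b])
      also have "\<dots> \<le> K"
        using K[OF t] by (simp add: Hs_norm_eq[OF g_in[OF t]])
      finally show ?thesis .
    qed
  qed
  define x\<^sub>0 where "x\<^sub>0 = J (s + \<theta>) v\<^sub>0"
  interpret E: evolution p k \<beta> ?\<nu> ?c "\<theta> / \<alpha>" G T K x\<^sub>0
    by (rule evolution.intro[OF res forc])
  \<comment> \<open>At t = 0 the given function itself is taken; its image under J is V(0), so
    continuity at 0 is that of V.\<close>
  define v where "v t = (if t = 0 then v\<^sub>0 else Jinv s (E.V t))" for t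
  have "v\<^sub>0 \<in> Hs s" "J s v\<^sub>0 = mul ?c x\<^sub>0"
    unfolding x\<^sub>0_def by (rule Hs_shift[OF v\<^sub>0_Hs \<theta>0])+
  then have v: "v t \<in> Hs s \<and> J s (v t) = E.V t" for t
    by (simp add: v_def Jinv_in[OF s] J_Jinv[OF s] E.V_0)
  have Q: "Q_conv \<gamma> \<alpha> m t u \<in> Hs s \<and> J s (Q_conv \<gamma> \<alpha> m t u) = mul (E.S t) (J (s + \<theta>) u)"
    if u: "u \<in> Hs (s + \<theta>)" for t u
  proof -
    have eq: "(\<lambda>\<xi>. s_gamma \<gamma> m (frac_symbol \<alpha> \<xi>) t) = (\<lambda>\<xi>. E.sol (?\<nu> \<xi>) t)"
      by (simp add: fun_eq_iff E.s_gamma_eq_sol[OF p_eq frac_symbol_nonneg])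
    have S: "E.S t = (\<lambda>\<xi>. E.sol (?\<nu> \<xi>) t * bessel (- \<theta>) \<xi>)"
      by (simp add: E.S_def fun_eq_iff)
    have meas: "(\<lambda>\<xi>. E.sol (?\<nu> \<xi>) t) \<in> borel_measurable borel"
      using E.section_measurable[OF E.sol_measurable2, of t] by simp
    show ?thesis
      unfolding Q_conv_def eq S
      using multiplier_shift[OF s \<theta>0 u meas E.S_symbol[of t, unfolded S]] by blast
  qed
  have L: "v t \<in> multiplier_domain (frac_symbol \<alpha>) \<and> frac_laplacian \<alpha> (v t) \<in> Hs s \<and> J s (frac_laplacian \<alpha> (v t)) = E.W t"
    if t: "0 < t" "t \<le> T" for t
    using multiplier_of_quotient[OF s conjunct1[OF v[of t]] E.\<nu>_measurable frac_symbol_nonneg, where F = "E.W t"] E.W_V[OF t] v[of t]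
    by simp
  have mem: "Hs_integrable s t (memory_integrand \<alpha> m v t)" "memory_term s \<alpha> m v t \<in> Hs s"
      "J s (memory_term s \<alpha> m v t) = E.Mem \<gamma> t" if t: "t \<in> {0<..T}" for t
  proof -
    have t': "0 < t" "t \<le> T"
      using t by auto
    have f: "memory_integrand \<alpha> m v t \<tau> \<in> Hs s \<and> J s (memory_integrand \<alpha> m v t \<tau>) = m (t - \<tau>) *\<^sub>R E.W \<tau>"
      if "0 < \<tau>" "\<tau> < t" for \<tau>
    proof -
      have "memory_integrand \<alpha> m v t \<tau> = (\<lambda>x. m (t - \<tau>) *\<^sub>R frac_laplacian \<alpha> (v \<tau>) x)"
        by (simp add: fun_eq_iff memory_integrand_def scaleR_conv_of_real)
      moreover have "frac_laplacian \<alpha> (v \<tau>) \<in> Hs s" "J s (frac_laplacian \<alpha> (v \<tau>)) = E.W \<tau>"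
        using L[of \<tau>] that t' by auto
      ultimately show ?thesis
        using Hs_scaleR[of "frac_laplacian \<alpha> (v \<tau>)" s "m (t - \<tau>)"] by simp
    qed
    note M = E.Mem_eq[OF t' \<gamma> p_eq']
    note I = Hs_integral_eq[OF s t'(1) f M(1)]
    show "Hs_integrable s t (memory_integrand \<alpha> m v t)"
      by (rule I(1))
    show "memory_term s \<alpha> m v t \<in> Hs s"
      unfolding memory_term_def by (rule I(2))
    show "J s (memory_term s \<alpha> m v t) = E.Mem \<gamma> t"
      unfolding memory_term_def by (rule trans[OF I(3) M(2)])
  qed
  \<comment> \<open>The right-hand side of the representation formula. Every classical solution
    agrees with it for t > 0, so it serves existence and uniqueness alike.\<close>
  define rep where "rep t = (\<lambda>x. Q_conv \<gamma> \<alpha> m t v\<^sub>0 x + Hs_integral s t (duhamel_integrand \<gamma> \<alpha> m g t) x)" for t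
  have duh: "Hs_integrable s t (duhamel_integrand \<gamma> \<alpha> m g t)" and rep: "rep t \<in> Hs s" "J s (rep t) = E.V t"
    if t: "t \<in> {0<..T}" for t
  proof -
    have t': "0 < t" "t \<le> T"
      using t by auto
    have f: "duhamel_integrand \<gamma> \<alpha> m g t \<tau> \<in> Hs s \<and> J s (duhamel_integrand \<gamma> \<alpha> m g t \<tau>) = mul (E.S (t - \<tau>)) (G \<tau>)"
      if "0 < \<tau>" "\<tau> < t" for \<tau>
      unfolding duhamel_integrand_def G_def using that t' by (intro Q g_Hs(1)) auto
    have int: "integrable lborel (\<lambda>\<tau>. indicator {0<..<t} \<tau> *\<^sub>R mul (E.S (t - \<tau>)) (G \<tau>))"
      by (rule E.opconv_flip_integrable[where B = "\<lambda>\<sigma>. mul (E.S \<sigma>)"]) (rule E.opconv_integrable[OF E.S_family t'(2)])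
    note I = Hs_integral_eq[OF s t'(1) f int]
    show "Hs_integrable s t (duhamel_integrand \<gamma> \<alpha> m g t)"
      by (rule I(1))
    note add = Hs_add[OF conjunct1[OF Q[OF v\<^sub>0_Hs, of t]] I(2)]
    show "rep t \<in> Hs s"
      unfolding rep_def by (rule add(1))
    have "J s (rep t) = J s (Q_conv \<gamma> \<alpha> m t v\<^sub>0) + J s (Hs_integral s t (duhamel_integrand \<gamma> \<alpha> m g t))"
      unfolding rep_def by (rule add(2))
    also have "J s (Q_conv \<gamma> \<alpha> m t v\<^sub>0) = mul (E.S t) x\<^sub>0"
      using Q[OF v\<^sub>0_Hs, of t] by (simp add: x\<^sub>0_def)
    also have "J s (Hs_integral s t (duhamel_integrand \<gamma> \<alpha> m g t)) = opconv (\<lambda>\<sigma>. mul (E.S \<sigma>)) G t"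
      by (rule trans[OF I(3) E.opconv_flip[of "\<lambda>\<sigma>. mul (E.S \<sigma>)" t, symmetric]])
    finally show "J s (rep t) = E.V t"
      by (simp only: E.V_def)
  qed
  define dv where "dv t = Jinv s (mul ?c (G t) - E.Y t)" for t
  define dM where "dM t = Jinv s ((1 / \<gamma>) *\<^sub>R (E.Y t - E.W t))" for t
  have dv: "has_Hs_derivative s {0<..T} v (dv t) t" if t: "t \<in> {0<..T}" for t
    unfolding dv_def by (rule has_Hs_derivativeI[OF s t v E.V_derivative[OF t]])
  have dM: "has_Hs_derivative s {0<..T} (memory_term s \<alpha> m v) (dM t) t" if t: "t \<in> {0<..T}" for t
    unfolding dM_def using mem by (intro has_Hs_derivativeI[OF s t _ E.Mem_derivative[OF t]]) auto
  have YW: "continuous_on {0<..T} (\<lambda>t. (1 / \<gamma>) *\<^sub>R (E.Y t - E.W t))"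
    by (intro continuous_on_scaleR continuous_on_const continuous_on_diff E.Y_continuous E.W_continuous)
  have dv_cont: "Hs_continuous_on s {0<..T} dv"
    by (rule Hs_continuous_onI[OF _ continuous_on_diff[OF E.forcing_continuous E.Y_continuous]])
      (simp add: dv_def Jinv_in[OF s] J_Jinv[OF s])
  have dM_cont: "Hs_continuous_on s {0<..T} dM"
    by (rule Hs_continuous_onI[OF _ YW]) (simp add: dM_def Jinv_in[OF s] J_Jinv[OF s])
  have ex_dv: "\<exists>dv. Hs_continuous_on s {0<..T} dv \<and> (\<forall>t\<in>{0<..T}. has_Hs_derivative s {0<..T} v (dv t) t)"
    using dv dv_cont by blast
  have ex_dM: "\<exists>dM. Hs_continuous_on s {0<..T} dM \<and>
      (\<forall>t\<in>{0<..T}. has_Hs_derivative s {0<..T} (memory_term s \<alpha> m v) (dM t) t)"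
    using dM dM_cont by blast
  have classical: "classical_solution \<gamma> \<alpha> m s T v\<^sub>0 g v"
    unfolding classical_solution_def
  proof (intro conjI ballI ex_dv ex_dM mem duh)
    show "Hs_continuous_on s {0..T} v"
      by (rule Hs_continuous_onI[OF v E.V_continuous])
    fix t assume t: "t \<in> {0<..T}"
    then have t': "0 < t" "t \<le> T"
      by auto
    show "v t \<in> multiplier_domain (frac_symbol \<alpha>)" "frac_laplacian \<alpha> (v t) \<in> Hs s"
      using L[OF t'] by auto
    have "AE x in lborel. v t x = rep t x"
      using J_eq_iff[OF conjunct1[OF v] rep(1)[OF t], of t] v[of t] rep(2)[OF t] by simp
    then show "AE x in lborel. v t x = Q_conv \<gamma> \<alpha> m t v\<^sub>0 x + Hs_integral s t (duhamel_integrand \<gamma> \<alpha> m g t) x"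
      by (simp add: rep_def)
  qed
  have "solves_problem \<gamma> \<alpha> m s T v\<^sub>0 g v"
    unfolding solves_problem_def
  proof (intro conjI ballI)
    fix t assume t: "t \<in> {0<..T}"
    then have L_t: "frac_laplacian \<alpha> (v t) \<in> Hs s" "J s (frac_laplacian \<alpha> (v t)) = E.W t"
      using L[of t] by auto
    have d: "dv t \<in> Hs s" "J s (dv t) = mul ?c (G t) - E.Y t" and e: "dM t \<in> Hs s" "J s (dM t) = (1 / \<gamma>) *\<^sub>R (E.Y t - E.W t)"
      by (simp_all add: dv_def dM_def Jinv_in[OF s] J_Jinv[OF s])
    note sum1 = Hs_add[OF d(1) L_t(1)]
    note sum2 = Hs_add[OF sum1(1) Hs_scaleR(1)[OF e(1), of \<gamma>]]
    note gs = Hs_shift[OF g_Hs(1)[OF t] \<theta>0]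
    \<comment> \<open>In images under J the left-hand side of the equation is c G - Y, plus W, plus
      Y - W, which adds up to c G.\<close>
    have "J s (\<lambda>x. (dv t x + frac_laplacian \<alpha> (v t) x) + \<gamma> *\<^sub>R dM t x) = J s (g t)"
      unfolding sum2(2) sum1(2) Hs_scaleR(2)[OF e(1)] d(2) e(2) L_t(2) gs(2) using \<gamma> by (simp add: G_def)
    then have "AE x in lborel. (dv t x + frac_laplacian \<alpha> (v t) x) + \<gamma> *\<^sub>R dM t x = g t x"
      by (simp only: J_eq_iff[OF sum2(1) gs(1)])
    then have "AE x in lborel. dv t x + frac_laplacian \<alpha> (v t) x + complex_of_real \<gamma> * dM t x = g t x"
      by (simp only: scaleR_conv_of_real)
    then show "\<exists>d e. has_Hs_derivative s {0<..T} v d t \<and> has_Hs_derivative s {0<..T} (memory_term s \<alpha> m v) e t \<and>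
        (AE x in lborel. d x + frac_laplacian \<alpha> (v t) x + complex_of_real \<gamma> * e x = g t x)"
      using dv[OF t] dM[OF t] by blast
  qed (simp add: v_def)
  moreover have "\<forall>w. classical_solution \<gamma> \<alpha> m s T v\<^sub>0 g w \<longrightarrow> (\<forall>t\<in>{0..T}. AE x in lborel. w t x = v t x)"
  proof (intro allI impI ballI)
    fix w t assume w: "classical_solution \<gamma> \<alpha> m s T v\<^sub>0 g w" and t: "t \<in> {0..T}"
    have w_cont: "Hs_continuous_on s {0..T} w"
      and w_rep: "\<And>t. t \<in> {0<..T} \<Longrightarrow> AE x in lborel. w t x = rep t x"
      using w by (auto simp: classical_solution_def rep_def)
    have w_Hs: "w t \<in> Hs s" if "t \<in> {0..T}" for t
      using w_cont that by (simp add: Hs_continuous_on_iff)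
    have Jw: "J s (w t) = E.V t" if "t \<in> {0<..T}" for t
      using J_eq_iff[OF w_Hs rep(1)[OF that], of t] w_rep[OF that] rep(2)[OF that] that by simp
    \<comment> \<open>The representation formula is imposed for t > 0; the value at t = 0 is
      recovered from continuity on [0,T].\<close>
    have Jw_lim: "((\<lambda>t. J s (w t)) \<longlongrightarrow> J s (w 0)) (at 0 within {0..T})"
      using w_cont T0 by (simp add: Hs_continuous_on_iff continuous_on_def)
    have "(E.V \<longlongrightarrow> E.V 0) (at 0 within {0..T})"
      using E.V_continuous T0 by (simp add: continuous_on_def)
    moreover have "\<forall>\<^sub>F t in at 0 within {0..T}. E.V t = J s (w t)"
      unfolding eventually_at_filter by (intro always_eventually) (simp add: Jw)
    ultimately have "((\<lambda>t. J s (w t)) \<longlongrightarrow> E.V 0) (at 0 within {0..T})"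
      by (rule Lim_transform_eventually)
    moreover have "at 0 within {0..T} \<noteq> bot"
      using T0 by (simp add: at_within_Icc_at_right)
    ultimately have "J s (w 0) = E.V 0"
      using Jw_lim tendsto_unique by blast
    then have "J s (w t) = J s (v t)"
      using Jw[of t] t v[of t] by (cases "t = 0") auto
    then show "AE x in lborel. w t x = v t x"
      using J_eq_iff[OF w_Hs[OF t] conjunct1[OF v]] by blast
  qed
  ultimately show "\<exists>v. classical_solution \<gamma> \<alpha> m s T v\<^sub>0 g v \<and> solves_problem \<gamma> \<alpha> m s T v\<^sub>0 g v \<and>
      (\<forall>w. classical_solution \<gamma> \<alpha> m s T v\<^sub>0 g w \<longrightarrow> (\<forall>t\<in>{0..T}. AE x in lborel. w t x = v t x))"
    using classical by blast
qed

end
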